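(* Let $Q$ be a quiver, $\underline{d}^{(0)},\ldots,\underline{d}^{(\ell)}\in\mathbb{Z}_{\ge0}^{Q_0}$ dimension vectors with $d^{(0)}_v\ge d^{(1)}_v\ge\cdots\ge d^{(\ell)}_v$ for all $v\in Q_0$, and $\underline f\in\mathbb{Z}_{\ge0}^{Q_0}$ a framing vector. The natural projection $$\mathcal{M}_Q(\underline{d}^{(0)},\ldots,\underline{d}^{(\ell)};\underline f)\to\mathcal{M}_Q(\underline{d}^{(0)},\underline{d}^{(\ell)};\underline f)$$ is a locally trivial fibration with fiber the product of partial flag varieties $$\prod_{v\in Q_0}\mathrm{Fl}\left(d_v^{(\ell-1)}-d_v^{(\ell)},\ldots,d_v^{(1)}-d_v^{(\ell)};\,d_v^{(0)}-d_v^{(\ell)}\right).$$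
   Context: Everything is over $\mathbb{C}$. $Q=(Q_0,Q_1,\mathrm{out},\mathrm{in})$ is a quiver; an arrow $e\in Q_1$ goes from $\mathrm{out}(e)$ to $\mathrm{in}(e)$. Given $\underline{d},\underline{f}\in\mathbb{Z}_{\ge0}^{Q_0}$, fix vector spaces $D_v,F_v$ with $\dim D_v=d_v$, $\dim F_v=f_v$. A representation of the double framed quiver with dimension vector $\underline d$ and framing vector $\underline f$ is a tuple $(A_e,B_e,i_v,j_v)$ with $A_e:D_{\mathrm{out}(e)}\to D_{\mathrm{in}(e)}$, $B_e:D_{\mathrm{in}(e)}\to D_{\mathrm{out}(e)}$, $i_v:F_v\to D_v$, $j_v:D_v\to F_v$ linear. Moment map equations: for all $v$, $\sum_{\mathrm{in}(e)=v}A_eB_e-\sum_{\mathrm{out}(e)=v}B_eA_e+i_vj_v=0$. Stability: the only collection of subspaces $D'_v\subseteq D_v$ with $i_v(F_v)\subseteq D'_v$ for all $v$ and preserved by all $A_e,B_e$ is $D'_v=D_v$. The group $G_{\underline d}=\prod_v\mathrm{GL}(D_v)$ acts by $g\cdot(A,B,i,j)=(g_{\mathrm{in}(e)}A_eg_{\mathrm{out}(e)}^{-1},g_{\mathrm{out}(e)}B_eg_{\mathrm{in}(e)}^{-1},g_vi_v,j_vg_v^{-1})$. Split parabolic quiver variety: let $\mathcal{P}_Q(\underline{d}^{(0)},\ldots,\underline{d}^{(\ell)};\underline f)$ be the variety of tuples $(A^{(m)},B^{(m)},i^{(m)},j^{(m)})_{0\le m\le\ell}$, $(\pi^{(m)}_v)_{0\le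 m\le \ell-1,\,v\in Q_0}$ such that: (1) for each $m$, $(A^{(m)},B^{(m)},i^{(m)},j^{(m)})$ is a stable representation of the double framed quiver on spaces $D^{(m)}_v$ of dimension $d^{(m)}_v$, with the same framing spaces $F_v$ for all $m$, satisfying the moment map equations; (2) $\pi_v^{(m)}:D_v^{(m)}\to D_v^{(m+1)}$ are linear maps with $\pi^{(m)}A^{(m)}_e=A^{(m+1)}_e\pi^{(m)}$, $\pi^{(m)}B^{(m)}_e=B^{(m+1)}_e\pi^{(m)}$ (at the relevant vertices), $\pi^{(m)}_vi^{(m)}_v=i^{(m+1)}_v$, $j_v^{(m+1)}\pi_v^{(m)}=j_v^{(m)}$; (3) for $K_v:=\ker(\pi_v^{(\ell-1)}\circ\cdots\circ\pi_v^{(0)})\subseteq D_v^{(0)}$, all $A^{(0)}_e$ (with $\mathrm{out}(e)=v$), $B_e^{(0)}$ (with $\mathrm{in}(e)=v$) and $j^{(0)}_v$ vanish on $K_v$, for every $v$. (Stability forces all $\pi^{(m)}_v$ to be surjective.) The group $G=\prod_{m=0}^{\ell}G_{\underline d^{(m)}}$ acts freely, with $\pi_v^{(m)}\mapsto g_{m+1,v}\pi^{(m)}_vg_{m,v}^{-1}$, and $\mathcal{M}_Q(\underline{d}^{(0)},\ldots,\underline{d}^{(\ell)};\underline f):=\mathcal{P}_Q/G$. The natural projection keeps $D^{(0)}$, $D^{(\ell)}$ and the composition $\pi_v^{(\ell-1)}\circ\cdots\circ\pi_v^{(0)}$. $\mathrm{Fl}(a_1,\ldots,a_s;n)$, for $a_1\le\cdots\le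 a_s\le n$, is the variety of partial flags $V_{a_1}\subseteq\cdots\subseteq V_{a_s}\subseteq\mathbb{C}^n$ with $\dim V_{a_j}=a_j$. *)

theory Defs
  imports
    "HOL-Analysis.Abstract_Topology"
    "HOL-Algebra.Group_Action"
    "HOL-Algebra.Product_Groups"
    "Jordan_Normal_Form.Matrix_Kernel"
    "Graph_Theory.Digraph"
begin

section \<open>Varieties as spaces with functions\<close>

text \<open>
  Complex varieties are treated classically, as spaces with functions (Kempf, Springer): a set of
  points with a topology and, for every open \<open>U\<close>, a \<open>\<complex>\<close>-algebra of regular functions on \<open>U\<close>.
  In \<open>f \<in> reg X U\<close> only the values of \<open>f\<close> on \<open>U\<close> matter.
\<close>

record 'a fspace =
  topo :: "'a topology"
  reg :: "'a set \<Rightarrow> ('a \<Rightarrow> complex) set"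

abbreviation points :: "'a fspace \<Rightarrow> 'a set" where
  "points X \<equiv> topspace (topo X)"

locale space_with_functions =
  fixes X :: "'a fspace"
  assumes reg_openin: "f \<in> reg X U \<Longrightarrow> openin (topo X) U"
    and reg_const: "openin (topo X) U \<Longrightarrow> (\<lambda>_. c) \<in> reg X U"
    and reg_add: "f \<in> reg X U \<Longrightarrow> g \<in> reg X U \<Longrightarrow> (\<lambda>x. f x + g x) \<in> reg X U"
    and reg_mult: "f \<in> reg X U \<Longrightarrow> g \<in> reg X U \<Longrightarrow> (\<lambda>x. f x * g x) \<in> reg X U"
    and reg_inverse: "f \<in> reg X U \<Longrightarrow> (\<lambda>x. inverse (f x)) \<in> reg X {x \<in> U. f x \<noteq> 0}"
    and reg_restrict: "f \<in> reg X U \<Longrightarrow> openin (topo X) V \<Longrightarrow> V \<subseteq> U \<Longrightarrow> f \<in> reg X V"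
    and reg_glue: "(\<And>x. x \<in> U \<Longrightarrow> \<exists>V g. x \<in> V \<and> V \<subseteq> U \<and> g \<in> reg X V \<and> (\<forall>y\<in>V. f y = g y))
          \<Longrightarrow> f \<in> reg X U"

definition fs_morphism :: "'a fspace \<Rightarrow> 'b fspace \<Rightarrow> ('a \<Rightarrow> 'b) \<Rightarrow> bool" where
  "fs_morphism X Y \<phi> \<longleftrightarrow>
     continuous_map (topo X) (topo Y) \<phi> \<and>
     (\<forall>V. \<forall>f \<in> reg Y V. f \<circ> \<phi> \<in> reg X {x \<in> points X. \<phi> x \<in> V})"

definition fs_isomorphism :: "'a fspace \<Rightarrow> 'b fspace \<Rightarrow> ('a \<Rightarrow> 'b) \<Rightarrow> bool" where
  "fs_isomorphism X Y \<phi> \<longleftrightarrow>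
     (\<exists>\<psi>. fs_morphism X Y \<phi> \<and> fs_morphism Y X \<psi> \<and>
          (\<forall>x \<in> points X. \<psi> (\<phi> x) = x) \<and> (\<forall>y \<in> points Y. \<phi> (\<psi> y) = y))"

definition fs_open_sub :: "'a fspace \<Rightarrow> 'a set \<Rightarrow> 'a fspace" where
  "fs_open_sub X U =
     \<lparr>topo = subtopology (topo X) U, reg = (\<lambda>W. if W \<subseteq> U then reg X W else {})\<rparr>"

text \<open>
  The finest structure on the set \<open>Y\<close> for which \<open>q\<close> is a morphism. For the orbit map of a group
  action this is the geometric quotient: the quotient topology, and the invariant regular
  functions.
\<close>

definition fs_coinduced :: "'a fspace \<Rightarrow> 'b set \<Rightarrow> ('a \<Rightarrow> 'b) \<Rightarrow> 'b fspace" where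
  "fs_coinduced X Y q =
     \<lparr>topo = topology (\<lambda>U. U \<subseteq> Y \<and> openin (topo X) {x \<in> points X. q x \<in> U}),
      reg = (\<lambda>U. {f. U \<subseteq> Y \<and> f \<circ> q \<in> reg X {x \<in> points X. q x \<in> U}})\<rparr>"

text \<open>
  The coarsest structure on the set \<open>X\<close> for which every \<open>(U, f) \<in> B\<close> is a regular function on an
  open subset; \<open>gen_reg X B U f\<close> says that \<open>U\<close> is open and \<open>f\<close> is regular on \<open>U\<close>.
\<close>

inductive gen_reg :: "'a set \<Rightarrow> ('a set \<times> ('a \<Rightarrow> complex)) set \<Rightarrow> 'a set \<Rightarrow> ('a \<Rightarrow> complex) \<Rightarrow> bool"
  for X B where
  base: "(U, f) \<in> B \<Longrightarrow> gen_reg X B U f"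
| const: "gen_reg X B X (\<lambda>_. c)"
| add: "gen_reg X B U f \<Longrightarrow> gen_reg X B V g \<Longrightarrow> gen_reg X B (U \<inter> V) (\<lambda>x. f x + g x)"
| mult: "gen_reg X B U f \<Longrightarrow> gen_reg X B V g \<Longrightarrow> gen_reg X B (U \<inter> V) (\<lambda>x. f x * g x)"
| inverse: "gen_reg X B U f \<Longrightarrow> gen_reg X B {x \<in> U. f x \<noteq> 0} (\<lambda>x. inverse (f x))"
| glue: "(\<And>x. x \<in> U \<Longrightarrow> \<exists>V g. x \<in> V \<and> V \<subseteq> U \<and> gen_reg X B V g \<and> (\<forall>y\<in>V. f y = g y))
          \<Longrightarrow> gen_reg X B U f"

definition fs_generated :: "'a set \<Rightarrow> ('a set \<times> ('a \<Rightarrow> complex)) set \<Rightarrow> 'a fspace" where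
  "fs_generated X B =
     \<lparr>topo = topology (\<lambda>U. gen_reg X B U (\<lambda>_. 0)), reg = (\<lambda>U. {f. gen_reg X B U f})\<rparr>"

text \<open>
  For a locally closed subset \<open>X\<close> of an affine space with coordinate functions \<open>C\<close>, the following is
  the usual variety structure on \<open>X\<close> (see \<open>reg_zariski_iff\<close>).
\<close>

definition fs_zariski :: "'a set \<Rightarrow> ('a \<Rightarrow> complex) set \<Rightarrow> 'a fspace" where
  "fs_zariski X C = fs_generated X ((\<lambda>c. (X, c)) ` C)"

text \<open>
  Binary and finite products in the category of spaces with functions, hence of varieties. (The
  topology is finer than the product topology.)
\<close>

definition fs_prod :: "'a fspace \<Rightarrow> 'b fspace \<Rightarrow> ('a \<times> 'b) fspace" where
  "fs_prod X Y = fs_generated (points X \<times> points Y)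
     ({(U \<times> points Y, f \<circ> fst) |U f. f \<in> reg X U} \<union>
      {(points X \<times> V, g \<circ> snd) |V g. g \<in> reg Y V})"

definition fs_PiE :: "'i set \<Rightarrow> ('i \<Rightarrow> 'a fspace) \<Rightarrow> ('i \<Rightarrow> 'a) fspace" where
  "fs_PiE I X = fs_generated (\<Pi>\<^sub>E i\<in>I. points (X i))
     {({x \<in> \<Pi>\<^sub>E i\<in>I. points (X i). x i \<in> U}, \<lambda>x. f (x i)) |i U f. i \<in> I \<and> f \<in> reg (X i) U}"

definition locally_trivial_fibration ::
    "'e fspace \<Rightarrow> 'b fspace \<Rightarrow> ('e \<Rightarrow> 'b) \<Rightarrow> 'f fspace \<Rightarrow> bool" where
  "locally_trivial_fibration E B p F \<longleftrightarrow>
     fs_morphism E B p \<and>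
     (\<forall>b \<in> points B. \<exists>U \<phi>. openin (topo B) U \<and> b \<in> U \<and>
        fs_isomorphism (fs_open_sub E {x \<in> points E. p x \<in> U}) (fs_prod (fs_open_sub B U) F) \<phi> \<and>
        (\<forall>x \<in> points E. p x \<in> U \<longrightarrow> fst (\<phi> x) = p x))"


subsection \<open>Basic properties of the constructions\<close>

lemma gen_reg_cong: "gen_reg X B U f \<Longrightarrow> (\<And>x. x \<in> U \<Longrightarrow> g x = f x) \<Longrightarrow> gen_reg X B U g"
  by (rule gen_reg.glue) blast

lemma gen_reg_subset:
  assumes "B \<subseteq> Pow X \<times> UNIV" "gen_reg X B U f"
  shows "U \<subseteq> X"
  using assms(2) by (induction rule: gen_reg.induct) (use assms(1) in blast)+

lemma gen_reg_zero:
  assumes "B \<subseteq> Pow X \<times> UNIV" "gen_reg X B U f"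
  shows "gen_reg X B U (\<lambda>_. 0)"
proof -
  have "U \<inter> X = U"
    using gen_reg_subset[OF assms] by auto
  then show ?thesis
    using gen_reg.mult[OF assms(2) gen_reg.const[of X B 0]] by simp
qed

lemma istopology_gen_reg: "istopology (\<lambda>U. gen_reg X B U (\<lambda>_. 0))"
  unfolding istopology_def
proof (intro conjI allI impI)
  fix S T assume "gen_reg X B S (\<lambda>_. 0)" "gen_reg X B T (\<lambda>_. 0)"
  from gen_reg.add[OF this] show "gen_reg X B (S \<inter> T) (\<lambda>_. 0)" by simp
next
  fix K assume "\<forall>S\<in>K. gen_reg X B S (\<lambda>_. 0)"
  then show "gen_reg X B (\<Union>K) (\<lambda>_. 0)"
    by (intro gen_reg.glue) blast
qed

lemma openin_generated: "openin (topo (fs_generated X B)) U \<longleftrightarrow> gen_reg X B U (\<lambda>_. 0)"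
  by (simp add: fs_generated_def topology_inverse'[OF istopology_gen_reg])

lemma reg_generated: "f \<in> reg (fs_generated X B) U \<longleftrightarrow> gen_reg X B U f"
  by (simp add: fs_generated_def)

lemma points_generated:
  assumes "B \<subseteq> Pow X \<times> UNIV"
  shows "points (fs_generated X B) = X"
proof
  show "points (fs_generated X B) \<subseteq> X"
    unfolding topspace_def using assms by (auto simp: openin_generated dest!: gen_reg_subset)
  have "openin (topo (fs_generated X B)) X"
    by (simp add: openin_generated gen_reg.const)
  then show "X \<subseteq> points (fs_generated X B)"
    by (rule openin_subset)
qed

lemma space_with_functions_generated:
  assumes B: "B \<subseteq> Pow X \<times> UNIV"
  shows "space_with_functions (fs_generated X B)"
proof (unfold_locales, unfold openin_generated reg_generated)
  fix f g U V and c :: complex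
  show "gen_reg X B U (\<lambda>_. 0)" if "gen_reg X B U f"
    using gen_reg_zero[OF B that] .
  show "gen_reg X B U (\<lambda>_. c)" if U: "gen_reg X B U (\<lambda>_. 0)"
    using gen_reg.add[OF U gen_reg.const[of X B c]] gen_reg_subset[OF B U]
    by (simp add: Int_absorb2)
  show "gen_reg X B U (\<lambda>x. f x + g x)" if "gen_reg X B U f" "gen_reg X B U g"
    using gen_reg.add[OF that] by simp
  show "gen_reg X B U (\<lambda>x. f x * g x)" if "gen_reg X B U f" "gen_reg X B U g"
    using gen_reg.mult[OF that] by simp
  show "gen_reg X B {x \<in> U. f x \<noteq> 0} (\<lambda>x. inverse (f x))" if "gen_reg X B U f"
    using gen_reg.inverse[OF that] .
  show "gen_reg X B V f" if "gen_reg X B U f" "gen_reg X B V (\<lambda>_. 0)" "V \<subseteq> U"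
    using gen_reg.add[OF that(1,2)] that(3) by (simp add: Int_absorb1)
  show "gen_reg X B U f"
    if "\<And>x. x \<in> U \<Longrightarrow> \<exists>V g. x \<in> V \<and> V \<subseteq> U \<and> gen_reg X B V g \<and> (\<forall>y\<in>V. f y = g y)"
    using that by (rule gen_reg.glue)
qed

lemma istopology_coinduced: "istopology (\<lambda>U. U \<subseteq> Y \<and> openin T {x \<in> topspace T. q x \<in> U})"
  unfolding istopology_def
proof (intro conjI allI impI; (elim conjE)?)
  fix U V assume "openin T {x \<in> topspace T. q x \<in> U}" "openin T {x \<in> topspace T. q x \<in> V}"
  then have "openin T ({x \<in> topspace T. q x \<in> U} \<inter> {x \<in> topspace T. q x \<in> V})"
    by (rule openin_Int)
  then show "openin T {x \<in> topspace T. q x \<in> U \<inter> V}"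
    by (rule back_subst) auto
next
  fix K assume K: "\<forall>U\<in>K. U \<subseteq> Y \<and> openin T {x \<in> topspace T. q x \<in> U}"
  then have "openin T (\<Union>U\<in>K. {x \<in> topspace T. q x \<in> U})"
    by blast
  then show "openin T {x \<in> topspace T. q x \<in> \<Union> K}"
    by (rule back_subst) auto
qed auto

lemma openin_coinduced:
  "openin (topo (fs_coinduced X Y q)) U \<longleftrightarrow> U \<subseteq> Y \<and> openin (topo X) {x \<in> points X. q x \<in> U}"
  by (simp add: fs_coinduced_def topology_inverse'[OF istopology_coinduced])

lemma points_coinduced:
  assumes "q ` points X \<subseteq> Y"
  shows "points (fs_coinduced X Y q) = Y"
proof
  show "points (fs_coinduced X Y q) \<subseteq> Y"
    unfolding topspace_def[of "topo (fs_coinduced X Y q)"] by (auto simp: openin_coinduced)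
  have "{x \<in> points X. q x \<in> Y} = points X"
    using assms by auto
  then have "openin (topo (fs_coinduced X Y q)) Y"
    by (simp add: openin_coinduced)
  then show "Y \<subseteq> points (fs_coinduced X Y q)"
    by (rule openin_subset)
qed

lemma space_with_functions_coinduced:
  assumes "space_with_functions X"
  shows "space_with_functions (fs_coinduced X Y q)"
proof -
  interpret X: space_with_functions X by fact
  have reg: "f \<in> reg (fs_coinduced X Y q) U \<longleftrightarrow> U \<subseteq> Y \<and> f \<circ> q \<in> reg X {x \<in> points X. q x \<in> U}" for f U
    by (simp add: fs_coinduced_def)
  show ?thesis
  proof (unfold_locales, unfold openin_coinduced reg)
    fix f g U V and c :: complex
    assume f: "U \<subseteq> Y \<and> f \<circ> q \<in> reg X {x \<in> points X. q x \<in> U}"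
    show "U \<subseteq> Y \<and> openin (topo X) {x \<in> points X. q x \<in> U}"
      using f X.reg_openin by blast
    show "U \<subseteq> Y \<and> (\<lambda>x. f x + g x) \<circ> q \<in> reg X {x \<in> points X. q x \<in> U}"
      if "U \<subseteq> Y \<and> g \<circ> q \<in> reg X {x \<in> points X. q x \<in> U}"
      using f that X.reg_add[of "f \<circ> q" _ "g \<circ> q"] by (simp add: o_def)
    show "U \<subseteq> Y \<and> (\<lambda>x. f x * g x) \<circ> q \<in> reg X {x \<in> points X. q x \<in> U}"
      if "U \<subseteq> Y \<and> g \<circ> q \<in> reg X {x \<in> points X. q x \<in> U}"
      using f that X.reg_mult[of "f \<circ> q" _ "g \<circ> q"] by (simp add: o_def)
    have "{x \<in> {x \<in> points X. q x \<in> U}. f (q x) \<noteq> 0} = {x \<in> points X. q x \<in> {y \<in> U. f y \<noteq> 0}}"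
      by auto
    then show "{y \<in> U. f y \<noteq> 0} \<subseteq> Y \<and>
        (\<lambda>x. inverse (f x)) \<circ> q \<in> reg X {x \<in> points X. q x \<in> {y \<in> U. f y \<noteq> 0}}"
      using f X.reg_inverse[of "f \<circ> q" "{x \<in> points X. q x \<in> U}"] by (auto simp: o_def)
    show "V \<subseteq> Y \<and> f \<circ> q \<in> reg X {x \<in> points X. q x \<in> V}"
      if "V \<subseteq> Y \<and> openin (topo X) {x \<in> points X. q x \<in> V}" "V \<subseteq> U"
      using f that X.reg_restrict[of "f \<circ> q" _ "{x \<in> points X. q x \<in> V}"] by blast
  next
    fix U and c :: complex
    assume "U \<subseteq> Y \<and> openin (topo X) {x \<in> points X. q x \<in> U}"
    then show "U \<subseteq> Y \<and> (\<lambda>_. c) \<circ> q \<in> reg X {x \<in> points X. q x \<in> U}"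
      using X.reg_const by (simp add: o_def)
  next
    fix U and f :: "'b \<Rightarrow> complex"
    assume loc: "\<And>x. x \<in> U \<Longrightarrow> \<exists>V g. x \<in> V \<and> V \<subseteq> U \<and>
      (V \<subseteq> Y \<and> g \<circ> q \<in> reg X {x \<in> points X. q x \<in> V}) \<and> (\<forall>y\<in>V. f y = g y)"
    have "f \<circ> q \<in> reg X {x \<in> points X. q x \<in> U}"
    proof (rule X.reg_glue)
      fix x assume x: "x \<in> {x \<in> points X. q x \<in> U}"
      then obtain V g where "q x \<in> V" "V \<subseteq> U" "g \<circ> q \<in> reg X {x \<in> points X. q x \<in> V}"
        "\<forall>y\<in>V. f y = g y"
        using loc[of "q x"] by auto
      then show "\<exists>V g. x \<in> V \<and> V \<subseteq> {x \<in> points X. q x \<in> U} \<and> g \<in> reg X V \<and> (\<forall>y\<in>V. (f \<circ> q) y = g y)"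
        using x by (intro exI[of _ "{x \<in> points X. q x \<in> V}"] exI[of _ "g \<circ> q"]) auto
    qed
    moreover have "U \<subseteq> Y"
      using loc by blast
    ultimately show "U \<subseteq> Y \<and> f \<circ> q \<in> reg X {x \<in> points X. q x \<in> U}"
      by blast
  qed
qed

inductive_set poly_fun :: "('a \<Rightarrow> complex) set \<Rightarrow> ('a \<Rightarrow> complex) set" for C where
  coord: "c \<in> C \<Longrightarrow> c \<in> poly_fun C"
| const: "(\<lambda>_. a) \<in> poly_fun C"
| add: "p \<in> poly_fun C \<Longrightarrow> q \<in> poly_fun C \<Longrightarrow> (\<lambda>x. p x + q x) \<in> poly_fun C"
| mult: "p \<in> poly_fun C \<Longrightarrow> q \<in> poly_fun C \<Longrightarrow> (\<lambda>x. p x * q x) \<in> poly_fun C"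

lemma gen_reg_poly_fun:
  assumes "p \<in> poly_fun C"
  shows "gen_reg X ((\<lambda>c. (X, c)) ` C) X p"
  using assms
proof (induction rule: poly_fun.induct)
  case (add p q)
  show ?case using gen_reg.add[OF add.IH] by simp
next
  case (mult p q)
  show ?case using gen_reg.mult[OF mult.IH] by simp
qed (auto intro: gen_reg.intros)

lemma reg_zariski_iff:
  "f \<in> reg (fs_zariski X C) U \<longleftrightarrow>
     U \<subseteq> X \<and> (\<forall>x\<in>U. \<exists>p \<in> poly_fun C. \<exists>q \<in> poly_fun C. q x \<noteq> 0 \<and>
       (\<forall>y\<in>X. q y \<noteq> 0 \<longrightarrow> y \<in> U \<and> f y = p y / q y))" (is "_ \<longleftrightarrow> ?R U f")
proof
  let ?B = "(\<lambda>c. (X, c)) ` C"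
  assume "f \<in> reg (fs_zariski X C) U"
  then have "gen_reg X ?B U f"
    by (simp add: fs_zariski_def reg_generated)
  then show "?R U f"
  proof (induction rule: gen_reg.induct)
    case (base U f)
    have "f \<in> poly_fun C" using base by (auto intro: poly_fun.coord)
    moreover have "U = X" using base by auto
    ultimately show ?case
      using poly_fun.const[of 1 C] by (intro conjI ballI bexI[of _ f] bexI[of _ "\<lambda>_. 1"]) auto
  next
    case (const c)
    then show ?case
      using poly_fun.const[of 1 C] poly_fun.const[of c C]
      by (intro conjI ballI bexI[of _ "\<lambda>_. c"] bexI[of _ "\<lambda>_. 1"]) auto
  next
    case (add U f V g)
    show ?case
    proof (intro conjI ballI)
      show "U \<inter> V \<subseteq> X" using add.IH by auto
      fix x assume x: "x \<in> U \<inter> V"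
      obtain p q where pq: "p \<in> poly_fun C" "q \<in> poly_fun C" "q x \<noteq> 0"
        "\<forall>y\<in>X. q y \<noteq> 0 \<longrightarrow> y \<in> U \<and> f y = p y / q y" using add.IH(1) x by blast
      obtain r s where rs: "r \<in> poly_fun C" "s \<in> poly_fun C" "s x \<noteq> 0"
        "\<forall>y\<in>X. s y \<noteq> 0 \<longrightarrow> y \<in> V \<and> g y = r y / s y" using add.IH(2) x by blast
      show "\<exists>p\<in>poly_fun C. \<exists>q\<in>poly_fun C. q x \<noteq> 0 \<and>
          (\<forall>y\<in>X. q y \<noteq> 0 \<longrightarrow> y \<in> U \<inter> V \<and> f y + g y = p y / q y)"
        by (rule bexI[of _ "\<lambda>y. p y * s y + r y * q y"], rule bexI[of _ "\<lambda>y. q y * s y"])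
          (use pq rs in \<open>auto intro!: poly_fun.add poly_fun.mult simp: add_frac_eq\<close>)
    qed
  next
    case (mult U f V g)
    show ?case
    proof (intro conjI ballI)
      show "U \<inter> V \<subseteq> X" using mult.IH by auto
      fix x assume x: "x \<in> U \<inter> V"
      obtain p q where pq: "p \<in> poly_fun C" "q \<in> poly_fun C" "q x \<noteq> 0"
        "\<forall>y\<in>X. q y \<noteq> 0 \<longrightarrow> y \<in> U \<and> f y = p y / q y" using mult.IH(1) x by blast
      obtain r s where rs: "r \<in> poly_fun C" "s \<in> poly_fun C" "s x \<noteq> 0"
        "\<forall>y\<in>X. s y \<noteq> 0 \<longrightarrow> y \<in> V \<and> g y = r y / s y" using mult.IH(2) x by blast
      show "\<exists>p\<in>poly_fun C. \<exists>q\<in>poly_fun C. q x \<noteq> 0 \<and>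
          (\<forall>y\<in>X. q y \<noteq> 0 \<longrightarrow> y \<in> U \<inter> V \<and> f y * g y = p y / q y)"
        by (rule bexI[of _ "\<lambda>y. p y * r y"], rule bexI[of _ "\<lambda>y. q y * s y"])
          (use pq rs in \<open>auto intro!: poly_fun.add poly_fun.mult\<close>)
    qed
  next
    case (inverse U f)
    show ?case
    proof (intro conjI ballI)
      show "{x \<in> U. f x \<noteq> 0} \<subseteq> X" using inverse.IH by auto
      fix x assume x: "x \<in> {x \<in> U. f x \<noteq> 0}"
      obtain p q where pq: "p \<in> poly_fun C" "q \<in> poly_fun C" "q x \<noteq> 0"
        "\<forall>y\<in>X. q y \<noteq> 0 \<longrightarrow> y \<in> U \<and> f y = p y / q y" using inverse.IH x by blast
      have "x \<in> X" "f x \<noteq> 0" using inverse.IH x by auto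
      then have "p x \<noteq> 0" using pq by auto
      have "y \<in> U \<and> f y \<noteq> 0 \<and> inverse (f y) = (q y * q y) / (p y * q y)"
        if "y \<in> X" "p y * q y \<noteq> 0" for y
      proof -
        have "q y \<noteq> 0" "p y \<noteq> 0" using that by auto
        moreover have "y \<in> U" "f y = p y / q y" using pq(4) that by auto
        ultimately show ?thesis by simp
      qed
      then show "\<exists>p\<in>poly_fun C. \<exists>q\<in>poly_fun C. q x \<noteq> 0 \<and>
          (\<forall>y\<in>X. q y \<noteq> 0 \<longrightarrow> y \<in> {x \<in> U. f x \<noteq> 0} \<and> inverse (f y) = p y / q y)"
        using pq(1-3) \<open>p x \<noteq> 0\<close>
        by (intro bexI[of _ "\<lambda>y. q y * q y"] bexI[of _ "\<lambda>y. p y * q y"] poly_fun.mult) simp_all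
    qed
  next
    case (glue U f)
    show ?case
    proof (intro conjI ballI)
      show "U \<subseteq> X"
      proof
        fix x assume "x \<in> U"
        from glue.IH[OF this] show "x \<in> X" by (elim exE conjE) (rule subsetD)
      qed
      fix x assume "x \<in> U"
      from glue.IH[OF this] obtain V g where V: "x \<in> V" "V \<subseteq> U" "\<forall>y\<in>V. f y = g y"
        and R: "\<forall>x\<in>V. \<exists>p \<in> poly_fun C. \<exists>q \<in> poly_fun C. q x \<noteq> 0 \<and>
          (\<forall>y\<in>X. q y \<noteq> 0 \<longrightarrow> y \<in> V \<and> g y = p y / q y)"
        by (elim exE conjE) (rule that)
      from bspec[OF R V(1)] obtain p q where pq: "p \<in> poly_fun C" "q \<in> poly_fun C" "q x \<noteq> 0"
        "\<forall>y\<in>X. q y \<noteq> 0 \<longrightarrow> y \<in> V \<and> g y = p y / q y" by blast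
      have "\<forall>y\<in>X. q y \<noteq> 0 \<longrightarrow> y \<in> U \<and> f y = p y / q y"
        using pq(4) V(2,3) by auto
      with pq(1-3) show "\<exists>p\<in>poly_fun C. \<exists>q\<in>poly_fun C. q x \<noteq> 0 \<and>
          (\<forall>y\<in>X. q y \<noteq> 0 \<longrightarrow> y \<in> U \<and> f y = p y / q y)"
        by blast
    qed
  qed
next
  let ?B = "(\<lambda>c. (X, c)) ` C"
  assume R: "?R U f"
  have "gen_reg X ?B U f"
  proof (rule gen_reg.glue)
    fix x assume x: "x \<in> U"
    then obtain p q where pq: "p \<in> poly_fun C" "q \<in> poly_fun C" "q x \<noteq> 0"
      "\<forall>y\<in>X. q y \<noteq> 0 \<longrightarrow> y \<in> U \<and> f y = p y / q y" using R by blast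
    let ?V = "{y \<in> X. q y \<noteq> 0}"
    have "gen_reg X ?B (X \<inter> ?V) (\<lambda>y. p y * inverse (q y))"
      by (intro gen_reg.mult gen_reg.inverse gen_reg_poly_fun pq)
    moreover have "X \<inter> ?V = ?V" by auto
    ultimately show "\<exists>V g. x \<in> V \<and> V \<subseteq> U \<and> gen_reg X ?B V g \<and> (\<forall>y\<in>V. f y = g y)"
      using pq x R by (intro exI[of _ ?V] exI[of _ "\<lambda>y. p y * inverse (q y)"])
        (auto simp: divide_inverse)
  qed
  then show "f \<in> reg (fs_zariski X C) U"
    by (simp add: fs_zariski_def reg_generated)
qed


section \<open>General linear groups and partial flag varieties\<close>

abbreviation GL :: "nat \<Rightarrow> complex mat monoid" where
  "GL n \<equiv> units_of (ring_mat TYPE(complex) n ())"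

abbreviation cvec_space :: "nat \<Rightarrow> (complex, complex vec) module" where
  "cvec_space n \<equiv> module_vec TYPE(complex) n"

abbreviation is_subspace :: "nat \<Rightarrow> complex vec set \<Rightarrow> bool" where
  "is_subspace n W \<equiv> VectorSpace.subspace class_ring W (cvec_space n)"

abbreviation subspace_dim :: "nat \<Rightarrow> complex vec set \<Rightarrow> nat" where
  "subspace_dim n W \<equiv> vectorspace.dim class_ring ((cvec_space n)\<lparr>carrier := W\<rparr>)"

definition flags :: "nat list \<Rightarrow> nat \<Rightarrow> complex vec set list set" where
  "flags as n = {Vs. length Vs = length as \<and>
     (\<forall>k < length as. is_subspace n (Vs ! k) \<and> subspace_dim n (Vs ! k) = as ! k) \<and>
     (\<forall>k < length as. \<forall>k' < length as. k \<le> k' \<longrightarrow> Vs ! k \<subseteq> Vs ! k')}"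

definition GL_space :: "nat \<Rightarrow> complex mat fspace" where
  "GL_space n = fs_zariski (carrier (GL n)) {\<lambda>g. g $$ (r, c) |r c. r < n \<and> c < n}"

definition coord_subspace :: "nat \<Rightarrow> nat \<Rightarrow> complex vec set" where
  "coord_subspace n a = {x \<in> carrier_vec n. \<forall>r < n. a \<le> r \<longrightarrow> x $ r = 0}"

text \<open>
  \<open>Fl(a\<^sub>1, \<dots>, a\<^sub>s; n)\<close>, as the homogeneous space of \<open>GL\<^sub>n\<close> through the standard flag.
\<close>

definition flag_variety :: "nat list \<Rightarrow> nat \<Rightarrow> complex vec set list fspace" where
  "flag_variety as n = fs_coinduced (GL_space n) (flags as n)
     (\<lambda>g. map (\<lambda>a. (\<lambda>x. g *\<^sub>v x) ` coord_subspace n a) as)"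


section \<open>Representations of the double framed quiver\<close>

text \<open>
  A quiver is a finite directed multigraph; an arc \<open>e\<close> goes from \<open>tail Q e\<close> (that is, \<open>out(e)\<close>)
  to \<open>head Q e\<close> (that is, \<open>in(e)\<close>). The spaces are \<open>D\<^sub>v = \<complex>\<^bsup>d v\<^esup>\<close> and \<open>F\<^sub>v = \<complex>\<^bsup>f v\<^esup>\<close>.
\<close>

record ('v, 'e) framed_rep =
  repA :: "'e \<Rightarrow> complex mat"
  repB :: "'e \<Rightarrow> complex mat"
  repI :: "'v \<Rightarrow> complex mat"
  repJ :: "'v \<Rightarrow> complex mat"

definition framed_reps ::
    "('v, 'e) pre_digraph \<Rightarrow> ('v \<Rightarrow> nat) \<Rightarrow> ('v \<Rightarrow> nat) \<Rightarrow> ('v, 'e) framed_rep set" where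
  "framed_reps Q d f = {R.
     repA R \<in> (\<Pi>\<^sub>E e\<in>arcs Q. carrier_mat (d (head Q e)) (d (tail Q e))) \<and>
     repB R \<in> (\<Pi>\<^sub>E e\<in>arcs Q. carrier_mat (d (tail Q e)) (d (head Q e))) \<and>
     repI R \<in> (\<Pi>\<^sub>E v\<in>verts Q. carrier_mat (d v) (f v)) \<and>
     repJ R \<in> (\<Pi>\<^sub>E v\<in>verts Q. carrier_mat (f v) (d v))}"

definition moment_map_eqs ::
    "('v, 'e) pre_digraph \<Rightarrow> ('v \<Rightarrow> nat) \<Rightarrow> ('v, 'e) framed_rep \<Rightarrow> bool" where
  "moment_map_eqs Q d R \<longleftrightarrow> (\<forall>v \<in> verts Q. \<forall>r < d v. \<forall>c < d v.
     (\<Sum>e | e \<in> arcs Q \<and> head Q e = v. (repA R e * repB R e) $$ (r, c))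
     - (\<Sum>e | e \<in> arcs Q \<and> tail Q e = v. (repB R e * repA R e) $$ (r, c))
     + (repI R v * repJ R v) $$ (r, c) = 0)"

definition stable ::
    "('v, 'e) pre_digraph \<Rightarrow> ('v \<Rightarrow> nat) \<Rightarrow> ('v \<Rightarrow> nat) \<Rightarrow> ('v, 'e) framed_rep \<Rightarrow> bool" where
  "stable Q d f R \<longleftrightarrow> (\<forall>W.
     (\<forall>v \<in> verts Q. is_subspace (d v) (W v) \<and> (\<forall>x \<in> carrier_vec (f v). repI R v *\<^sub>v x \<in> W v)) \<and>
     (\<forall>e \<in> arcs Q. (\<forall>x \<in> W (tail Q e). repA R e *\<^sub>v x \<in> W (head Q e)) \<and>
                   (\<forall>x \<in> W (head Q e). repB R e *\<^sub>v x \<in> W (tail Q e)))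
     \<longrightarrow> (\<forall>v \<in> verts Q. W v = carrier_vec (d v)))"

definition rep_act ::
    "('v, 'e) pre_digraph \<Rightarrow> ('v \<Rightarrow> nat) \<Rightarrow> ('v \<Rightarrow> complex mat) \<Rightarrow> ('v, 'e) framed_rep
      \<Rightarrow> ('v, 'e) framed_rep" where
  "rep_act Q d g R = \<lparr>
     repA = (\<lambda>e\<in>arcs Q. g (head Q e) * repA R e * inv\<^bsub>GL (d (tail Q e))\<^esub> (g (tail Q e))),
     repB = (\<lambda>e\<in>arcs Q. g (tail Q e) * repB R e * inv\<^bsub>GL (d (head Q e))\<^esub> (g (head Q e))),
     repI = (\<lambda>v\<in>verts Q. g v * repI R v),
     repJ = (\<lambda>v\<in>verts Q. repJ R v * inv\<^bsub>GL (d v)\<^esub> (g v))\<rparr>"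


section \<open>Split parabolic quiver varieties\<close>

text \<open>\<open>link x m v\<close> is the map \<open>\<pi>\<^sub>v\<^bsup>(m)\<^esup>\<close>, and \<open>d m v\<close> is the dimension \<open>d\<^sub>v\<^bsup>(m)\<^esup>\<close>.\<close>

record ('v, 'e) chain_rep =
  stage :: "nat \<Rightarrow> ('v, 'e) framed_rep"
  link :: "nat \<Rightarrow> 'v \<Rightarrow> complex mat"

fun link_comp :: "(nat \<Rightarrow> 'v \<Rightarrow> nat) \<Rightarrow> ('v, 'e) chain_rep \<Rightarrow> nat \<Rightarrow> 'v \<Rightarrow> complex mat" where
  "link_comp d x 0 v = 1\<^sub>m (d 0 v)"
| "link_comp d x (Suc m) v = link x m v * link_comp d x m v"

definition parabolic_points ::
    "('v, 'e) pre_digraph \<Rightarrow> nat \<Rightarrow> (nat \<Rightarrow> 'v \<Rightarrow> nat) \<Rightarrow> ('v \<Rightarrow> nat) \<Rightarrow> ('v, 'e) chain_rep set" where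
  "parabolic_points Q l d f = {x.
     stage x \<in> (\<Pi>\<^sub>E m\<in>{..l}. {R \<in> framed_reps Q (d m) f. stable Q (d m) f R \<and> moment_map_eqs Q (d m) R}) \<and>
     link x \<in> (\<Pi>\<^sub>E m\<in>{..<l}. \<Pi>\<^sub>E v\<in>verts Q. carrier_mat (d (Suc m) v) (d m v)) \<and>
     (\<forall>m < l.
        (\<forall>e \<in> arcs Q.
           link x m (head Q e) * repA (stage x m) e = repA (stage x (Suc m)) e * link x m (tail Q e) \<and>
           link x m (tail Q e) * repB (stage x m) e = repB (stage x (Suc m)) e * link x m (head Q e)) \<and>
        (\<forall>v \<in> verts Q.
           link x m v * repI (stage x m) v = repI (stage x (Suc m)) v \<and>
           repJ (stage x (Suc m)) v * link x m v = repJ (stage x m) v)) \<and>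
     (\<forall>v \<in> verts Q. \<forall>k \<in> mat_kernel (link_comp d x l v).
        (\<forall>e \<in> arcs Q. tail Q e = v \<longrightarrow> repA (stage x 0) e *\<^sub>v k = 0\<^sub>v (d 0 (head Q e))) \<and>
        (\<forall>e \<in> arcs Q. head Q e = v \<longrightarrow> repB (stage x 0) e *\<^sub>v k = 0\<^sub>v (d 0 (tail Q e))) \<and>
        repJ (stage x 0) v *\<^sub>v k = 0\<^sub>v (f v))}"

definition chain_coords ::
    "('v, 'e) pre_digraph \<Rightarrow> nat \<Rightarrow> (nat \<Rightarrow> 'v \<Rightarrow> nat) \<Rightarrow> ('v \<Rightarrow> nat) \<Rightarrow> (('v, 'e) chain_rep \<Rightarrow> complex) set" where
  "chain_coords Q l d f =
     {\<lambda>x. repA (stage x m) e $$ (r, c) |m e r c.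
        m \<le> l \<and> e \<in> arcs Q \<and> r < d m (head Q e) \<and> c < d m (tail Q e)} \<union>
     {\<lambda>x. repB (stage x m) e $$ (r, c) |m e r c.
        m \<le> l \<and> e \<in> arcs Q \<and> r < d m (tail Q e) \<and> c < d m (head Q e)} \<union>
     {\<lambda>x. repI (stage x m) v $$ (r, c) |m v r c. m \<le> l \<and> v \<in> verts Q \<and> r < d m v \<and> c < f v} \<union>
     {\<lambda>x. repJ (stage x m) v $$ (r, c) |m v r c. m \<le> l \<and> v \<in> verts Q \<and> r < f v \<and> c < d m v} \<union>
     {\<lambda>x. link x m v $$ (r, c) |m v r c. m < l \<and> v \<in> verts Q \<and> r < d (Suc m) v \<and> c < d m v}"

definition parabolic_space ::
    "('v, 'e) pre_digraph \<Rightarrow> nat \<Rightarrow> (nat \<Rightarrow> 'v \<Rightarrow> nat) \<Rightarrow> ('v \<Rightarrow> nat) \<Rightarrow> ('v, 'e) chain_rep fspace" where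
  "parabolic_space Q l d f = fs_zariski (parabolic_points Q l d f) (chain_coords Q l d f)"

definition gauge_group ::
    "('v, 'e) pre_digraph \<Rightarrow> nat \<Rightarrow> (nat \<Rightarrow> 'v \<Rightarrow> nat) \<Rightarrow> (nat \<times> 'v \<Rightarrow> complex mat) monoid" where
  "gauge_group Q l d = product_group ({..l} \<times> verts Q) (\<lambda>(m, v). GL (d m v))"

definition gauge_act ::
    "('v, 'e) pre_digraph \<Rightarrow> nat \<Rightarrow> (nat \<Rightarrow> 'v \<Rightarrow> nat) \<Rightarrow> (nat \<times> 'v \<Rightarrow> complex mat)
      \<Rightarrow> ('v, 'e) chain_rep \<Rightarrow> ('v, 'e) chain_rep" where
  "gauge_act Q l d g x = \<lparr>
     stage = (\<lambda>m\<in>{..l}. rep_act Q (d m) (\<lambda>v. g (m, v)) (stage x m)),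
     link = (\<lambda>m\<in>{..<l}. \<lambda>v\<in>verts Q. g (Suc m, v) * link x m v * inv\<^bsub>GL (d m v)\<^esub> (g (m, v)))\<rparr>"

definition gauge_orbit ::
    "('v, 'e) pre_digraph \<Rightarrow> nat \<Rightarrow> (nat \<Rightarrow> 'v \<Rightarrow> nat) \<Rightarrow> ('v, 'e) chain_rep \<Rightarrow> ('v, 'e) chain_rep set" where
  "gauge_orbit Q l d = orbit (gauge_group Q l d) (gauge_act Q l d)"

definition parabolic_variety ::
    "('v, 'e) pre_digraph \<Rightarrow> nat \<Rightarrow> (nat \<Rightarrow> 'v \<Rightarrow> nat) \<Rightarrow> ('v \<Rightarrow> nat) \<Rightarrow> ('v, 'e) chain_rep set fspace" where
  "parabolic_variety Q l d f =
     fs_coinduced (parabolic_space Q l d f)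
       (orbits (gauge_group Q l d) (parabolic_points Q l d f) (gauge_act Q l d))
       (gauge_orbit Q l d)"

definition end_dims :: "nat \<Rightarrow> (nat \<Rightarrow> 'v \<Rightarrow> nat) \<Rightarrow> nat \<Rightarrow> 'v \<Rightarrow> nat" where
  "end_dims l d = (\<lambda>m. if m = 0 then d 0 else d l)"

definition forget_middle ::
    "('v, 'e) pre_digraph \<Rightarrow> nat \<Rightarrow> (nat \<Rightarrow> 'v \<Rightarrow> nat) \<Rightarrow> ('v, 'e) chain_rep \<Rightarrow> ('v, 'e) chain_rep" where
  "forget_middle Q l d x = \<lparr>
     stage = (\<lambda>m\<in>{..1}. if m = 0 then stage x 0 else stage x l),
     link = (\<lambda>m\<in>{..<1}. \<lambda>v\<in>verts Q. link_comp d x l v)\<rparr>"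

text \<open>
  The map on orbits induced by \<open>forget_middle\<close>, which sends all points of one orbit into one
  orbit; \<open>the_elem\<close> extracts that orbit.
\<close>

definition natural_projection ::
    "('v, 'e) pre_digraph \<Rightarrow> nat \<Rightarrow> (nat \<Rightarrow> 'v \<Rightarrow> nat)
      \<Rightarrow> ('v, 'e) chain_rep set \<Rightarrow> ('v, 'e) chain_rep set" where
  "natural_projection Q l d X =
     the_elem ((\<lambda>x. gauge_orbit Q 1 (end_dims l d) (forget_middle Q l d x)) ` X)"

end

theory Submission
  imports Defs "Jordan_Normal_Form.DL_Rank"
begin

text \<open>
  Why the theorem holds. Write \<open>K\<close> for the kernel of the total projection of a chain. On \<open>K\<close> all arrows of
  stage zero vanish, hence every subspace of \<open>K\<close> is a subrepresentation, and a quotient of a stable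
  representation that satisfies the moment map equations has both properties again. By stability the maps
  between the stages are surjective, so a chain over a given point of the base is, up to isomorphism of the
  intermediate stages, a flag of subspaces of \<open>K\<close>; taking annihilators, it is a flag in the dual of \<open>K\<close>
  with members of dimension \<open>d m v - d l v\<close>. Conversely, every flag occurs. In coordinates: each chain has
  a gauge equivalent standard chain, in which all maps between the stages are projections to the first
  coordinates (\<open>normal_form\<close>), and the remaining freedom in stage zero is a block triangular group
  (\<open>orbit_std_chain_parabolic\<close>).

  For local triviality, the bundle of the spaces \<open>K\<close> has to be trivialised locally on the orbit space of the
  base. Words, that is, paths that start at framing vectors, span all spaces by stability. They transform
  like vectors under the gauge group and depend polynomially on the representation, so fixing words that
  form bases at one point gives coordinates near this point that are equivariant and regular
  (\<open>coframe_exists\<close>). Stage zero in these coordinates is an invariant regular function, which plays the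
  role of a section of the quotient map.

  It remains to see that the resulting bijection between chains and pairs of a point of the base and a
  flag is a morphism in both directions. A family of flags given by column spaces of regular matrices lifts
  locally to the general linear group (\<open>fs_morphism_flag_variety\<close>), and the flag variety, being defined
  as a quotient of the general linear group, admits local sections (\<open>flag_variety_local_section\<close>). The
  first fact makes the flag of a chain a morphism, the second one produces a chain with regular entries
  from a flag.
\<close>

section \<open>Spaces with functions\<close>

lemma (in space_with_functions) reg_cong:
  assumes "f \<in> reg X U" "\<And>x. x \<in> U \<Longrightarrow> g x = f x"
  shows "g \<in> reg X U"
  by (rule reg_glue) (use assms in blast)

lemma (in space_with_functions) reg_sum:
  assumes "openin (topo X) U" "\<And>i. i \<in> I \<Longrightarrow> f i \<in> reg X U"
  shows "(\<lambda>x. \<Sum>i\<in>I. f i x) \<in> reg X U"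
  using assms(2)
proof (induction I rule: infinite_finite_induct)
  case (insert i I)
  then show ?case using reg_add[of "f i" U "\<lambda>x. \<Sum>i\<in>I. f i x"] by simp
qed (use assms(1) reg_const in simp_all)

lemma (in space_with_functions) reg_prod:
  assumes "openin (topo X) U" "\<And>i. i \<in> I \<Longrightarrow> f i \<in> reg X U"
  shows "(\<lambda>x. \<Prod>i\<in>I. f i x) \<in> reg X U"
  using assms(2)
proof (induction I rule: infinite_finite_induct)
  case (insert i I)
  then show ?case using reg_mult[of "f i" U "\<lambda>x. \<Prod>i\<in>I. f i x"] by simp
qed (use assms(1) reg_const in simp_all)

lemma (in space_with_functions) openin_nonzero:
  assumes "f \<in> reg X U"
  shows "openin (topo X) {x \<in> U. f x \<noteq> 0}"
  using reg_openin[OF reg_inverse[OF assms]] .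

lemma fs_morphism_compose:
  assumes "fs_morphism X Y \<phi>" "fs_morphism Y Z \<psi>"
  shows "fs_morphism X Z (\<psi> \<circ> \<phi>)"
  unfolding fs_morphism_def
proof (intro conjI allI ballI)
  have cont: "continuous_map (topo X) (topo Y) \<phi>" "continuous_map (topo Y) (topo Z) \<psi>"
    using assms by (auto simp: fs_morphism_def)
  then show "continuous_map (topo X) (topo Z) (\<psi> \<circ> \<phi>)"
    by (rule continuous_map_compose)
  fix V f assume f: "f \<in> reg Z V"
  have "f \<circ> \<psi> \<in> reg Y {y \<in> points Y. \<psi> y \<in> V}"
    using assms(2) f by (auto simp: fs_morphism_def)
  then have "f \<circ> \<psi> \<circ> \<phi> \<in> reg X {x \<in> points X. \<phi> x \<in> {y \<in> points Y. \<psi> y \<in> V}}"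
    using assms(1) unfolding fs_morphism_def by blast
  moreover have "{x \<in> points X. \<phi> x \<in> {y \<in> points Y. \<psi> y \<in> V}} = {x \<in> points X. (\<psi> \<circ> \<phi>) x \<in> V}"
    using cont(1) by (auto simp: continuous_map_def)
  ultimately show "f \<circ> (\<psi> \<circ> \<phi>) \<in> reg X {x \<in> points X. (\<psi> \<circ> \<phi>) x \<in> V}"
    by (simp add: comp_assoc)
qed

lemma fs_morphism_points: "fs_morphism X Y \<phi> \<Longrightarrow> x \<in> points X \<Longrightarrow> \<phi> x \<in> points Y"
  by (auto simp: fs_morphism_def continuous_map_def)

lemma fs_morphism_openin:
  "fs_morphism X Y \<phi> \<Longrightarrow> openin (topo Y) V \<Longrightarrow> openin (topo X) {x \<in> points X. \<phi> x \<in> V}"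
  by (auto simp: fs_morphism_def continuous_map_def)

lemma fs_morphism_reg:
  "fs_morphism X Y \<phi> \<Longrightarrow> f \<in> reg Y V \<Longrightarrow> (\<lambda>x. f (\<phi> x)) \<in> reg X {x \<in> points X. \<phi> x \<in> V}"
  by (auto simp: fs_morphism_def o_def)

lemma fs_morphism_reg_points:
  assumes "fs_morphism X Y \<phi>" "f \<in> reg Y (points Y)"
  shows "(\<lambda>x. f (\<phi> x)) \<in> reg X (points X)"
proof -
  have "{x \<in> points X. \<phi> x \<in> points Y} = points X"
    using fs_morphism_points[OF assms(1)] by auto
  with fs_morphism_reg[OF assms] show ?thesis by simp
qed

lemma fs_morphism_cong:
  assumes "space_with_functions X" "fs_morphism X Y \<phi>" "\<And>x. x \<in> points X \<Longrightarrow> \<psi> x = \<phi> x"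
  shows "fs_morphism X Y \<psi>"
proof -
  interpret X: space_with_functions X by fact
  have eq: "{x \<in> points X. \<psi> x \<in> V} = {x \<in> points X. \<phi> x \<in> V}" for V
    using assms(3) by auto
  show ?thesis
    unfolding fs_morphism_def
  proof (intro conjI allI ballI)
    show "continuous_map (topo X) (topo Y) \<psi>"
      using assms(2) assms(3)[symmetric] by (intro continuous_map_eq[of _ _ \<phi> \<psi>]) (auto simp: fs_morphism_def)
    fix V f assume "f \<in> reg Y V"
    from fs_morphism_reg[OF assms(2) this]
    show "f \<circ> \<psi> \<in> reg X {x \<in> points X. \<psi> x \<in> V}"
      unfolding eq by (rule X.reg_cong) (use assms(3) in auto)
  qed
qed

lemma space_with_functions_open_sub:
  assumes "space_with_functions X" "openin (topo X) U"
  shows "space_with_functions (fs_open_sub X U)"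
proof -
  interpret X: space_with_functions X by fact
  have reg: "f \<in> reg (fs_open_sub X U) W \<longleftrightarrow> W \<subseteq> U \<and> f \<in> reg X W" for f W
    by (simp add: fs_open_sub_def)
  have op: "openin (topo (fs_open_sub X U)) W \<longleftrightarrow> W \<subseteq> U \<and> openin (topo X) W" for W
    using assms(2) by (auto simp: fs_open_sub_def openin_open_subtopology)
  show ?thesis
  proof (unfold_locales, unfold reg op)
    fix f :: "'a \<Rightarrow> complex" and W
    assume loc: "\<And>x. x \<in> W \<Longrightarrow> \<exists>V g. x \<in> V \<and> V \<subseteq> W \<and> (V \<subseteq> U \<and> g \<in> reg X V) \<and> (\<forall>y\<in>V. f y = g y)"
    have "W \<subseteq> U"
    proof
      fix x assume "x \<in> W"
      from loc[OF this] show "x \<in> U" by (elim exE conjE) (rule subsetD)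
    qed
    moreover have "f \<in> reg X W"
    proof (rule X.reg_glue)
      fix x assume "x \<in> W"
      from loc[OF this] show "\<exists>V g. x \<in> V \<and> V \<subseteq> W \<and> g \<in> reg X V \<and> (\<forall>y\<in>V. f y = g y)"
        by (elim exE conjE) (intro exI conjI)
    qed
    ultimately show "W \<subseteq> U \<and> f \<in> reg X W" ..
  next
    fix f g :: "'a \<Rightarrow> complex" and W V
    assume f: "W \<subseteq> U \<and> f \<in> reg X W"
    show "W \<subseteq> U \<and> openin (topo X) W" using f X.reg_openin[of f W] by simp
    show "W \<subseteq> U \<and> (\<lambda>x. f x + g x) \<in> reg X W" if "W \<subseteq> U \<and> g \<in> reg X W"
      using f that X.reg_add[of f W g] by simp
    show "W \<subseteq> U \<and> (\<lambda>x. f x * g x) \<in> reg X W" if "W \<subseteq> U \<and> g \<in> reg X W"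
      using f that X.reg_mult[of f W g] by simp
    show "{x \<in> W. f x \<noteq> 0} \<subseteq> U \<and> (\<lambda>x. inverse (f x)) \<in> reg X {x \<in> W. f x \<noteq> 0}"
      using f X.reg_inverse[of f W] by auto
    show "V \<subseteq> U \<and> f \<in> reg X V" if "V \<subseteq> U \<and> openin (topo X) V" "V \<subseteq> W"
      using f that X.reg_restrict[of f W V] by simp
  next
    fix W and c :: complex
    assume "W \<subseteq> U \<and> openin (topo X) W"
    then show "W \<subseteq> U \<and> (\<lambda>_. c) \<in> reg X W" using X.reg_const by simp
  qed
qed

lemma reg_open_sub: "f \<in> reg (fs_open_sub X U) W \<longleftrightarrow> W \<subseteq> U \<and> f \<in> reg X W"
  by (simp add: fs_open_sub_def)

lemma points_open_sub: "points (fs_open_sub X U) = points X \<inter> U"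
  by (simp add: fs_open_sub_def)

lemma points_open_sub_open: "openin (topo X) U \<Longrightarrow> points (fs_open_sub X U) = U"
  using openin_subset by (auto simp: points_open_sub)

lemma openin_open_sub:
  "openin (topo X) U \<Longrightarrow> openin (topo (fs_open_sub X U)) W \<longleftrightarrow> W \<subseteq> U \<and> openin (topo X) W"
  by (auto simp: fs_open_sub_def openin_open_subtopology)

text \<open>
  Being a morphism is a local condition, since open sets and regular functions can be glued.
\<close>

lemma fs_morphism_local:
  assumes "space_with_functions X"
    and loc: "\<And>x. x \<in> points X \<Longrightarrow> \<exists>U. openin (topo X) U \<and> x \<in> U \<and> fs_morphism (fs_open_sub X U) Y \<phi>"
  shows "fs_morphism X Y \<phi>"
proof -
  interpret X: space_with_functions X by fact
  have pre: "{z \<in> points (fs_open_sub X U). \<phi> z \<in> V} = U \<inter> {z \<in> points X. \<phi> z \<in> V}"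
    if "openin (topo X) U" for U V
    using openin_subset[OF that] by (auto simp: points_open_sub_open[OF that])
  show ?thesis
    unfolding fs_morphism_def
  proof (intro conjI allI ballI)
    show "continuous_map (topo X) (topo Y) \<phi>"
      unfolding continuous_map_def
    proof (intro conjI allI impI)
      show "\<phi> \<in> points X \<rightarrow> points Y"
      proof
        fix x assume "x \<in> points X"
        then obtain U where "openin (topo X) U" "x \<in> U" "fs_morphism (fs_open_sub X U) Y \<phi>"
          using loc by blast
        then show "\<phi> x \<in> points Y"
          using fs_morphism_points[of "fs_open_sub X U" Y \<phi> x] by (simp add: points_open_sub_open)
      qed
      fix V assume V: "openin (topo Y) V"
      show "openin (topo X) {x \<in> points X. \<phi> x \<in> V}"
      proof (subst openin_subopen, intro ballI)
        fix x assume x: "x \<in> {x \<in> points X. \<phi> x \<in> V}"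
        then obtain U where U: "openin (topo X) U" "x \<in> U" "fs_morphism (fs_open_sub X U) Y \<phi>"
          using loc by blast
        have "openin (topo X) (U \<inter> {x \<in> points X. \<phi> x \<in> V})"
          using fs_morphism_openin[OF U(3) V] unfolding pre[OF U(1)] openin_open_sub[OF U(1)] by simp
        then show "\<exists>T. openin (topo X) T \<and> x \<in> T \<and> T \<subseteq> {x \<in> points X. \<phi> x \<in> V}"
          using U(2) x by blast
      qed
    qed
    fix V f assume f: "f \<in> reg Y V"
    show "f \<circ> \<phi> \<in> reg X {x \<in> points X. \<phi> x \<in> V}"
    proof (rule X.reg_glue)
      fix x assume x: "x \<in> {x \<in> points X. \<phi> x \<in> V}"
      then obtain U where U: "openin (topo X) U" "x \<in> U" "fs_morphism (fs_open_sub X U) Y \<phi>"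
        using loc by blast
      have "f \<circ> \<phi> \<in> reg X (U \<inter> {x \<in> points X. \<phi> x \<in> V})"
        using fs_morphism_reg[OF U(3) f] unfolding pre[OF U(1)] reg_open_sub by (simp add: o_def)
      then show "\<exists>W g. x \<in> W \<and> W \<subseteq> {x \<in> points X. \<phi> x \<in> V} \<and> g \<in> reg X W \<and> (\<forall>y\<in>W. (f \<circ> \<phi>) y = g y)"
        using U(2) x
        by (intro exI[of _ "U \<inter> {x \<in> points X. \<phi> x \<in> V}"] exI[of _ "f \<circ> \<phi>"]) simp
    qed
  qed
qed

lemma fs_morphism_open_sub_inclusion:
  assumes "space_with_functions X" "openin (topo X) U"
  shows "fs_morphism (fs_open_sub X U) X (\<lambda>x. x)"
proof -
  interpret X: space_with_functions X by fact
  have eq: "{x \<in> U. x \<in> V} = U \<inter> V" for V by auto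
  show ?thesis
    unfolding fs_morphism_def continuous_map_def points_open_sub_open[OF assms(2)] eq o_def
  proof (intro conjI allI ballI impI)
    show "(\<lambda>x. x) \<in> U \<rightarrow> points X"
      using openin_subset[OF assms(2)] by auto
    show "openin (topo (fs_open_sub X U)) (U \<inter> V)" if "openin (topo X) V" for V
      using openin_Int[OF assms(2) that] by (simp add: openin_open_sub[OF assms(2)])
    show "f \<in> reg (fs_open_sub X U) (U \<inter> V)" if "f \<in> reg X V" for f V
      using X.reg_restrict[OF that openin_Int[OF assms(2) X.reg_openin[OF that]]]
      by (simp add: reg_open_sub)
  qed
qed

lemma fs_morphism_restrict:
  assumes "space_with_functions X" "openin (topo X) U" "fs_morphism X Y \<phi>"
  shows "fs_morphism (fs_open_sub X U) Y \<phi>"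
  using fs_morphism_compose[OF fs_morphism_open_sub_inclusion[OF assms(1,2)] assms(3)]
  by (simp add: o_def)

lemma fs_morphism_into_open_sub:
  assumes "openin (topo Y) V" "fs_morphism X Y \<phi>" "\<And>x. x \<in> points X \<Longrightarrow> \<phi> x \<in> V"
  shows "fs_morphism X (fs_open_sub Y V) \<phi>"
  using assms unfolding fs_morphism_def continuous_map_def
  by (auto simp: points_open_sub_open openin_open_sub reg_open_sub)

text \<open>
  The generated structure is the coarsest one, so only the generators have to be pulled back: the rules
  for \<open>gen_reg\<close> are closure properties of the regular functions on any space, and they commute with
  taking preimages.
\<close>

lemma fs_morphism_generated:
  assumes X: "space_with_functions X" and B: "B \<subseteq> Pow Y \<times> UNIV"
    and \<phi>: "\<And>x. x \<in> points X \<Longrightarrow> \<phi> x \<in> Y"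
    and base: "\<And>U f. (U, f) \<in> B \<Longrightarrow> f \<circ> \<phi> \<in> reg X {x \<in> points X. \<phi> x \<in> U}"
  shows "fs_morphism X (fs_generated Y B) \<phi>"
proof -
  interpret X: space_with_functions X by fact
  have reg: "f \<circ> \<phi> \<in> reg X {x \<in> points X. \<phi> x \<in> U}" if "gen_reg Y B U f" for U f
    using that
  proof (induction rule: gen_reg.induct)
    case (base U f)
    then show ?case by (rule assms(4))
  next
    case (const c)
    have "{x \<in> points X. \<phi> x \<in> Y} = points X" using \<phi> by auto
    then show ?case using X.reg_const by (simp add: o_def)
  next
    case (add U f V g)
    have *: "{x \<in> points X. \<phi> x \<in> U \<inter> V} = {x \<in> points X. \<phi> x \<in> U} \<inter> {x \<in> points X. \<phi> x \<in> V}" by auto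
    then have o: "openin (topo X) {x \<in> points X. \<phi> x \<in> U \<inter> V}"
      by (simp only: *) (intro openin_Int X.reg_openin[OF add.IH(1)] X.reg_openin[OF add.IH(2)])
    have "(\<lambda>x. (f \<circ> \<phi>) x + (g \<circ> \<phi>) x) \<in> reg X {x \<in> points X. \<phi> x \<in> U \<inter> V}"
      by (intro X.reg_add X.reg_restrict[OF add.IH(1) o] X.reg_restrict[OF add.IH(2) o]) auto
    then show ?case by (simp add: o_def)
  next
    case (mult U f V g)
    have *: "{x \<in> points X. \<phi> x \<in> U \<inter> V} = {x \<in> points X. \<phi> x \<in> U} \<inter> {x \<in> points X. \<phi> x \<in> V}" by auto
    then have o: "openin (topo X) {x \<in> points X. \<phi> x \<in> U \<inter> V}"
      by (simp only: *) (intro openin_Int X.reg_openin[OF mult.IH(1)] X.reg_openin[OF mult.IH(2)])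
    have "(\<lambda>x. (f \<circ> \<phi>) x * (g \<circ> \<phi>) x) \<in> reg X {x \<in> points X. \<phi> x \<in> U \<inter> V}"
      by (intro X.reg_mult X.reg_restrict[OF mult.IH(1) o] X.reg_restrict[OF mult.IH(2) o]) auto
    then show ?case by (simp add: o_def)
  next
    case (inverse U f)
    have "{x \<in> points X. \<phi> x \<in> {y \<in> U. f y \<noteq> 0}} = {x \<in> {x \<in> points X. \<phi> x \<in> U}. (f \<circ> \<phi>) x \<noteq> 0}"
      by auto
    then show ?case using X.reg_inverse[OF inverse.IH] by (simp add: o_def)
  next
    case (glue U f)
    show ?case
    proof (rule X.reg_glue)
      fix x assume x: "x \<in> {x \<in> points X. \<phi> x \<in> U}"
      then have "\<phi> x \<in> U" by simp
      from glue.IH[OF this] obtain V g where "\<phi> x \<in> V" "V \<subseteq> U" "\<forall>y\<in>V. f y = g y"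
        "g \<circ> \<phi> \<in> reg X {x \<in> points X. \<phi> x \<in> V}" by blast
      then show "\<exists>V g. x \<in> V \<and> V \<subseteq> {x \<in> points X. \<phi> x \<in> U} \<and> g \<in> reg X V \<and> (\<forall>y\<in>V. (f \<circ> \<phi>) y = g y)"
        using x by (intro exI[of _ "{x \<in> points X. \<phi> x \<in> V}"] exI[of _ "g \<circ> \<phi>"]) auto
    qed
  qed
  show ?thesis
    unfolding fs_morphism_def continuous_map_def points_generated[OF B] openin_generated
    using \<phi> reg X.reg_openin[OF reg] by (auto simp: reg_generated)
qed

lemma fs_morphism_zariski:
  assumes X: "space_with_functions X"
    and \<phi>: "\<And>x. x \<in> points X \<Longrightarrow> \<phi> x \<in> Y"
    and base: "\<And>c. c \<in> C \<Longrightarrow> (\<lambda>x. c (\<phi> x)) \<in> reg X (points X)"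
  shows "fs_morphism X (fs_zariski Y C) \<phi>"
  unfolding fs_zariski_def
proof (rule fs_morphism_generated[OF X])
  fix U f assume "(U, f) \<in> (\<lambda>c. (Y, c)) ` C"
  then have "f \<in> C" "U = Y" by auto
  moreover have "{x \<in> points X. \<phi> x \<in> Y} = points X" using \<phi> by auto
  ultimately show "f \<circ> \<phi> \<in> reg X {x \<in> points X. \<phi> x \<in> U}"
    using base by (simp add: o_def)
qed (use \<phi> in auto)

lemma space_with_functions_zariski: "space_with_functions (fs_zariski Y C)"
  unfolding fs_zariski_def by (rule space_with_functions_generated) auto

lemma points_zariski [simp]: "points (fs_zariski Y C) = Y"
  unfolding fs_zariski_def by (rule points_generated) auto

lemma reg_zariski_coord: "c \<in> C \<Longrightarrow> c \<in> reg (fs_zariski Y C) Y"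
  unfolding fs_zariski_def reg_generated by (rule gen_reg.base) auto

lemma fs_prod_base:
  assumes "space_with_functions X" "space_with_functions Y"
  shows "{(U \<times> points Y, f \<circ> fst) |U f. f \<in> reg X U} \<union> {(points X \<times> V, g \<circ> snd) |V g. g \<in> reg Y V}
    \<subseteq> Pow (points X \<times> points Y) \<times> UNIV"
  using space_with_functions.reg_openin[OF assms(1), THEN openin_subset]
    space_with_functions.reg_openin[OF assms(2), THEN openin_subset] by fast

lemma space_with_functions_prod:
  "space_with_functions X \<Longrightarrow> space_with_functions Y \<Longrightarrow> space_with_functions (fs_prod X Y)"
  unfolding fs_prod_def by (intro space_with_functions_generated fs_prod_base)

lemma points_prod:
  "space_with_functions X \<Longrightarrow> space_with_functions Y \<Longrightarrow> points (fs_prod X Y) = points X \<times> points Y"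
  unfolding fs_prod_def by (intro points_generated fs_prod_base)

lemma fs_morphism_into_prod:
  assumes "space_with_functions X" "space_with_functions Y" "space_with_functions Z"
    and "fs_morphism Z X (\<lambda>z. fst (\<phi> z))" "fs_morphism Z Y (\<lambda>z. snd (\<phi> z))"
  shows "fs_morphism Z (fs_prod X Y) \<phi>"
  unfolding fs_prod_def
proof (rule fs_morphism_generated[OF assms(3) fs_prod_base[OF assms(1,2)]])
  have f: "fst (\<phi> z) \<in> points X" and s: "snd (\<phi> z) \<in> points Y" if "z \<in> points Z" for z
    using fs_morphism_points[OF assms(4) that] fs_morphism_points[OF assms(5) that] by auto
  then show "\<phi> z \<in> points X \<times> points Y" if "z \<in> points Z" for z
    using that by (simp add: mem_Times_iff)
  fix U f
  assume "(U, f) \<in> {(U \<times> points Y, f \<circ> fst) |U f. f \<in> reg X U} \<union>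
      {(points X \<times> V, g \<circ> snd) |V g. g \<in> reg Y V}"
  then consider (X) U' f' where "U = U' \<times> points Y" "f = f' \<circ> fst" "f' \<in> reg X U'"
    | (Y) V g where "U = points X \<times> V" "f = g \<circ> snd" "g \<in> reg Y V" by blast
  then show "f \<circ> \<phi> \<in> reg Z {z \<in> points Z. \<phi> z \<in> U}"
  proof cases
    case X
    have "{z \<in> points Z. \<phi> z \<in> U} = {z \<in> points Z. fst (\<phi> z) \<in> U'}"
      using s X by (auto simp: mem_Times_iff)
    then show ?thesis using fs_morphism_reg[OF assms(4) X(3)] X by (simp add: o_def)
  next
    case Y
    have "{z \<in> points Z. \<phi> z \<in> U} = {z \<in> points Z. snd (\<phi> z) \<in> V}"
      using f Y by (auto simp: mem_Times_iff)
    then show ?thesis using fs_morphism_reg[OF assms(5) Y(3)] Y by (simp add: o_def)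
  qed
qed

lemma fs_morphism_fst:
  assumes "space_with_functions X" "space_with_functions Y"
  shows "fs_morphism (fs_prod X Y) X fst"
proof -
  interpret X: space_with_functions X by fact
  note B = fs_prod_base[OF assms]
  have pre: "{p \<in> points X \<times> points Y. fst p \<in> U} = U \<times> points Y" if "openin (topo X) U" for U
    using openin_subset[OF that] by auto
  have reg: "gen_reg (points X \<times> points Y) ({(U \<times> points Y, f \<circ> fst) |U f. f \<in> reg X U} \<union>
      {(points X \<times> V, g \<circ> snd) |V g. g \<in> reg Y V}) {p \<in> points X \<times> points Y. fst p \<in> U} (f \<circ> fst)"
    if "f \<in> reg X U" for f U
    unfolding pre[OF X.reg_openin[OF that]] by (rule gen_reg.base) (use that in auto)
  show ?thesis
    unfolding fs_morphism_def continuous_map_def points_prod[OF assms]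
  proof (intro conjI allI ballI impI)
    fix U assume "openin (topo X) U"
    from X.reg_const[OF this, of 0]
    show "openin (topo (fs_prod X Y)) {p \<in> points X \<times> points Y. fst p \<in> U}"
      unfolding fs_prod_def openin_generated by (rule gen_reg_zero[OF B reg])
  qed (use reg in \<open>auto simp: fs_prod_def reg_generated\<close>)
qed

lemma fs_morphism_snd:
  assumes "space_with_functions X" "space_with_functions Y"
  shows "fs_morphism (fs_prod X Y) Y snd"
proof -
  interpret Y: space_with_functions Y by fact
  note B = fs_prod_base[OF assms]
  have pre: "{p \<in> points X \<times> points Y. snd p \<in> V} = points X \<times> V" if "openin (topo Y) V" for V
    using openin_subset[OF that] by auto
  have reg: "gen_reg (points X \<times> points Y) ({(U \<times> points Y, f \<circ> fst) |U f. f \<in> reg X U} \<union>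
      {(points X \<times> V, g \<circ> snd) |V g. g \<in> reg Y V}) {p \<in> points X \<times> points Y. snd p \<in> V} (g \<circ> snd)"
    if "g \<in> reg Y V" for g V
    unfolding pre[OF Y.reg_openin[OF that]] by (rule gen_reg.base) (use that in auto)
  show ?thesis
    unfolding fs_morphism_def continuous_map_def points_prod[OF assms]
  proof (intro conjI allI ballI impI)
    fix U assume "openin (topo Y) U"
    from Y.reg_const[OF this, of 0]
    show "openin (topo (fs_prod X Y)) {p \<in> points X \<times> points Y. snd p \<in> U}"
      unfolding fs_prod_def openin_generated by (rule gen_reg_zero[OF B reg])
  qed (use reg in \<open>auto simp: fs_prod_def reg_generated\<close>)
qed

lemma space_with_functions_PiE: "space_with_functions (fs_PiE I X)"
  unfolding fs_PiE_def by (rule space_with_functions_generated) auto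

lemma points_PiE: "points (fs_PiE I X) = (\<Pi>\<^sub>E i\<in>I. points (X i))"
  unfolding fs_PiE_def by (rule points_generated) auto

lemma fs_morphism_into_PiE:
  assumes "space_with_functions Z" "\<And>i. i \<in> I \<Longrightarrow> fs_morphism Z (X i) (\<lambda>z. \<phi> z i)"
    "\<And>z. z \<in> points Z \<Longrightarrow> \<phi> z \<in> extensional I"
  shows "fs_morphism Z (fs_PiE I X) \<phi>"
  unfolding fs_PiE_def
proof (rule fs_morphism_generated[OF assms(1)])
  show mem: "\<phi> z \<in> (\<Pi>\<^sub>E i\<in>I. points (X i))" if "z \<in> points Z" for z
    using assms(3) fs_morphism_points[OF assms(2)] that by (auto simp: PiE_iff)
  fix U f
  assume "(U, f) \<in> {({x \<in> \<Pi>\<^sub>E i\<in>I. points (X i). x i \<in> U}, \<lambda>x. f (x i)) |i U f. i \<in> I \<and> f \<in> reg (X i) U}"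
  then obtain i V g where i: "U = {x \<in> \<Pi>\<^sub>E i\<in>I. points (X i). x i \<in> V}" "f = (\<lambda>x. g (x i))"
    "i \<in> I" "g \<in> reg (X i) V" by blast
  have "{z \<in> points Z. \<phi> z \<in> U} = {z \<in> points Z. \<phi> z i \<in> V}"
    using mem i(1) by auto
  then show "f \<circ> \<phi> \<in> reg Z {z \<in> points Z. \<phi> z \<in> U}"
    using fs_morphism_reg[OF assms(2)[OF i(3)] i(4)] i(2) by (simp add: o_def)
qed auto

lemma fs_morphism_PiE_component:
  assumes "i \<in> I" "space_with_functions (X i)"
  shows "fs_morphism (fs_PiE I X) (X i) (\<lambda>x. x i)"
proof -
  interpret Xi: space_with_functions "X i" by fact
  let ?B = "{({x \<in> \<Pi>\<^sub>E i\<in>I. points (X i). x i \<in> U}, \<lambda>x. f (x i)) |i U f. i \<in> I \<and> f \<in> reg (X i) U}"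
  have reg: "gen_reg (\<Pi>\<^sub>E i\<in>I. points (X i)) ?B {x \<in> \<Pi>\<^sub>E i\<in>I. points (X i). x i \<in> U} (\<lambda>x. f (x i))"
    if "f \<in> reg (X i) U" for f U
    by (rule gen_reg.base) (use that assms(1) in blast)
  have B: "?B \<subseteq> Pow (\<Pi>\<^sub>E i\<in>I. points (X i)) \<times> UNIV" by auto
  show ?thesis
    unfolding fs_morphism_def continuous_map_def points_PiE
  proof (intro conjI allI ballI impI)
    fix U assume "openin (topo (X i)) U"
    from Xi.reg_const[OF this, of 0]
    show "openin (topo (fs_PiE I X)) {x \<in> \<Pi>\<^sub>E i\<in>I. points (X i). x i \<in> U}"
      unfolding fs_PiE_def openin_generated by (rule gen_reg_zero[OF B reg])
  qed (use reg assms(1) in \<open>auto simp: fs_PiE_def reg_generated o_def\<close>)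
qed

lemma reg_coinduced:
  "f \<in> reg (fs_coinduced X Y q) U \<longleftrightarrow> U \<subseteq> Y \<and> f \<circ> q \<in> reg X {x \<in> points X. q x \<in> U}"
  by (simp add: fs_coinduced_def)

lemma fs_morphism_coinduced_map:
  assumes "q ` points X \<subseteq> Y"
  shows "fs_morphism X (fs_coinduced X Y q) q"
  using assms unfolding fs_morphism_def continuous_map_def
  by (auto simp: points_coinduced openin_coinduced reg_coinduced)

text \<open>
  A morphism from a quotient, or from an open part of it, is the same as a morphism from the saturated
  open set above it that is constant on fibers. All morphisms from orbit spaces and from flag varieties
  are obtained in this way.
\<close>

lemma fs_morphism_from_coinduced_open:
  assumes X: "space_with_functions X" and q: "q ` points X = Y" and U: "openin (topo (fs_coinduced X Y q)) U"
    and \<psi>: "fs_morphism (fs_open_sub X {x \<in> points X. q x \<in> U}) Z (\<lambda>x. \<psi> (q x))"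
  shows "fs_morphism (fs_open_sub (fs_coinduced X Y q) U) Z \<psi>"
proof -
  interpret X: space_with_functions X by fact
  let ?U = "{x \<in> points X. q x \<in> U}"
  have oU: "openin (topo X) ?U" and "U \<subseteq> Y" using U by (auto simp: openin_coinduced)
  have pU: "points (fs_open_sub (fs_coinduced X Y q) U) = U"
    by (rule points_open_sub_open[OF U])
  have pre: "{x \<in> points (fs_open_sub X ?U). \<psi> (q x) \<in> V} = {x \<in> points X. q x \<in> {y \<in> U. \<psi> y \<in> V}}" for V
    by (auto simp: points_open_sub_open[OF oU])
  show ?thesis
    unfolding fs_morphism_def continuous_map_def pU
  proof (intro conjI allI ballI impI funcsetI)
    fix y assume y: "y \<in> U"
    then obtain x where "x \<in> points X" "q x = y" using q \<open>U \<subseteq> Y\<close> by blast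
    then show "\<psi> y \<in> points Z"
      using fs_morphism_points[OF \<psi>, of x] y by (simp add: points_open_sub_open[OF oU])
  next
    fix V assume V: "openin (topo Z) V"
    show "openin (topo (fs_open_sub (fs_coinduced X Y q) U)) {y \<in> U. \<psi> y \<in> V}"
      using fs_morphism_openin[OF \<psi> V] \<open>U \<subseteq> Y\<close>
      unfolding pre openin_open_sub[OF U] openin_coinduced openin_open_sub[OF oU] by auto
  next
    fix V f assume f: "f \<in> reg Z V"
    show "f \<circ> \<psi> \<in> reg (fs_open_sub (fs_coinduced X Y q) U) {y \<in> U. \<psi> y \<in> V}"
      using fs_morphism_reg[OF \<psi> f] \<open>U \<subseteq> Y\<close>
      unfolding pre reg_open_sub reg_coinduced by (auto simp: o_def)
  qed
qed

lemma fs_open_sub_points: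
  assumes "space_with_functions X"
  shows "fs_open_sub X (points X) = X"
  using space_with_functions.reg_openin[OF assms, THEN openin_subset]
  by (cases X) (auto simp: fs_open_sub_def fun_eq_iff)

lemma fs_morphism_from_coinduced:
  assumes X: "space_with_functions X" and q: "q ` points X = Y"
    and \<psi>: "fs_morphism X Z (\<lambda>x. \<psi> (q x))"
  shows "fs_morphism (fs_coinduced X Y q) Z \<psi>"
proof -
  note eq = fs_open_sub_points[OF X]
    fs_open_sub_points[OF space_with_functions_coinduced[OF X], of Y q]
  have pY: "points (fs_coinduced X Y q) = Y" using q by (simp add: points_coinduced)
  have "{x \<in> points X. q x \<in> Y} = points X" using q by auto
  then show ?thesis
    using fs_morphism_from_coinduced_open[OF X q, of Y Z \<psi>] \<psi> openin_topspace[of "topo (fs_coinduced X Y q)"]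
    by (simp add: eq(1) eq(2)[unfolded pY] pY)
qed

section \<open>Matrices\<close>

lemma mat_assoc:
  fixes A B C :: "'a :: semiring_0 mat"
  assumes "dim_col A = dim_row B" "dim_col B = dim_row C"
  shows "(A * B) * C = A * (B * C)"
  using assoc_mult_mat[of A "dim_row A" "dim_row B" B "dim_row C" C "dim_col C"] assms
  by (metis carrier_matI)

lemma mat_vec_assoc:
  fixes A B :: "'a :: semiring_0 mat"
  assumes "dim_col A = dim_row B" "dim_col B = dim_vec v"
  shows "(A * B) *\<^sub>v v = A *\<^sub>v (B *\<^sub>v v)"
  using assoc_mult_mat_vec[of A "dim_row A" "dim_row B" B "dim_vec v" v] assms
  by (metis carrier_matI carrier_vec_dim_vec)

lemma mat_mult_index:
  fixes A B :: "'a :: semiring_0 mat"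
  assumes "A \<in> carrier_mat n m" "B \<in> carrier_mat m p" "i < n" "j < p"
  shows "(A * B) $$ (i, j) = (\<Sum>k<m. A $$ (i, k) * B $$ (k, j))"
  using assms by (auto simp: scalar_prod_def lessThan_atLeast0 intro!: sum.cong)

abbreviation gl_inv :: "nat \<Rightarrow> complex mat \<Rightarrow> complex mat" where
  "gl_inv n g \<equiv> inv\<^bsub>GL n\<^esub> g"

lemma GL_iff: "g \<in> carrier (GL n) \<longleftrightarrow> g \<in> carrier_mat n n \<and> det g \<noteq> 0"
  using det_non_zero_imp_unit[of g n "()"] unit_imp_det_non_zero[of g n "()"]
  by (auto simp: units_of_def Units_def ring_mat_simps)

lemma GL_group: "group (GL n)"
proof -
  interpret ring "ring_mat TYPE(complex) n ()" by (rule ring_mat)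
  show ?thesis by (rule units_group)
qed

lemma GL_mult [simp]: "x \<otimes>\<^bsub>GL n\<^esub> y = x * y"
  by (simp add: units_of_def ring_mat_simps)

lemma GL_one [simp]: "\<one>\<^bsub>GL n\<^esub> = 1\<^sub>m n"
  by (simp add: units_of_def ring_mat_simps)

lemma GL_carrier [intro]: "g \<in> carrier (GL n) \<Longrightarrow> g \<in> carrier_mat n n"
  by (simp add: GL_iff)

lemma GL_dim [simp]: "g \<in> carrier (GL n) \<Longrightarrow> dim_row g = n" "g \<in> carrier (GL n) \<Longrightarrow> dim_col g = n"
  using carrier_matD[OF GL_carrier] by blast+

lemma gl_inv_GL [simp, intro]: "g \<in> carrier (GL n) \<Longrightarrow> gl_inv n g \<in> carrier (GL n)"
  using group.inv_closed[OF GL_group] .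

lemma gl_inv_carrier [simp]: "g \<in> carrier (GL n) \<Longrightarrow> gl_inv n g \<in> carrier_mat n n"
  by (rule GL_carrier) simp

lemma gl_inv_dim [simp]:
  "g \<in> carrier (GL n) \<Longrightarrow> dim_row (gl_inv n g) = n" "g \<in> carrier (GL n) \<Longrightarrow> dim_col (gl_inv n g) = n"
  using GL_dim[OF gl_inv_GL] by blast+

lemma GL_mult_closed [simp, intro]:
  "g \<in> carrier (GL n) \<Longrightarrow> h \<in> carrier (GL n) \<Longrightarrow> g * h \<in> carrier (GL n)"
  using monoid.m_closed[OF group.is_monoid[OF GL_group[of n]]] by simp

lemma GL_one_closed [simp, intro]: "1\<^sub>m n \<in> carrier (GL n)"
  by (simp add: GL_iff)

lemma gl_inv_left [simp]: "g \<in> carrier (GL n) \<Longrightarrow> gl_inv n g * g = 1\<^sub>m n"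
  using group.l_inv[OF GL_group[of n]] by simp

lemma gl_inv_right [simp]: "g \<in> carrier (GL n) \<Longrightarrow> g * gl_inv n g = 1\<^sub>m n"
  using group.r_inv[OF GL_group[of n]] by simp

lemma gl_inv_gl_inv [simp]: "g \<in> carrier (GL n) \<Longrightarrow> gl_inv n (gl_inv n g) = g"
  using group.inv_inv[OF GL_group] .

lemma gl_inv_one [simp]: "gl_inv n (1\<^sub>m n) = 1\<^sub>m n"
  using monoid.inv_one[OF group.is_monoid[OF GL_group[of n]]] by simp

lemma gl_inv_mult:
  "g \<in> carrier (GL n) \<Longrightarrow> h \<in> carrier (GL n) \<Longrightarrow> gl_inv n (g * h) = gl_inv n h * gl_inv n g"
  using group.inv_mult_group[OF GL_group[of n]] by simp

lemma gl_inv_left_cancel [simp]: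
  "g \<in> carrier (GL n) \<Longrightarrow> dim_row A = n \<Longrightarrow> gl_inv n g * (g * A) = A"
  using mat_assoc[of "gl_inv n g" g A] by simp

lemma gl_inv_right_cancel [simp]:
  "g \<in> carrier (GL n) \<Longrightarrow> dim_row A = n \<Longrightarrow> g * (gl_inv n g * A) = A"
  using mat_assoc[of g "gl_inv n g" A] by simp

lemma GL_kernelI:
  assumes "A \<in> carrier_mat n n" "\<And>x. x \<in> carrier_vec n \<Longrightarrow> A *\<^sub>v x = 0\<^sub>v n \<Longrightarrow> x = 0\<^sub>v n"
  shows "A \<in> carrier (GL n)"
  using assms det_0_iff_vec_prod_zero_field[OF assms(1)] by (auto simp: GL_iff)

lemma GL_transpose [simp, intro]: "g \<in> carrier (GL n) \<Longrightarrow> g\<^sup>T \<in> carrier (GL n)"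
  by (auto simp: GL_iff det_transpose)

lemma gl_inv_adjugate:
  assumes "g \<in> carrier (GL n)"
  shows "gl_inv n g = inverse (det g) \<cdot>\<^sub>m adj_mat g"
proof -
  have g: "g \<in> carrier_mat n n" "det g \<noteq> 0" using assms by (auto simp: GL_iff)
  note a = adj_mat[OF g(1)]
  have "g * (inverse (det g) \<cdot>\<^sub>m adj_mat g) = inverse (det g) \<cdot>\<^sub>m (g * adj_mat g)"
    using g a(1) by (simp add: mult_smult_distrib)
  also have "\<dots> = 1\<^sub>m n"
    using g(2) unfolding a(2) by (intro eq_matI) auto
  finally have "gl_inv n g * (g * (inverse (det g) \<cdot>\<^sub>m adj_mat g)) = gl_inv n g"
    using gl_inv_GL[OF assms] by (simp add: right_mult_one_mat[OF GL_carrier])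
  then show ?thesis using assms a(1) g by simp
qed

text \<open>
  The rectangular identity matrix: for \<open>n \<le> m\<close> it embeds \<open>\<complex>\<^sup>n\<close> as the first coordinates of \<open>\<complex>\<^sup>m\<close>,
  for \<open>m \<le> n\<close> it projects onto the first coordinates.
\<close>

definition rect :: "nat \<Rightarrow> nat \<Rightarrow> complex mat" where
  "rect m n = mat m n (\<lambda>(i, j). if i = j then 1 else 0)"

lemma rect_carrier [simp]: "rect m n \<in> carrier_mat m n"
  and rect_dim [simp]: "dim_row (rect m n) = m" "dim_col (rect m n) = n"
  and rect_transpose [simp]: "(rect m n)\<^sup>T = rect n m"
  and rect_self [simp]: "rect n n = 1\<^sub>m n"
  by (auto simp: rect_def)

lemma rect_mult_index:
  assumes "A \<in> carrier_mat n c" "i < m" "j < c"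
  shows "(rect m n * A) $$ (i, j) = (if i < n then A $$ (i, j) else 0)"
proof -
  have "(rect m n * A) $$ (i, j) = (\<Sum>k<n. (if i = k then 1 else 0) * A $$ (k, j))"
    using assms by (auto simp: rect_def scalar_prod_def lessThan_atLeast0 intro!: sum.cong)
  also have "\<dots> = (\<Sum>k<n. if k = i then A $$ (k, j) else 0)"
    by (intro sum.cong) auto
  finally have "(rect m n * A) $$ (i, j) = (\<Sum>k<n. if k = i then A $$ (k, j) else 0)" .
  then show ?thesis by (simp add: sum.delta')
qed

lemma mult_rect_index:
  assumes "A \<in> carrier_mat c n" "i < c" "j < m"
  shows "(A * rect n m) $$ (i, j) = (if j < n then A $$ (i, j) else 0)"
proof -
  have "(A * rect n m) $$ (i, j) = (\<Sum>k<n. A $$ (i, k) * (if k = j then 1 else 0))"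
    using assms by (auto simp: rect_def scalar_prod_def lessThan_atLeast0 intro!: sum.cong)
  also have "\<dots> = (\<Sum>k<n. if k = j then A $$ (i, k) else 0)"
    by (intro sum.cong) auto
  finally have "(A * rect n m) $$ (i, j) = (\<Sum>k<n. if k = j then A $$ (i, k) else 0)" .
  then show ?thesis by (simp add: sum.delta')
qed

lemma rect_rect [simp]: "a \<le> b \<or> c \<le> b \<Longrightarrow> rect a b * rect b c = rect a c"
  by (rule eq_matI) (auto simp: rect_mult_index[of _ b c] simp del: index_mult_mat(1), auto simp: rect_def)

lemma rect_rect_mult [simp]:
  "a \<le> b \<or> c \<le> b \<Longrightarrow> dim_row A = c \<Longrightarrow> rect a b * (rect b c * A) = rect a c * A"
  by (simp add: mat_assoc[symmetric])

lemma rect_vec_index: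
  assumes "x \<in> carrier_vec n" "i < m"
  shows "(rect m n *\<^sub>v x) $ i = (if i < n then x $ i else 0)"
proof -
  have "(rect m n *\<^sub>v x) $ i = (\<Sum>k<n. (if i = k then 1 else 0) * x $ k)"
    using assms by (auto simp: rect_def scalar_prod_def lessThan_atLeast0 intro!: sum.cong)
  also have "\<dots> = (\<Sum>k<n. if k = i then x $ k else 0)"
    by (intro sum.cong) auto
  finally have "(rect m n *\<^sub>v x) $ i = (\<Sum>k<n. if k = i then x $ k else 0)" .
  then show ?thesis by (simp add: sum.delta')
qed

lemma rect_block:
  assumes "a \<le> m" "a \<le> n"
  shows "rect m n = four_block_mat (1\<^sub>m a) (0\<^sub>m a (n - a)) (0\<^sub>m (m - a) a) (rect (m - a) (n - a))"
  using assms by (intro eq_matI) (auto simp: rect_def)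

text \<open>
  Flags will be read off from row spaces. The transpose is chosen such that the last \<open>k\<close> entries of the
  first \<open>a + c\<close> rows of \<open>gdiag a k g\<close> span the same subspace as the first \<open>c\<close> columns of \<open>g\<close>.
\<close>

definition gdiag :: "nat \<Rightarrow> nat \<Rightarrow> complex mat \<Rightarrow> complex mat" where
  "gdiag a k g = four_block_mat (1\<^sub>m a) (0\<^sub>m a k) (0\<^sub>m k a) g\<^sup>T"

lemma gdiag_carrier [simp]: "g \<in> carrier_mat k k \<Longrightarrow> gdiag a k g \<in> carrier_mat (a + k) (a + k)"
  by (auto simp: gdiag_def)

lemma gdiag_GL [intro]: "g \<in> carrier (GL k) \<Longrightarrow> a + k = n \<Longrightarrow> gdiag a k g \<in> carrier (GL n)"
  unfolding GL_iff gdiag_def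
  by (auto simp: det_four_block_mat_lower_left_zero[of _ a _ k] det_transpose)

lemma gdiag_mult:
  assumes "g \<in> carrier_mat k k" "p \<in> carrier_mat k k"
  shows "gdiag a k (g * p) = gdiag a k p * gdiag a k g"
proof -
  have "gdiag a k p * gdiag a k g = four_block_mat (1\<^sub>m a * 1\<^sub>m a + 0\<^sub>m a k * 0\<^sub>m k a)
     (1\<^sub>m a * 0\<^sub>m a k + 0\<^sub>m a k * g\<^sup>T) (0\<^sub>m k a * 1\<^sub>m a + p\<^sup>T * 0\<^sub>m k a) (0\<^sub>m k a * 0\<^sub>m a k + p\<^sup>T * g\<^sup>T)"
    unfolding gdiag_def by (rule mult_four_block_mat) (use assms in auto)
  then show ?thesis
    using assms unfolding gdiag_def by (simp add: transpose_mult[OF assms])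
qed

text \<open>
  If \<open>p\<close> is block upper triangular, its transpose is block lower triangular and therefore descends to
  the first coordinates.
\<close>

lemma gdiag_rect:
  assumes "p \<in> carrier_mat k k" "C \<in> carrier_mat c c" "p * rect k c = rect k c * C" "m = a + c"
  shows "rect m (a + k) * gdiag a k p = gdiag a c C * rect m (a + k)"
proof -
  have pC: "rect c k * p\<^sup>T = C\<^sup>T * rect c k"
    using arg_cong[OF assms(3), of transpose_mat] assms(1,2)
    by (simp add: transpose_mult[of _ k k _ c] transpose_mult[of _ k c _ c])
  have rb: "rect m (a + k) = four_block_mat (1\<^sub>m a) (0\<^sub>m a k) (0\<^sub>m c a) (rect c k)"
    using rect_block[of a m "a + k"] assms(4) by simp
  have "rect m (a + k) * gdiag a k p = four_block_mat (1\<^sub>m a * 1\<^sub>m a + 0\<^sub>m a k * 0\<^sub>m k a)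
     (1\<^sub>m a * 0\<^sub>m a k + 0\<^sub>m a k * p\<^sup>T) (0\<^sub>m c a * 1\<^sub>m a + rect c k * 0\<^sub>m k a) (0\<^sub>m c a * 0\<^sub>m a k + rect c k * p\<^sup>T)"
    unfolding gdiag_def rb by (rule mult_four_block_mat) (use assms in auto)
  moreover have "gdiag a c C * rect m (a + k) = four_block_mat (1\<^sub>m a * 1\<^sub>m a + 0\<^sub>m a c * 0\<^sub>m c a)
     (1\<^sub>m a * 0\<^sub>m a k + 0\<^sub>m a c * rect c k) (0\<^sub>m c a * 1\<^sub>m a + C\<^sup>T * 0\<^sub>m c a) (0\<^sub>m c a * 0\<^sub>m a k + C\<^sup>T * rect c k)"
    unfolding gdiag_def rb by (rule mult_four_block_mat) (use assms in auto)
  ultimately show ?thesis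
    using assms pC by simp
qed

definition last_coords :: "nat \<Rightarrow> nat \<Rightarrow> complex mat" where
  "last_coords a k = mat k (a + k) (\<lambda>(i, j). if j = a + i then 1 else 0)"

lemma last_coords_carrier [simp]: "last_coords a k \<in> carrier_mat k (a + k)"
  and last_coords_dim [simp]: "dim_row (last_coords a k) = k" "dim_col (last_coords a k) = a + k"
  by (auto simp: last_coords_def)

lemma last_coords_block: "last_coords a k = four_block_mat (0\<^sub>m 0 a) (0\<^sub>m 0 k) (0\<^sub>m k a) (1\<^sub>m k)"
  by (intro eq_matI) (auto simp: last_coords_def)

lemma last_coords_gdiag:
  assumes "g \<in> carrier_mat k k"
  shows "last_coords a k * (gdiag a k g)\<^sup>T = g * last_coords a k"
proof -
  have "(gdiag a k g)\<^sup>T = four_block_mat (1\<^sub>m a) (0\<^sub>m a k) (0\<^sub>m k a) g"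
    unfolding gdiag_def using assms by (subst transpose_four_block_mat[of _ a a]) auto
  then have "last_coords a k * (gdiag a k g)\<^sup>T = four_block_mat (0\<^sub>m 0 a * 1\<^sub>m a + 0\<^sub>m 0 k * 0\<^sub>m k a)
      (0\<^sub>m 0 a * 0\<^sub>m a k + 0\<^sub>m 0 k * g) (0\<^sub>m k a * 1\<^sub>m a + 1\<^sub>m k * 0\<^sub>m k a) (0\<^sub>m k a * 0\<^sub>m a k + 1\<^sub>m k * g)"
    unfolding last_coords_block by (simp only:) (rule mult_four_block_mat; use assms in auto)
  moreover have "four_block_mat (0\<^sub>m 0 0) (0\<^sub>m 0 k) (0\<^sub>m k 0) g = g"
    using assms by (intro eq_matI) auto
  moreover have "four_block_mat (0\<^sub>m 0 0) (0\<^sub>m 0 k) (0\<^sub>m k 0) g * last_coords a k =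
      four_block_mat (0\<^sub>m 0 0 * 0\<^sub>m 0 a + 0\<^sub>m 0 k * 0\<^sub>m k a)
      (0\<^sub>m 0 0 * 0\<^sub>m 0 k + 0\<^sub>m 0 k * 1\<^sub>m k) (0\<^sub>m k 0 * 0\<^sub>m 0 a + g * 0\<^sub>m k a) (0\<^sub>m k 0 * 0\<^sub>m 0 k + g * 1\<^sub>m k)"
    unfolding last_coords_block by (rule mult_four_block_mat; use assms in auto)
  ultimately show ?thesis using assms by simp
qed

subsection \<open>Column spaces\<close>

definition colsp :: "complex mat \<Rightarrow> complex vec set" where
  "colsp A = (\<lambda>x. A *\<^sub>v x) ` carrier_vec (dim_col A)"

lemma colspI: "x \<in> carrier_vec (dim_col A) \<Longrightarrow> A *\<^sub>v x \<in> colsp A"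
  by (simp add: colsp_def)

lemma colsp_carrier: "A \<in> carrier_mat n m \<Longrightarrow> colsp A \<subseteq> carrier_vec n"
  by (auto simp: colsp_def)

lemma mult_mat_unit_vec:
  fixes A :: "complex mat"
  assumes "A \<in> carrier_mat n m" "j < m"
  shows "A *\<^sub>v unit_vec m j = col A j"
  using assms by (intro eq_vecI) auto

lemma col_in_colsp:
  assumes "j < dim_col A"
  shows "col A j \<in> colsp A"
  using colspI[of "unit_vec (dim_col A) j" A] mult_mat_unit_vec[of A "dim_row A" "dim_col A" j] assms
  by auto

lemma colsp_mult: "dim_col A = dim_row B \<Longrightarrow> colsp (A * B) \<subseteq> colsp A"
  by (auto simp: colsp_def mat_vec_assoc intro!: imageI carrier_vecI)

lemma colsp_leD:
  assumes "A \<in> carrier_mat n a" "B \<in> carrier_mat n b" "\<And>j. j < a \<Longrightarrow> col A j \<in> colsp B"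
  shows "\<exists>C \<in> carrier_mat b a. A = B * C"
proof -
  have "\<exists>x \<in> carrier_vec b. col A j = B *\<^sub>v x" if "j < a" for j
    using assms(2) assms(3)[OF that] by (auto simp: colsp_def)
  then obtain X where X: "\<And>j. j < a \<Longrightarrow> X j \<in> carrier_vec b \<and> col A j = B *\<^sub>v X j" by metis
  let ?C = "mat_of_cols b (map X [0..<a])"
  have "A = B * ?C"
  proof (rule mat_col_eqI)
    fix i assume "i < dim_col (B * ?C)"
    then have i: "i < a" by simp
    then have "col ?C i = X i" using X by (subst col_mat_of_cols) auto
    then show "col A i = col (B * ?C) i"
      using X[OF i] i assms(2) by (subst col_mult2[of B n b ?C a]) auto
  qed (use assms in auto)
  moreover have "?C \<in> carrier_mat b a" by auto
  ultimately show ?thesis by blast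
qed

text \<open>
  Inclusions of column spaces are factorisations. Statements on subspaces become matrix identities in
  this way.
\<close>

lemma colsp_le_iff:
  assumes "A \<in> carrier_mat n a" "B \<in> carrier_mat n b"
  shows "colsp A \<subseteq> colsp B \<longleftrightarrow> (\<exists>C \<in> carrier_mat b a. A = B * C)"
proof
  assume "colsp A \<subseteq> colsp B"
  then show "\<exists>C \<in> carrier_mat b a. A = B * C"
    using colsp_leD[OF assms] col_in_colsp[of _ A] assms by blast
qed (use assms colsp_mult[of B] in auto)

lemma colsp_mult_GL:
  assumes "A \<in> carrier_mat n m" "h \<in> carrier (GL m)"
  shows "colsp (A * h) = colsp A"
proof
  show "colsp (A * h) \<subseteq> colsp A" using assms by (intro colsp_mult) auto
  have "colsp ((A * h) * gl_inv m h) \<subseteq> colsp (A * h)"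
    using assms GL_dim[OF gl_inv_GL[OF assms(2)]] by (intro colsp_mult) auto
  moreover have "(A * h) * gl_inv m h = A"
    using assms GL_dim[OF gl_inv_GL[OF assms(2)]] by (simp add: mat_assoc)
  ultimately show "colsp A \<subseteq> colsp (A * h)" by simp
qed

lemma colsp_one: "colsp (1\<^sub>m n) = carrier_vec n"
  by (auto simp: colsp_def image_iff)

lemma colsp_rect:
  assumes "a \<le> n"
  shows "colsp (rect n a) = coord_subspace n a"
proof
  show "colsp (rect n a) \<subseteq> coord_subspace n a"
    by (auto simp: colsp_def coord_subspace_def rect_vec_index intro!: carrier_vecI
        simp del: index_mult_mat_vec)
  show "coord_subspace n a \<subseteq> colsp (rect n a)"
  proof
    fix x assume x: "x \<in> coord_subspace n a"
    then have xc: "x \<in> carrier_vec n" by (simp add: coord_subspace_def)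
    have "x = rect n a *\<^sub>v (rect a n *\<^sub>v x)"
    proof (rule eq_vecI)
      fix i assume "i < dim_vec (rect n a *\<^sub>v (rect a n *\<^sub>v x))"
      then have "i < n" by simp
      moreover have "(rect n a *\<^sub>v (rect a n *\<^sub>v x)) $ i = (if i < a then (rect a n *\<^sub>v x) $ i else 0)"
        using \<open>i < n\<close> by (intro rect_vec_index carrier_vecI) auto
      ultimately show "x $ i = (rect n a *\<^sub>v (rect a n *\<^sub>v x)) $ i"
        using x xc assms by (auto simp: coord_subspace_def rect_vec_index simp del: index_mult_mat_vec)
    qed (use xc in auto)
    then show "x \<in> colsp (rect n a)"
      by (metis colspI carrier_vec_dim_vec dim_mult_mat_vec rect_dim)
  qed
qed

lemma image_coord_subspace:
  assumes "a \<le> n" "g \<in> carrier_mat n n"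
  shows "(\<lambda>x. g *\<^sub>v x) ` coord_subspace n a = colsp (g * rect n a)"
proof -
  have "(\<lambda>x. g *\<^sub>v (rect n a *\<^sub>v x)) ` carrier_vec a = (\<lambda>x. (g * rect n a) *\<^sub>v x) ` carrier_vec a"
    by (intro image_cong) (use assms in \<open>auto simp: mat_vec_assoc\<close>)
  then show ?thesis
    using assms(1) by (simp add: colsp_rect[symmetric] colsp_def image_image)
qed

lemma last_coords_rect:
  assumes "c \<le> k"
  shows "colsp (last_coords a k * rect (a + k) (a + c)) = colsp (rect k c)"
proof -
  have 1: "last_coords a k * rect (a + k) (a + c) = rect k c * last_coords a c"
  proof (rule eq_matI)
    fix i j assume "i < dim_row (rect k c * last_coords a c)" "j < dim_col (rect k c * last_coords a c)"
    then have ij: "i < k" "j < a + c" by auto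
    have "(last_coords a k * rect (a + k) (a + c)) $$ (i, j) = last_coords a k $$ (i, j)"
      using ij assms by (subst mult_rect_index[of _ k]) auto
    moreover have "(rect k c * last_coords a c) $$ (i, j) = (if i < c then last_coords a c $$ (i, j) else 0)"
      using ij by (subst rect_mult_index[of _ c "a + c"]) auto
    ultimately show "(last_coords a k * rect (a + k) (a + c)) $$ (i, j) = (rect k c * last_coords a c) $$ (i, j)"
      using ij assms by (auto simp: last_coords_def)
  qed auto
  have "last_coords a c * (last_coords a c)\<^sup>T = 1\<^sub>m c"
  proof (intro eq_matI)
    fix i j assume ij: "i < dim_row (1\<^sub>m c :: complex mat)" "j < dim_col (1\<^sub>m c :: complex mat)"
    have "(last_coords a c * (last_coords a c)\<^sup>T) $$ (i, j) =
        (\<Sum>r<a + c. (if r = a + i then 1 else 0) * (if r = a + j then 1 else 0))"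
      using ij by (auto simp: last_coords_def scalar_prod_def lessThan_atLeast0 intro!: sum.cong)
    also have "\<dots> = (\<Sum>r<a + c. if r = a + i then (if i = j then 1 else 0) else 0)"
      by (intro sum.cong) auto
    finally have "(last_coords a c * (last_coords a c)\<^sup>T) $$ (i, j) =
        (\<Sum>r<a + c. if r = a + i then (if i = j then 1 else 0) else 0)" .
    then show "(last_coords a c * (last_coords a c)\<^sup>T) $$ (i, j) = 1\<^sub>m c $$ (i, j)"
      using ij by (simp add: sum.delta')
  qed auto
  then have "rect k c = (rect k c * last_coords a c) * (last_coords a c)\<^sup>T"
    by (simp add: mat_assoc)
  then have "colsp (rect k c) \<subseteq> colsp (rect k c * last_coords a c)"
    using colsp_mult[of "rect k c * last_coords a c" "(last_coords a c)\<^sup>T"] by simp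
  moreover have "colsp (rect k c * last_coords a c) \<subseteq> colsp (rect k c)"
    by (rule colsp_mult) simp
  ultimately show ?thesis unfolding 1 by simp
qed

subsection \<open>Independent lists of vectors\<close>

definition inj_mat :: "complex mat \<Rightarrow> bool" where
  "inj_mat A \<longleftrightarrow> (\<forall>x \<in> carrier_vec (dim_col A). A *\<^sub>v x = 0\<^sub>v (dim_row A) \<longrightarrow> x = 0\<^sub>v (dim_col A))"

lemma inj_matI:
  assumes "A \<in> carrier_mat n m" "B \<in> carrier_mat m n" "B * A = 1\<^sub>m m"
  shows "inj_mat A"
  unfolding inj_mat_def
proof (intro ballI impI)
  fix x assume x: "x \<in> carrier_vec (dim_col A)" "A *\<^sub>v x = 0\<^sub>v (dim_row A)"
  have "x = (B * A) *\<^sub>v x" using assms x(1) by simp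
  also have "\<dots> = B *\<^sub>v (A *\<^sub>v x)" using assms x(1) by (intro mat_vec_assoc) auto
  also have "\<dots> = 0\<^sub>v (dim_col A)" using assms x(2) by auto
  finally show "x = 0\<^sub>v (dim_col A)" .
qed

lemma inj_mat_mult_rightD:
  assumes "inj_mat (A * B)" "dim_col A = dim_row B"
  shows "inj_mat B"
  unfolding inj_mat_def
proof (intro ballI impI)
  fix x assume x: "x \<in> carrier_vec (dim_col B)" "B *\<^sub>v x = 0\<^sub>v (dim_row B)"
  have "(A * B) *\<^sub>v x = A *\<^sub>v 0\<^sub>v (dim_col A)"
    using x assms(2) by (simp add: mat_vec_assoc)
  then have "(A * B) *\<^sub>v x = 0\<^sub>v (dim_row A)" by auto
  then show "x = 0\<^sub>v (dim_col B)" using assms(1) x(1) by (auto simp: inj_mat_def)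
qed

lemma inj_mat_mult:
  assumes "inj_mat A" "inj_mat B" "dim_col A = dim_row B"
  shows "inj_mat (A * B)"
  unfolding inj_mat_def
proof (intro ballI impI)
  fix x assume x: "x \<in> carrier_vec (dim_col (A * B))" "(A * B) *\<^sub>v x = 0\<^sub>v (dim_row (A * B))"
  then have "A *\<^sub>v (B *\<^sub>v x) = 0\<^sub>v (dim_row A)" using assms(3) by (simp add: mat_vec_assoc)
  moreover have "B *\<^sub>v x \<in> carrier_vec (dim_col A)" using assms(3) by (intro carrier_vecI) simp
  ultimately have "B *\<^sub>v x = 0\<^sub>v (dim_row B)" using assms(1,3) by (auto simp: inj_mat_def)
  then show "x = 0\<^sub>v (dim_col (A * B))" using assms(2) x(1) by (auto simp: inj_mat_def)
qed

lemma inj_mat_square: "A \<in> carrier_mat n n \<Longrightarrow> inj_mat A \<Longrightarrow> A \<in> carrier (GL n)"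
  by (rule GL_kernelI) (auto simp: inj_mat_def)

lemma GL_inj_mat: "A \<in> carrier (GL n) \<Longrightarrow> inj_mat A"
  by (rule inj_matI[of A n n "gl_inv n A"]) auto

text \<open>Padding a wide matrix with zero rows gives a singular square matrix.\<close>

lemma inj_mat_le:
  assumes "A \<in> carrier_mat n m" "inj_mat A"
  shows "m \<le> n"
proof (rule ccontr)
  assume "\<not> m \<le> n"
  then have mn: "n < m" by simp
  have "inj_mat (rect m n * A)"
    using assms mn by (intro inj_mat_mult inj_matI[of "rect m n" m n "rect n m"]) auto
  then have "rect m n * A \<in> carrier (GL m)"
    using assms by (intro inj_mat_square) auto
  then have "rect m n * (A * gl_inv m (rect m n * A)) = 1\<^sub>m m"
    using gl_inv_right assms by (subst mat_assoc[symmetric]) auto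
  then have "(rect m n * (A * gl_inv m (rect m n * A))) $$ (n, n) = 1"
    using mn by simp
  moreover have "A * gl_inv m (rect m n * A) \<in> carrier_mat n m"
    using assms \<open>rect m n * A \<in> carrier (GL m)\<close> by (intro mult_carrier_mat) auto
  ultimately show False
    using mn by (simp add: rect_mult_index[of _ n m] del: index_mult_mat(1))
qed

definition indep :: "nat \<Rightarrow> complex vec list \<Rightarrow> bool" where
  "indep n bs \<longleftrightarrow> set bs \<subseteq> carrier_vec n \<and> inj_mat (mat_of_cols n bs)"

lemma mat_of_cols_append_vec:
  fixes bs :: "complex vec list"
  assumes "set bs \<subseteq> carrier_vec n" "v \<in> carrier_vec n" "x \<in> carrier_vec (Suc (length bs))"
  shows "mat_of_cols n (bs @ [v]) *\<^sub>v x =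
    mat_of_cols n bs *\<^sub>v (vec (length bs) (\<lambda>i. x $ i)) + x $ length bs \<cdot>\<^sub>v v"
proof (rule eq_vecI)
  fix i assume "i < dim_vec (mat_of_cols n bs *\<^sub>v (vec (length bs) (\<lambda>i. x $ i)) + x $ length bs \<cdot>\<^sub>v v)"
  then have i: "i < n" using assms by simp
  then show "(mat_of_cols n (bs @ [v]) *\<^sub>v x) $ i =
      (mat_of_cols n bs *\<^sub>v (vec (length bs) (\<lambda>i. x $ i)) + x $ length bs \<cdot>\<^sub>v v) $ i"
    using assms by (auto simp: scalar_prod_def mat_of_cols_index nth_append mult.commute[of "x $ length bs"])
qed (use assms in auto)

lemma indep_append:
  assumes "indep n bs" "v \<in> carrier_vec n" "v \<notin> colsp (mat_of_cols n bs)"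
  shows "indep n (bs @ [v])"
  unfolding indep_def
proof
  show "set (bs @ [v]) \<subseteq> carrier_vec n" using assms by (auto simp: indep_def)
  have bs: "set bs \<subseteq> carrier_vec n" using assms by (auto simp: indep_def)
  show "inj_mat (mat_of_cols n (bs @ [v]))"
    unfolding inj_mat_def
  proof (intro ballI impI)
    fix x assume x: "x \<in> carrier_vec (dim_col (mat_of_cols n (bs @ [v])))"
      "mat_of_cols n (bs @ [v]) *\<^sub>v x = 0\<^sub>v (dim_row (mat_of_cols n (bs @ [v])))"
    let ?M = "mat_of_cols n bs" and ?y = "vec (length bs) (\<lambda>i. x $ i)" and ?c = "x $ length bs"
    have eq: "?M *\<^sub>v ?y + ?c \<cdot>\<^sub>v v = 0\<^sub>v n"
      using mat_of_cols_append_vec[OF bs assms(2)] x by simp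
    have c0: "?c = 0"
    proof (rule ccontr)
      assume c: "?c \<noteq> 0"
      have "?M *\<^sub>v (- inverse ?c \<cdot>\<^sub>v ?y) = v"
      proof (rule eq_vecI)
        fix i assume i: "i < dim_vec v"
        then have "(?M *\<^sub>v ?y) $ i + ?c * v $ i = 0"
          using arg_cong[OF eq, of "\<lambda>w. w $ i"] assms(2) by (simp del: index_mult_mat_vec)
        then have "- inverse ?c * (?M *\<^sub>v ?y) $ i = v $ i"
          using c by (simp add: field_simps add_eq_0_iff del: index_mult_mat_vec)
        moreover have "(?M *\<^sub>v (- inverse ?c \<cdot>\<^sub>v ?y)) = - inverse ?c \<cdot>\<^sub>v (?M *\<^sub>v ?y)"
          by (rule mult_mat_vec[of _ n "length bs"]) auto
        ultimately show "(?M *\<^sub>v (- inverse ?c \<cdot>\<^sub>v ?y)) $ i = v $ i"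
          using i assms(2) by (simp del: index_mult_mat_vec)
      qed (use assms in auto)
      then show False using assms(3) colspI[of "- inverse ?c \<cdot>\<^sub>v ?y" ?M] by simp
    qed
    have "0 \<cdot>\<^sub>v v = 0\<^sub>v n" using assms(2) by auto
    moreover have "?M *\<^sub>v ?y + 0\<^sub>v n = ?M *\<^sub>v ?y"
      by (rule right_zero_vec[of _ n]) (auto intro!: carrier_vecI)
    ultimately have "?M *\<^sub>v ?y = 0\<^sub>v n" using eq c0 by simp
    then have y: "?y = 0\<^sub>v (length bs)"
      using assms(1) by (auto simp: indep_def inj_mat_def)
    show "x = 0\<^sub>v (dim_col (mat_of_cols n (bs @ [v])))"
    proof (rule eq_vecI)
      fix i assume "i < dim_vec (0\<^sub>v (dim_col (mat_of_cols n (bs @ [v])) ) :: complex vec)"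
      then have "i < length bs \<or> i = length bs" by auto
      then show "x $ i = 0\<^sub>v (dim_col (mat_of_cols n (bs @ [v]))) $ i"
        using \<open>x $ length bs = 0\<close> arg_cong[OF y, of "\<lambda>w. w $ i"] by auto
    qed (use x in auto)
  qed
qed

lemma indep_length_le:
  assumes "indep n bs" "indep n cs" "set bs \<subseteq> colsp (mat_of_cols n cs)"
  shows "length bs \<le> length cs"
proof -
  have "\<exists>C \<in> carrier_mat (length cs) (length bs). mat_of_cols n bs = mat_of_cols n cs * C"
  proof (rule colsp_leD)
    fix j assume "j < length bs"
    then show "col (mat_of_cols n bs) j \<in> colsp (mat_of_cols n cs)"
      using assms by (subst col_mat_of_cols) (auto simp: indep_def)
  qed auto
  then obtain C where C: "C \<in> carrier_mat (length cs) (length bs)" "mat_of_cols n bs = mat_of_cols n cs * C"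
    by blast
  then have "inj_mat C" using assms(1) inj_mat_mult_rightD[of "mat_of_cols n cs" C] by (auto simp: indep_def)
  then show ?thesis using inj_mat_le[OF C(1)] by simp
qed

lemma indep_Nil: "indep n []"
  by (auto simp: indep_def inj_mat_def)

lemma indep_length: "indep n bs \<Longrightarrow> length bs \<le> n"
  unfolding indep_def using inj_mat_le[of "mat_of_cols n bs" n "length bs"] by auto

text \<open>
  Steinitz exchange: an independent list is extended by members of a generating set \<open>S\<close>. That the span
  of \<open>S\<close> contains \<open>cs\<close> is expressed by column spaces, because every subspace is one.
\<close>

lemma indep_extend:
  assumes "indep n bs" "indep n cs" "length bs \<le> length cs" "S \<subseteq> carrier_vec n"
    and span: "\<And>as. set as \<subseteq> carrier_vec n \<Longrightarrow> S \<subseteq> colsp (mat_of_cols n as) \<Longrightarrow> set cs \<subseteq> colsp (mat_of_cols n as)"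
  shows "\<exists>ss. set ss \<subseteq> S \<and> length bs + length ss = length cs \<and> indep n (bs @ ss)"
  using assms(1,3)
proof (induction "length cs - length bs" arbitrary: bs)
  case 0
  then show ?case by (intro exI[of _ "[]"]) auto
next
  case (Suc k)
  have "\<not> set cs \<subseteq> colsp (mat_of_cols n bs)"
    using indep_length_le[OF assms(2) Suc.prems(1)] Suc.hyps(2) by auto
  then obtain s where s: "s \<in> S" "s \<notin> colsp (mat_of_cols n bs)"
    using span[of bs] Suc.prems(1) by (auto simp: indep_def)
  have "indep n (bs @ [s])"
    using indep_append[OF Suc.prems(1) _ s(2)] s(1) assms(4) by blast
  then obtain ss where "set ss \<subseteq> S" "length (bs @ [s]) + length ss = length cs" "indep n ((bs @ [s]) @ ss)"
    using Suc.hyps(1)[OF _ \<open>indep n (bs @ [s])\<close>] Suc.hyps(2) by fastforce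
  then show ?case using s(1) by (intro exI[of _ "s # ss"]) auto
qed

lemma indep_colsp_eq:
  assumes "indep n bs" "indep n cs" "length cs \<le> length bs" "set bs \<subseteq> colsp (mat_of_cols n cs)"
  shows "colsp (mat_of_cols n bs) = colsp (mat_of_cols n cs)"
proof -
  have "\<exists>C \<in> carrier_mat (length cs) (length bs). mat_of_cols n bs = mat_of_cols n cs * C"
  proof (rule colsp_leD)
    fix j assume "j < length bs"
    then show "col (mat_of_cols n bs) j \<in> colsp (mat_of_cols n cs)"
      using assms by (subst col_mat_of_cols) (auto simp: indep_def)
  qed auto
  then obtain C where C: "C \<in> carrier_mat (length cs) (length bs)" "mat_of_cols n bs = mat_of_cols n cs * C"
    by blast
  then have "inj_mat C" using assms(1) inj_mat_mult_rightD[of "mat_of_cols n cs" C] by (auto simp: indep_def)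
  moreover have "length cs = length bs" using assms indep_length_le by force
  ultimately have "C \<in> carrier (GL (length cs))" using C by (intro inj_mat_square) auto
  then show ?thesis unfolding C(2) by (intro colsp_mult_GL) auto
qed

lemma inj_mat_cols: "A \<in> carrier_mat n m \<Longrightarrow> inj_mat A \<Longrightarrow> indep n (cols A)"
  by (auto simp: indep_def cols_dim mat_of_cols_cols) (use cols_dim in blast)

subsection \<open>Subspaces and flags\<close>

lemma is_subspace_iff:
  "is_subspace n W \<longleftrightarrow> W \<subseteq> carrier_vec n \<and> 0\<^sub>v n \<in> W \<and> (\<forall>x\<in>W. \<forall>y\<in>W. x + y \<in> W) \<and>
     (\<forall>c. \<forall>x\<in>W. c \<cdot>\<^sub>v x \<in> W)"
  unfolding VectorSpace.subspace_def LinearCombinations.submodule_def module_vec_simps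
  using vec_vs[of n, where 'a = complex] vec_module[of n, where 'a = complex] by auto

lemma is_subspace_colsp:
  assumes "A \<in> carrier_mat n m"
  shows "is_subspace n (colsp A)"
  unfolding is_subspace_iff
proof (intro conjI ballI allI)
  show "colsp A \<subseteq> carrier_vec n" using assms by (rule colsp_carrier)
  have "A *\<^sub>v 0\<^sub>v m = 0\<^sub>v n" using assms by auto
  then show "0\<^sub>v n \<in> colsp A" using colspI[of "0\<^sub>v m" A] assms by simp
  fix x assume "x \<in> colsp A"
  then obtain u where u: "u \<in> carrier_vec m" "x = A *\<^sub>v u" using assms by (auto simp: colsp_def)
  show "c \<cdot>\<^sub>v x \<in> colsp A" for c
    using colspI[of "c \<cdot>\<^sub>v u" A] u assms by (simp add: mult_mat_vec[OF assms u(1)])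
  fix y assume "y \<in> colsp A"
  then obtain v where v: "v \<in> carrier_vec m" "y = A *\<^sub>v v" using assms by (auto simp: colsp_def)
  show "x + y \<in> colsp A"
    using colspI[of "u + v" A] u v assms by (simp add: mult_add_distrib_mat_vec[OF assms u(1) v(1)])
qed

lemma colsp_least:
  assumes "is_subspace n W" "set bs \<subseteq> W"
  shows "colsp (mat_of_cols n bs) \<subseteq> W"
  using assms(2)
proof (induction bs rule: rev_induct)
  case Nil
  have "mat_of_cols n [] *\<^sub>v x = 0\<^sub>v n" if "x \<in> carrier_vec 0" for x :: "complex vec"
    using that by (intro eq_vecI) (auto simp: scalar_prod_def)
  then show ?case using assms(1) by (auto simp: colsp_def is_subspace_iff)
next
  case (snoc v bs)
  have W: "W \<subseteq> carrier_vec n" using assms(1) by (simp add: is_subspace_iff)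
  show ?case
  proof
    fix y assume "y \<in> colsp (mat_of_cols n (bs @ [v]))"
    then obtain x where x: "x \<in> carrier_vec (Suc (length bs))" "y = mat_of_cols n (bs @ [v]) *\<^sub>v x"
      by (auto simp: colsp_def)
    have "mat_of_cols n bs *\<^sub>v vec (length bs) (\<lambda>i. x $ i) \<in> W"
      using snoc colspI[of "vec (length bs) (\<lambda>i. x $ i)" "mat_of_cols n bs"] by auto
    moreover have "x $ length bs \<cdot>\<^sub>v v \<in> W"
      using snoc.prems assms(1) by (auto simp: is_subspace_iff)
    moreover have "y = mat_of_cols n bs *\<^sub>v vec (length bs) (\<lambda>i. x $ i) + x $ length bs \<cdot>\<^sub>v v"
      unfolding x(2) by (rule mat_of_cols_append_vec) (use snoc.prems W x(1) in auto)
    ultimately show "y \<in> W" using assms(1) by (auto simp: is_subspace_iff)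
  qed
qed

lemma subspace_dim_colsp:
  assumes "indep n bs"
  shows "subspace_dim n (colsp (mat_of_cols n bs)) = length bs"
proof -
  interpret vec_space "TYPE(complex)" n .
  let ?A = "mat_of_cols n bs"
  have A: "?A \<in> carrier_mat n (length bs)" by simp
  have cols: "cols ?A = bs" using assms by (auto simp: indep_def)
  have inj: "inj_mat ?A" using assms by (simp add: indep_def)
  have dist: "distinct bs"
  proof (rule ccontr)
    assume "\<not> distinct bs"
    then obtain i j where ij: "i < length bs" "j < length bs" "i \<noteq> j" "bs ! i = bs ! j"
      by (auto simp: distinct_conv_nth)
    let ?x = "unit_vec (length bs) i - unit_vec (length bs) j :: complex vec"
    have "?A *\<^sub>v ?x = col ?A i - col ?A j"
      using ij by (subst mult_minus_distrib_mat_vec[OF A]) (auto simp: mult_mat_unit_vec[OF A])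
    also have "\<dots> = 0\<^sub>v n"
      using ij by (intro eq_vecI) (auto simp: mat_of_cols_index)
    finally have "?x = 0\<^sub>v (length bs)" using inj by (auto simp: inj_mat_def)
    then have "?x $ i = 0" using ij by simp
    then show False using ij by simp
  qed
  have "lin_indpt (set (cols ?A))"
  proof
    assume "lin_dep (set (cols ?A))"
    then obtain v where "v \<in> carrier_vec (length bs)" "v \<noteq> 0\<^sub>v (length bs)" "?A *\<^sub>v v = 0\<^sub>v n"
      using lin_depE[OF A] dist cols by metis
    then show False using inj by (auto simp: inj_mat_def)
  qed
  then have "rank ?A = length bs"
    using lin_indpt_full_rank[OF A] dist cols by simp
  moreover have "colsp ?A = span (set (cols ?A))"
    using col_space_eq[OF A] colsp_carrier[OF A] unfolding col_space_def by (auto simp: colsp_def)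
  ultimately show ?thesis by (simp add: rank_def)
qed

lemma subspace_basis:
  assumes "is_subspace n W"
  shows "\<exists>bs. indep n bs \<and> colsp (mat_of_cols n bs) = W \<and> length bs = subspace_dim n W"
proof -
  let ?P = "\<lambda>bs. indep n bs \<and> set bs \<subseteq> W"
  have "?P []" by (simp add: indep_Nil)
  moreover have "\<forall>bs. ?P bs \<longrightarrow> length bs \<le> n" using indep_length by blast
  ultimately obtain bs where bs: "?P bs" "\<And>cs. ?P cs \<Longrightarrow> length cs \<le> length bs"
    using ex_has_greatest_nat[of ?P "[]" length "Suc n"] by (auto simp: less_Suc_eq_le)
  have "W \<subseteq> colsp (mat_of_cols n bs)"
  proof (rule ccontr)
    assume "\<not> W \<subseteq> colsp (mat_of_cols n bs)"
    then obtain w where w: "w \<in> W" "w \<notin> colsp (mat_of_cols n bs)" by blast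
    then have "?P (bs @ [w])"
      using bs(1) assms indep_append[of n bs w] by (auto simp: is_subspace_iff)
    then show False using bs(2) by fastforce
  qed
  then have "colsp (mat_of_cols n bs) = W" using colsp_least[OF assms] bs(1) by blast
  then show ?thesis using bs(1) subspace_dim_colsp[of n bs] by auto
qed

lemma flags_mono:
  assumes "Vs \<in> flags as n" "i \<le> j" "j < length as"
  shows "as ! i \<le> as ! j" "as ! j \<le> n"
proof -
  have *: "\<exists>bs. indep n bs \<and> colsp (mat_of_cols n bs) = Vs ! k \<and> length bs = as ! k" if "k < length as" for k
    using subspace_basis[of "Vs ! k" n] assms(1) that by (auto simp: flags_def)
  obtain bs where bs: "indep n bs" "colsp (mat_of_cols n bs) = Vs ! i" "length bs = as ! i"
    using *[of i] assms by auto
  obtain cs where cs: "indep n cs" "colsp (mat_of_cols n cs) = Vs ! j" "length cs = as ! j"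
    using *[OF assms(3)] by auto
  have "set bs \<subseteq> Vs ! i"
    unfolding bs(2)[symmetric] using bs(1) col_in_colsp[of _ "mat_of_cols n bs"]
    by (force simp: indep_def in_set_conv_nth)
  also have "\<dots> \<subseteq> Vs ! j" using assms by (auto simp: flags_def)
  finally show "as ! i \<le> as ! j" using indep_length_le[OF bs(1) cs(1)] bs cs by simp
  show "as ! j \<le> n" using indep_length[OF cs(1)] cs by simp
qed

lemma set_subset_colsp:
  assumes "set bs \<subseteq> carrier_vec n"
  shows "set bs \<subseteq> colsp (mat_of_cols n bs)"
  using assms col_in_colsp[of _ "mat_of_cols n bs"] by (force simp: in_set_conv_nth)

lemma mat_of_cols_rect:
  assumes "a \<le> length bs" "length bs = n"
  shows "mat_of_cols n bs * rect n a = mat_of_cols n (take a bs)"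
proof (rule eq_matI)
  fix i j assume "i < dim_row (mat_of_cols n (take a bs))" "j < dim_col (mat_of_cols n (take a bs))"
  then have ij: "i < n" "j < a" using assms by auto
  have "(mat_of_cols n bs * rect n a) $$ (i, j) = mat_of_cols n bs $$ (i, j)"
    using ij assms by (subst mult_rect_index[of _ n]) auto
  then show "(mat_of_cols n bs * rect n a) $$ (i, j) = mat_of_cols n (take a bs) $$ (i, j)"
    using ij assms by (simp add: mat_of_cols_index)
qed (use assms in auto)

text \<open>The general linear group acts transitively on flags: a basis is chosen along the flag.\<close>

lemma flags_transitive:
  assumes "Vs \<in> flags as n"
  shows "\<exists>g \<in> carrier (GL n). Vs = map (\<lambda>a. (\<lambda>x. g *\<^sub>v x) ` coord_subspace n a) as"
proof -
  let ?M = "mat_of_cols n"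
  have "\<exists>bs. indep n bs \<and> (\<forall>i<j. as ! i \<le> length bs \<and> colsp (?M (take (as ! i) bs)) = Vs ! i) \<and>
      (\<forall>i<length as. j \<le> i \<longrightarrow> length bs \<le> as ! i \<and> set bs \<subseteq> Vs ! i)" if "j \<le> length as" for j
    using that
  proof (induction j)
    case 0
    then show ?case using indep_Nil by (intro exI[of _ "[]"]) auto
  next
    case (Suc j)
    then obtain bs where bs: "indep n bs"
      "\<forall>i<j. as ! i \<le> length bs \<and> colsp (?M (take (as ! i) bs)) = Vs ! i"
      "\<forall>i<length as. j \<le> i \<longrightarrow> length bs \<le> as ! i \<and> set bs \<subseteq> Vs ! i" by auto
    obtain cs where cs: "indep n cs" "colsp (?M cs) = Vs ! j" "length cs = as ! j"
      using subspace_basis[of "Vs ! j" n] assms Suc.prems by (auto simp: flags_def)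
    have cn: "set cs \<subseteq> carrier_vec n" using cs(1) by (simp add: indep_def)
    have "\<exists>ss. set ss \<subseteq> set cs \<and> length bs + length ss = length cs \<and> indep n (bs @ ss)"
      by (rule indep_extend) (use bs cs Suc.prems cn in auto)
    then obtain ss where ss: "set ss \<subseteq> set cs" "length bs + length ss = length cs" "indep n (bs @ ss)"
      by blast
    have sub: "set (bs @ ss) \<subseteq> Vs ! j"
      using ss(1) set_subset_colsp[OF cn] cs(2) bs(3) Suc.prems by auto
    have eq: "colsp (?M (bs @ ss)) = Vs ! j"
      using indep_colsp_eq[OF ss(3) cs(1)] ss(2) cs(2) sub by simp
    show ?case
    proof (intro exI[of _ "bs @ ss"] conjI allI impI)
      show "indep n (bs @ ss)" by fact
      fix i assume "i < Suc j"
      then show "as ! i \<le> length (bs @ ss)" "colsp (?M (take (as ! i) (bs @ ss))) = Vs ! i"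
        using bs(2) eq ss(2) cs(3) by (auto simp: less_Suc_eq trans_le_add1)
    next
      fix i assume i: "i < length as" "Suc j \<le> i"
      then show "length (bs @ ss) \<le> as ! i"
        using flags_mono(1)[OF assms, of j i] ss(2) cs(3) by simp
      have "Vs ! j \<subseteq> Vs ! i" using assms i by (auto simp: flags_def)
      then show "set (bs @ ss) \<subseteq> Vs ! i" using sub by blast
    qed
  qed
  from this[of "length as"] obtain bs where bs: "indep n bs"
    "\<forall>i<length as. as ! i \<le> length bs \<and> colsp (?M (take (as ! i) bs)) = Vs ! i" by auto
  have id: "indep n (cols (1\<^sub>m n :: complex mat))" "length (cols (1\<^sub>m n :: complex mat)) = n"
    using inj_mat_cols[of "1\<^sub>m n" n n] GL_inj_mat[OF GL_one_closed] by auto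
  have "\<exists>ss. set ss \<subseteq> set (cols (1\<^sub>m n :: complex mat)) \<and> length bs + length ss = length (cols (1\<^sub>m n :: complex mat))
      \<and> indep n (bs @ ss)"
    by (rule indep_extend) (use bs(1) id indep_length[OF bs(1)] in \<open>auto simp: indep_def\<close>)
  then obtain ss where ss: "length (bs @ ss) = n" "indep n (bs @ ss)" using id(2) by auto
  let ?g = "?M (bs @ ss)"
  have g: "?g \<in> carrier (GL n)"
    using ss by (intro inj_mat_square) (auto simp: indep_def)
  have "Vs = map (\<lambda>a. (\<lambda>x. ?g *\<^sub>v x) ` coord_subspace n a) as"
  proof (rule nth_equalityI)
    show "length Vs = length (map (\<lambda>a. (\<lambda>x. ?g *\<^sub>v x) ` coord_subspace n a) as)"
      using assms by (simp add: flags_def)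
    fix i assume "i < length Vs"
    then have i: "i < length as" using assms by (simp add: flags_def)
    have "(\<lambda>x. ?g *\<^sub>v x) ` coord_subspace n (as ! i) = colsp (?g * rect n (as ! i))"
      using g flags_mono(2)[OF assms order_refl i] by (intro image_coord_subspace) auto
    also have "?g * rect n (as ! i) = ?M (take (as ! i) (bs @ ss))"
      using flags_mono(2)[OF assms order_refl i] ss by (intro mat_of_cols_rect) auto
    also have "take (as ! i) (bs @ ss) = take (as ! i) bs" using bs(2) i by simp
    finally show "Vs ! i = map (\<lambda>a. (\<lambda>x. ?g *\<^sub>v x) ` coord_subspace n a) as ! i"
      using bs(2) i by simp
  qed
  then show ?thesis using g by blast
qed

lemma coord_flag_in_flags:
  assumes "g \<in> carrier (GL n)" "sorted as" "\<forall>a\<in>set as. a \<le> n"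
  shows "map (\<lambda>a. (\<lambda>x. g *\<^sub>v x) ` coord_subspace n a) as \<in> flags as n"
proof -
  let ?c = "\<lambda>a. g * rect n a"
  have im: "(\<lambda>x. g *\<^sub>v x) ` coord_subspace n (as ! i) = colsp (?c (as ! i))" if "i < length as" for i
    using assms that by (intro image_coord_subspace) auto
  have "subspace_dim n (colsp (?c a)) = a" if "a \<le> n" for a
  proof -
    have "inj_mat (?c a)"
      using assms that by (intro inj_mat_mult GL_inj_mat[of _ n] inj_matI[of "rect n a" n a "rect a n"]) auto
    then have "indep n (cols (?c a))" using assms(1) by (intro inj_mat_cols[of _ n a]) auto
    then show ?thesis
      using subspace_dim_colsp[of n "cols (?c a)"] assms(1) mat_of_cols_cols[of "?c a"] by simp
  qed
  moreover have "is_subspace n (colsp (?c a))" for a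
    using assms(1) by (intro is_subspace_colsp[of _ n a]) auto
  moreover have "colsp (?c a) \<subseteq> colsp (?c b)" if "a \<le> b" for a b
  proof -
    have "?c a = ?c b * rect b a" using assms(1) that by (simp add: mat_assoc)
    then show ?thesis by (simp only:) (rule colsp_mult, simp)
  qed
  ultimately show ?thesis
    using assms(2,3) unfolding flags_def by (auto simp: im sorted_nth_mono)
qed

text \<open>
  Both column spaces have dimension \<open>c\<close>, so the inclusion is an equality and the two bases differ by an
  invertible matrix.
\<close>

lemma colsp_rect_eq:
  assumes "g \<in> carrier (GL n)" "g' \<in> carrier (GL n)" "c \<le> n"
    and "colsp (g' * rect n c) \<subseteq> colsp (g * rect n c)"
  shows "\<exists>C \<in> carrier (GL c). g' * rect n c = g * rect n c * C"
proof -
  have car: "g' * rect n c \<in> carrier_mat n c" "g * rect n c \<in> carrier_mat n c"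
    using assms by auto
  obtain C where C: "C \<in> carrier_mat c c" "g' * rect n c = g * rect n c * C"
    using assms(4) colsp_le_iff[OF car] by blast
  have "inj_mat (g' * rect n c)"
    using assms by (intro inj_mat_mult GL_inj_mat[of _ n] inj_matI[of "rect n c" n c "rect c n"]) auto
  then have "inj_mat C" using C assms inj_mat_mult_rightD[of "g * rect n c" C] by auto
  then show ?thesis using C inj_mat_square by blast
qed

text \<open>
  A chain of surjections \<open>\<rho>\<^sub>0, \<dots>, \<rho>\<^sub>l\<close>, each factoring through the previous one and the last one being
  the projection to the first \<open>a\<close> coordinates up to isomorphism, is brought to standard form by
  changing the last \<open>k\<close> coordinates only: the row spaces of the \<open>\<rho>\<^sub>m\<close> form a flag, and a basis along
  it can be chosen to begin with the first \<open>a\<close> coordinate vectors.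
\<close>

lemma adapted_coordinates:
  assumes n: "n = a + k" and \<rho>: "\<And>m. m \<le> l \<Longrightarrow> \<rho> m \<in> carrier_mat (d m) n"
    and inj: "\<And>m. m \<le> l \<Longrightarrow> inj_mat ((\<rho> m)\<^sup>T)"
    and step: "\<And>m. m < l \<Longrightarrow> \<exists>L \<in> carrier_mat (d (Suc m)) (d m). \<rho> (Suc m) = L * \<rho> m"
    and d: "\<And>m. m < l \<Longrightarrow> d (Suc m) \<le> d m"
    and last: "d l = a" "P \<in> carrier (GL a)" "\<rho> l = P * rect a n"
  shows "\<exists>g \<in> carrier (GL k). \<forall>m\<le>l. \<exists>h \<in> carrier (GL (d m)). h * \<rho> m = rect (d m) n * gdiag a k g"
proof -
  let ?ms = "rev [0..<Suc l]"
  let ?V = "\<lambda>m. colsp ((\<rho> m)\<^sup>T)"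
  have car: "(\<rho> m)\<^sup>T \<in> carrier_mat n (d m)" if "m \<le> l" for m
    using \<rho>[OF that] by simp
  have ge: "d m' \<le> d m \<and> ?V m' \<subseteq> ?V m" if "m \<le> m'" "m' \<le> l" for m m'
    using that
  proof (induction m' rule: dec_induct)
    case (step i)
    obtain L where L: "L \<in> carrier_mat (d (Suc i)) (d i)" "\<rho> (Suc i) = L * \<rho> i"
      using assms(4)[of i] step by auto
    then have "(\<rho> (Suc i))\<^sup>T = (\<rho> i)\<^sup>T * L\<^sup>T"
      using \<rho>[of i] step by (simp add: transpose_mult[of L "d (Suc i)" "d i" _ n])
    then have "?V (Suc i) \<subseteq> ?V i"
      using L \<rho>[of i] step by (simp only:) (rule colsp_mult, simp)
    then show ?case using step d[of i] by auto
  qed auto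
  have dim: "subspace_dim n (?V m) = d m" if "m \<le> l" for m
    using subspace_dim_colsp[OF inj_mat_cols[OF car[OF that] inj[OF that]]] car[OF that]
      mat_of_cols_cols[of "(\<rho> m)\<^sup>T"] by (simp del: Matrix.cols_transpose)
  have nth: "?ms ! i = l - i" if "i < Suc l" for i
    using that by (subst rev_nth) (auto simp del: upt_Suc)
  have "map ?V ?ms \<in> flags (map d ?ms) n"
    unfolding flags_def
    using ge dim is_subspace_colsp[OF car] by (auto simp: nth simp del: upt_Suc)
  from flags_transitive[OF this] obtain G where G: "G \<in> carrier (GL n)"
    "map ?V ?ms = map (\<lambda>a. (\<lambda>x. G *\<^sub>v x) ` coord_subspace n a) (map d ?ms)" by blast
  have dn: "d m \<le> n" if "m \<le> l" for m using inj_mat_le[OF car inj] that by blast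
  have VG: "?V m = colsp (G * rect n (d m))" if "m \<le> l" for m
  proof -
    have "m \<in> set ?ms" using that by auto
    then have "?V m = (\<lambda>x. G *\<^sub>v x) ` coord_subspace n (d m)"
      using G(2) by (auto simp del: upt_Suc)
    then show ?thesis using image_coord_subspace[OF dn[OF that] GL_carrier[OF G(1)]] by simp
  qed
  have an: "a \<le> n" using n by simp
  have "(\<rho> l)\<^sup>T = rect n a * P\<^sup>T"
    unfolding last(3) using last(2) by (subst transpose_mult[of _ a a]) auto
  then have "?V l = colsp (1\<^sub>m n * rect n a)"
    using colsp_mult_GL[of "rect n a" n a "P\<^sup>T"] last(2) by simp
  then have "colsp (G * rect n a) \<subseteq> colsp (1\<^sub>m n * rect n a)" using VG[of l] last(1) by simp
  then obtain C where C: "C \<in> carrier (GL a)" "G * rect n a = rect n a * C"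
    using colsp_rect_eq[OF GL_one_closed G(1) an] by auto
  \<comment> \<open>\<open>G\<close> is block upper triangular, because its first \<open>a\<close> columns span the row space of \<open>\<rho> l\<close>\<close>
  define B where "B = mat a k (\<lambda>(i, j). G $$ (i, a + j))"
  define g where "g = mat k k (\<lambda>(i, j). G $$ (a + i, a + j))"
  have Bg: "B \<in> carrier_mat a k" "g \<in> carrier_mat k k" by (auto simp: B_def g_def)
  have Gc: "G \<in> carrier_mat n n" "C \<in> carrier_mat a a" using G C by auto
  have Gblock: "G = four_block_mat C B (0\<^sub>m k a) g"
  proof (rule eq_matI)
    fix i j assume "i < dim_row (four_block_mat C B (0\<^sub>m k a) g)" "j < dim_col (four_block_mat C B (0\<^sub>m k a) g)"
    then have ij: "i < n" "j < n" using Gc Bg n by auto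
    have "G $$ (i, j) = (if i < a then C $$ (i, j) else 0)" if "j < a"
      using arg_cong[OF C(2), of "\<lambda>M. M $$ (i, j)"] that ij Gc
      by (simp add: mult_rect_index[OF Gc(1)] rect_mult_index[OF Gc(2)] del: index_mult_mat(1))
    then show "G $$ (i, j) = four_block_mat C B (0\<^sub>m k a) g $$ (i, j)"
      using ij Gc Bg n by (auto simp: B_def g_def)
  qed (use Gc Bg n in auto)
  have "det G = det C * det g"
    unfolding Gblock by (rule det_four_block_mat_lower_left_zero[of _ a _ k]) (use Gc Bg in auto)
  then have g: "g \<in> carrier (GL k)" using G(1) Bg(2) by (auto simp: GL_iff)
  let ?C = "gl_inv a C"
  have Cc: "?C \<in> carrier_mat a a" using C(1) by simp
  \<comment> \<open>clearing the block \<open>B\<close> subtracts vectors of the smallest member and does not change the flag\<close>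
  have U: "(gdiag a k g)\<^sup>T * rect n (a + c) = (G * rect n (a + c)) * four_block_mat ?C (- (?C * B * rect k c)) (0\<^sub>m c a) (1\<^sub>m c)"
    if "c \<le> k" for c
  proof -
    let ?U = "four_block_mat ?C (- (?C * B)) (0\<^sub>m k a) (1\<^sub>m k)"
    let ?R = "four_block_mat (1\<^sub>m a) (0\<^sub>m a c) (0\<^sub>m k a) (rect k c)"
    have R: "rect n (a + c) = ?R" using rect_block[of a n "a + c"] n by simp
    have "G * ?U = four_block_mat (C * ?C + B * 0\<^sub>m k a) (C * - (?C * B) + B * 1\<^sub>m k)
        (0\<^sub>m k a * ?C + g * 0\<^sub>m k a) (0\<^sub>m k a * - (?C * B) + g * 1\<^sub>m k)"
      unfolding Gblock by (rule mult_four_block_mat) (use Gc Bg Cc in auto)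
    moreover have "C * - (?C * B) = - B"
      using C(1) Bg Cc by (subst uminus_mult_right_mat) auto
    moreover have "- B + B = 0\<^sub>m a k" using Bg by (intro eq_matI) auto
    moreover have "- 0\<^sub>m k k + g = g" using Bg by (intro eq_matI) auto
    moreover have "(gdiag a k g)\<^sup>T = four_block_mat (1\<^sub>m a) (0\<^sub>m a k) (0\<^sub>m k a) g"
      unfolding gdiag_def using Bg by (subst transpose_four_block_mat[of _ a a]) auto
    ultimately have 1: "(gdiag a k g)\<^sup>T = G * ?U" using C(1) Gc Bg Cc by simp
    have "?U * ?R = four_block_mat (?C * 1\<^sub>m a + - (?C * B) * 0\<^sub>m k a) (?C * 0\<^sub>m a c + - (?C * B) * rect k c)
        (0\<^sub>m k a * 1\<^sub>m a + 1\<^sub>m k * 0\<^sub>m k a) (0\<^sub>m k a * 0\<^sub>m a c + 1\<^sub>m k * rect k c)"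
      by (rule mult_four_block_mat) (use Gc Bg Cc in auto)
    moreover have "?R * four_block_mat ?C (- (?C * B * rect k c)) (0\<^sub>m c a) (1\<^sub>m c) =
        four_block_mat (1\<^sub>m a * ?C + 0\<^sub>m a c * 0\<^sub>m c a) (1\<^sub>m a * - (?C * B * rect k c) + 0\<^sub>m a c * 1\<^sub>m c)
        (0\<^sub>m k a * ?C + rect k c * 0\<^sub>m c a) (0\<^sub>m k a * - (?C * B * rect k c) + rect k c * 1\<^sub>m c)"
      by (rule mult_four_block_mat) (use Gc Bg Cc in auto)
    moreover have "- (?C * B) * rect k c = - (?C * B * rect k c)"
      using Bg Cc by (subst uminus_mult_left_mat) auto
    moreover have "?C * B * rect k c \<in> carrier_mat a c" using Bg Cc by auto
    moreover have "- 0\<^sub>m k c + rect k c = rect k c" by (intro eq_matI) auto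
    ultimately have 2: "?U * ?R = ?R * four_block_mat ?C (- (?C * B * rect k c)) (0\<^sub>m c a) (1\<^sub>m c)"
      using Bg Cc by simp
    have "(gdiag a k g)\<^sup>T * ?R = G * (?U * ?R)"
      unfolding 1 using Gc Bg Cc n by (intro mat_assoc) auto
    also have "\<dots> = (G * ?R) * four_block_mat ?C (- (?C * B * rect k c)) (0\<^sub>m c a) (1\<^sub>m c)"
      unfolding 2 using Gc Bg Cc n by (intro mat_assoc[symmetric]) auto
    finally show ?thesis by (simp only: R)
  qed
  have "\<exists>h \<in> carrier (GL (d m)). h * \<rho> m = rect (d m) n * gdiag a k g" if m: "m \<le> l" for m
  proof -
    have ad: "a \<le> d m" using ge[OF m] last(1) by simp
    define c where "c = d m - a"
    have dc: "d m = a + c" "c \<le> k" using ad dn[OF m] n by (auto simp: c_def)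
    let ?T = "(gdiag a k g)\<^sup>T * rect n (d m)"
    have gd: "gdiag a k g \<in> carrier (GL n)" using g n by auto
    have "colsp ?T \<subseteq> colsp (G * rect n (d m))"
      unfolding dc(1) U[OF dc(2)] by (rule colsp_mult) (use Cc in auto)
    then have "colsp ?T \<subseteq> ?V m" using VG[OF m] by simp
    moreover have Tc: "?T \<in> carrier_mat n (d m)" using gd by auto
    ultimately obtain H where H: "H \<in> carrier_mat (d m) (d m)" "?T = (\<rho> m)\<^sup>T * H"
      using colsp_le_iff[OF Tc car[OF m]] by blast
    have "inj_mat ?T"
      using gd dn[OF m] by (intro inj_mat_mult GL_inj_mat[of _ n] GL_transpose
          inj_matI[of "rect n (d m)" n "d m" "rect (d m) n"]) auto
    then have "inj_mat H" using H car[OF m] inj_mat_mult_rightD[of "(\<rho> m)\<^sup>T" H] by auto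
    then have "H\<^sup>T \<in> carrier (GL (d m))" using inj_mat_square[OF H(1)] by auto
    moreover have "H\<^sup>T * \<rho> m = rect (d m) n * gdiag a k g"
      using arg_cong[OF H(2), of transpose_mat] gd H(1) car[OF m]
      by (simp add: transpose_mult[of _ n n _ "d m"] transpose_mult[of _ n "d m" _ "d m"] GL_carrier)
    ultimately show ?thesis by blast
  qed
  then show ?thesis using g by blast
qed

section \<open>Regular matrix-valued functions\<close>

definition regular_mat :: "'a fspace \<Rightarrow> nat \<Rightarrow> nat \<Rightarrow> ('a \<Rightarrow> complex mat) \<Rightarrow> bool" where
  "regular_mat X n m M \<longleftrightarrow> (\<forall>z\<in>points X. M z \<in> carrier_mat n m) \<and>
     (\<forall>i<n. \<forall>j<m. (\<lambda>z. M z $$ (i, j)) \<in> reg X (points X))"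

lemma regular_matI:
  assumes "\<And>z. z \<in> points X \<Longrightarrow> M z \<in> carrier_mat n m"
    and "\<And>i j. i < n \<Longrightarrow> j < m \<Longrightarrow> (\<lambda>z. M z $$ (i, j)) \<in> reg X (points X)"
  shows "regular_mat X n m M"
  using assms by (simp add: regular_mat_def)

lemma regular_matD:
  assumes "regular_mat X n m M"
  shows "z \<in> points X \<Longrightarrow> M z \<in> carrier_mat n m"
    and "i < n \<Longrightarrow> j < m \<Longrightarrow> (\<lambda>z. M z $$ (i, j)) \<in> reg X (points X)"
  using assms by (auto simp: regular_mat_def)

lemma regular_mat_dim:
  assumes "regular_mat X n m M" "z \<in> points X"
  shows "dim_row (M z) = n" "dim_col (M z) = m"
  using assms by (auto simp: regular_mat_def)

lemma regular_mat_compose: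
  assumes "fs_morphism X Y \<phi>" "regular_mat Y n m M"
  shows "regular_mat X n m (\<lambda>x. M (\<phi> x))"
  using assms fs_morphism_points[OF assms(1)]
    fs_morphism_reg_points[OF assms(1), of "\<lambda>z. M z $$ (i, j)" for i j]
  by (auto simp: regular_mat_def)

context space_with_functions
begin

lemma regular_mat_cong:
  assumes "regular_mat X n m M" "\<And>z. z \<in> points X \<Longrightarrow> N z = M z"
  shows "regular_mat X n m N"
proof (rule regular_matI)
  show "N z \<in> carrier_mat n m" if "z \<in> points X" for z
    using regular_matD(1)[OF assms(1) that] assms(2)[OF that] by simp
  fix i j assume "i < n" "j < m"
  from regular_matD(2)[OF assms(1) this] show "(\<lambda>z. N z $$ (i, j)) \<in> reg X (points X)"
    by (rule reg_cong) (simp add: assms(2))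
qed

lemma regular_mat_const: "A \<in> carrier_mat n m \<Longrightarrow> regular_mat X n m (\<lambda>_. A)"
  by (simp add: regular_mat_def reg_const)

lemma regular_mat_mult:
  assumes "regular_mat X n m M" "regular_mat X m p N"
  shows "regular_mat X n p (\<lambda>z. M z * N z)"
proof (rule regular_matI)
  show "M z * N z \<in> carrier_mat n p" if "z \<in> points X" for z
    using regular_matD(1)[OF assms(1) that] regular_matD(1)[OF assms(2) that] by simp
  fix i j assume ij: "i < n" "j < p"
  have "(\<lambda>z. \<Sum>k<m. M z $$ (i, k) * N z $$ (k, j)) \<in> reg X (points X)"
    by (intro reg_sum reg_mult regular_matD(2)[OF assms(1)] regular_matD(2)[OF assms(2)] ij) auto
  then show "(\<lambda>z. (M z * N z) $$ (i, j)) \<in> reg X (points X)"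
  proof (rule reg_cong)
    fix z assume "z \<in> points X"
    note regular_matD(1)[OF assms(1) this] regular_matD(1)[OF assms(2) this]
    then show "(M z * N z) $$ (i, j) = (\<Sum>k<m. M z $$ (i, k) * N z $$ (k, j))"
      using ij by (intro mat_mult_index)
  qed
qed

lemma regular_mat_transpose:
  assumes "regular_mat X n m M"
  shows "regular_mat X m n (\<lambda>z. (M z)\<^sup>T)"
proof (rule regular_matI)
  fix i j assume ij: "i < m" "j < n"
  show "(\<lambda>z. (M z)\<^sup>T $$ (i, j)) \<in> reg X (points X)"
    by (rule reg_cong[OF regular_matD(2)[OF assms ij(2,1)]])
      (use ij in \<open>simp add: regular_mat_dim[OF assms]\<close>)
qed (use regular_matD(1)[OF assms] in auto)

lemma regular_det:
  assumes "regular_mat X n n M"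
  shows "(\<lambda>z. det (M z)) \<in> reg X (points X)"
proof -
  have "(\<lambda>z. \<Sum>p \<in> {p. p permutes {0..<n}}. signof p * (\<Prod>i\<in>{0..<n}. M z $$ (i, p i))) \<in> reg X (points X)"
  proof (intro reg_sum reg_mult reg_prod reg_const)
    fix p i assume "p \<in> {p. p permutes {0..<n}}" "i \<in> {0..<n}"
    then show "(\<lambda>z. M z $$ (i, p i)) \<in> reg X (points X)"
      using regular_matD(2)[OF assms, of i "p i"] permutes_in_image[of p "{0..<n}" i] by auto
  qed auto
  then show ?thesis
    by (rule reg_cong) (use regular_matD(1)[OF assms] in \<open>auto simp: det_def'\<close>)
qed

lemma regular_gl_inv:
  assumes "regular_mat X n n M" "\<And>z. z \<in> points X \<Longrightarrow> M z \<in> carrier (GL n)"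
  shows "regular_mat X n n (\<lambda>z. gl_inv n (M z))"
proof (rule regular_matI)
  fix i j assume ij: "i < n" "j < n"
  have del: "regular_mat X (n - 1) (n - 1) (\<lambda>z. mat_delete (M z) j i)"
  proof (rule regular_matI)
    fix i' j' assume ij': "i' < n - 1" "j' < n - 1"
    show "(\<lambda>z. mat_delete (M z) j i $$ (i', j')) \<in> reg X (points X)"
      by (rule reg_cong[OF regular_matD(2)[OF assms(1), of "if i' < j then i' else Suc i'" "if j' < i then j' else Suc j'"]])
        (use ij ij' in \<open>auto simp: mat_delete_def regular_mat_dim[OF assms(1)]\<close>)
  qed (auto simp: mat_delete_def regular_mat_dim[OF assms(1)])
  have "{z \<in> points X. det (M z) \<noteq> 0} = points X" using assms(2) by (auto simp: GL_iff)
  then have "(\<lambda>z. inverse (det (M z))) \<in> reg X (points X)"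
    using reg_inverse[OF regular_det[OF assms(1)]] by simp
  then have "(\<lambda>z. inverse (det (M z)) * ((- 1) ^ (j + i) * det (mat_delete (M z) j i))) \<in> reg X (points X)"
    by (intro reg_mult reg_const regular_det[OF del]) auto
  then show "(\<lambda>z. gl_inv n (M z) $$ (i, j)) \<in> reg X (points X)"
    by (rule reg_cong) (use ij assms(2) in \<open>simp add: gl_inv_adjugate adj_mat_def cofactor_def regular_mat_dim[OF assms(1)]\<close>)
qed (use assms(2) in auto)

lemma openin_GL:
  assumes "regular_mat X n n M"
  shows "openin (topo X) {z \<in> points X. M z \<in> carrier (GL n)}"
proof -
  have "{z \<in> points X. M z \<in> carrier (GL n)} = {z \<in> points X. det (M z) \<noteq> 0}"
    using regular_matD(1)[OF assms] by (auto simp: GL_iff)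
  then show ?thesis using openin_nonzero[OF regular_det[OF assms]] by simp
qed

lemma regular_mat_cols:
  assumes "\<And>j. j < m \<Longrightarrow> regular_mat X n (p j) (N j) \<and> c j < p j"
  shows "regular_mat X n m (\<lambda>z. mat n m (\<lambda>(i, j). N j z $$ (i, c j)))"
proof (rule regular_matI)
  fix i j assume ij: "i < n" "j < m"
  show "(\<lambda>z. mat n m (\<lambda>(i, j). N j z $$ (i, c j)) $$ (i, j)) \<in> reg X (points X)"
    using regular_matD(2)[of X n "p j" "N j" i "c j"] assms[OF ij(2)] ij by simp
qed auto

lemma regular_gdiag:
  assumes "regular_mat X k k M"
  shows "regular_mat X (a + k) (a + k) (\<lambda>z. gdiag a k (M z))"
proof (rule regular_matI)
  fix i j assume ij: "i < a + k" "j < a + k"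
  show "(\<lambda>z. gdiag a k (M z) $$ (i, j)) \<in> reg X (points X)"
  proof (cases "i < a \<or> j < a")
    case True
    have "(\<lambda>_. if i = j then 1 else 0) \<in> reg X (points X)" by (rule reg_const) simp
    then show ?thesis
      by (rule reg_cong) (use True ij in \<open>auto simp: gdiag_def regular_mat_dim[OF assms]\<close>)
  next
    case False
    show ?thesis
      by (rule reg_cong[OF regular_matD(2)[OF assms, of "j - a" "i - a"]])
        (use False ij in \<open>auto simp: gdiag_def regular_mat_dim[OF assms]\<close>)
  qed
qed (use regular_matD(1)[OF assms] in auto)

end

lemma regular_mat_open_sub:
  assumes "space_with_functions X" "openin (topo X) U" "regular_mat X n m M"
  shows "regular_mat (fs_open_sub X U) n m M"
  by (rule regular_mat_compose[OF fs_morphism_open_sub_inclusion[OF assms(1,2)] assms(3)])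

lemma regular_mat_coinduced:
  assumes X: "space_with_functions X" and q: "q ` points X = Y" and U: "openin (topo (fs_coinduced X Y q)) U"
    and M: "regular_mat (fs_open_sub X {x \<in> points X. q x \<in> U}) n m (\<lambda>x. M (q x))"
  shows "regular_mat (fs_open_sub (fs_coinduced X Y q) U) n m M"
proof -
  let ?U = "{x \<in> points X. q x \<in> U}"
  have oU: "openin (topo X) ?U" and UY: "U \<subseteq> Y" using U by (auto simp: openin_coinduced)
  note pts = points_open_sub_open[OF oU] points_open_sub_open[OF U]
  show ?thesis
  proof (rule regular_matI)
    fix z assume "z \<in> points (fs_open_sub (fs_coinduced X Y q) U)"
    then obtain x where "x \<in> ?U" "q x = z" using q UY by (auto simp: pts)
    then show "M z \<in> carrier_mat n m" using regular_matD(1)[OF M, of x] by (simp add: pts)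
  next
    fix i j assume "i < n" "j < m"
    from regular_matD(2)[OF M this]
    show "(\<lambda>z. M z $$ (i, j)) \<in> reg (fs_open_sub (fs_coinduced X Y q) U) (points (fs_open_sub (fs_coinduced X Y q) U))"
      using UY by (simp add: pts reg_open_sub reg_coinduced o_def)
  qed
qed

section \<open>The flag variety as a target and as a source of morphisms\<close>

abbreviation std_flag :: "nat list \<Rightarrow> nat \<Rightarrow> complex mat \<Rightarrow> complex vec set list" where
  "std_flag as n g \<equiv> map (\<lambda>a. (\<lambda>x. g *\<^sub>v x) ` coord_subspace n a) as"

lemma points_GL_space [simp]: "points (GL_space n) = carrier (GL n)"
  by (simp add: GL_space_def)

lemma space_with_functions_GL_space: "space_with_functions (GL_space n)"
  unfolding GL_space_def by (rule space_with_functions_zariski)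

lemma regular_mat_GL_space: "regular_mat (GL_space n) n n (\<lambda>g. g)"
  by (rule regular_matI) (auto simp: GL_space_def intro!: reg_zariski_coord)

lemma fs_morphism_GL_space:
  assumes "space_with_functions X" "regular_mat X n n M" "\<And>z. z \<in> points X \<Longrightarrow> M z \<in> carrier (GL n)"
  shows "fs_morphism X (GL_space n) M"
  unfolding GL_space_def
  by (rule fs_morphism_zariski[OF assms(1)]) (use assms regular_matD(2)[OF assms(2)] in auto)

lemma std_flag_image:
  assumes "sorted as" "\<forall>a\<in>set as. a \<le> n"
  shows "std_flag as n ` points (GL_space n) = flags as n"
  using flags_transitive[of _ as n] coord_flag_in_flags[OF _ assms] by auto

lemma space_with_functions_flag_variety: "space_with_functions (flag_variety as n)"
  unfolding flag_variety_def
  by (intro space_with_functions_coinduced space_with_functions_GL_space)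

lemma points_flag_variety:
  assumes "sorted as" "\<forall>a\<in>set as. a \<le> n"
  shows "points (flag_variety as n) = flags as n"
  unfolding flag_variety_def using std_flag_image[OF assms] by (simp add: points_coinduced)

lemma fs_morphism_std_flag:
  assumes "sorted as" "\<forall>a\<in>set as. a \<le> n"
  shows "fs_morphism (GL_space n) (flag_variety as n) (std_flag as n)"
  unfolding flag_variety_def by (rule fs_morphism_coinduced_map) (simp only: std_flag_image[OF assms] order_refl)

lemma std_flag_eqI:
  assumes "g \<in> carrier (GL n)" "g' \<in> carrier (GL n)" "\<forall>a\<in>set as. a \<le> n"
    and "\<And>a. a \<in> set as \<Longrightarrow> colsp (g' * rect n a) \<subseteq> colsp (g * rect n a)"
  shows "std_flag as n g' = std_flag as n g"
proof -
  have "(\<lambda>x. g' *\<^sub>v x) ` coord_subspace n a = (\<lambda>x. g *\<^sub>v x) ` coord_subspace n a" if a: "a \<in> set as" for a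
  proof -
    have an: "a \<le> n" using assms(3) a by simp
    obtain C where C: "C \<in> carrier (GL a)" "g' * rect n a = g * rect n a * C"
      using colsp_rect_eq[OF assms(1,2) an assms(4)[OF a]] by blast
    have "colsp (g * rect n a * C) = colsp (g * rect n a)"
      using assms(1) C(1) by (intro colsp_mult_GL[of _ n a]) auto
    then show ?thesis
      using image_coord_subspace[OF an GL_carrier[OF assms(1)]] image_coord_subspace[OF an GL_carrier[OF assms(2)]] C(2)
      by simp
  qed
  then show ?thesis by simp
qed

lemma std_flag_eqD:
  assumes "std_flag as n g' = std_flag as n g" "g \<in> carrier (GL n)" "g' \<in> carrier (GL n)" "a \<in> set as" "a \<le> n"
  shows "colsp (g' * rect n a) = colsp (g * rect n a)"
proof -
  have "(\<lambda>x. g' *\<^sub>v x) ` coord_subspace n a = (\<lambda>x. g *\<^sub>v x) ` coord_subspace n a"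
    using assms(1,4) by (simp add: list_eq_iff_nth_eq in_set_conv_nth) metis
  then show ?thesis
    using image_coord_subspace[OF assms(5) GL_carrier[OF assms(2)]]
      image_coord_subspace[OF assms(5) GL_carrier[OF assms(3)]] by simp
qed

text \<open>
  A family of flags \<open>z \<mapsto> (colsp (C m z))\<^sub>m\<close> with regular \<open>C m\<close> is a morphism: near \<open>z\<^sub>0\<close> it lifts to the
  general linear group, by keeping the coefficients constant that express a basis adapted to the
  flag at \<open>z\<^sub>0\<close> in the columns of the \<open>C m z\<^sub>0\<close>.
\<close>

lemma fs_morphism_flag_variety:
  fixes b :: "nat \<Rightarrow> nat"
  assumes X: "space_with_functions X"
    and C: "\<And>m. m \<le> l \<Longrightarrow> regular_mat X n (N m) (C m)"
    and flag: "\<And>z. z \<in> points X \<Longrightarrow>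
      \<exists>g \<in> carrier (GL n). \<forall>m\<le>l. colsp (C m z) = colsp (g * rect n (b m))"
    and b: "\<And>m. m \<le> l \<Longrightarrow> b m \<le> n" "b 0 = n" "\<And>m m'. m \<le> m' \<Longrightarrow> m' \<le> l \<Longrightarrow> b m' \<le> b m"
    and ms: "set ms \<subseteq> {..l}" "sorted (map b ms)"
  shows "fs_morphism X (flag_variety (map b ms) n) (\<lambda>z. map (\<lambda>m. colsp (C m z)) ms)"
proof (rule fs_morphism_local[OF X])
  interpret X: space_with_functions X by fact
  have bn: "\<forall>a\<in>set (map b ms). a \<le> n" using ms b by auto
  fix z0 assume z0: "z0 \<in> points X"
  obtain g0 where g0: "g0 \<in> carrier (GL n)" "\<And>m. m \<le> l \<Longrightarrow> colsp (C m z0) = colsp (g0 * rect n (b m))"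
    using flag[OF z0] by blast
  \<comment> \<open>the smallest member of the flag that contains column \<open>c\<close> of the adapted basis\<close>
  define top where "top c = (GREATEST m. m \<le> l \<and> c < b m)" for c
  have top: "top c \<le> l \<and> c < b (top c)" if "c < n" for c
    unfolding top_def by (rule GreatestI_nat[of _ 0 l]) (use that b(2) in auto)
  have top_ge: "m \<le> top c" if "m \<le> l" "c < b m" for m c
    unfolding top_def by (rule Greatest_le_nat[of _ _ l]) (use that in auto)
  have "\<exists>u. u \<in> carrier_vec (N (top c)) \<and> col g0 c = C (top c) z0 *\<^sub>v u" if "c < n" for c
  proof -
    have Cc: "C (top c) z0 \<in> carrier_mat n (N (top c))"
      using regular_matD(1)[OF C z0] top[OF that] by simp
    have "col (g0 * rect n (b (top c))) c = col g0 c"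
      using top[OF that] that g0(1)
      by (intro eq_vecI) (auto simp: mult_rect_index[OF GL_carrier[OF g0(1)]] simp del: index_mult_mat(1))
    then have "col g0 c \<in> colsp (C (top c) z0)"
      using col_in_colsp[of c "g0 * rect n (b (top c))"] g0(2)[of "top c"] top[OF that] by simp
    then show ?thesis using Cc by (auto simp: colsp_def)
  qed
  then obtain u where u: "\<And>c. c < n \<Longrightarrow> u c \<in> carrier_vec (N (top c))"
    "\<And>c. c < n \<Longrightarrow> col g0 c = C (top c) z0 *\<^sub>v u c" by metis
  let ?U = "\<lambda>c. mat_of_cols (N (top c)) [u c]"
  define L where "L z = mat n n (\<lambda>(i, c). (C (top c) z * ?U c) $$ (i, 0))" for z
  have L: "regular_mat X n n L"
    unfolding L_def
    by (rule X.regular_mat_cols[of n n "\<lambda>_. 1" "\<lambda>c z. C (top c) z * ?U c" "\<lambda>_. 0"])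
      (auto intro!: X.regular_mat_mult[OF C] X.regular_mat_const dest!: top)
  have col: "col (L z) c = C (top c) z *\<^sub>v u c" if "z \<in> points X" "c < n" for z c
  proof -
    have Cc: "C (top c) z \<in> carrier_mat n (N (top c))"
      using regular_matD(1)[OF C that(1)] top[OF that(2)] by simp
    have "col (C (top c) z * ?U c) 0 = C (top c) z *\<^sub>v col (?U c) 0"
      by (rule col_mult2[OF Cc]) auto
    moreover have "col (?U c) 0 = u c" using u(1)[OF that(2)] by (subst col_mat_of_cols) auto
    moreover have "col (L z) c = col (C (top c) z * ?U c) 0"
      using Cc that by (intro eq_vecI) (auto simp: L_def simp del: index_mult_mat(1))
    ultimately show ?thesis by simp
  qed
  let ?W = "{z \<in> points X. L z \<in> carrier (GL n)}"
  have oW: "openin (topo X) ?W" by (rule X.openin_GL[OF L])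
  have pW: "points (fs_open_sub X ?W) = ?W" by (rule points_open_sub_open[OF oW])
  note XW = space_with_functions_open_sub[OF X oW]
  have "L z0 = g0"
    using u(2) col[OF z0] g0(1) by (intro mat_col_eqI) (auto simp: L_def)
  then have "z0 \<in> ?W" using z0 g0(1) by simp
  moreover have "fs_morphism (fs_open_sub X ?W) (flag_variety (map b ms) n) (\<lambda>z. map (\<lambda>m. colsp (C m z)) ms)"
  proof (rule fs_morphism_cong[OF XW])
    have "fs_morphism (fs_open_sub X ?W) (GL_space n) L"
      by (rule fs_morphism_GL_space[OF XW regular_mat_open_sub[OF X oW L]]) (simp add: pW)
    from fs_morphism_compose[OF this fs_morphism_std_flag[OF ms(2) bn]]
    show "fs_morphism (fs_open_sub X ?W) (flag_variety (map b ms) n) (std_flag (map b ms) n \<circ> L)" .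
    fix z assume "z \<in> points (fs_open_sub X ?W)"
    then have z: "z \<in> points X" "L z \<in> carrier (GL n)" by (auto simp: pW)
    obtain g where g: "g \<in> carrier (GL n)" "\<And>m. m \<le> l \<Longrightarrow> colsp (C m z) = colsp (g * rect n (b m))"
      using flag[OF z(1)] by blast
    have "colsp (C m z) = (\<lambda>x. g *\<^sub>v x) ` coord_subspace n (b m)" if "m \<in> set ms" for m
      using g(2)[of m] image_coord_subspace[OF b(1)[of m] GL_carrier[OF g(1)]] that ms(1) by auto
    then have "map (\<lambda>m. colsp (C m z)) ms = std_flag (map b ms) n g" by simp
    also have "\<dots> = std_flag (map b ms) n (L z)"
    proof (rule std_flag_eqI[OF g(1) z(2) bn, symmetric])
      fix a assume "a \<in> set (map b ms)"
      then obtain m where m: "m \<le> l" "a = b m" using ms(1) by auto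
      have "\<exists>D \<in> carrier_mat (b m) (b m). L z * rect n (b m) = (g * rect n (b m)) * D"
      proof (rule colsp_leD)
        fix c assume c: "c < b m"
        then have cn: "c < n" using b(1)[OF m(1)] by simp
        have "col (L z * rect n (b m)) c = col (L z) c"
          using c cn z(2)
          by (intro eq_vecI) (auto simp: mult_rect_index[OF GL_carrier[OF z(2)]] simp del: index_mult_mat(1))
        also have "\<dots> = C (top c) z *\<^sub>v u c" using col z(1) cn by simp
        also have "\<dots> \<in> colsp (C (top c) z)"
          using u(1)[OF cn] regular_matD(1)[OF C z(1), of "top c"] top[OF cn] by (intro colspI) simp
        also have "\<dots> = colsp (g * rect n (b (top c)))" using g(2) top[OF cn] by simp
        also have "g * rect n (b (top c)) = (g * rect n (b m)) * rect (b m) (b (top c))"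
          using b(3)[OF top_ge[OF m(1) c]] top[OF cn] g(1) by (simp add: mat_assoc)
        also have "colsp \<dots> \<subseteq> colsp (g * rect n (b m))" by (rule colsp_mult) simp
        finally show "col (L z * rect n (b m)) c \<in> colsp (g * rect n (b m))" .
      qed (use g z in auto)
      then obtain D where "D \<in> carrier_mat (b m) (b m)" "L z * rect n (b m) = (g * rect n (b m)) * D" ..
      then show "colsp (L z * rect n a) \<subseteq> colsp (g * rect n a)"
        using m(2) colsp_mult[of "g * rect n (b m)" D] by simp
    qed
    finally show "map (\<lambda>m. colsp (C m z)) ms = (std_flag (map b ms) n \<circ> L) z" by simp
  qed
  ultimately show "\<exists>U. openin (topo X) U \<and> z0 \<in> U \<and>
      fs_morphism (fs_open_sub X U) (flag_variety (map b ms) n) (\<lambda>z. map (\<lambda>m. colsp (C m z)) ms)"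
    using oW by blast
qed

text \<open>
  The orbit map of the general linear group to the flag variety has local sections. In the big cell
  around the flag of \<open>g\<^sub>0\<close>, the member of dimension \<open>a\<close> of a flag projects isomorphically to the first
  \<open>a\<close> coordinates with respect to \<open>g\<^sub>0\<close>. Column \<open>c\<close> of the section is the vector over the coordinate
  vector \<open>c\<close> in the smallest member of dimension greater than \<open>c\<close>.
\<close>

lemma flag_variety_local_section:
  assumes as: "sorted as" "\<forall>a\<in>set as. a \<le> n" and V0: "V0 \<in> flags as n"
  shows "\<exists>W s. openin (topo (flag_variety as n)) W \<and> V0 \<in> W \<and>
    regular_mat (fs_open_sub (flag_variety as n) W) n n s \<and>
    (\<forall>V\<in>W. s V \<in> carrier (GL n) \<and> std_flag as n (s V) = V)"
proof -
  obtain g0 where g0: "g0 \<in> carrier (GL n)" "V0 = std_flag as n g0"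
    using flags_transitive[OF V0] by blast
  let ?i = "gl_inv n g0"
  define S where "S = insert n (set as)"
  have S: "finite S" "n \<in> S" "\<And>a. a \<in> S \<Longrightarrow> a \<le> n" using as(2) by (auto simp: S_def)
  define up where "up c = Min {a \<in> S. c < a}" for c
  have up: "up c \<in> S \<and> c < up c" if "c < n" for c
  proof -
    have "{a \<in> S. c < a} \<noteq> {}" using S(2) that by auto
    then show ?thesis using Min_in[of "{a \<in> S. c < a}"] S(1) unfolding up_def by simp
  qed
  have up_le: "up c \<le> a" if "a \<in> S" "c < a" for a c
    using S that by (auto simp: up_def)
  define M where "M a g = rect a n * (?i * (g * rect n a))" for a g
  define col' where "col' c g = g * (rect n (up c) * gl_inv (up c) (M (up c) g))" for c g
  define s0 where "s0 g = mat n n (\<lambda>(i, c). col' c g $$ (i, c))" for g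
  let ?Z = "{g \<in> carrier (GL n). \<forall>a\<in>S. M a g \<in> carrier (GL a)}"
  let ?W = "std_flag as n ` ?Z"
  interpret G: space_with_functions "GL_space n" by (rule space_with_functions_GL_space)
  have Mreg: "regular_mat (GL_space n) a a (M a)" for a
    unfolding M_def
    by (rule G.regular_mat_mult[OF G.regular_mat_const G.regular_mat_mult[OF G.regular_mat_const
          G.regular_mat_mult[OF regular_mat_GL_space G.regular_mat_const]]]) (use g0(1) in auto)
  have oW0: "openin (topo (GL_space n)) ?Z"
  proof -
    have "?Z = carrier (GL n) \<inter> (\<Inter>a\<in>S. {g \<in> points (GL_space n). M a g \<in> carrier (GL a)})"
      by auto
    moreover have "openin (topo (GL_space n)) (\<Inter>a\<in>S. {g \<in> points (GL_space n). M a g \<in> carrier (GL a)})"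
      using S(1,2) by (intro openin_Inter) (auto intro: G.openin_GL[OF Mreg, unfolded points_GL_space])
    ultimately show ?thesis using openin_Int[OF openin_topspace[of "topo (GL_space n)"]] by simp
  qed
  \<comment> \<open>changing the representative of the flag is absorbed by the inverse\<close>
  have change: "(M a g' \<in> carrier (GL a) \<longleftrightarrow> M a g \<in> carrier (GL a)) \<and>
      (M a g \<in> carrier (GL a) \<longrightarrow> g' * (rect n a * gl_inv a (M a g')) = g * (rect n a * gl_inv a (M a g)))"
    if g: "g \<in> carrier (GL n)" "g' \<in> carrier (GL n)" "std_flag as n g' = std_flag as n g" and a: "a \<in> S" for g g' a
  proof -
    have an: "a \<le> n" using S a by simp
    have "colsp (g' * rect n a) = colsp (g * rect n a)"
    proof (cases "a \<in> set as")
      case True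
      then show ?thesis using std_flag_eqD[OF g(3,1,2) True an] by simp
    next
      case False
      then have "a = n" using a by (simp add: S_def)
      then show ?thesis
        using colsp_mult_GL[of "1\<^sub>m n" n n g] colsp_mult_GL[of "1\<^sub>m n" n n g'] g by (simp add: GL_carrier)
    qed
    then obtain C where C: "C \<in> carrier (GL a)" "g' * rect n a = g * rect n a * C"
      using colsp_rect_eq[OF g(1,2) an] by auto
    have MC: "M a g' = M a g * C"
      unfolding M_def C(2) using g g0(1) C(1) by (simp add: mat_assoc)
    have Mc: "M a g \<in> carrier_mat a a" "M a g' \<in> carrier_mat a a"
      unfolding M_def using g g0(1) by auto
    have iff: "M a g' \<in> carrier (GL a) \<longleftrightarrow> M a g \<in> carrier (GL a)"
      using Mc C(1) unfolding GL_iff MC by (auto simp: det_mult[of _ a])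
    moreover have "g' * (rect n a * gl_inv a (M a g')) = g * (rect n a * gl_inv a (M a g))" if M: "M a g \<in> carrier (GL a)"
    proof -
      have "g' * (rect n a * gl_inv a (M a g')) = (g' * rect n a) * gl_inv a (M a g')"
        using g M iff by (simp add: mat_assoc)
      also have "\<dots> = g * rect n a * C * (gl_inv a C * gl_inv a (M a g))"
        unfolding C(2) MC using gl_inv_mult[OF M C(1)] by simp
      also have "\<dots> = g * (rect n a * gl_inv a (M a g))"
        using g M C(1) by (simp add: mat_assoc)
      finally show ?thesis .
    qed
    ultimately show ?thesis by blast
  qed
  have pre: "{g \<in> points (GL_space n). std_flag as n g \<in> ?W} = ?Z"
  proof
    show "{g \<in> points (GL_space n). std_flag as n g \<in> ?W} \<subseteq> ?Z"
    proof
      fix g assume "g \<in> {g \<in> points (GL_space n). std_flag as n g \<in> ?W}"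
      then obtain g' where g: "g \<in> carrier (GL n)" "g' \<in> ?Z" "std_flag as n g = std_flag as n g'" by auto
      then show "g \<in> ?Z" using change[of g' g] by auto
    qed
  qed auto
  have WF: "?W \<subseteq> flags as n" using coord_flag_in_flags[OF _ as] by auto
  have oW: "openin (topo (flag_variety as n)) ?W"
    unfolding flag_variety_def openin_coinduced pre using WF oW0 by blast
  have "M a g0 = 1\<^sub>m a" if "a \<in> S" for a
    using g0(1) S that by (simp add: M_def)
  then have V0W: "V0 \<in> ?W" using g0 by auto
  define s where "s V = s0 (SOME g. g \<in> ?Z \<and> std_flag as n g = V)" for V
  have s: "s (std_flag as n g) = s0 g" if g: "g \<in> ?Z" for g
  proof -
    define g' where "g' = (SOME g'. g' \<in> ?Z \<and> std_flag as n g' = std_flag as n g)"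
    have g': "g' \<in> ?Z \<and> std_flag as n g' = std_flag as n g"
      unfolding g'_def by (rule someI[of _ g]) (use g in auto)
    have "col' c g' = col' c g" if "c < n" for c
      unfolding col'_def using change[of g g' "up c"] up[OF that] g g' by auto
    then have "s0 g' = s0 g" unfolding s0_def by (intro cong_mat) auto
    then show ?thesis by (simp add: s_def g'_def)
  qed
  have colc: "col' c g \<in> carrier_mat n (up c)" if "g \<in> ?Z" "c < n" for c g
  proof -
    have "M (up c) g \<in> carrier (GL (up c))" using that up[of c] by auto
    then show ?thesis unfolding col'_def using that(1) by auto
  qed
  \<comment> \<open>with respect to \<open>g\<^sub>0\<close> the section is lower unitriangular\<close>
  have s0GL: "s0 g \<in> carrier (GL n)" if g: "g \<in> ?Z" for g
  proof -
    let ?T = "?i * s0 g"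
    have s0c: "s0 g \<in> carrier_mat n n" by (simp add: s0_def)
    have Tc: "?T \<in> carrier_mat n n" using g0(1) s0c by auto
    have ent: "?T $$ (r, c) = (if r = c then 1 else 0)" if rc: "c < n" "r < up c" for r c
    proof -
      have rn: "r < n" using rc up[of c] S(3) by fastforce
      have M: "M (up c) g \<in> carrier (GL (up c))" using g up[OF rc(1)] by auto
      have "?T $$ (r, c) = (?i * col' c g) $$ (r, c)"
        using rn rc colc[OF g rc(1)] up[OF rc(1)] g0(1) s0c
        by (auto simp: s0_def scalar_prod_def intro!: sum.cong)
      also have "\<dots> = (rect (up c) n * (?i * col' c g)) $$ (r, c)"
        using rn rc up[OF rc(1)] colc[OF g rc(1)] g0(1)
        by (subst rect_mult_index[of _ n "up c"]) auto
      also have "rect (up c) n * (?i * col' c g) = M (up c) g * gl_inv (up c) (M (up c) g)"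
      proof -
        have *: "rect a n * (?i * (g * (rect n a * N))) = M a g * N" if "dim_row N = a" for a N
        proof -
          have "g \<in> carrier (GL n)" using g by simp
          then show ?thesis unfolding M_def using g0(1) that by (simp add: mat_assoc)
        qed
        show ?thesis unfolding col'_def by (rule *) (use M in simp)
      qed
      also have "\<dots> = 1\<^sub>m (up c)" using M by simp
      finally show ?thesis using rc up[OF rc(1)] by simp
    qed
    have "det ?T = prod_list (diag_mat ?T)"
      by (rule det_lower_triangular[OF _ Tc]) (use ent up in force)
    also have "diag_mat ?T = map (\<lambda>_. 1) [0..<n]"
      unfolding diag_mat_def using ent up Tc by (auto simp del: index_mult_mat(1))
    finally have "det ?i * det (s0 g) = 1"
      using det_mult[OF GL_carrier[OF gl_inv_GL[OF g0(1)]] s0c] by (simp add: map_replicate_const)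
    then show ?thesis using s0c by (auto simp: GL_iff)
  qed
  have s0flag: "std_flag as n (s0 g) = std_flag as n g" if g: "g \<in> ?Z" for g
  proof (rule std_flag_eqI[OF _ s0GL[OF g] as(2)])
    show gG: "g \<in> carrier (GL n)" using g by simp
    fix a assume a: "a \<in> set as"
    have an: "a \<le> n" using as(2) a by simp
    have "\<exists>D \<in> carrier_mat a a. s0 g * rect n a = (g * rect n a) * D"
    proof (rule colsp_leD)
      fix c assume c: "c < a"
      then have cn: "c < n" using an by simp
      have ua: "up c \<le> a" using up_le a c by (auto simp: S_def)
      have M: "M (up c) g \<in> carrier (GL (up c))" using g up[OF cn] by auto
      have "col (s0 g * rect n a) c = col (s0 g) c"
        using c cn s0GL[OF g]
        by (intro eq_vecI) (auto simp: mult_rect_index[OF GL_carrier[OF s0GL[OF g]]] simp del: index_mult_mat(1))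
      also have "\<dots> = col (col' c g) c"
        using cn colc[OF g cn] up[OF cn] by (intro eq_vecI) (auto simp: s0_def)
      also have "\<dots> \<in> colsp (col' c g)" using colc[OF g cn] up[OF cn] by (intro col_in_colsp) auto
      also have "col' c g = (g * rect n a) * (rect a (up c) * gl_inv (up c) (M (up c) g))"
        unfolding col'_def using M gG ua by (simp add: mat_assoc)
      also have "colsp \<dots> \<subseteq> colsp (g * rect n a)" by (rule colsp_mult) simp
      finally show "col (s0 g * rect n a) c \<in> colsp (g * rect n a)" .
    qed (use gG s0GL[OF g] in auto)
    then obtain D where "D \<in> carrier_mat a a" "s0 g * rect n a = (g * rect n a) * D" ..
    then show "colsp (s0 g * rect n a) \<subseteq> colsp (g * rect n a)"
      using colsp_mult[of "g * rect n a" D] by simp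
  qed
  have s0reg: "regular_mat (fs_open_sub (GL_space n) ?Z) n n s0"
  proof -
    let ?X = "fs_open_sub (GL_space n) ?Z"
    interpret X: space_with_functions ?X
      by (rule space_with_functions_open_sub[OF space_with_functions_GL_space oW0])
    have pX: "points ?X = ?Z" by (rule points_open_sub_open[OF oW0])
    note res = regular_mat_open_sub[OF space_with_functions_GL_space oW0]
    show ?thesis
      unfolding s0_def
    proof (rule X.regular_mat_cols, intro conjI)
      fix c assume c: "c < n"
      show "regular_mat ?X n (up c) (col' c)"
        unfolding col'_def
        by (rule X.regular_mat_mult[OF res[OF regular_mat_GL_space] X.regular_mat_mult[OF
              X.regular_mat_const X.regular_gl_inv[OF res[OF Mreg]]]]) (use up[OF c] in \<open>auto simp: pX\<close>)
      show "c < up c" using up[OF c] by simp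
    qed
  qed
  have sreg: "regular_mat (fs_open_sub (flag_variety as n) ?W) n n s"
    unfolding flag_variety_def
  proof (rule regular_mat_coinduced[OF space_with_functions_GL_space std_flag_image[OF as]])
    show "openin (topo (fs_coinduced (GL_space n) (flags as n) (std_flag as n))) ?W"
      using oW by (simp add: flag_variety_def)
    interpret X: space_with_functions "fs_open_sub (GL_space n) ?Z"
      by (rule space_with_functions_open_sub[OF space_with_functions_GL_space oW0])
    show "regular_mat (fs_open_sub (GL_space n) {g \<in> points (GL_space n). std_flag as n g \<in> ?W}) n n
        (\<lambda>g. s (std_flag as n g))"
      unfolding pre by (rule X.regular_mat_cong[OF s0reg]) (use s points_open_sub_open[OF oW0] in auto)
  qed
  have "\<forall>V\<in>?W. s V \<in> carrier (GL n) \<and> std_flag as n (s V) = V"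
    using s s0GL s0flag by auto
  with oW V0W sreg show ?thesis by blast
qed

section \<open>The gauge action\<close>

lemma mat_conj_index:
  fixes A B X :: "complex mat"
  assumes "A \<in> carrier_mat n m" "X \<in> carrier_mat m p" "B \<in> carrier_mat p q" "r < n" "c < q"
  shows "(A * X * B) $$ (r, c) = (\<Sum>b<p. \<Sum>a<m. A $$ (r, a) * B $$ (b, c) * X $$ (a, b))"
proof -
  have "(A * X * B) $$ (r, c) = (\<Sum>b<p. (\<Sum>a<m. A $$ (r, a) * X $$ (a, b)) * B $$ (b, c))"
    unfolding mat_mult_index[OF mult_carrier_mat[OF assms(1,2)] assms(3,4,5)]
    by (intro sum.cong refl arg_cong2[where f = "(*)"]) (use assms in \<open>simp add: mat_mult_index del: index_mult_mat(1)\<close>)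
  then show ?thesis by (simp add: sum_distrib_left sum_distrib_right ac_simps)
qed

lemma GL_mult_zero_vec [simp]: "g \<in> carrier (GL n) \<Longrightarrow> g *\<^sub>v 0\<^sub>v n = 0\<^sub>v n"
  by (intro eq_vecI) (auto simp: scalar_prod_def)

lemma is_subspace_vimage:
  assumes "is_subspace m W" "M \<in> carrier_mat n m'" "m = n"
  shows "is_subspace m' {x \<in> carrier_vec m'. M *\<^sub>v x \<in> W}"
proof -
  have "M *\<^sub>v 0\<^sub>v m' = 0\<^sub>v n" using assms(2) by auto
  then show ?thesis
    using assms unfolding is_subspace_iff
    by (auto simp: mult_add_distrib_mat_vec[OF assms(2)] mult_mat_vec[OF assms(2)])
qed

text \<open>
  Gauge transformations without extensionality, so that they can be given by arbitrary functions.
\<close>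

definition gauge_family :: "('v, 'e) pre_digraph \<Rightarrow> nat \<Rightarrow> (nat \<Rightarrow> 'v \<Rightarrow> nat) \<Rightarrow> (nat \<times> 'v \<Rightarrow> complex mat) \<Rightarrow> bool"
  where "gauge_family Q l d h \<longleftrightarrow> (\<forall>m\<le>l. \<forall>v\<in>verts Q. h (m, v) \<in> carrier (GL (d m v)))"

lemma gauge_familyD: "gauge_family Q l d h \<Longrightarrow> m \<le> l \<Longrightarrow> v \<in> verts Q \<Longrightarrow> h (m, v) \<in> carrier (GL (d m v))"
  by (simp add: gauge_family_def)

lemma framed_repsD:
  assumes "R \<in> framed_reps Q d f"
  shows "e \<in> arcs Q \<Longrightarrow> repA R e \<in> carrier_mat (d (head Q e)) (d (tail Q e))"
    and "e \<in> arcs Q \<Longrightarrow> repB R e \<in> carrier_mat (d (tail Q e)) (d (head Q e))"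
    and "v \<in> verts Q \<Longrightarrow> repI R v \<in> carrier_mat (d v) (f v)"
    and "v \<in> verts Q \<Longrightarrow> repJ R v \<in> carrier_mat (f v) (d v)"
  using assms by (auto simp: framed_reps_def PiE_iff)

lemma framed_reps_dim [simp]:
  assumes "R \<in> framed_reps Q d f"
  shows "e \<in> arcs Q \<Longrightarrow> dim_row (repA R e) = d (head Q e)" "e \<in> arcs Q \<Longrightarrow> dim_col (repA R e) = d (tail Q e)"
    "e \<in> arcs Q \<Longrightarrow> dim_row (repB R e) = d (tail Q e)" "e \<in> arcs Q \<Longrightarrow> dim_col (repB R e) = d (head Q e)"
    "v \<in> verts Q \<Longrightarrow> dim_row (repI R v) = d v" "v \<in> verts Q \<Longrightarrow> dim_col (repI R v) = f v"
    "v \<in> verts Q \<Longrightarrow> dim_row (repJ R v) = f v" "v \<in> verts Q \<Longrightarrow> dim_col (repJ R v) = d v"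
  by (blast dest: framed_repsD(1)[OF assms] framed_repsD(2)[OF assms] framed_repsD(3)[OF assms]
      framed_repsD(4)[OF assms] carrier_matD)+

lemma framed_repsI:
  assumes "repA R \<in> extensional (arcs Q)" "repB R \<in> extensional (arcs Q)"
    "repI R \<in> extensional (verts Q)" "repJ R \<in> extensional (verts Q)"
    and "\<And>e. e \<in> arcs Q \<Longrightarrow> repA R e \<in> carrier_mat (d (head Q e)) (d (tail Q e))"
    and "\<And>e. e \<in> arcs Q \<Longrightarrow> repB R e \<in> carrier_mat (d (tail Q e)) (d (head Q e))"
    and "\<And>v. v \<in> verts Q \<Longrightarrow> repI R v \<in> carrier_mat (d v) (f v)"
    and "\<And>v. v \<in> verts Q \<Longrightarrow> repJ R v \<in> carrier_mat (f v) (d v)"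
  shows "R \<in> framed_reps Q d f"
  using assms by (auto simp: framed_reps_def PiE_iff)

lemma framed_reps_eqI:
  assumes "R \<in> framed_reps Q d f" "S \<in> framed_reps Q d f"
    and "\<And>e. e \<in> arcs Q \<Longrightarrow> repA R e = repA S e" "\<And>e. e \<in> arcs Q \<Longrightarrow> repB R e = repB S e"
    "\<And>v. v \<in> verts Q \<Longrightarrow> repI R v = repI S v" "\<And>v. v \<in> verts Q \<Longrightarrow> repJ R v = repJ S v"
  shows "R = S"
proof -
  have "repA R = repA S" "repB R = repB S" "repI R = repI S" "repJ R = repJ S"
    using assms(1,2) unfolding framed_reps_def PiE_iff
    by (blast intro: extensionalityI assms(3-6))+
  then show ?thesis by simp
qed

lemma stableD:
  assumes "stable Q d f R" "v \<in> verts Q"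
    and "\<And>v. v \<in> verts Q \<Longrightarrow> is_subspace (d v) (W v)"
    and "\<And>v x. v \<in> verts Q \<Longrightarrow> x \<in> carrier_vec (f v) \<Longrightarrow> repI R v *\<^sub>v x \<in> W v"
    and "\<And>e x. e \<in> arcs Q \<Longrightarrow> x \<in> W (tail Q e) \<Longrightarrow> repA R e *\<^sub>v x \<in> W (head Q e)"
    and "\<And>e x. e \<in> arcs Q \<Longrightarrow> x \<in> W (head Q e) \<Longrightarrow> repB R e *\<^sub>v x \<in> W (tail Q e)"
  shows "W v = carrier_vec (d v)"
  using assms(1)[unfolded stable_def, THEN spec[of _ W]] assms(2-) by blast

context fin_digraph
begin

lemma rep_act_simps [simp]:
  "e \<in> arcs G \<Longrightarrow> repA (rep_act G d g R) e = g (head G e) * repA R e * gl_inv (d (tail G e)) (g (tail G e))"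
  "e \<in> arcs G \<Longrightarrow> repB (rep_act G d g R) e = g (tail G e) * repB R e * gl_inv (d (head G e)) (g (head G e))"
  "v \<in> verts G \<Longrightarrow> repI (rep_act G d g R) v = g v * repI R v"
  "v \<in> verts G \<Longrightarrow> repJ (rep_act G d g R) v = repJ R v * gl_inv (d v) (g v)"
  by (auto simp: rep_act_def)

lemma rep_act_framed:
  assumes "\<And>v. v \<in> verts G \<Longrightarrow> g v \<in> carrier (GL (d v))" "R \<in> framed_reps G d f"
  shows "rep_act G d g R \<in> framed_reps G d f"
proof (rule framed_repsI)
  fix e assume e: "e \<in> arcs G"
  then have g: "g (head G e) \<in> carrier (GL (d (head G e)))" "g (tail G e) \<in> carrier (GL (d (tail G e)))"
    using assms(1) by auto
  show "repA (rep_act G d g R) e \<in> carrier_mat (d (head G e)) (d (tail G e))"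
    "repB (rep_act G d g R) e \<in> carrier_mat (d (tail G e)) (d (head G e))"
    using g e assms(2) by auto
next
  fix v assume v: "v \<in> verts G"
  show "repI (rep_act G d g R) v \<in> carrier_mat (d v) (f v)" "repJ (rep_act G d g R) v \<in> carrier_mat (f v) (d v)"
    using assms(1)[OF v] v assms(2) by auto
qed (auto simp: rep_act_def)

lemma rep_act_mult:
  assumes "\<And>v. v \<in> verts G \<Longrightarrow> g v \<in> carrier (GL (d v))" "\<And>v. v \<in> verts G \<Longrightarrow> h v \<in> carrier (GL (d v))"
    "R \<in> framed_reps G d f"
  shows "rep_act G d (\<lambda>v. g v * h v) R = rep_act G d g (rep_act G d h R)"
proof (rule framed_reps_eqI)
  show "rep_act G d (\<lambda>v. g v * h v) R \<in> framed_reps G d f"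
    "rep_act G d g (rep_act G d h R) \<in> framed_reps G d f"
    using assms by (auto intro!: rep_act_framed)
  fix e assume e: "e \<in> arcs G"
  note gh = assms(1)[OF head_in_verts[OF e]] assms(1)[OF tail_in_verts[OF e]]
    assms(2)[OF head_in_verts[OF e]] assms(2)[OF tail_in_verts[OF e]]
  show "repA (rep_act G d (\<lambda>v. g v * h v) R) e = repA (rep_act G d g (rep_act G d h R)) e"
    "repB (rep_act G d (\<lambda>v. g v * h v) R) e = repB (rep_act G d g (rep_act G d h R)) e"
    using gh e assms(3) by (simp_all add: gl_inv_mult mat_assoc)
next
  fix v assume v: "v \<in> verts G"
  show "repI (rep_act G d (\<lambda>v. g v * h v) R) v = repI (rep_act G d g (rep_act G d h R)) v"
    "repJ (rep_act G d (\<lambda>v. g v * h v) R) v = repJ (rep_act G d g (rep_act G d h R)) v"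
    using assms(1,2)[OF v] v assms(3) by (simp_all add: gl_inv_mult mat_assoc)
qed

lemma rep_act_one:
  assumes "\<And>v. v \<in> verts G \<Longrightarrow> g v = 1\<^sub>m (d v)" "R \<in> framed_reps G d f"
  shows "rep_act G d g R = R"
proof (rule framed_reps_eqI)
  show "rep_act G d g R \<in> framed_reps G d f"
    using assms by (intro rep_act_framed) auto
  fix e assume e: "e \<in> arcs G"
  show "repA (rep_act G d g R) e = repA R e" "repB (rep_act G d g R) e = repB R e"
    using assms e framed_repsD[OF assms(2)] by auto
next
  fix v assume v: "v \<in> verts G"
  show "repI (rep_act G d g R) v = repI R v" "repJ (rep_act G d g R) v = repJ R v"
    using assms v framed_repsD[OF assms(2)] by auto
qed (use assms in auto)

lemma stable_rep_act:
  assumes g: "\<And>v. v \<in> verts G \<Longrightarrow> g v \<in> carrier (GL (d v))" and R: "R \<in> framed_reps G d f"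
    and st: "stable G d f R"
  shows "stable G d f (rep_act G d g R)"
  unfolding stable_def
proof (intro allI impI ballI)
  fix W v
  assume W: "(\<forall>v\<in>verts G. is_subspace (d v) (W v) \<and>
        (\<forall>x\<in>carrier_vec (f v). repI (rep_act G d g R) v *\<^sub>v x \<in> W v)) \<and>
     (\<forall>e\<in>arcs G. (\<forall>x\<in>W (tail G e). repA (rep_act G d g R) e *\<^sub>v x \<in> W (head G e)) \<and>
        (\<forall>x\<in>W (head G e). repB (rep_act G d g R) e *\<^sub>v x \<in> W (tail G e)))"
    and v: "v \<in> verts G"
  let ?W = "\<lambda>v. {x \<in> carrier_vec (d v). g v *\<^sub>v x \<in> W v}"
  have inv: "gl_inv (d v) (g v) *\<^sub>v (g v *\<^sub>v x) = x" if "v \<in> verts G" "x \<in> carrier_vec (d v)" for v x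
    using g[OF that(1)] that(2) by (subst mat_vec_assoc[symmetric]) auto
  have full: "?W v = carrier_vec (d v)"
  proof (rule stableD[OF st v, of ?W])
    fix v assume v: "v \<in> verts G"
    show "is_subspace (d v) (?W v)"
      using W v g[OF v] by (intro is_subspace_vimage[where m = "d v" and n = "d v"]) auto
    fix x :: "complex vec" assume x: "x \<in> carrier_vec (f v)"
    then have "g v *\<^sub>v (repI R v *\<^sub>v x) = repI (rep_act G d g R) v *\<^sub>v x"
      using v R g[OF v] by (simp add: mat_vec_assoc)
    then show "repI R v *\<^sub>v x \<in> ?W v"
      using W v x R by (auto intro!: carrier_vecI)
  next
    fix e x assume e: "e \<in> arcs G" and x: "x \<in> ?W (tail G e)"
    note gg = g[OF head_in_verts[OF e]] g[OF tail_in_verts[OF e]]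
    have "repA (rep_act G d g R) e *\<^sub>v (g (tail G e) *\<^sub>v x) = g (head G e) *\<^sub>v (repA R e *\<^sub>v x)"
    proof -
      have xc: "x \<in> carrier_vec (d (tail G e))" "dim_vec x = d (tail G e)" using x by auto
      show ?thesis
        using e R gg inv[OF tail_in_verts[OF e] xc(1)] xc by (simp add: mat_vec_assoc)
    qed
    then show "repA R e *\<^sub>v x \<in> ?W (head G e)"
      using W e x R by (auto intro!: carrier_vecI) metis
  next
    fix e x assume e: "e \<in> arcs G" and x: "x \<in> ?W (head G e)"
    note gg = g[OF head_in_verts[OF e]] g[OF tail_in_verts[OF e]]
    have "repB (rep_act G d g R) e *\<^sub>v (g (head G e) *\<^sub>v x) = g (tail G e) *\<^sub>v (repB R e *\<^sub>v x)"
    proof -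
      have xc: "x \<in> carrier_vec (d (head G e))" "dim_vec x = d (head G e)" using x by auto
      show ?thesis
        using e R gg inv[OF head_in_verts[OF e] xc(1)] xc by (simp add: mat_vec_assoc)
    qed
    then show "repB R e *\<^sub>v x \<in> ?W (tail G e)"
      using W e x R by (auto intro!: carrier_vecI) metis
  qed
  have sub: "W v \<subseteq> carrier_vec (d v)" using W v by (auto simp: is_subspace_iff)
  have "y \<in> W v" if y: "y \<in> carrier_vec (d v)" for y
  proof -
    have "gl_inv (d v) (g v) *\<^sub>v y \<in> ?W v"
      unfolding full using g[OF v] y by (auto intro!: carrier_vecI)
    then have "g v *\<^sub>v (gl_inv (d v) (g v) *\<^sub>v y) \<in> W v" by simp
    moreover have "g v *\<^sub>v (gl_inv (d v) (g v) *\<^sub>v y) = y"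
      using g[OF v] y by (subst mat_vec_assoc[symmetric]) auto
    ultimately show ?thesis by simp
  qed
  then show "W v = carrier_vec (d v)" using sub by blast
qed

text \<open>
  The entries of \<open>P * Z * P'\<close> are linear in \<open>Z\<close>, so the moment map equations survive multiplication from
  both sides. Gauge transformations and truncations to the first coordinates are both of this form.
\<close>

lemma moment_map_conj:
  assumes R: "R \<in> framed_reps G d f" "moment_map_eqs G d R" and v: "v \<in> verts G"
    and P: "P \<in> carrier_mat n (d v)" and P': "P' \<in> carrier_mat (d v) n" and rc: "r < n" "c < n"
  shows "(\<Sum>e | e \<in> arcs G \<and> head G e = v. (P * (repA R e * repB R e) * P') $$ (r, c))
     - (\<Sum>e | e \<in> arcs G \<and> tail G e = v. (P * (repB R e * repA R e) * P') $$ (r, c))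
     + (P * (repI R v * repJ R v) * P') $$ (r, c) = 0"
proof -
  note car = framed_repsD[OF R(1)]
  let ?w = "\<lambda>a b. P $$ (r, a) * P' $$ (b, c)"
  have ent: "(P * X * P') $$ (r, c) = (\<Sum>b<d v. \<Sum>a<d v. ?w a b * X $$ (a, b))" if "X \<in> carrier_mat (d v) (d v)" for X
    using mat_conj_index[OF P that P' rc] .
  have 1: "(\<Sum>e | e \<in> arcs G \<and> head G e = v. (P * (repA R e * repB R e) * P') $$ (r, c)) =
     (\<Sum>b<d v. \<Sum>a<d v. ?w a b * (\<Sum>e | e \<in> arcs G \<and> head G e = v. (repA R e * repB R e) $$ (a, b)))"
  proof -
    have "(\<Sum>e | e \<in> arcs G \<and> head G e = v. (P * (repA R e * repB R e) * P') $$ (r, c)) =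
      (\<Sum>e | e \<in> arcs G \<and> head G e = v. \<Sum>b<d v. \<Sum>a<d v. ?w a b * (repA R e * repB R e) $$ (a, b))"
      by (intro sum.cong refl ent) (auto intro!: mult_carrier_mat[OF car(1,2)])
    then show ?thesis
      by (simp only: sum_distrib_left) (subst sum.swap, rule sum.cong[OF refl], rule sum.swap)
  qed
  have 2: "(\<Sum>e | e \<in> arcs G \<and> tail G e = v. (P * (repB R e * repA R e) * P') $$ (r, c)) =
     (\<Sum>b<d v. \<Sum>a<d v. ?w a b * (\<Sum>e | e \<in> arcs G \<and> tail G e = v. (repB R e * repA R e) $$ (a, b)))"
  proof -
    have "(\<Sum>e | e \<in> arcs G \<and> tail G e = v. (P * (repB R e * repA R e) * P') $$ (r, c)) =
      (\<Sum>e | e \<in> arcs G \<and> tail G e = v. \<Sum>b<d v. \<Sum>a<d v. ?w a b * (repB R e * repA R e) $$ (a, b))"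
      by (intro sum.cong refl ent) (auto intro!: mult_carrier_mat[OF car(2,1)])
    then show ?thesis
      by (simp only: sum_distrib_left) (subst sum.swap, rule sum.cong[OF refl], rule sum.swap)
  qed
  have 3: "(P * (repI R v * repJ R v) * P') $$ (r, c) =
     (\<Sum>b<d v. \<Sum>a<d v. ?w a b * (repI R v * repJ R v) $$ (a, b))"
    by (rule ent[OF mult_carrier_mat[OF car(3,4)]]) (use v in auto)
  have "(\<Sum>b<d v. \<Sum>a<d v. ?w a b * ((\<Sum>e | e \<in> arcs G \<and> head G e = v. (repA R e * repB R e) $$ (a, b))
      - (\<Sum>e | e \<in> arcs G \<and> tail G e = v. (repB R e * repA R e) $$ (a, b))
      + (repI R v * repJ R v) $$ (a, b))) = 0"
  proof (intro sum.neutral ballI)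
    fix a b assume "b \<in> {..<d v}" "a \<in> {..<d v}"
    then have "(\<Sum>e | e \<in> arcs G \<and> head G e = v. (repA R e * repB R e) $$ (a, b))
      - (\<Sum>e | e \<in> arcs G \<and> tail G e = v. (repB R e * repA R e) $$ (a, b))
      + (repI R v * repJ R v) $$ (a, b) = 0"
      using R(2) v unfolding moment_map_eqs_def by blast
    then show "?w a b * ((\<Sum>e | e \<in> arcs G \<and> head G e = v. (repA R e * repB R e) $$ (a, b))
      - (\<Sum>e | e \<in> arcs G \<and> tail G e = v. (repB R e * repA R e) $$ (a, b))
      + (repI R v * repJ R v) $$ (a, b)) = 0" by (simp only: mult_zero_right)
  qed
  then show ?thesis
    unfolding 1 2 3 by (simp only: distrib_left right_diff_distrib sum.distrib sum_subtractf)
qed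

lemma moment_map_rep_act:
  assumes g: "\<And>v. v \<in> verts G \<Longrightarrow> g v \<in> carrier (GL (d v))" and R: "R \<in> framed_reps G d f"
    and mm: "moment_map_eqs G d R"
  shows "moment_map_eqs G d (rep_act G d g R)"
  unfolding moment_map_eqs_def
proof (intro ballI allI impI)
  fix v r c assume v: "v \<in> verts G" and rc: "r < d v" "c < d v"
  let ?g = "g v" and ?i = "gl_inv (d v) (g v)"
  have A: "repA (rep_act G d g R) e * repB (rep_act G d g R) e = ?g * (repA R e * repB R e) * ?i"
    if "e \<in> arcs G \<and> head G e = v" for e
    using that R g[OF head_in_verts[of e]] g[OF tail_in_verts[of e]] by (auto simp: mat_assoc)
  have B: "repB (rep_act G d g R) e * repA (rep_act G d g R) e = ?g * (repB R e * repA R e) * ?i"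
    if "e \<in> arcs G \<and> tail G e = v" for e
    using that R g[OF head_in_verts[of e]] g[OF tail_in_verts[of e]] by (auto simp: mat_assoc)
  have I: "repI (rep_act G d g R) v * repJ (rep_act G d g R) v = ?g * (repI R v * repJ R v) * ?i"
    using R v g[OF v] by (auto simp: mat_assoc)
  have "(\<Sum>e | e \<in> arcs G \<and> head G e = v. (repA (rep_act G d g R) e * repB (rep_act G d g R) e) $$ (r, c)) =
      (\<Sum>e | e \<in> arcs G \<and> head G e = v. (?g * (repA R e * repB R e) * ?i) $$ (r, c))"
    by (intro sum.cong refl arg_cong[where f = "\<lambda>M. M $$ (r, c)"]) (use A in blast)
  moreover have "(\<Sum>e | e \<in> arcs G \<and> tail G e = v. (repB (rep_act G d g R) e * repA (rep_act G d g R) e) $$ (r, c)) =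
      (\<Sum>e | e \<in> arcs G \<and> tail G e = v. (?g * (repB R e * repA R e) * ?i) $$ (r, c))"
    by (intro sum.cong refl arg_cong[where f = "\<lambda>M. M $$ (r, c)"]) (use B in blast)
  ultimately show "(\<Sum>e | e \<in> arcs G \<and> head G e = v. (repA (rep_act G d g R) e * repB (rep_act G d g R) e) $$ (r, c))
     - (\<Sum>e | e \<in> arcs G \<and> tail G e = v. (repB (rep_act G d g R) e * repA (rep_act G d g R) e) $$ (r, c))
     + (repI (rep_act G d g R) v * repJ (rep_act G d g R) v) $$ (r, c) = 0"
    unfolding I using moment_map_conj[OF R mm v _ _ rc, of ?g ?i] g[OF v] by (simp only:) blast
qed

end

subsection \<open>Points of the parabolic space\<close>

locale dim_chain = fin_digraph Q for Q :: "('v, 'e) pre_digraph" +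
  fixes l :: nat and d :: "nat \<Rightarrow> 'v \<Rightarrow> nat" and f :: "'v \<Rightarrow> nat"
  assumes d_step: "m < l \<Longrightarrow> v \<in> verts Q \<Longrightarrow> d (Suc m) v \<le> d m v"
begin

lemma d_mono: "m \<le> m' \<Longrightarrow> m' \<le> l \<Longrightarrow> v \<in> verts Q \<Longrightarrow> d m' v \<le> d m v"
proof (induction m' rule: dec_induct)
  case (step i)
  then show ?case using d_step[of i v] by simp
qed simp

definition link_eqs :: "('v, 'e) chain_rep \<Rightarrow> nat \<Rightarrow> bool" where
  "link_eqs x m \<longleftrightarrow>
     (\<forall>e \<in> arcs Q. link x m (head Q e) * repA (stage x m) e = repA (stage x (Suc m)) e * link x m (tail Q e) \<and>
       link x m (tail Q e) * repB (stage x m) e = repB (stage x (Suc m)) e * link x m (head Q e)) \<and>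
     (\<forall>v \<in> verts Q. link x m v * repI (stage x m) v = repI (stage x (Suc m)) v \<and>
       repJ (stage x (Suc m)) v * link x m v = repJ (stage x m) v)"

definition kills :: "('v, 'e) framed_rep \<Rightarrow> 'v \<Rightarrow> complex vec \<Rightarrow> bool" where
  "kills R v k \<longleftrightarrow> (\<forall>e \<in> arcs Q. tail Q e = v \<longrightarrow> repA R e *\<^sub>v k = 0\<^sub>v (d 0 (head Q e))) \<and>
     (\<forall>e \<in> arcs Q. head Q e = v \<longrightarrow> repB R e *\<^sub>v k = 0\<^sub>v (d 0 (tail Q e))) \<and> repJ R v *\<^sub>v k = 0\<^sub>v (f v)"

abbreviation "X \<equiv> parabolic_points Q l d f"

lemma parabolic_points_iff:
  "x \<in> X \<longleftrightarrow>
     stage x \<in> extensional {..l} \<and> link x \<in> extensional {..<l} \<and> (\<forall>m<l. link x m \<in> extensional (verts Q)) \<and>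
     (\<forall>m\<le>l. stage x m \<in> framed_reps Q (d m) f \<and> stable Q (d m) f (stage x m) \<and> moment_map_eqs Q (d m) (stage x m)) \<and>
     (\<forall>m<l. (\<forall>v\<in>verts Q. link x m v \<in> carrier_mat (d (Suc m) v) (d m v)) \<and> link_eqs x m) \<and>
     (\<forall>v\<in>verts Q. \<forall>k \<in> mat_kernel (link_comp d x l v). kills (stage x 0) v k)"
  unfolding parabolic_points_def link_eqs_def kills_def by (auto simp: PiE_iff)

lemma parabolic_pointsD:
  assumes "x \<in> X"
  shows "stage x \<in> extensional {..l}" "link x \<in> extensional {..<l}"
    "m < l \<Longrightarrow> link x m \<in> extensional (verts Q)"
    "m \<le> l \<Longrightarrow> stage x m \<in> framed_reps Q (d m) f" "m \<le> l \<Longrightarrow> stable Q (d m) f (stage x m)"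
    "m \<le> l \<Longrightarrow> moment_map_eqs Q (d m) (stage x m)"
    "m < l \<Longrightarrow> v \<in> verts Q \<Longrightarrow> link x m v \<in> carrier_mat (d (Suc m) v) (d m v)"
    "m < l \<Longrightarrow> link_eqs x m"
    "v \<in> verts Q \<Longrightarrow> k \<in> mat_kernel (link_comp d x l v) \<Longrightarrow> kills (stage x 0) v k"
  using assms unfolding parabolic_points_iff by blast+

lemma link_comp_carrier:
  assumes "x \<in> X" "m \<le> l" "v \<in> verts Q"
  shows "link_comp d x m v \<in> carrier_mat (d m v) (d 0 v)"
  using assms(2)
proof (induction m)
  case (Suc m)
  then show ?case using parabolic_pointsD(7)[OF assms(1) _ assms(3), of m] by auto
qed simp

lemma link_comp_dim [simp]:
  assumes "x \<in> X" "m \<le> l" "v \<in> verts Q"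
  shows "dim_row (link_comp d x m v) = d m v" "dim_col (link_comp d x m v) = d 0 v"
  using link_comp_carrier[OF assms] by auto

lemma link_dim [simp]:
  assumes "x \<in> X" "m < l" "v \<in> verts Q"
  shows "dim_row (link x m v) = d (Suc m) v" "dim_col (link x m v) = d m v"
  using parabolic_pointsD(7)[OF assms] by auto

lemma stage_dim [simp]:
  assumes "x \<in> X" "m \<le> l"
  shows "e \<in> arcs Q \<Longrightarrow> dim_row (repA (stage x m) e) = d m (head Q e)"
    "e \<in> arcs Q \<Longrightarrow> dim_col (repA (stage x m) e) = d m (tail Q e)"
    "e \<in> arcs Q \<Longrightarrow> dim_row (repB (stage x m) e) = d m (tail Q e)"
    "e \<in> arcs Q \<Longrightarrow> dim_col (repB (stage x m) e) = d m (head Q e)"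
    "v \<in> verts Q \<Longrightarrow> dim_row (repI (stage x m) v) = d m v"
    "v \<in> verts Q \<Longrightarrow> dim_col (repI (stage x m) v) = f v"
    "v \<in> verts Q \<Longrightarrow> dim_row (repJ (stage x m) v) = f v"
    "v \<in> verts Q \<Longrightarrow> dim_col (repJ (stage x m) v) = d m v"
  using parabolic_pointsD(4)[OF assms] by simp_all

lemma link_comp_eqs:
  assumes x: "x \<in> X" and "m \<le> l"
  shows "e \<in> arcs Q \<Longrightarrow> link_comp d x m (head Q e) * repA (stage x 0) e = repA (stage x m) e * link_comp d x m (tail Q e)"
    and "e \<in> arcs Q \<Longrightarrow> link_comp d x m (tail Q e) * repB (stage x 0) e = repB (stage x m) e * link_comp d x m (head Q e)"
    and "v \<in> verts Q \<Longrightarrow> link_comp d x m v * repI (stage x 0) v = repI (stage x m) v"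
    and "v \<in> verts Q \<Longrightarrow> repJ (stage x m) v * link_comp d x m v = repJ (stage x 0) v"
proof -
  have "(\<forall>e\<in>arcs Q. link_comp d x m (head Q e) * repA (stage x 0) e = repA (stage x m) e * link_comp d x m (tail Q e) \<and>
      link_comp d x m (tail Q e) * repB (stage x 0) e = repB (stage x m) e * link_comp d x m (head Q e)) \<and>
    (\<forall>v\<in>verts Q. link_comp d x m v * repI (stage x 0) v = repI (stage x m) v \<and>
      repJ (stage x m) v * link_comp d x m v = repJ (stage x 0) v)"
    using assms(2)
  proof (induction m)
    case 0
    note R = framed_repsD[OF parabolic_pointsD(4)[OF x, of 0]]
    show ?case
      by (simp add: left_mult_one_mat[OF R(1)] right_mult_one_mat[OF R(1)] left_mult_one_mat[OF R(2)]
          right_mult_one_mat[OF R(2)] left_mult_one_mat[OF R(3)] right_mult_one_mat[OF R(4)])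
  next
    case (Suc m)
    then have m: "m < l" "m \<le> l" by auto
    note eqs = parabolic_pointsD(8)[OF x m(1), unfolded link_eqs_def]
    show ?case
    proof (intro conjI ballI)
      fix e assume e: "e \<in> arcs Q"
      have "link_comp d x (Suc m) (head Q e) * repA (stage x 0) e
          = link x m (head Q e) * (link_comp d x m (head Q e) * repA (stage x 0) e)"
        using x e m by (simp add: mat_assoc)
      also have "\<dots> = (link x m (head Q e) * repA (stage x m) e) * link_comp d x m (tail Q e)"
        using x e m Suc by (simp add: mat_assoc)
      also have "\<dots> = repA (stage x (Suc m)) e * link_comp d x (Suc m) (tail Q e)"
        using x e m eqs Suc.prems by (simp add: mat_assoc)
      finally show "link_comp d x (Suc m) (head Q e) * repA (stage x 0) e
          = repA (stage x (Suc m)) e * link_comp d x (Suc m) (tail Q e)" .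
      have "link_comp d x (Suc m) (tail Q e) * repB (stage x 0) e
          = link x m (tail Q e) * (link_comp d x m (tail Q e) * repB (stage x 0) e)"
        using x e m by (simp add: mat_assoc)
      also have "\<dots> = (link x m (tail Q e) * repB (stage x m) e) * link_comp d x m (head Q e)"
        using x e m Suc by (simp add: mat_assoc)
      also have "\<dots> = repB (stage x (Suc m)) e * link_comp d x (Suc m) (head Q e)"
        using x e m eqs Suc.prems by (simp add: mat_assoc)
      finally show "link_comp d x (Suc m) (tail Q e) * repB (stage x 0) e
          = repB (stage x (Suc m)) e * link_comp d x (Suc m) (head Q e)" .
    next
      fix v assume v: "v \<in> verts Q"
      have "link_comp d x (Suc m) v * repI (stage x 0) v = link x m v * (link_comp d x m v * repI (stage x 0) v)"
        using x v m by (simp add: mat_assoc)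
      then show "link_comp d x (Suc m) v * repI (stage x 0) v = repI (stage x (Suc m)) v"
        using v m eqs Suc by simp
      have "repJ (stage x (Suc m)) v * link_comp d x (Suc m) v = (repJ (stage x (Suc m)) v * link x m v) * link_comp d x m v"
        using x v m Suc.prems by (simp add: mat_assoc)
      then show "repJ (stage x (Suc m)) v * link_comp d x (Suc m) v = repJ (stage x 0) v"
        using v m eqs Suc by simp
    qed
  qed
  then show "e \<in> arcs Q \<Longrightarrow> link_comp d x m (head Q e) * repA (stage x 0) e = repA (stage x m) e * link_comp d x m (tail Q e)"
    "e \<in> arcs Q \<Longrightarrow> link_comp d x m (tail Q e) * repB (stage x 0) e = repB (stage x m) e * link_comp d x m (head Q e)"
    "v \<in> verts Q \<Longrightarrow> link_comp d x m v * repI (stage x 0) v = repI (stage x m) v"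
    "v \<in> verts Q \<Longrightarrow> repJ (stage x m) v * link_comp d x m v = repJ (stage x 0) v" by blast+
qed

text \<open>Stability makes all maps between the stages surjective: their images generate.\<close>

lemma link_comp_surj:
  assumes x: "x \<in> X" and m: "m \<le> l" and v: "v \<in> verts Q"
  shows "colsp (link_comp d x m v) = carrier_vec (d m v)"
proof -
  let ?\<pi> = "link_comp d x m"
  show ?thesis
  proof (rule stableD[OF parabolic_pointsD(5)[OF x m] v, of "\<lambda>v. colsp (?\<pi> v)"])
    fix v assume v: "v \<in> verts Q"
    show "is_subspace (d m v) (colsp (?\<pi> v))"
      using is_subspace_colsp[OF link_comp_carrier[OF x m v]] .
    fix u :: "complex vec" assume u: "u \<in> carrier_vec (f v)"
    have "repI (stage x m) v *\<^sub>v u = ?\<pi> v *\<^sub>v (repI (stage x 0) v *\<^sub>v u)"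
      using link_comp_eqs(3)[OF x m v] x m v u by (subst mat_vec_assoc[symmetric]) auto
    then show "repI (stage x m) v *\<^sub>v u \<in> colsp (?\<pi> v)"
      using x m v by (auto intro!: colspI carrier_vecI)
  next
    fix e y assume e: "e \<in> arcs Q" and y: "y \<in> colsp (?\<pi> (tail Q e))"
    then obtain u where u: "u \<in> carrier_vec (d 0 (tail Q e))" "y = ?\<pi> (tail Q e) *\<^sub>v u"
      using x m by (auto simp: colsp_def)
    have "repA (stage x m) e *\<^sub>v y = (repA (stage x m) e * ?\<pi> (tail Q e)) *\<^sub>v u"
      unfolding u(2) using x m e u(1) by (subst mat_vec_assoc[symmetric]) auto
    also have "\<dots> = ?\<pi> (head Q e) *\<^sub>v (repA (stage x 0) e *\<^sub>v u)"
      unfolding link_comp_eqs(1)[OF x m e, symmetric] using x m e u(1) by (subst mat_vec_assoc) auto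
    finally show "repA (stage x m) e *\<^sub>v y \<in> colsp (?\<pi> (head Q e))"
      using x m e by (auto intro!: colspI carrier_vecI)
  next
    fix e y assume e: "e \<in> arcs Q" and y: "y \<in> colsp (?\<pi> (head Q e))"
    then obtain u where u: "u \<in> carrier_vec (d 0 (head Q e))" "y = ?\<pi> (head Q e) *\<^sub>v u"
      using x m by (auto simp: colsp_def)
    have "repB (stage x m) e *\<^sub>v y = (repB (stage x m) e * ?\<pi> (head Q e)) *\<^sub>v u"
      unfolding u(2) using x m e u(1) by (subst mat_vec_assoc[symmetric]) auto
    also have "\<dots> = ?\<pi> (tail Q e) *\<^sub>v (repB (stage x 0) e *\<^sub>v u)"
      unfolding link_comp_eqs(2)[OF x m e, symmetric] using x m e u(1) by (subst mat_vec_assoc) auto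
    finally show "repB (stage x m) e *\<^sub>v y \<in> colsp (?\<pi> (tail Q e))"
      using x m e by (auto intro!: colspI carrier_vecI)
  qed
qed

lemma link_comp_right_inverse:
  assumes x: "x \<in> X" and m: "m \<le> l" and v: "v \<in> verts Q"
  shows "\<exists>S \<in> carrier_mat (d 0 v) (d m v). link_comp d x m v * S = 1\<^sub>m (d m v)"
proof -
  have "colsp (1\<^sub>m (d m v)) \<subseteq> colsp (link_comp d x m v)"
    unfolding link_comp_surj[OF assms] colsp_one by simp
  then show ?thesis
    using colsp_le_iff[of "1\<^sub>m (d m v)" "d m v" "d m v", OF _ link_comp_carrier[OF assms]] by auto
qed

lemma stage_gauge_act: "m \<le> l \<Longrightarrow> stage (gauge_act Q l d h x) m = rep_act Q (d m) (\<lambda>v. h (m, v)) (stage x m)"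
  by (simp add: gauge_act_def)

lemma link_gauge_act:
  "m < l \<Longrightarrow> v \<in> verts Q \<Longrightarrow> link (gauge_act Q l d h x) m v = h (Suc m, v) * link x m v * gl_inv (d m v) (h (m, v))"
  by (simp add: gauge_act_def)

lemma link_comp_gauge_act:
  assumes x: "x \<in> X" and h: "gauge_family Q l d h" and "m \<le> l" and v: "v \<in> verts Q"
  shows "link_comp d (gauge_act Q l d h x) m v = h (m, v) * link_comp d x m v * gl_inv (d 0 v) (h (0, v))"
  using assms(3)
proof (induction m)
  case 0
  then show ?case using gauge_familyD[OF h _ v, of 0] by simp
next
  case (Suc m)
  then have m: "m < l" "m \<le> l" by auto
  show ?case
    using Suc.IH[OF m(2)] m x v gauge_familyD[OF h m(2) v] gauge_familyD[OF h Suc.prems v] gauge_familyD[OF h le0 v]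
    by (simp add: link_gauge_act mat_assoc)
qed

lemma gauge_act_closed:
  assumes x: "x \<in> X" and h: "gauge_family Q l d h"
  shows "gauge_act Q l d h x \<in> X"
  unfolding parabolic_points_iff
proof (intro conjI allI impI ballI)
  let ?y = "gauge_act Q l d h x"
  note hG = gauge_familyD[OF h]
  show "stage ?y \<in> extensional {..l}" "link ?y \<in> extensional {..<l}" by (auto simp: gauge_act_def)
  show "link ?y m \<in> extensional (verts Q)" if "m < l" for m using that by (simp add: gauge_act_def)
  show "stage ?y m \<in> framed_reps Q (d m) f" if "m \<le> l" for m
    unfolding stage_gauge_act[OF that] using hG that parabolic_pointsD(4)[OF x that] by (intro rep_act_framed) auto
  show "stable Q (d m) f (stage ?y m)" if "m \<le> l" for m
    unfolding stage_gauge_act[OF that] using hG that parabolic_pointsD(4,5)[OF x that] by (intro stable_rep_act) auto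
  show "moment_map_eqs Q (d m) (stage ?y m)" if "m \<le> l" for m
    unfolding stage_gauge_act[OF that]
    using hG that parabolic_pointsD(6)[OF x that] by (intro moment_map_rep_act[OF _ parabolic_pointsD(4)[OF x that]]) auto
  show "link ?y m v \<in> carrier_mat (d (Suc m) v) (d m v)" if "m < l" "v \<in> verts Q" for m v
    unfolding link_gauge_act[OF that]
    using that hG[of m v] hG[of "Suc m" v] parabolic_pointsD(7)[OF x that] by (intro carrier_matI) simp_all
  show "link_eqs ?y m" if m: "m < l" for m
  proof -
    have m': "m \<le> l" "Suc m \<le> l" using m by auto
    note eqs = parabolic_pointsD(8)[OF x m, unfolded link_eqs_def]
    have cA: "link x m (head Q e) * (repA (stage x m) e * Z) = repA (stage x (Suc m)) e * (link x m (tail Q e) * Z)"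
      if "e \<in> arcs Q" "dim_row Z = d m (tail Q e)" for e Z
      using eqs that x m m' by (simp add: mat_assoc[symmetric])
    have cB: "link x m (tail Q e) * (repB (stage x m) e * Z) = repB (stage x (Suc m)) e * (link x m (head Q e) * Z)"
      if "e \<in> arcs Q" "dim_row Z = d m (head Q e)" for e Z
      using eqs that x m m' by (simp add: mat_assoc[symmetric])
    have cJ: "repJ (stage x (Suc m)) v * (link x m v * Z) = repJ (stage x m) v * Z"
      if "v \<in> verts Q" "dim_row Z = d m v" for v Z
      using eqs that x m m' by (simp add: mat_assoc[symmetric])
    show ?thesis
      unfolding link_eqs_def
    proof (intro conjI ballI)
      fix e assume e: "e \<in> arcs Q"
      note hh = hG[OF m'(1) head_in_verts[OF e]] hG[OF m'(1) tail_in_verts[OF e]]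
        hG[OF m'(2) head_in_verts[OF e]] hG[OF m'(2) tail_in_verts[OF e]]
      show "link ?y m (head Q e) * repA (stage ?y m) e = repA (stage ?y (Suc m)) e * link ?y m (tail Q e)"
        using hh e x m m' by (simp add: stage_gauge_act link_gauge_act mat_assoc cA)
      show "link ?y m (tail Q e) * repB (stage ?y m) e = repB (stage ?y (Suc m)) e * link ?y m (head Q e)"
        using hh e x m m' by (simp add: stage_gauge_act link_gauge_act mat_assoc cB)
    next
      fix v assume v: "v \<in> verts Q"
      note hh = hG[OF m'(1) v] hG[OF m'(2) v]
      show "link ?y m v * repI (stage ?y m) v = repI (stage ?y (Suc m)) v"
        using hh v x m m' eqs by (simp add: stage_gauge_act link_gauge_act mat_assoc)
      show "repJ (stage ?y (Suc m)) v * link ?y m v = repJ (stage ?y m) v"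
        using hh v x m m' by (simp add: stage_gauge_act link_gauge_act mat_assoc cJ)
    qed
  qed
  fix v k assume v: "v \<in> verts Q" and k: "k \<in> mat_kernel (link_comp d ?y l v)"
  note h0 = hG[OF le0 v] and hl = hG[OF order_refl v]
  let ?i = "gl_inv (d 0 v) (h (0, v))"
  have lc: "link_comp d ?y l v = h (l, v) * (link_comp d x l v * ?i)"
    using link_comp_gauge_act[OF x h order_refl v] x v h0 hl by (simp add: mat_assoc)
  have kc: "k \<in> carrier_vec (d 0 v)" "link_comp d ?y l v *\<^sub>v k = 0\<^sub>v (d l v)"
    using k x v h0 hl unfolding mat_kernel_def lc by auto
  have "link_comp d x l v *\<^sub>v (?i *\<^sub>v k) = (gl_inv (d l v) (h (l, v)) * (h (l, v) * (link_comp d x l v * ?i))) *\<^sub>v k"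
    using kc(1) x v h0 hl by (simp add: mat_vec_assoc)
  also have "\<dots> = gl_inv (d l v) (h (l, v)) *\<^sub>v (link_comp d ?y l v *\<^sub>v k)"
    unfolding lc using kc(1) x v h0 hl by (intro mat_vec_assoc) auto
  also have "\<dots> = 0\<^sub>v (d l v)" unfolding kc(2) using hl by auto
  finally have "?i *\<^sub>v k \<in> mat_kernel (link_comp d x l v)"
    using x v h0 by (auto simp: mat_kernel_def intro!: carrier_vecI)
  then have kill: "kills (stage x 0) v (?i *\<^sub>v k)" by (rule parabolic_pointsD(9)[OF x v])
  show "kills (stage ?y 0) v k"
    unfolding kills_def
  proof (intro conjI ballI impI)
    fix e assume e: "e \<in> arcs Q" "tail Q e = v"
    have "repA (stage ?y 0) e *\<^sub>v k = h (0, head Q e) *\<^sub>v (repA (stage x 0) e *\<^sub>v (?i *\<^sub>v k))"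
      using e kc(1) x h0 hG[OF le0 head_in_verts[OF e(1)]] by (auto simp: stage_gauge_act mat_vec_assoc)
    also have "\<dots> = 0\<^sub>v (d 0 (head Q e))"
      using kill e hG[OF le0 head_in_verts[OF e(1)]] by (auto simp: kills_def)
    finally show "repA (stage ?y 0) e *\<^sub>v k = 0\<^sub>v (d 0 (head Q e))" .
  next
    fix e assume e: "e \<in> arcs Q" "head Q e = v"
    have "repB (stage ?y 0) e *\<^sub>v k = h (0, tail Q e) *\<^sub>v (repB (stage x 0) e *\<^sub>v (?i *\<^sub>v k))"
      using e kc(1) x h0 hG[OF le0 tail_in_verts[OF e(1)]] by (auto simp: stage_gauge_act mat_vec_assoc)
    also have "\<dots> = 0\<^sub>v (d 0 (tail Q e))"
      using kill e hG[OF le0 tail_in_verts[OF e(1)]] by (auto simp: kills_def)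
    finally show "repB (stage ?y 0) e *\<^sub>v k = 0\<^sub>v (d 0 (tail Q e))" .
  next
    have "repJ (stage ?y 0) v *\<^sub>v k = repJ (stage x 0) v *\<^sub>v (?i *\<^sub>v k)"
      using v kc(1) x h0 by (auto simp: stage_gauge_act mat_vec_assoc)
    then show "repJ (stage ?y 0) v *\<^sub>v k = 0\<^sub>v (f v)" using kill by (simp add: kills_def)
  qed
qed

lemma parabolic_points_eqI:
  assumes "x \<in> X" "y \<in> X" "\<And>m. m \<le> l \<Longrightarrow> stage x m = stage y m"
    "\<And>m v. m < l \<Longrightarrow> v \<in> verts Q \<Longrightarrow> link x m v = link y m v"
  shows "x = y"
proof -
  have "stage x = stage y"
    using parabolic_pointsD(1)[OF assms(1)] parabolic_pointsD(1)[OF assms(2)] assms(3)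
    by (intro extensionalityI[of _ "{..l}"]) auto
  moreover have "link x = link y"
  proof (rule extensionalityI[of _ "{..<l}"])
    fix m assume "m \<in> {..<l}"
    then show "link x m = link y m"
      using parabolic_pointsD(3)[OF assms(1)] parabolic_pointsD(3)[OF assms(2)] assms(4)
      by (intro extensionalityI[of _ "verts Q"]) auto
  qed (use parabolic_pointsD(2)[OF assms(1)] parabolic_pointsD(2)[OF assms(2)] in auto)
  ultimately show ?thesis by simp
qed

lemma gauge_act_mult:
  assumes x: "x \<in> X" and g: "gauge_family Q l d g" and h: "gauge_family Q l d h"
  shows "gauge_act Q l d (\<lambda>i. g i * h i) x = gauge_act Q l d g (gauge_act Q l d h x)"
proof (rule parabolic_points_eqI)
  have gh: "gauge_family Q l d (\<lambda>i. g i * h i)"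
    using g h by (simp add: gauge_family_def)
  show "gauge_act Q l d (\<lambda>i. g i * h i) x \<in> X" by (rule gauge_act_closed[OF x gh])
  show "gauge_act Q l d g (gauge_act Q l d h x) \<in> X"
    by (rule gauge_act_closed[OF gauge_act_closed[OF x h] g])
  show "stage (gauge_act Q l d (\<lambda>i. g i * h i) x) m = stage (gauge_act Q l d g (gauge_act Q l d h x)) m" if "m \<le> l" for m
    unfolding stage_gauge_act[OF that]
    by (rule rep_act_mult[OF _ _ parabolic_pointsD(4)[OF x that]]) (use gauge_familyD[OF g that] gauge_familyD[OF h that] in auto)
  fix m v assume m: "m < l" and v: "v \<in> verts Q"
  have m': "m \<le> l" "Suc m \<le> l" using m by auto
  note gauge_familyD[OF g m'(1) v] gauge_familyD[OF g m'(2) v] gauge_familyD[OF h m'(1) v] gauge_familyD[OF h m'(2) v]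
  then show "link (gauge_act Q l d (\<lambda>i. g i * h i) x) m v = link (gauge_act Q l d g (gauge_act Q l d h x)) m v"
    using m v x by (simp add: link_gauge_act gl_inv_mult mat_assoc)
qed

lemma gauge_act_one:
  assumes x: "x \<in> X" and g: "\<And>m v. m \<le> l \<Longrightarrow> v \<in> verts Q \<Longrightarrow> g (m, v) = 1\<^sub>m (d m v)"
  shows "gauge_act Q l d g x = x"
proof (rule parabolic_points_eqI[OF _ x])
  show "gauge_act Q l d g x \<in> X"
    by (rule gauge_act_closed[OF x]) (use g in \<open>simp add: gauge_family_def\<close>)
  show "stage (gauge_act Q l d g x) m = stage x m" if "m \<le> l" for m
    unfolding stage_gauge_act[OF that]
    by (rule rep_act_one[OF _ parabolic_pointsD(4)[OF x that]]) (use g that in auto)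
  show "link (gauge_act Q l d g x) m v = link x m v" if "m < l" "v \<in> verts Q" for m v
    using that g parabolic_pointsD(7)[OF x that] by (simp add: link_gauge_act)
qed

lemma gauge_act_cong:
  assumes "\<And>m v. m \<le> l \<Longrightarrow> v \<in> verts Q \<Longrightarrow> g (m, v) = h (m, v)"
  shows "gauge_act Q l d g x = gauge_act Q l d h x"
  using assms by (auto simp: gauge_act_def rep_act_def fun_eq_iff restrict_def)

abbreviation "q \<equiv> gauge_orbit Q l d"

lemma orbit_iff:
  "y \<in> q x \<longleftrightarrow> (\<exists>h. gauge_family Q l d h \<and> y = gauge_act Q l d h x)"
proof
  assume "y \<in> q x"
  then obtain h where "h \<in> carrier (gauge_group Q l d)" "y = gauge_act Q l d h x"
    by (auto simp: gauge_orbit_def orbit_def)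
  then show "\<exists>h. gauge_family Q l d h \<and> y = gauge_act Q l d h x"
    by (intro exI[of _ h]) (auto simp: gauge_group_def gauge_family_def PiE_iff)
next
  assume "\<exists>h. gauge_family Q l d h \<and> y = gauge_act Q l d h x"
  then obtain h where h: "gauge_family Q l d h" "y = gauge_act Q l d h x" by blast
  let ?h = "restrict h ({..l} \<times> verts Q)"
  have "?h \<in> carrier (gauge_group Q l d)"
    using h(1) by (auto simp: gauge_group_def gauge_family_def)
  moreover have "y = gauge_act Q l d ?h x"
    unfolding h(2) by (rule gauge_act_cong) auto
  ultimately show "y \<in> q x" by (auto simp: gauge_orbit_def orbit_def)
qed

lemma orbit_self: "x \<in> X \<Longrightarrow> x \<in> q x"
  unfolding orbit_iff
  by (rule exI[of _ "\<lambda>(m, v). 1\<^sub>m (d m v)"]) (auto simp: gauge_family_def gauge_act_one)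

lemma orbit_gauge_act:
  assumes x: "x \<in> X" and h: "gauge_family Q l d h"
  shows "q (gauge_act Q l d h x) = q x"
proof (intro Set.set_eqI iffI)
  fix y assume "y \<in> q (gauge_act Q l d h x)"
  then obtain g where g: "gauge_family Q l d g" "y = gauge_act Q l d g (gauge_act Q l d h x)"
    by (auto simp: orbit_iff)
  then show "y \<in> q x"
    unfolding orbit_iff using gauge_act_mult[OF x g(1) h] h
    by (intro exI[of _ "\<lambda>i. g i * h i"]) (auto simp: gauge_family_def)
next
  fix y assume "y \<in> q x"
  then obtain g where g: "gauge_family Q l d g" "y = gauge_act Q l d g x" by (auto simp: orbit_iff)
  let ?h = "\<lambda>(m, v). gl_inv (d m v) (h (m, v))"
  have ih: "gauge_family Q l d ?h" using h by (auto simp: gauge_family_def)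
  have "gauge_act Q l d ?h (gauge_act Q l d h x) = x"
    unfolding gauge_act_mult[OF x ih h, symmetric]
    by (rule gauge_act_one[OF x]) (use gauge_familyD[OF h] in auto)
  then have "y = gauge_act Q l d (\<lambda>i. g i * ?h i) (gauge_act Q l d h x)"
    using gauge_act_mult[OF gauge_act_closed[OF x h] g(1) ih] g(2) by simp
  then show "y \<in> q (gauge_act Q l d h x)"
    unfolding orbit_iff using g(1) ih
    by (intro exI[of _ "\<lambda>i. g i * ?h i"]) (auto simp: gauge_family_def)
qed

lemma orbit_eq_iff:
  assumes "x \<in> X" "y \<in> X"
  shows "q x = q y \<longleftrightarrow> (\<exists>h. gauge_family Q l d h \<and> y = gauge_act Q l d h x)"
  using orbit_self[OF assms(2)] orbit_iff orbit_gauge_act[OF assms(1)] by metis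

abbreviation "MS \<equiv> parabolic_variety Q l d f"
abbreviation "XS \<equiv> parabolic_space Q l d f"

lemma points_XS: "points XS = X"
  by (simp add: parabolic_space_def)

lemma XS: "space_with_functions XS"
  unfolding parabolic_space_def by (rule space_with_functions_zariski)

lemma orbits_eq: "orbits (gauge_group Q l d) X (gauge_act Q l d) = q ` X"
  by (auto simp: orbits_def gauge_orbit_def)

lemma MS_eq: "MS = fs_coinduced XS (q ` X) q"
  by (simp add: parabolic_variety_def orbits_eq)

lemma MS: "space_with_functions MS"
  unfolding MS_eq by (rule space_with_functions_coinduced[OF XS])

lemma points_MS: "points MS = q ` X"
  unfolding MS_eq by (simp add: points_coinduced points_XS)

lemma fs_morphism_orbit: "fs_morphism XS MS q"
  unfolding MS_eq by (rule fs_morphism_coinduced_map) (simp add: points_XS)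

end

section \<open>Standard chains\<close>

definition trunc_rep :: "('v, 'e) pre_digraph \<Rightarrow> ('v \<Rightarrow> nat) \<Rightarrow> ('v \<Rightarrow> nat) \<Rightarrow> ('v, 'e) framed_rep \<Rightarrow> ('v, 'e) framed_rep"
  where "trunc_rep Q n m R = \<lparr>
     repA = (\<lambda>e\<in>arcs Q. rect (m (head Q e)) (n (head Q e)) * repA R e * rect (n (tail Q e)) (m (tail Q e))),
     repB = (\<lambda>e\<in>arcs Q. rect (m (tail Q e)) (n (tail Q e)) * repB R e * rect (n (head Q e)) (m (head Q e))),
     repI = (\<lambda>v\<in>verts Q. rect (m v) (n v) * repI R v),
     repJ = (\<lambda>v\<in>verts Q. repJ R v * rect (n v) (m v))\<rparr>"

text \<open>
  The model of a chain, in which every stage is the quotient of stage zero by its last coordinates.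
\<close>

definition std_chain :: "('v, 'e) pre_digraph \<Rightarrow> nat \<Rightarrow> (nat \<Rightarrow> 'v \<Rightarrow> nat) \<Rightarrow> ('v, 'e) framed_rep \<Rightarrow> ('v, 'e) chain_rep"
  where "std_chain Q l d R = \<lparr>
     stage = (\<lambda>m\<in>{..l}. trunc_rep Q (d 0) (d m) R),
     link = (\<lambda>m\<in>{..<l}. \<lambda>v\<in>verts Q. rect (d (Suc m) v) (d m v))\<rparr>"

lemma trunc_rep_simps [simp]:
  "e \<in> arcs Q \<Longrightarrow> repA (trunc_rep Q n m R) e = rect (m (head Q e)) (n (head Q e)) * repA R e * rect (n (tail Q e)) (m (tail Q e))"
  "e \<in> arcs Q \<Longrightarrow> repB (trunc_rep Q n m R) e = rect (m (tail Q e)) (n (tail Q e)) * repB R e * rect (n (head Q e)) (m (head Q e))"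
  "v \<in> verts Q \<Longrightarrow> repI (trunc_rep Q n m R) v = rect (m v) (n v) * repI R v"
  "v \<in> verts Q \<Longrightarrow> repJ (trunc_rep Q n m R) v = repJ R v * rect (n v) (m v)"
  by (auto simp: trunc_rep_def)

lemma std_chain_simps [simp]:
  "m \<le> l \<Longrightarrow> stage (std_chain Q l d R) m = trunc_rep Q (d 0) (d m) R"
  "m < l \<Longrightarrow> v \<in> verts Q \<Longrightarrow> link (std_chain Q l d R) m v = rect (d (Suc m) v) (d m v)"
  by (auto simp: std_chain_def)

lemma trunc_rep_framed:
  assumes "R \<in> framed_reps Q n f"
  shows "trunc_rep Q n m R \<in> framed_reps Q m f"
proof (rule framed_repsI)
  show "repA (trunc_rep Q n m R) e \<in> carrier_mat (m (head Q e)) (m (tail Q e))"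
    "repB (trunc_rep Q n m R) e \<in> carrier_mat (m (tail Q e)) (m (head Q e))" if "e \<in> arcs Q" for e
    using that assms by auto
  show "repI (trunc_rep Q n m R) v \<in> carrier_mat (m v) (f v)"
    "repJ (trunc_rep Q n m R) v \<in> carrier_mat (f v) (m v)" if "v \<in> verts Q" for v
    using that assms by auto
qed (auto simp: trunc_rep_def)

lemma trunc_rep_self:
  assumes "R \<in> framed_reps Q n f"
  shows "trunc_rep Q n n R = R"
proof (rule framed_reps_eqI[OF trunc_rep_framed[OF assms] assms])
  note R = framed_repsD[OF assms]
  show "repA (trunc_rep Q n n R) e = repA R e" "repB (trunc_rep Q n n R) e = repB R e" if "e \<in> arcs Q" for e
    using that by (simp_all add: left_mult_one_mat[OF R(1)] right_mult_one_mat[OF R(1)]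
        left_mult_one_mat[OF R(2)] right_mult_one_mat[OF R(2)])
  show "repI (trunc_rep Q n n R) v = repI R v" "repJ (trunc_rep Q n n R) v = repJ R v" if "v \<in> verts Q" for v
    using that by (simp_all add: left_mult_one_mat[OF R(3)] right_mult_one_mat[OF R(4)])
qed

text \<open>A matrix supported on the first \<open>c\<close> columns is not changed by a detour over \<open>p \<ge> c\<close> coordinates.\<close>

lemma rect_absorb:
  assumes "A * (rect n c * rect c n) = A" "dim_col A = n" "c \<le> p" "c \<le> n"
  shows "A * (rect n p * rect p r) = A * rect n r"
    and "dim_row Z = r \<Longrightarrow> A * (rect n p * (rect p r * Z)) = A * (rect n r * Z)"
proof -
  have "A * (rect n p * rect p r) = (A * (rect n c * rect c n)) * (rect n p * rect p r)"
    using assms(1) by simp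
  also have "\<dots> = A * (rect n c * (rect c n * (rect n p * rect p r)))"
    using assms(2) by (simp add: mat_assoc)
  also have "rect c n * (rect n p * rect p r) = rect c n * rect n r"
    using assms(3,4) by simp
  also have "A * (rect n c * (rect c n * rect n r)) = (A * (rect n c * rect c n)) * rect n r"
    using assms(2) by (simp add: mat_assoc)
  finally show 1: "A * (rect n p * rect p r) = A * rect n r"
    using assms(1) by simp
  assume Z: "dim_row Z = r"
  have "A * (rect n p * (rect p r * Z)) = (A * (rect n p * rect p r)) * Z"
    using assms(2) Z by (simp add: mat_assoc)
  then show "A * (rect n p * (rect p r * Z)) = A * (rect n r * Z)"
    unfolding 1 using assms(2) Z by (simp add: mat_assoc)
qed

context dim_chain
begin

text \<open>
  The representations that can be stage zero of a standard chain: as everything vanishes on the last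
  \<open>d 0 v - d l v\<close> coordinates, every subspace of their span is a subrepresentation, and there is a
  quotient representation on the first \<open>d m v\<close> coordinates for every \<open>m \<le> l\<close>.
\<close>

definition split_reps :: "('v, 'e) framed_rep set" where
  "split_reps = {R \<in> framed_reps Q (d 0) f. stable Q (d 0) f R \<and> moment_map_eqs Q (d 0) R \<and>
     (\<forall>e\<in>arcs Q. repA R e * (rect (d 0 (tail Q e)) (d l (tail Q e)) * rect (d l (tail Q e)) (d 0 (tail Q e))) = repA R e \<and>
       repB R e * (rect (d 0 (head Q e)) (d l (head Q e)) * rect (d l (head Q e)) (d 0 (head Q e))) = repB R e) \<and>
     (\<forall>v\<in>verts Q. repJ R v * (rect (d 0 v) (d l v) * rect (d l v) (d 0 v)) = repJ R v)}"

lemma split_repsD: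
  assumes "R \<in> split_reps"
  shows "R \<in> framed_reps Q (d 0) f" "stable Q (d 0) f R" "moment_map_eqs Q (d 0) R"
    "e \<in> arcs Q \<Longrightarrow> repA R e * (rect (d 0 (tail Q e)) (d l (tail Q e)) * rect (d l (tail Q e)) (d 0 (tail Q e))) = repA R e"
    "e \<in> arcs Q \<Longrightarrow> repB R e * (rect (d 0 (head Q e)) (d l (head Q e)) * rect (d l (head Q e)) (d 0 (head Q e))) = repB R e"
    "v \<in> verts Q \<Longrightarrow> repJ R v * (rect (d 0 v) (d l v) * rect (d l v) (d 0 v)) = repJ R v"
  using assms by (auto simp: split_reps_def)

lemma split_reps_absorb:
  assumes R: "R \<in> split_reps" and m: "m \<le> l"
  shows "e \<in> arcs Q \<Longrightarrow> repA R e * (rect (d 0 (tail Q e)) (d m (tail Q e)) * rect (d m (tail Q e)) r) = repA R e * rect (d 0 (tail Q e)) r"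
    and "e \<in> arcs Q \<Longrightarrow> dim_row Z = r \<Longrightarrow>
      repA R e * (rect (d 0 (tail Q e)) (d m (tail Q e)) * (rect (d m (tail Q e)) r * Z)) = repA R e * (rect (d 0 (tail Q e)) r * Z)"
    and "e \<in> arcs Q \<Longrightarrow> repB R e * (rect (d 0 (head Q e)) (d m (head Q e)) * rect (d m (head Q e)) r) = repB R e * rect (d 0 (head Q e)) r"
    and "e \<in> arcs Q \<Longrightarrow> dim_row Z = r \<Longrightarrow>
      repB R e * (rect (d 0 (head Q e)) (d m (head Q e)) * (rect (d m (head Q e)) r * Z)) = repB R e * (rect (d 0 (head Q e)) r * Z)"
    and "v \<in> verts Q \<Longrightarrow> repJ R v * (rect (d 0 v) (d m v) * rect (d m v) r) = repJ R v * rect (d 0 v) r"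
proof -
  note R' = split_repsD[OF R]
  note dm = d_mono[OF m order_refl] d_mono[OF le0 order_refl]
  show "e \<in> arcs Q \<Longrightarrow> repA R e * (rect (d 0 (tail Q e)) (d m (tail Q e)) * rect (d m (tail Q e)) r) = repA R e * rect (d 0 (tail Q e)) r"
    "e \<in> arcs Q \<Longrightarrow> dim_row Z = r \<Longrightarrow>
      repA R e * (rect (d 0 (tail Q e)) (d m (tail Q e)) * (rect (d m (tail Q e)) r * Z)) = repA R e * (rect (d 0 (tail Q e)) r * Z)"
    using rect_absorb[OF R'(4)] R'(1) dm by auto
  show "e \<in> arcs Q \<Longrightarrow> repB R e * (rect (d 0 (head Q e)) (d m (head Q e)) * rect (d m (head Q e)) r) = repB R e * rect (d 0 (head Q e)) r"
    "e \<in> arcs Q \<Longrightarrow> dim_row Z = r \<Longrightarrow>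
      repB R e * (rect (d 0 (head Q e)) (d m (head Q e)) * (rect (d m (head Q e)) r * Z)) = repB R e * (rect (d 0 (head Q e)) r * Z)"
    using rect_absorb[OF R'(5)] R'(1) dm by auto
  show "v \<in> verts Q \<Longrightarrow> repJ R v * (rect (d 0 v) (d m v) * rect (d m v) r) = repJ R v * rect (d 0 v) r"
    using rect_absorb(1)[OF R'(6)] R'(1) dm by auto
qed

lemma link_comp_std_chain: "m \<le> l \<Longrightarrow> v \<in> verts Q \<Longrightarrow> link_comp d (std_chain Q l d R) m v = rect (d m v) (d 0 v)"
proof (induction m)
  case (Suc m)
  then show ?case using d_mono[of m "Suc m" v] by simp
qed simp

text \<open>
  Quotients of stable representations are stable: the preimage of a subrepresentation that contains the
  framing is everything.
\<close>

lemma stable_trunc_rep: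
  assumes R: "R \<in> split_reps" and m: "m \<le> l"
  shows "stable Q (d m) f (trunc_rep Q (d 0) (d m) R)" (is "stable Q _ f ?T")
  unfolding stable_def
proof (intro allI impI ballI)
  fix W v
  assume W: "(\<forall>v\<in>verts Q. is_subspace (d m v) (W v) \<and> (\<forall>x\<in>carrier_vec (f v). repI ?T v *\<^sub>v x \<in> W v)) \<and>
     (\<forall>e\<in>arcs Q. (\<forall>x\<in>W (tail Q e). repA ?T e *\<^sub>v x \<in> W (head Q e)) \<and>
        (\<forall>x\<in>W (head Q e). repB ?T e *\<^sub>v x \<in> W (tail Q e)))"
    and v: "v \<in> verts Q"
  let ?\<pi> = "\<lambda>v. rect (d m v) (d 0 v)"
  let ?W = "\<lambda>v. {x \<in> carrier_vec (d 0 v). ?\<pi> v *\<^sub>v x \<in> W v}"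
  note R' = split_repsD[OF R]
  have full: "?W v = carrier_vec (d 0 v)"
  proof (rule stableD[OF R'(2) v, of ?W])
    fix v assume v: "v \<in> verts Q"
    show "is_subspace (d 0 v) (?W v)"
      using W v by (intro is_subspace_vimage[where m = "d m v" and n = "d m v"]) auto
    fix x :: "complex vec" assume x: "x \<in> carrier_vec (f v)"
    then have "?\<pi> v *\<^sub>v (repI R v *\<^sub>v x) = repI ?T v *\<^sub>v x"
      using v R'(1) by (simp add: mat_vec_assoc)
    then show "repI R v *\<^sub>v x \<in> ?W v"
      using W v x R'(1) by (auto intro!: carrier_vecI)
  next
    fix e x assume e: "e \<in> arcs Q" and x: "x \<in> ?W (tail Q e)"
    have xc: "x \<in> carrier_vec (d 0 (tail Q e))" "dim_vec x = d 0 (tail Q e)" using x by auto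
    have "repA ?T e *\<^sub>v (?\<pi> (tail Q e) *\<^sub>v x) = (repA ?T e * ?\<pi> (tail Q e)) *\<^sub>v x"
      using e R'(1) xc by (intro mat_vec_assoc[symmetric]) auto
    also have "repA ?T e * ?\<pi> (tail Q e) = ?\<pi> (head Q e) * repA R e"
      using e R'(1) right_mult_one_mat[OF framed_repsD(1)[OF R'(1) e]]
      by (simp add: mat_assoc split_reps_absorb[OF R m])
    also have "\<dots> *\<^sub>v x = ?\<pi> (head Q e) *\<^sub>v (repA R e *\<^sub>v x)"
      using e R'(1) xc by (intro mat_vec_assoc) auto
    finally show "repA R e *\<^sub>v x \<in> ?W (head Q e)"
      using W e x R'(1) by (auto intro!: carrier_vecI) metis
  next
    fix e x assume e: "e \<in> arcs Q" and x: "x \<in> ?W (head Q e)"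
    have xc: "x \<in> carrier_vec (d 0 (head Q e))" "dim_vec x = d 0 (head Q e)" using x by auto
    have "repB ?T e *\<^sub>v (?\<pi> (head Q e) *\<^sub>v x) = (repB ?T e * ?\<pi> (head Q e)) *\<^sub>v x"
      using e R'(1) xc by (intro mat_vec_assoc[symmetric]) auto
    also have "repB ?T e * ?\<pi> (head Q e) = ?\<pi> (tail Q e) * repB R e"
      using e R'(1) right_mult_one_mat[OF framed_repsD(2)[OF R'(1) e]]
      by (simp add: mat_assoc split_reps_absorb[OF R m])
    also have "\<dots> *\<^sub>v x = ?\<pi> (tail Q e) *\<^sub>v (repB R e *\<^sub>v x)"
      using e R'(1) xc by (intro mat_vec_assoc) auto
    finally show "repB R e *\<^sub>v x \<in> ?W (tail Q e)"
      using W e x R'(1) by (auto intro!: carrier_vecI) metis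
  qed
  have sub: "W v \<subseteq> carrier_vec (d m v)" using W v by (auto simp: is_subspace_iff)
  have "y \<in> W v" if y: "y \<in> carrier_vec (d m v)" for y
  proof -
    have "rect (d 0 v) (d m v) *\<^sub>v y \<in> ?W v"
      unfolding full by (auto intro!: carrier_vecI)
    then have "?\<pi> v *\<^sub>v (rect (d 0 v) (d m v) *\<^sub>v y) \<in> W v" by simp
    moreover have "?\<pi> v *\<^sub>v (rect (d 0 v) (d m v) *\<^sub>v y) = y"
      using d_mono[OF le0 m v] y by (subst mat_vec_assoc[symmetric]) auto
    ultimately show ?thesis by simp
  qed
  then show "W v = carrier_vec (d m v)" using sub by blast
qed

lemma moment_map_trunc_rep:
  assumes R: "R \<in> split_reps" and m: "m \<le> l"
  shows "moment_map_eqs Q (d m) (trunc_rep Q (d 0) (d m) R)" (is "moment_map_eqs Q _ ?T")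
  unfolding moment_map_eqs_def
proof (intro ballI allI impI)
  fix v r c assume v: "v \<in> verts Q" and rc: "r < d m v" "c < d m v"
  note R' = split_repsD[OF R]
  note car = framed_repsD[OF R'(1)]
  have dm: "d m v \<le> d 0 v" using d_mono[OF le0 m v] .
  let ?c = "\<lambda>Z. rect (d m v) (d 0 v) * Z * rect (d 0 v) (d m v)"
  have A: "repA ?T e * repB ?T e = ?c (repA R e * repB R e)" if "e \<in> arcs Q \<and> head Q e = v" for e
    using that R'(1) right_mult_one_mat[OF car(1)] by (auto simp: mat_assoc split_reps_absorb[OF R m])
  have B: "repB ?T e * repA ?T e = ?c (repB R e * repA R e)" if "e \<in> arcs Q \<and> tail Q e = v" for e
    using that R'(1) right_mult_one_mat[OF car(2)] by (auto simp: mat_assoc split_reps_absorb[OF R m])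
  have I: "repI ?T v * repJ ?T v = ?c (repI R v * repJ R v)"
    using R'(1) v by (simp add: mat_assoc)
  have "(\<Sum>e | e \<in> arcs Q \<and> head Q e = v. (repA ?T e * repB ?T e) $$ (r, c)) =
      (\<Sum>e | e \<in> arcs Q \<and> head Q e = v. ?c (repA R e * repB R e) $$ (r, c))"
    by (intro sum.cong refl arg_cong[where f = "\<lambda>M. M $$ (r, c)"]) (use A in blast)
  moreover have "(\<Sum>e | e \<in> arcs Q \<and> tail Q e = v. (repB ?T e * repA ?T e) $$ (r, c)) =
      (\<Sum>e | e \<in> arcs Q \<and> tail Q e = v. ?c (repB R e * repA R e) $$ (r, c))"
    by (intro sum.cong refl arg_cong[where f = "\<lambda>M. M $$ (r, c)"]) (use B in blast)
  ultimately show "(\<Sum>e | e \<in> arcs Q \<and> head Q e = v. (repA ?T e * repB ?T e) $$ (r, c))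
     - (\<Sum>e | e \<in> arcs Q \<and> tail Q e = v. (repB ?T e * repA ?T e) $$ (r, c))
     + (repI ?T v * repJ ?T v) $$ (r, c) = 0"
    unfolding I using moment_map_conj[OF R'(1,3) v _ _ rc, of "rect (d m v) (d 0 v)" "rect (d 0 v) (d m v)"]
    by (simp only: rect_carrier)
qed

lemma std_chain_in_X:
  assumes R: "R \<in> split_reps"
  shows "std_chain Q l d R \<in> X"
  unfolding parabolic_points_iff
proof (intro conjI allI impI ballI)
  note R' = split_repsD[OF R]
  note car = framed_repsD[OF R'(1)]
  let ?x = "std_chain Q l d R"
  show "stage ?x \<in> extensional {..l}" "link ?x \<in> extensional {..<l}" by (auto simp: std_chain_def)
  show "link ?x m \<in> extensional (verts Q)" if "m < l" for m using that by (simp add: std_chain_def)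
  show "stage ?x m \<in> framed_reps Q (d m) f" if "m \<le> l" for m
    using that trunc_rep_framed[OF R'(1)] by simp
  show "stable Q (d m) f (stage ?x m)" if "m \<le> l" for m using that stable_trunc_rep[OF R that] by simp
  show "moment_map_eqs Q (d m) (stage ?x m)" if "m \<le> l" for m using that moment_map_trunc_rep[OF R that] by simp
  show "link ?x m v \<in> carrier_mat (d (Suc m) v) (d m v)" if "m < l" "v \<in> verts Q" for m v
    using that by simp
  show "link_eqs ?x m" if m: "m < l" for m
    unfolding link_eqs_def
  proof (intro conjI ballI)
    have m': "m \<le> l" "Suc m \<le> l" using m by auto
    fix e assume e: "e \<in> arcs Q"
    have ht: "d m (head Q e) \<le> d 0 (head Q e)" "d m (tail Q e) \<le> d 0 (tail Q e)"
      "d (Suc m) (head Q e) \<le> d m (head Q e)" "d (Suc m) (tail Q e) \<le> d m (tail Q e)"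
      using d_mono[OF le0 m'(1)] d_mono[OF le_SucI[OF order_refl] m'(2)] e by auto
    show "link ?x m (head Q e) * repA (stage ?x m) e = repA (stage ?x (Suc m)) e * link ?x m (tail Q e)"
      using e m m' ht R'(1) by (simp add: mat_assoc split_reps_absorb[OF R m'(2)])
    show "link ?x m (tail Q e) * repB (stage ?x m) e = repB (stage ?x (Suc m)) e * link ?x m (head Q e)"
      using e m m' ht R'(1) by (simp add: mat_assoc split_reps_absorb[OF R m'(2)])
  next
    have m': "m \<le> l" "Suc m \<le> l" using m by auto
    fix v assume v: "v \<in> verts Q"
    have dv: "d (Suc m) v \<le> d m v" using d_step[OF m v] .
    show "link ?x m v * repI (stage ?x m) v = repI (stage ?x (Suc m)) v"
      using v m m' dv R'(1) by simp
    show "repJ (stage ?x (Suc m)) v * link ?x m v = repJ (stage ?x m) v"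
      using v m m' R'(1) by (simp add: mat_assoc split_reps_absorb[OF R m'(2)])
  qed
  fix v k assume v: "v \<in> verts Q" and k: "k \<in> mat_kernel (link_comp d ?x l v)"
  have k': "k \<in> carrier_vec (d 0 v)" "rect (d l v) (d 0 v) *\<^sub>v k = 0\<^sub>v (d l v)"
    using k v by (auto simp: mat_kernel_def link_comp_std_chain)
  have zero: "M *\<^sub>v k = 0\<^sub>v n"
    if "M \<in> carrier_mat n (d 0 v)" "M * (rect (d 0 v) (d l v) * rect (d l v) (d 0 v)) = M" for M n
  proof -
    have "M *\<^sub>v k = (M * (rect (d 0 v) (d l v) * rect (d l v) (d 0 v))) *\<^sub>v k"
      by (simp only: that(2))
    also have "\<dots> = (M * rect (d 0 v) (d l v)) *\<^sub>v (rect (d l v) (d 0 v) *\<^sub>v k)"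
      using that(1) k'(1) by (simp add: mat_vec_assoc)
    finally show ?thesis
      unfolding k'(2) using that(1) by (auto intro!: eq_vecI simp: scalar_prod_def)
  qed
  show "kills (stage ?x 0) v k"
    unfolding kills_def using zero car R'(4-6) v by (auto simp: trunc_rep_self[OF R'(1)])
qed

text \<open>
  A chain whose links compose to coordinate projections is standard, since surjectivity of the
  projections determines the stages.
\<close>

lemma std_chainI:
  assumes y: "y \<in> X" and lc: "\<And>m v. m \<le> l \<Longrightarrow> v \<in> verts Q \<Longrightarrow> link_comp d y m v = rect (d m v) (d 0 v)"
  shows "y = std_chain Q l d (stage y 0)" "stage y 0 \<in> split_reps"
proof -
  let ?R = "stage y 0"
  note R = parabolic_pointsD(4)[OF y le0]
  note car = framed_repsD[OF R]
  have kl: "M * (rect (d 0 v) (d l v) * rect (d l v) (d 0 v)) = M"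
    if v: "v \<in> verts Q" and M: "M \<in> carrier_mat n (d 0 v)"
      and kill: "\<And>k. k \<in> mat_kernel (link_comp d y l v) \<Longrightarrow> M *\<^sub>v k = 0\<^sub>v n" for M n v
  proof (rule eq_matI)
    let ?E = "rect (d 0 v) (d l v) * rect (d l v) (d 0 v)"
    fix i j assume "i < dim_row M" "j < dim_col M"
    then have ij: "i < n" "j < d 0 v" using M by auto
    have "(M * ?E) $$ (i, j) = ((M * rect (d 0 v) (d l v)) * rect (d l v) (d 0 v)) $$ (i, j)"
      using M by (simp add: mat_assoc)
    also have "\<dots> = (if j < d l v then (M * rect (d 0 v) (d l v)) $$ (i, j) else 0)"
      using ij M by (intro mult_rect_index) auto
    also have "\<dots> = (if j < d l v then M $$ (i, j) else 0)"
      using ij M mult_rect_index[OF M ij(1), of j "d l v"] by auto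
    also have "\<dots> = M $$ (i, j)"
    proof (cases "j < d l v")
      case False
      have "unit_vec (d 0 v) j \<in> mat_kernel (link_comp d y l v)"
        using False ij(2) lc[OF order_refl v]
        by (auto simp: mat_kernel_def intro!: eq_vecI simp: rect_vec_index simp del: index_mult_mat_vec)
      from kill[OF this] have "col M j = 0\<^sub>v n"
        using mult_mat_unit_vec[OF M ij(2)] by simp
      then have "col M j $ i = 0" using ij(1) by simp
      then show ?thesis using False ij M by simp
    qed simp
    finally show "(M * ?E) $$ (i, j) = M $$ (i, j)" .
  qed (use M in auto)
  note kill = parabolic_pointsD(9)[OF y, unfolded kills_def]
  show split: "?R \<in> split_reps"
    unfolding split_reps_def
  proof (intro CollectI conjI ballI)
    fix e assume e: "e \<in> arcs Q"
    show "repA ?R e * (rect (d 0 (tail Q e)) (d l (tail Q e)) * rect (d l (tail Q e)) (d 0 (tail Q e))) = repA ?R e"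
      by (rule kl[OF tail_in_verts[OF e] car(1)[OF e]]) (use kill[OF tail_in_verts[OF e]] e in blast)
    show "repB ?R e * (rect (d 0 (head Q e)) (d l (head Q e)) * rect (d l (head Q e)) (d 0 (head Q e))) = repB ?R e"
      by (rule kl[OF head_in_verts[OF e] car(2)[OF e]]) (use kill[OF head_in_verts[OF e]] e in blast)
  next
    fix v assume v: "v \<in> verts Q"
    show "repJ ?R v * (rect (d 0 v) (d l v) * rect (d l v) (d 0 v)) = repJ ?R v"
      by (rule kl[OF v car(4)[OF v]]) (use kill[OF v] in blast)
  qed (use R parabolic_pointsD[OF y] in auto)
  show "y = std_chain Q l d ?R"
  proof (rule parabolic_points_eqI[OF y std_chain_in_X[OF split]])
    fix m assume m: "m \<le> l"
    have "stage y m = trunc_rep Q (d 0) (d m) ?R"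
    proof (rule framed_reps_eqI[OF parabolic_pointsD(4)[OF y m] trunc_rep_framed[OF R]])
      note eqs = link_comp_eqs[OF y m]
      fix e assume e: "e \<in> arcs Q"
      note vs = head_in_verts[OF e] tail_in_verts[OF e]
      have "repA (stage y m) e = repA (stage y m) e * (rect (d m (tail Q e)) (d 0 (tail Q e)) * rect (d 0 (tail Q e)) (d m (tail Q e)))"
        using d_mono[OF le0 m vs(2)] framed_repsD(1)[OF parabolic_pointsD(4)[OF y m] e] by simp
      also have "\<dots> = (repA (stage y m) e * link_comp d y m (tail Q e)) * rect (d 0 (tail Q e)) (d m (tail Q e))"
        using lc[OF m vs(2)] y m e by (simp add: mat_assoc)
      also have "\<dots> = repA (trunc_rep Q (d 0) (d m) ?R) e"
        using e lc[OF m vs(1)] by (simp add: eqs(1)[symmetric])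
      finally show "repA (stage y m) e = repA (trunc_rep Q (d 0) (d m) ?R) e" .
      have "repB (stage y m) e = repB (stage y m) e * (rect (d m (head Q e)) (d 0 (head Q e)) * rect (d 0 (head Q e)) (d m (head Q e)))"
        using d_mono[OF le0 m vs(1)] framed_repsD(2)[OF parabolic_pointsD(4)[OF y m] e] by simp
      also have "\<dots> = (repB (stage y m) e * link_comp d y m (head Q e)) * rect (d 0 (head Q e)) (d m (head Q e))"
        using lc[OF m vs(1)] y m e by (simp add: mat_assoc)
      also have "\<dots> = repB (trunc_rep Q (d 0) (d m) ?R) e"
        using e lc[OF m vs(2)] by (simp add: eqs(2)[symmetric])
      finally show "repB (stage y m) e = repB (trunc_rep Q (d 0) (d m) ?R) e" .
    next
      note eqs = link_comp_eqs[OF y m]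
      fix v assume v: "v \<in> verts Q"
      show "repI (stage y m) v = repI (trunc_rep Q (d 0) (d m) ?R) v"
        using eqs(3)[OF v] lc[OF m v] v by simp
      have "repJ (stage y m) v = repJ (stage y m) v * (rect (d m v) (d 0 v) * rect (d 0 v) (d m v))"
        using d_mono[OF le0 m v] framed_repsD(4)[OF parabolic_pointsD(4)[OF y m] v] by simp
      also have "\<dots> = (repJ (stage y m) v * link_comp d y m v) * rect (d 0 v) (d m v)"
        using lc[OF m v] y m v by (simp add: mat_assoc)
      also have "\<dots> = repJ (trunc_rep Q (d 0) (d m) ?R) v"
        using v by (simp add: eqs(4))
      finally show "repJ (stage y m) v = repJ (trunc_rep Q (d 0) (d m) ?R) v" .
    qed
    then show "stage y m = stage (std_chain Q l d ?R) m" using m by simp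
  next
    fix m v assume m: "m < l" and v: "v \<in> verts Q"
    have "link y m v = link y m v * (rect (d m v) (d 0 v) * rect (d 0 v) (d m v))"
      using d_mono[OF le0 less_imp_le[OF m] v] parabolic_pointsD(7)[OF y m v] by simp
    also have "\<dots> = link_comp d y (Suc m) v * rect (d 0 v) (d m v)"
      using lc[of m v] y m v by (simp add: mat_assoc)
    also have "\<dots> = rect (d (Suc m) v) (d m v)"
      using lc[of "Suc m" v] m v d_mono[OF le0 less_imp_le[OF m] v] by (simp del: link_comp.simps)
    finally show "link y m v = link (std_chain Q l d ?R) m v" using m v by simp
  qed
qed

text \<open>
  Bases of all stages in which the maps from stage zero are coordinate projections bring a chain to
  standard form.
\<close>

lemma normal_form:
  assumes x: "x \<in> X" and h: "gauge_family Q l d h"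
    and eq: "\<And>m v. m \<le> l \<Longrightarrow> v \<in> verts Q \<Longrightarrow> h (m, v) * link_comp d x m v = rect (d m v) (d 0 v) * h (0, v)"
  shows "gauge_act Q l d h x = std_chain Q l d (rep_act Q (d 0) (\<lambda>v. h (0, v)) (stage x 0))"
    and "rep_act Q (d 0) (\<lambda>v. h (0, v)) (stage x 0) \<in> split_reps"
proof -
  let ?y = "gauge_act Q l d h x"
  have lc: "link_comp d ?y m v = rect (d m v) (d 0 v)" if "m \<le> l" "v \<in> verts Q" for m v
    using link_comp_gauge_act[OF x h that] eq[OF that] gauge_familyD[OF h le0 that(2)]
    by (simp add: mat_assoc)
  from std_chainI[OF gauge_act_closed[OF x h] lc, unfolded stage_gauge_act[OF le0]]
  show "?y = std_chain Q l d (rep_act Q (d 0) (\<lambda>v. h (0, v)) (stage x 0))"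
    "rep_act Q (d 0) (\<lambda>v. h (0, v)) (stage x 0) \<in> split_reps" by simp_all
qed

lemma orbit_normal_form:
  assumes x: "x \<in> X" and g: "\<And>v. v \<in> verts Q \<Longrightarrow> g v \<in> carrier_mat (d 0 v) (d 0 v)"
    and ex: "\<And>m v. m \<le> l \<Longrightarrow> v \<in> verts Q \<Longrightarrow> \<exists>h \<in> carrier (GL (d m v)). h * link_comp d x m v = rect (d m v) (d 0 v) * g v"
  shows "rep_act Q (d 0) g (stage x 0) \<in> split_reps" "q (std_chain Q l d (rep_act Q (d 0) g (stage x 0))) = q x"
proof -
  obtain h where h: "\<And>m v. m \<le> l \<Longrightarrow> v \<in> verts Q \<Longrightarrow> h m v \<in> carrier (GL (d m v)) \<and> h m v * link_comp d x m v = rect (d m v) (d 0 v) * g v"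
    using ex by metis
  let ?h = "\<lambda>(m, v). h m v"
  have fam: "gauge_family Q l d ?h" using h by (simp add: gauge_family_def)
  have h0: "h 0 v = g v" if "v \<in> verts Q" for v
    using h[OF le0 that] right_mult_one_mat[OF GL_carrier, of "h 0 v" "d 0 v"] left_mult_one_mat[OF g[OF that]]
    by simp
  have eq: "?h (m, v) * link_comp d x m v = rect (d m v) (d 0 v) * ?h (0, v)" if "m \<le> l" "v \<in> verts Q" for m v
    using h[OF that] h0[OF that(2)] by simp
  have "rep_act Q (d 0) (\<lambda>v. ?h (0, v)) (stage x 0) = rep_act Q (d 0) g (stage x 0)"
    using h0 by (auto simp: rep_act_def fun_eq_iff restrict_def)
  with normal_form[OF x fam eq] orbit_gauge_act[OF x fam]
  show "rep_act Q (d 0) g (stage x 0) \<in> split_reps" "q (std_chain Q l d (rep_act Q (d 0) g (stage x 0))) = q x"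
    by simp_all
qed

text \<open>Changing coordinates by a block triangular matrix does not change the orbit of a standard chain.\<close>

lemma orbit_std_chain_parabolic:
  assumes R: "R \<in> split_reps" and p: "\<And>v. v \<in> verts Q \<Longrightarrow> p v \<in> carrier_mat (d 0 v) (d 0 v)"
    and ex: "\<And>m v. m \<le> l \<Longrightarrow> v \<in> verts Q \<Longrightarrow> \<exists>C \<in> carrier (GL (d m v)). rect (d m v) (d 0 v) * p v = C * rect (d m v) (d 0 v)"
  shows "rep_act Q (d 0) p R \<in> split_reps" "q (std_chain Q l d (rep_act Q (d 0) p R)) = q (std_chain Q l d R)"
proof -
  have st: "stage (std_chain Q l d R) 0 = R" by (simp add: trunc_rep_self[OF split_repsD(1)[OF R]])
  have ex': "\<exists>h \<in> carrier (GL (d m v)). h * link_comp d (std_chain Q l d R) m v = rect (d m v) (d 0 v) * p v"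
    if "m \<le> l" "v \<in> verts Q" for m v
    using ex[OF that] by (simp add: link_comp_std_chain[OF that]) metis
  from orbit_normal_form[OF std_chain_in_X[OF R] p ex']
  show "rep_act Q (d 0) p R \<in> split_reps" "q (std_chain Q l d (rep_act Q (d 0) p R)) = q (std_chain Q l d R)"
    by (simp_all add: st)
qed

end

section \<open>Words and coframes\<close>

text \<open>
  A word is a path in the doubled quiver that starts at a framing vector. It assigns to every
  representation the vector that is obtained by transporting the framing vector along the path.
\<close>

inductive word :: "('v, 'e) pre_digraph \<Rightarrow> ('v \<Rightarrow> nat) \<Rightarrow> 'v \<Rightarrow> (('v, 'e) framed_rep \<Rightarrow> complex vec) \<Rightarrow> bool"
  for Q f where
  start: "v \<in> verts Q \<Longrightarrow> c < f v \<Longrightarrow> word Q f v (\<lambda>R. col (repI R v) c)"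
| stepA: "e \<in> arcs Q \<Longrightarrow> word Q f (tail Q e) w \<Longrightarrow> word Q f (head Q e) (\<lambda>R. repA R e *\<^sub>v w R)"
| stepB: "e \<in> arcs Q \<Longrightarrow> word Q f (head Q e) w \<Longrightarrow> word Q f (tail Q e) (\<lambda>R. repB R e *\<^sub>v w R)"

lemma word_carrier:
  assumes "word Q f v w" "R \<in> framed_reps Q d f"
  shows "w R \<in> carrier_vec (d v)"
  using assms(1)
proof induction
  case (start v c)
  then show ?case using framed_repsD(3)[OF assms(2)] by auto
next
  case (stepA e w)
  then show ?case using framed_reps_dim[OF assms(2)] by (intro carrier_vecI) simp
next
  case (stepB e w)
  then show ?case using framed_reps_dim[OF assms(2)] by (intro carrier_vecI) simp
qed

lemma mat_of_cols_map_mult: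
  fixes M :: "complex mat"
  assumes "M \<in> carrier_mat m n" "\<And>w. w \<in> set ws \<Longrightarrow> a w \<in> carrier_vec n" "\<And>w. w \<in> set ws \<Longrightarrow> b w = M *\<^sub>v a w"
  shows "M * mat_of_cols n (map a ws) = mat_of_cols m (map b ws)"
proof (rule mat_col_eqI)
  fix i assume "i < dim_col (mat_of_cols m (map b ws))"
  then have i: "i < length ws" by simp
  have b: "b (ws ! i) \<in> carrier_vec m" using assms i by (auto intro!: carrier_vecI)
  have "col (M * mat_of_cols n (map a ws)) i = M *\<^sub>v col (mat_of_cols n (map a ws)) i"
    using i by (intro col_mult2[OF assms(1)]) auto
  also have "col (mat_of_cols n (map a ws)) i = a (ws ! i)"
    using i assms(2) by (subst col_mat_of_cols) auto
  also have "M *\<^sub>v \<dots> = b (ws ! i)" using assms(3) i by simp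
  also have "\<dots> = col (mat_of_cols m (map b ws)) i"
    using i b by (subst col_mat_of_cols) auto
  finally show "col (M * mat_of_cols n (map a ws)) i = col (mat_of_cols m (map b ws)) i" .
qed (use assms in auto)

context fin_digraph
begin

text \<open>
  Words commute with homomorphisms of framed representations. This gives the equivariance of words under
  the gauge group as well as their compatibility with the links.
\<close>

lemma word_natural:
  assumes R: "R \<in> framed_reps G d f" and S: "S \<in> framed_reps G d' f"
    and M: "\<And>v. v \<in> verts G \<Longrightarrow> M v \<in> carrier_mat (d' v) (d v)"
    and A: "\<And>e. e \<in> arcs G \<Longrightarrow> M (head G e) * repA R e = repA S e * M (tail G e)"
    and B: "\<And>e. e \<in> arcs G \<Longrightarrow> M (tail G e) * repB R e = repB S e * M (head G e)"
    and I: "\<And>v. v \<in> verts G \<Longrightarrow> M v * repI R v = repI S v"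
    and w: "word G f v w"
  shows "M v *\<^sub>v w R = w S"
  using w
proof induction
  case (start v c)
  have "col (M v * repI R v) c = M v *\<^sub>v col (repI R v) c"
    using start framed_repsD(3)[OF R] by (intro col_mult2[OF M]) auto
  then show ?case using I[OF start(1)] by simp
next
  case (stepA e w)
  note vs = head_in_verts[OF stepA(1)] tail_in_verts[OF stepA(1)]
  note wR = word_carrier[OF stepA(2) R]
  have "M (head G e) *\<^sub>v (repA R e *\<^sub>v w R) = (M (head G e) * repA R e) *\<^sub>v w R"
    using M[OF vs(1)] framed_repsD(1)[OF R stepA(1)] wR by simp
  also have "\<dots> = repA S e *\<^sub>v (M (tail G e) *\<^sub>v w R)"
    unfolding A[OF stepA(1)] using M[OF vs(2)] framed_repsD(1)[OF S stepA(1)] wR by simp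
  finally show ?case using stepA.IH by simp
next
  case (stepB e w)
  note vs = head_in_verts[OF stepB(1)] tail_in_verts[OF stepB(1)]
  note wR = word_carrier[OF stepB(2) R]
  have "M (tail G e) *\<^sub>v (repB R e *\<^sub>v w R) = (M (tail G e) * repB R e) *\<^sub>v w R"
    using M[OF vs(2)] framed_repsD(2)[OF R stepB(1)] wR by simp
  also have "\<dots> = repB S e *\<^sub>v (M (head G e) *\<^sub>v w R)"
    unfolding B[OF stepB(1)] using M[OF vs(1)] framed_repsD(2)[OF S stepB(1)] wR by simp
  finally show ?case using stepB.IH by simp
qed

text \<open>
  The span of the words is the smallest subrepresentation that contains the framing, so stability makes
  it everything.
\<close>

lemma words_span:
  assumes R: "R \<in> framed_reps G d f" and st: "stable G d f R" and v: "v \<in> verts G"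
    and U: "is_subspace (d v) U" "{w R |w. word G f v w} \<subseteq> U"
  shows "U = carrier_vec (d v)"
proof -
  let ?S = "\<lambda>v. {w R |w. word G f v w}"
  let ?W = "\<lambda>v. {x \<in> carrier_vec (d v). \<forall>U. is_subspace (d v) U \<longrightarrow> ?S v \<subseteq> U \<longrightarrow> x \<in> U}"
  have least: "x \<in> U" if "x \<in> ?W v" "is_subspace (d v) U" "?S v \<subseteq> U" for x v U using that by blast
  have mem: "w R \<in> ?W v" if "word G f v w" for v w
    using that word_carrier[OF that R] by blast
  have sub: "is_subspace (d v) (?W v)" for v
    unfolding is_subspace_iff[of "?W v" "d v"]
  proof (intro conjI ballI allI)
    show "?W v \<subseteq> carrier_vec (d v)" by blast
    show "0\<^sub>v (d v) \<in> ?W v" by (simp add: is_subspace_iff)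
    show "x + y \<in> ?W v" if "x \<in> ?W v" "y \<in> ?W v" for x y
    proof -
      have "x + y \<in> U" if U: "is_subspace (d v) U" "?S v \<subseteq> U" for U
        using least[OF \<open>x \<in> ?W v\<close> U] least[OF \<open>y \<in> ?W v\<close> U] U(1) by (simp add: is_subspace_iff)
      moreover have "x + y \<in> carrier_vec (d v)" using that by simp
      ultimately show ?thesis by simp
    qed
    show "c \<cdot>\<^sub>v x \<in> ?W v" if "x \<in> ?W v" for c x
    proof -
      have "c \<cdot>\<^sub>v x \<in> U" if U: "is_subspace (d v) U" "?S v \<subseteq> U" for U
        using least[OF \<open>x \<in> ?W v\<close> U] U(1) by (simp add: is_subspace_iff)
      then show ?thesis using that by simp
    qed
  qed
  have "?W v = carrier_vec (d v)"
  proof (rule stableD[OF st v, of ?W])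
    fix v assume v: "v \<in> verts G"
    show "is_subspace (d v) (?W v)" by (rule sub)
    fix x :: "complex vec" assume x: "x \<in> carrier_vec (f v)"
    note Ic = framed_repsD(3)[OF R v]
    have "set (cols (repI R v)) \<subseteq> ?W v"
    proof
      fix y assume "y \<in> set (cols (repI R v))"
      then obtain c where "c < f v" "y = col (repI R v) c"
        using Ic by (auto simp: cols_def)
      then show "y \<in> ?W v" using mem[OF start[OF v], of c] by simp
    qed
    from colsp_least[OF sub this] show "repI R v *\<^sub>v x \<in> ?W v"
      using colspI[of x "repI R v"] Ic x mat_of_cols_cols[of "repI R v"] by auto
  next
    fix e x assume e: "e \<in> arcs G" and x: "x \<in> ?W (tail G e)"
    note Ac = framed_repsD(1)[OF R e]
    have "repA R e *\<^sub>v x \<in> U" if U: "is_subspace (d (head G e)) U" "?S (head G e) \<subseteq> U" for U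
    proof -
      have "x \<in> {x \<in> carrier_vec (d (tail G e)). repA R e *\<^sub>v x \<in> U}"
        by (rule least[OF x is_subspace_vimage[OF U(1) Ac refl]])
          (use U(2) stepA[OF e] word_carrier[OF _ R] in blast)
      then show ?thesis by simp
    qed
    then show "repA R e *\<^sub>v x \<in> ?W (head G e)" using Ac by (auto intro!: carrier_vecI)
  next
    fix e x assume e: "e \<in> arcs G" and x: "x \<in> ?W (head G e)"
    note Bc = framed_repsD(2)[OF R e]
    have "repB R e *\<^sub>v x \<in> U" if U: "is_subspace (d (tail G e)) U" "?S (tail G e) \<subseteq> U" for U
    proof -
      have "x \<in> {x \<in> carrier_vec (d (head G e)). repB R e *\<^sub>v x \<in> U}"
        by (rule least[OF x is_subspace_vimage[OF U(1) Bc refl]])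
          (use U(2) stepB[OF e] word_carrier[OF _ R] in blast)
      then show ?thesis by simp
    qed
    then show "repB R e *\<^sub>v x \<in> ?W (tail G e)" using Bc by (auto intro!: carrier_vecI)
  qed
  then have "carrier_vec (d v) \<subseteq> U" using least[OF _ U] by blast
  then show ?thesis using U(1) by (auto simp: is_subspace_iff)
qed

lemma words_extend_basis:
  assumes R: "R \<in> framed_reps G d f" and st: "stable G d f R" and v: "v \<in> verts G"
    and bs: "indep (d v) bs"
  shows "\<exists>ws. (\<forall>w\<in>set ws. word G f v w) \<and> length bs + length ws = d v \<and> indep (d v) (bs @ map (\<lambda>w. w R) ws)"
proof -
  let ?n = "d v" and ?S = "{w R |w. word G f v w}"
  let ?cs = "cols (1\<^sub>m ?n :: complex mat)"
  have id: "indep ?n ?cs" "length ?cs = ?n"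
    using inj_mat_cols[of "1\<^sub>m ?n" ?n ?n] GL_inj_mat[OF GL_one_closed] by auto
  have "\<exists>ss. set ss \<subseteq> ?S \<and> length bs + length ss = length ?cs \<and> indep ?n (bs @ ss)"
  proof (rule indep_extend[OF bs id(1)])
    show "length bs \<le> length ?cs" using indep_length[OF bs] id(2) by simp
    show "?S \<subseteq> carrier_vec ?n" using word_carrier[OF _ R] by blast
    fix as :: "complex vec list" assume "set as \<subseteq> carrier_vec ?n" "?S \<subseteq> colsp (mat_of_cols ?n as)"
    then have "colsp (mat_of_cols ?n as) = carrier_vec ?n"
      using words_span[OF R st v is_subspace_colsp[of "mat_of_cols ?n as" ?n "length as"]] by auto
    then show "set ?cs \<subseteq> colsp (mat_of_cols ?n as)" using id(1) by (simp add: indep_def)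
  qed
  then obtain ss where ss: "set ss \<subseteq> ?S" "length bs + length ss = ?n" "indep ?n (bs @ ss)"
    using id(2) by auto
  have "\<forall>s\<in>set ss. \<exists>w. word G f v w \<and> s = w R" using ss(1) by blast
  then obtain F where F: "\<forall>s\<in>set ss. word G f v (F s) \<and> s = F s R" by metis
  have "map (\<lambda>w. w R) (map F ss) = ss" using F by (simp add: map_idI)
  then show ?thesis using ss F by (intro exI[of _ "map F ss"]) auto
qed

lemma word_rep_act:
  assumes g: "\<And>v. v \<in> verts G \<Longrightarrow> g v \<in> carrier (GL (d v))" and R: "R \<in> framed_reps G d f"
    and w: "word G f v w"
  shows "w (rep_act G d g R) = g v *\<^sub>v w R"
proof (rule word_natural[OF R rep_act_framed[OF g R] _ _ _ _ w, symmetric])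
  fix e assume e: "e \<in> arcs G"
  note gg = g[OF head_in_verts[OF e]] g[OF tail_in_verts[OF e]]
  show "g (head G e) * repA R e = repA (rep_act G d g R) e * g (tail G e)"
    using gg e R right_mult_one_mat[OF framed_repsD(1)[OF R e]] by (simp add: mat_assoc)
  show "g (tail G e) * repB R e = repB (rep_act G d g R) e * g (head G e)"
    using gg e R right_mult_one_mat[OF framed_repsD(2)[OF R e]] by (simp add: mat_assoc)
qed (use g in auto)

lemma regular_word:
  assumes X: "space_with_functions X" and R: "\<And>z. z \<in> points X \<Longrightarrow> R z \<in> framed_reps G d f"
    and A: "\<And>e. e \<in> arcs G \<Longrightarrow> regular_mat X (d (head G e)) (d (tail G e)) (\<lambda>z. repA (R z) e)"
    and B: "\<And>e. e \<in> arcs G \<Longrightarrow> regular_mat X (d (tail G e)) (d (head G e)) (\<lambda>z. repB (R z) e)"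
    and I: "\<And>v. v \<in> verts G \<Longrightarrow> regular_mat X (d v) (f v) (\<lambda>z. repI (R z) v)"
    and w: "word G f v w"
  shows "regular_mat X (d v) 1 (\<lambda>z. mat_of_cols (d v) [w (R z)])"
proof -
  interpret X: space_with_functions X by fact
  show ?thesis
    using w
  proof induction
    case (start v c)
    show ?case
    proof (rule regular_matI)
      fix i j :: nat assume "i < d v" "j < 1"
      then show "(\<lambda>z. mat_of_cols (d v) [col (repI (R z) v) c] $$ (i, j)) \<in> reg X (points X)"
        using start regular_mat_dim[OF I[OF start(1)]]
        by (intro X.reg_cong[OF regular_matD(2)[OF I[OF start(1)], of i c]]) (auto simp: mat_of_cols_index)
    qed auto
  next
    case (stepA e w)
    show ?case
    proof (rule X.regular_mat_cong[OF X.regular_mat_mult[OF A[OF stepA(1)] stepA.IH]])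
      fix z assume "z \<in> points X"
      from R[OF this] show "mat_of_cols (d (head G e)) [repA (R z) e *\<^sub>v w (R z)] =
          repA (R z) e * mat_of_cols (d (tail G e)) [w (R z)]"
        using mat_of_cols_map_mult[of "repA (R z) e" "d (head G e)" "d (tail G e)" "[w]" "\<lambda>w. w (R z)"
            "\<lambda>w. repA (R z) e *\<^sub>v w (R z)"] framed_repsD(1)[OF _ stepA(1)] word_carrier[OF stepA(2)]
        by auto
    qed
  next
    case (stepB e w)
    show ?case
    proof (rule X.regular_mat_cong[OF X.regular_mat_mult[OF B[OF stepB(1)] stepB.IH]])
      fix z assume "z \<in> points X"
      from R[OF this] show "mat_of_cols (d (tail G e)) [repB (R z) e *\<^sub>v w (R z)] =
          repB (R z) e * mat_of_cols (d (head G e)) [w (R z)]"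
        using mat_of_cols_map_mult[of "repB (R z) e" "d (tail G e)" "d (head G e)" "[w]" "\<lambda>w. w (R z)"
            "\<lambda>w. repB (R z) e *\<^sub>v w (R z)"] framed_repsD(2)[OF _ stepB(1)] word_carrier[OF stepB(2)]
        by auto
    qed
  qed
qed

end

context dim_chain
begin

lemma regular_stage:
  assumes m: "m \<le> l"
  shows "e \<in> arcs Q \<Longrightarrow> regular_mat XS (d m (head Q e)) (d m (tail Q e)) (\<lambda>x. repA (stage x m) e)"
    and "e \<in> arcs Q \<Longrightarrow> regular_mat XS (d m (tail Q e)) (d m (head Q e)) (\<lambda>x. repB (stage x m) e)"
    and "v \<in> verts Q \<Longrightarrow> regular_mat XS (d m v) (f v) (\<lambda>x. repI (stage x m) v)"
    and "v \<in> verts Q \<Longrightarrow> regular_mat XS (f v) (d m v) (\<lambda>x. repJ (stage x m) v)"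
proof -
  have c: "c \<in> chain_coords Q l d f \<Longrightarrow> c \<in> reg XS (points XS)" for c
    using reg_zariski_coord[of c "chain_coords Q l d f" X] by (simp add: parabolic_space_def)
  show "e \<in> arcs Q \<Longrightarrow> regular_mat XS (d m (head Q e)) (d m (tail Q e)) (\<lambda>x. repA (stage x m) e)"
  proof (rule regular_matI)
    fix r s assume "e \<in> arcs Q" "r < d m (head Q e)" "s < d m (tail Q e)"
    then have "(\<lambda>x. repA (stage x m) e $$ (r, s)) \<in> chain_coords Q l d f"
      unfolding chain_coords_def using m by (intro UnI1) blast
    then show "(\<lambda>x. repA (stage x m) e $$ (r, s)) \<in> reg XS (points XS)" by (rule c)
  qed (use framed_repsD(1)[OF parabolic_pointsD(4)[OF _ m]] points_XS in auto)
  show "e \<in> arcs Q \<Longrightarrow> regular_mat XS (d m (tail Q e)) (d m (head Q e)) (\<lambda>x. repB (stage x m) e)"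
  proof (rule regular_matI)
    fix r s assume "e \<in> arcs Q" "r < d m (tail Q e)" "s < d m (head Q e)"
    then have "(\<lambda>x. repB (stage x m) e $$ (r, s)) \<in> chain_coords Q l d f"
      unfolding chain_coords_def using m by (intro UnI1 UnI2[of _ "_ :: ('a set)"]) blast
    then show "(\<lambda>x. repB (stage x m) e $$ (r, s)) \<in> reg XS (points XS)" by (rule c)
  qed (use framed_repsD(2)[OF parabolic_pointsD(4)[OF _ m]] points_XS in auto)
  show "v \<in> verts Q \<Longrightarrow> regular_mat XS (d m v) (f v) (\<lambda>x. repI (stage x m) v)"
  proof (rule regular_matI)
    fix r s assume "v \<in> verts Q" "r < d m v" "s < f v"
    then have "(\<lambda>x. repI (stage x m) v $$ (r, s)) \<in> chain_coords Q l d f"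
      unfolding chain_coords_def using m by blast
    then show "(\<lambda>x. repI (stage x m) v $$ (r, s)) \<in> reg XS (points XS)" by (rule c)
  qed (use framed_repsD(3)[OF parabolic_pointsD(4)[OF _ m]] points_XS in auto)
  show "v \<in> verts Q \<Longrightarrow> regular_mat XS (f v) (d m v) (\<lambda>x. repJ (stage x m) v)"
  proof (rule regular_matI)
    fix r s assume "v \<in> verts Q" "r < f v" "s < d m v"
    then have "(\<lambda>x. repJ (stage x m) v $$ (r, s)) \<in> chain_coords Q l d f"
      unfolding chain_coords_def using m by blast
    then show "(\<lambda>x. repJ (stage x m) v $$ (r, s)) \<in> reg XS (points XS)" by (rule c)
  qed (use framed_repsD(4)[OF parabolic_pointsD(4)[OF _ m]] points_XS in auto)
qed

lemma regular_link:
  assumes m: "m < l" and v: "v \<in> verts Q"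
  shows "regular_mat XS (d (Suc m) v) (d m v) (\<lambda>x. link x m v)"
proof (rule regular_matI)
  fix r s assume "r < d (Suc m) v" "s < d m v"
  then have "(\<lambda>x. link x m v $$ (r, s)) \<in> chain_coords Q l d f"
    unfolding chain_coords_def using m v by blast
  then show "(\<lambda>x. link x m v $$ (r, s)) \<in> reg XS (points XS)"
    using reg_zariski_coord[of _ "chain_coords Q l d f" X] by (simp add: parabolic_space_def)
qed (use parabolic_pointsD(7)[OF _ m v] points_XS in auto)

lemma regular_link_comp:
  assumes "m \<le> l" "v \<in> verts Q"
  shows "regular_mat XS (d m v) (d 0 v) (\<lambda>x. link_comp d x m v)"
  using assms(1)
proof (induction m)
  case 0
  then show ?case by (simp add: space_with_functions.regular_mat_const[OF XS])
next
  case (Suc m)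
  then show ?case
    using space_with_functions.regular_mat_mult[OF XS regular_link[OF _ assms(2), of m]] by simp
qed

lemma regular_word_stage:
  assumes "m \<le> l" "\<forall>w\<in>set ws. word Q f v w"
  shows "regular_mat XS (d m v) (length ws) (\<lambda>x. mat_of_cols (d m v) (map (\<lambda>w. w (stage x m)) ws))"
proof -
  interpret S: space_with_functions XS by (rule XS)
  have w: "regular_mat XS (d m v) 1 (\<lambda>x. mat_of_cols (d m v) [w (stage x m)])" if "word Q f v w" for w
    by (rule regular_word[OF XS _ regular_stage(1-3)[OF assms(1)] that])
      (use parabolic_pointsD(4)[OF _ assms(1)] points_XS in auto)
  have "regular_mat XS (d m v) (length ws)
      (\<lambda>x. mat (d m v) (length ws) (\<lambda>(i, j). mat_of_cols (d m v) [(ws ! j) (stage x m)] $$ (i, 0)))"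
    by (rule S.regular_mat_cols[of _ _ "\<lambda>_. 1" _ "\<lambda>_. 0"]) (use w assms(2) in auto)
  then show ?thesis
    by (rule S.regular_mat_cong) (auto intro!: eq_matI simp: mat_of_cols_index)
qed

text \<open>
  Near any point there are coordinates \<open>\<Lambda>\<close> on the spaces of stage zero that depend regularly on the
  point, transform under the gauge group like a coframe, and in which the map to the last stage is the
  projection to the first coordinates. Words provide them: some of them form a basis of the last
  stage, and together with further ones a basis of stage zero; the first coordinates are taken with
  respect to the former basis, the other ones with respect to the latter.
\<close>

lemma coframe_exists:
  assumes x0: "x0 \<in> X"
  shows "\<exists>U \<Lambda>. openin (topo XS) U \<and> x0 \<in> U \<and>
    (\<forall>x\<in>U. \<forall>h. gauge_family Q l d h \<longrightarrow> gauge_act Q l d h x \<in> U) \<and>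
    (\<forall>v\<in>verts Q. regular_mat (fs_open_sub XS U) (d 0 v) (d 0 v) (\<Lambda> v)) \<and>
    (\<forall>x\<in>U. \<forall>v\<in>verts Q. \<Lambda> v x \<in> carrier (GL (d 0 v)) \<and>
       (\<exists>P \<in> carrier (GL (d l v)). P * link_comp d x l v = rect (d l v) (d 0 v) * \<Lambda> v x)) \<and>
    (\<forall>x\<in>U. \<forall>h. gauge_family Q l d h \<longrightarrow>
       (\<forall>v\<in>verts Q. \<Lambda> v (gauge_act Q l d h x) = \<Lambda> v x * gl_inv (d 0 v) (h (0, v))))"
proof -
  interpret S: space_with_functions XS by (rule XS)
  have stg: "stage x m \<in> framed_reps Q (d m) f" if "x \<in> X" "m \<le> l" for x m
    using parabolic_pointsD(4) that by blast
  have push: "w (stage x l) = link_comp d x l v *\<^sub>v w (stage x 0)" if "x \<in> X" "word Q f v w" "v \<in> verts Q" for x v w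
    by (rule word_natural[symmetric, OF stg[OF that(1) le0] stg[OF that(1) order_refl], where v = v])
      (use link_comp_eqs[OF that(1) order_refl] link_comp_carrier[OF that(1) order_refl] that in auto)
  have "\<exists>ws. length ws = d 0 v \<and> (\<forall>w\<in>set ws. word Q f v w) \<and>
      indep (d 0 v) (map (\<lambda>w. w (stage x0 0)) ws) \<and>
      indep (d l v) (map (\<lambda>w. w (stage x0 l)) (take (d l v) ws))" if v: "v \<in> verts Q" for v
  proof -
    obtain us where us: "\<forall>w\<in>set us. word Q f v w" "length us = d l v" "indep (d l v) (map (\<lambda>w. w (stage x0 l)) us)"
      using words_extend_basis[OF stg[OF x0 order_refl] parabolic_pointsD(5)[OF x0 order_refl] v indep_Nil] by auto
    let ?b = "map (\<lambda>w. w (stage x0 0)) us"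
    have eq: "link_comp d x0 l v * mat_of_cols (d 0 v) ?b = mat_of_cols (d l v) (map (\<lambda>w. w (stage x0 l)) us)"
      by (rule mat_of_cols_map_mult[OF link_comp_carrier[OF x0 order_refl v]])
        (use us(1) word_carrier[OF _ stg[OF x0 le0]] push[OF x0 _ v] in auto)
    have "inj_mat (link_comp d x0 l v * mat_of_cols (d 0 v) ?b)"
      unfolding eq using us(3) by (simp add: indep_def)
    then have "inj_mat (mat_of_cols (d 0 v) ?b)"
      by (rule inj_mat_mult_rightD) (use x0 v in simp)
    then have "indep (d 0 v) ?b"
      using us(1) word_carrier[OF _ stg[OF x0 le0]] by (auto simp: indep_def)
    from words_extend_basis[OF stg[OF x0 le0] parabolic_pointsD(5)[OF x0 le0] v this]
    obtain ws where "\<forall>w\<in>set ws. word Q f v w" "length us + length ws = d 0 v"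
      "indep (d 0 v) (?b @ map (\<lambda>w. w (stage x0 0)) ws)" by auto
    then show ?thesis using us by (intro exI[of _ "us @ ws"]) auto
  qed
  then obtain ws where ws: "\<And>v. v \<in> verts Q \<Longrightarrow> length (ws v) = d 0 v \<and> (\<forall>w\<in>set (ws v). word Q f v w) \<and>
      indep (d 0 v) (map (\<lambda>w. w (stage x0 0)) (ws v)) \<and>
      indep (d l v) (map (\<lambda>w. w (stage x0 l)) (take (d l v) (ws v)))" by metis
  define T where "T v x = mat_of_cols (d 0 v) (map (\<lambda>w. w (stage x 0)) (ws v))" for v and x :: "('v, 'e) chain_rep"
  define P where "P v x = mat_of_cols (d l v) (map (\<lambda>w. w (stage x l)) (take (d l v) (ws v)))" for v and x :: "('v, 'e) chain_rep"
  define Pr where "Pr v x = gl_inv (d l v) (P v x) * link_comp d x l v" for v and x :: "('v, 'e) chain_rep"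
  define \<Lambda> where "\<Lambda> v x = mat (d 0 v) (d 0 v) (\<lambda>(i, j).
      if i < d l v then Pr v x $$ (i, j) else gl_inv (d 0 v) (T v x) $$ (i, j))" for v and x :: "('v, 'e) chain_rep"
  define U where "U = {x \<in> X. \<forall>v\<in>verts Q. T v x \<in> carrier (GL (d 0 v)) \<and> P v x \<in> carrier (GL (d l v))}"
  have dl: "d l v \<le> d 0 v" if "v \<in> verts Q" for v using d_mono[OF le0 order_refl that] .
  have lent: "length (take (d l v) (ws v)) = d l v" if "v \<in> verts Q" for v
    using ws[OF that] dl[OF that] by simp
  have wt: "word Q f v w" if "v \<in> verts Q" "w \<in> set (take (d l v) (ws v)) \<or> w \<in> set (ws v)" for v w
    using ws[OF that(1)] that(2) by (auto dest: in_set_takeD)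
  have Tc: "T v x \<in> carrier_mat (d 0 v) (d 0 v)" if "v \<in> verts Q" for v x
    using ws[OF that] by (auto simp: T_def)
  have Pc: "P v x \<in> carrier_mat (d l v) (d l v)" if "v \<in> verts Q" for v x
  proof -
    have "P v x \<in> carrier_mat (d l v) (length (map (\<lambda>w. w (stage x l)) (take (d l v) (ws v))))"
      unfolding P_def by (rule mat_of_cols_carrier(1))
    then show ?thesis by (simp only: length_map lent[OF that])
  qed
  have Treg: "regular_mat XS (d 0 v) (d 0 v) (T v)" if "v \<in> verts Q" for v
    using regular_word_stage[OF le0, of "ws v" v] ws[OF that] by (simp add: T_def[abs_def])
  have Preg: "regular_mat XS (d l v) (d l v) (P v)" if "v \<in> verts Q" for v
    using regular_word_stage[OF order_refl, of "take (d l v) (ws v)" v] wt[OF that] lent[OF that]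
    by (simp add: P_def[abs_def])
  \<comment> \<open>the words in the last stage are the images of the words in stage zero\<close>
  have PT: "link_comp d x l v * T v x * rect (d 0 v) (d l v) = P v x" if x: "x \<in> X" and v: "v \<in> verts Q" for x v
  proof -
    have "T v x * rect (d 0 v) (d l v) = mat_of_cols (d 0 v) (take (d l v) (map (\<lambda>w. w (stage x 0)) (ws v)))"
      unfolding T_def using ws[OF v] dl[OF v] by (intro mat_of_cols_rect) auto
    then have "link_comp d x l v * (T v x * rect (d 0 v) (d l v)) = P v x"
      unfolding P_def take_map using word_carrier[OF wt[OF v] stg[OF x le0]] push[OF x wt[OF v] v]
      by (simp only:) (rule mat_of_cols_map_mult[OF link_comp_carrier[OF x order_refl v]]; blast)
    then show ?thesis using carrier_matD[OF Tc[OF v, of x]] x v by (simp add: mat_assoc)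
  qed
  have oU: "openin (topo XS) U"
  proof -
    have "U = X \<inter> (\<Inter>v\<in>verts Q. {x \<in> points XS. T v x \<in> carrier (GL (d 0 v))} \<inter> {x \<in> points XS. P v x \<in> carrier (GL (d l v))})"
      by (auto simp: U_def points_XS)
    moreover have "openin (topo XS) (X \<inter> (\<Inter>v\<in>verts Q. {x \<in> points XS. T v x \<in> carrier (GL (d 0 v))} \<inter> {x \<in> points XS. P v x \<in> carrier (GL (d l v))}))"
    proof (cases "verts Q = {}")
      case True
      then show ?thesis using openin_topspace[of "topo XS"] by (simp add: points_XS)
    next
      case False
      have "openin (topo XS) (\<Inter>v\<in>verts Q. {x \<in> points XS. T v x \<in> carrier (GL (d 0 v))} \<inter> {x \<in> points XS. P v x \<in> carrier (GL (d l v))})"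
        using False by (intro openin_Inter) (auto intro!: openin_Int S.openin_GL Treg Preg)
      then show ?thesis using openin_Int[OF openin_topspace[of "topo XS"]] by (simp add: points_XS)
    qed
    ultimately show ?thesis by simp
  qed
  have pU: "points (fs_open_sub XS U) = U" by (rule points_open_sub_open[OF oU])
  interpret SU: space_with_functions "fs_open_sub XS U" by (rule space_with_functions_open_sub[OF XS oU])
  have x0U: "x0 \<in> U"
    unfolding U_def
  proof (intro CollectI conjI ballI)
    show "x0 \<in> X" by fact
    fix v assume v: "v \<in> verts Q"
    show "T v x0 \<in> carrier (GL (d 0 v))"
      using ws[OF v] Tc[OF v] by (intro inj_mat_square) (auto simp: T_def indep_def)
    show "P v x0 \<in> carrier (GL (d l v))"
      using ws[OF v] Pc[OF v] by (intro inj_mat_square) (auto simp: P_def indep_def)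
  qed
  have UD: "x \<in> X" "T v x \<in> carrier (GL (d 0 v))" "P v x \<in> carrier (GL (d l v))" if "x \<in> U" "v \<in> verts Q" for x v
    using that by (auto simp: U_def)
  have Prc: "Pr v x \<in> carrier_mat (d l v) (d 0 v)" if "x \<in> U" "v \<in> verts Q" for x v
    unfolding Pr_def using UD[OF that] link_comp_carrier[OF UD(1)[OF that] order_refl that(2)]
    by (intro mult_carrier_mat) auto
  have \<Lambda>c: "\<Lambda> v x \<in> carrier_mat (d 0 v) (d 0 v)" for v x by (simp add: \<Lambda>_def)
  have \<Lambda>reg: "regular_mat (fs_open_sub XS U) (d 0 v) (d 0 v) (\<Lambda> v)" if v: "v \<in> verts Q" for v
  proof (rule regular_matI)
    note res = regular_mat_open_sub[OF XS oU]
    have Prreg: "regular_mat (fs_open_sub XS U) (d l v) (d 0 v) (Pr v)"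
      unfolding Pr_def
      by (rule SU.regular_mat_mult[OF SU.regular_gl_inv[OF res[OF Preg[OF v]]] res[OF regular_link_comp[OF order_refl v]]])
        (use UD v pU in auto)
    have TIreg: "regular_mat (fs_open_sub XS U) (d 0 v) (d 0 v) (\<lambda>x. gl_inv (d 0 v) (T v x))"
      by (rule SU.regular_gl_inv[OF res[OF Treg[OF v]]]) (use UD v pU in auto)
    fix i j assume ij: "i < d 0 v" "j < d 0 v"
    show "(\<lambda>x. \<Lambda> v x $$ (i, j)) \<in> reg (fs_open_sub XS U) (points (fs_open_sub XS U))"
      using regular_matD(2)[OF Prreg, of i j] regular_matD(2)[OF TIreg, of i j] ij
      by (cases "i < d l v") (simp_all add: \<Lambda>_def)
  qed (rule \<Lambda>c)
  have rect\<Lambda>: "rect (d l v) (d 0 v) * \<Lambda> v x = Pr v x" if "x \<in> U" "v \<in> verts Q" for x v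
  proof (rule eq_matI)
    fix i j assume "i < dim_row (Pr v x)" "j < dim_col (Pr v x)"
    then have ij: "i < d l v" "j < d 0 v" using Prc[OF that] by auto
    then show "(rect (d l v) (d 0 v) * \<Lambda> v x) $$ (i, j) = Pr v x $$ (i, j)"
      using rect_mult_index[OF \<Lambda>c, of i "d l v" j v x] dl[OF that(2)] by (simp add: \<Lambda>_def)
  qed (use Prc[OF that] \<Lambda>c in auto)
  \<comment> \<open>in the basis of words the coframe is upper unitriangular\<close>
  have \<Lambda>T: "(\<Lambda> v x * T v x) $$ (i, j) = (if i = j then 1 else 0)"
    if x: "x \<in> U" and v: "v \<in> verts Q" and ij: "i < d 0 v" "j < d 0 v" "d l v \<le> i \<or> j < d l v" for x v i j
  proof -
    note x' = UD[OF x v]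
    have "(\<Lambda> v x * T v x) $$ (i, j) = (\<Sum>k<d 0 v. \<Lambda> v x $$ (i, k) * T v x $$ (k, j))"
      using ij by (intro mat_mult_index[OF \<Lambda>c Tc[OF v]]) auto
    also have "\<dots> = (if i = j then 1 else 0)"
    proof (cases "i < d l v")
      case True
      then have j: "j < d l v" using ij by simp
      have "(\<Sum>k<d 0 v. \<Lambda> v x $$ (i, k) * T v x $$ (k, j)) = (Pr v x * T v x) $$ (i, j)"
        using True ij by (subst mat_mult_index[OF Prc[OF x v] Tc[OF v]]) (auto simp: \<Lambda>_def intro!: sum.cong)
      also have "\<dots> = (Pr v x * T v x * rect (d 0 v) (d l v)) $$ (i, j)"
        using True j ij Prc[OF x v] Tc[OF v] by (subst mult_rect_index[of _ "d l v"]) auto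
      also have "Pr v x * T v x * rect (d 0 v) (d l v) = gl_inv (d l v) (P v x) * P v x"
        unfolding PT[OF x'(1) v, symmetric] Pr_def
        using x' carrier_matD[OF Tc[OF v, of x]] carrier_matD[OF Pc[OF v, of x]] v PT[OF x'(1) v] by (simp add: mat_assoc)
      finally show ?thesis using x' True j by simp
    next
      case False
      have "(\<Sum>k<d 0 v. \<Lambda> v x $$ (i, k) * T v x $$ (k, j)) = (gl_inv (d 0 v) (T v x) * T v x) $$ (i, j)"
        using False ij x' by (subst mat_mult_index[OF gl_inv_carrier Tc[OF v]]) (auto simp: \<Lambda>_def intro!: sum.cong)
      then show ?thesis using x' ij by simp
    qed
    finally show ?thesis .
  qed
  have \<Lambda>GL: "\<Lambda> v x \<in> carrier (GL (d 0 v))" if x: "x \<in> U" and v: "v \<in> verts Q" for x v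
  proof -
    have LTc: "\<Lambda> v x * T v x \<in> carrier_mat (d 0 v) (d 0 v)" using \<Lambda>c Tc[OF v] by (rule mult_carrier_mat)
    have "upper_triangular (\<Lambda> v x * T v x)"
    proof (rule upper_triangularI)
      fix i j assume ij: "j < i" "i < dim_row (\<Lambda> v x * T v x)"
      then have "i < d 0 v" using carrier_matD[OF LTc] by (simp del: index_mult_mat(2))
      moreover have "d l v \<le> i \<or> j < d l v" using ij(1) by linarith
      ultimately show "(\<Lambda> v x * T v x) $$ (i, j) = 0"
        using \<Lambda>T[OF x v, of i j] ij(1) by (simp del: index_mult_mat(1))
    qed
    then have "det (\<Lambda> v x * T v x) = prod_list (diag_mat (\<Lambda> v x * T v x))"
      using LTc by (rule det_upper_triangular)
    also have "diag_mat (\<Lambda> v x * T v x) = map (\<lambda>_. 1) [0..<d 0 v]"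
    proof -
      have "(\<Lambda> v x * T v x) $$ (i, i) = 1" if "i < d 0 v" for i
        using \<Lambda>T[OF x v that that] by (cases "d l v \<le> i") (simp_all del: index_mult_mat(1))
      then show ?thesis unfolding diag_mat_def carrier_matD[OF LTc] by (auto simp del: index_mult_mat(1))
    qed
    finally have "det (\<Lambda> v x) * det (T v x) = 1"
      using det_mult[OF \<Lambda>c Tc[OF v]] by (simp add: map_replicate_const)
    then show ?thesis using \<Lambda>c by (auto simp: GL_iff)
  qed
  have act: "T v (gauge_act Q l d h x) = h (0, v) * T v x" "P v (gauge_act Q l d h x) = h (l, v) * P v x"
    if x: "x \<in> X" and h: "gauge_family Q l d h" and v: "v \<in> verts Q" for x h v
  proof -
    have w: "w (stage (gauge_act Q l d h x) m) = h (m, v) *\<^sub>v w (stage x m)" if "word Q f v w" "m \<le> l" for w m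
      unfolding stage_gauge_act[OF that(2)]
      using word_rep_act[of "\<lambda>v. h (m, v)", OF _ stg[OF x that(2)] that(1)] gauge_familyD[OF h that(2)] by simp
    show "T v (gauge_act Q l d h x) = h (0, v) * T v x"
      unfolding T_def by (rule mat_of_cols_map_mult[symmetric, OF GL_carrier[OF gauge_familyD[OF h le0 v]]])
        (use w wt[OF v] word_carrier[OF _ stg[OF x le0]] in auto)
    show "P v (gauge_act Q l d h x) = h (l, v) * P v x"
      unfolding P_def by (rule mat_of_cols_map_mult[symmetric, OF GL_carrier[OF gauge_familyD[OF h order_refl v]]])
        (use w wt[OF v] word_carrier[OF _ stg[OF x order_refl]] in auto)
  qed
  have inv: "gauge_act Q l d h x \<in> U" if x: "x \<in> U" and h: "gauge_family Q l d h" for x h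
  proof -
    have xX: "x \<in> X" using x by (simp add: U_def)
    show ?thesis
      unfolding U_def using gauge_act_closed[OF xX h] act[OF xX h] UD[OF x] gauge_familyD[OF h] by simp
  qed
  have equi: "\<Lambda> v (gauge_act Q l d h x) = \<Lambda> v x * gl_inv (d 0 v) (h (0, v))"
    if x: "x \<in> U" and h: "gauge_family Q l d h" and v: "v \<in> verts Q" for x h v
  proof (rule eq_matI)
    note x' = UD[OF x v]
    note h0 = gauge_familyD[OF h le0 v] and hl = gauge_familyD[OF h order_refl v]
    let ?i = "gl_inv (d 0 v) (h (0, v))" and ?y = "gauge_act Q l d h x"
    have Pr': "Pr v ?y = Pr v x * ?i"
      unfolding Pr_def act(2)[OF x'(1) h v] link_comp_gauge_act[OF x'(1) h order_refl v]
      using x' h0 hl v by (simp add: gl_inv_mult mat_assoc)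
    have TI': "gl_inv (d 0 v) (T v ?y) = gl_inv (d 0 v) (T v x) * ?i"
      unfolding act(1)[OF x'(1) h v] using x' h0 by (simp add: gl_inv_mult)
    have ic: "?i \<in> carrier_mat (d 0 v) (d 0 v)" using h0 by simp
    fix i j assume "i < dim_row (\<Lambda> v x * ?i)" "j < dim_col (\<Lambda> v x * ?i)"
    then have ij: "i < d 0 v" "j < d 0 v" using \<Lambda>c h0 by (auto simp: \<Lambda>_def)
    have "(\<Lambda> v x * ?i) $$ (i, j) = (\<Sum>k<d 0 v. \<Lambda> v x $$ (i, k) * ?i $$ (k, j))"
      by (rule mat_mult_index[OF \<Lambda>c ic ij])
    also have "\<dots> = \<Lambda> v ?y $$ (i, j)"
    proof (cases "i < d l v")
      case True
      then have "(Pr v x * ?i) $$ (i, j) = (\<Sum>k<d 0 v. Pr v x $$ (i, k) * ?i $$ (k, j))"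
        by (rule mat_mult_index[OF Prc[OF x v] ic _ ij(2)])
      then show ?thesis using True ij Pr' by (simp add: \<Lambda>_def)
    next
      case False
      have "(gl_inv (d 0 v) (T v x) * ?i) $$ (i, j) = (\<Sum>k<d 0 v. gl_inv (d 0 v) (T v x) $$ (i, k) * ?i $$ (k, j))"
        by (rule mat_mult_index[OF gl_inv_carrier[OF x'(2)] ic ij])
      then show ?thesis using False ij TI' by (simp add: \<Lambda>_def)
    qed
    finally show "\<Lambda> v ?y $$ (i, j) = (\<Lambda> v x * ?i) $$ (i, j)" ..
  qed (use gauge_familyD[OF h le0 v] in \<open>auto simp: \<Lambda>_def\<close>)
  have fac: "\<exists>P' \<in> carrier (GL (d l v)). P' * link_comp d x l v = rect (d l v) (d 0 v) * \<Lambda> v x" if "x \<in> U" "v \<in> verts Q" for x v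
    unfolding rect\<Lambda>[OF that] Pr_def using UD(3)[OF that] by blast
  show ?thesis
    by (rule exI[of _ U], rule exI[of _ \<Lambda>], intro conjI ballI allI impI)
      (fact oU x0U | erule (1) inv | erule \<Lambda>reg | erule (1) \<Lambda>GL | erule (1) fac | erule (2) equi)+
qed

end

section \<open>The local trivialisation\<close>

text \<open>
  The base consists of the chains of length 1; this numeral has to stay as it is for the facts about the
  base to match.
\<close>

declare One_nat_def [simp del]

lemma end_dims_simps [simp]: "end_dims l d 0 = d 0" "end_dims l d (Suc 0) = d l" "end_dims l d 1 = d l"
  by (simp_all add: end_dims_def)

lemma colsp_mult_left:
  assumes "g \<in> carrier_mat p n" "A \<in> carrier_mat n a" "B \<in> carrier_mat n b" "colsp A = colsp B"
  shows "colsp (g * A) = colsp (g * B)"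
proof -
  have eq: "colsp (g * M) = (\<lambda>x. g *\<^sub>v x) ` colsp M" if "M \<in> carrier_mat n c" for M c
    unfolding colsp_def image_image
    by (intro image_cong) (use assms(1) that in \<open>auto simp: mat_vec_assoc\<close>)
  show ?thesis by (simp add: eq[OF assms(2)] eq[OF assms(3)] assms(4))
qed

lemma colsp_GL:
  assumes "g \<in> carrier (GL n)"
  shows "colsp g = carrier_vec n"
  using colsp_mult_GL[OF one_carrier_mat assms] left_mult_one_mat[OF GL_carrier[OF assms]] by (simp add: colsp_one)

text \<open>
  In coordinates \<open>\<Lambda>\<close> whose last \<open>k\<close> ones are those of the kernel of the total projection, the rows of \<open>\<pi>\<close>
  restrict to linear forms on this kernel. They span the annihilator of the kernel of \<open>\<pi>\<close>. This is where
  flags with members of dimension \<open>d m v - d l v\<close>, in the dual space, take the place of flags of kernels.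
\<close>

lemma colsp_flag_of_coframe:
  assumes g: "g \<in> carrier (GL k)" and \<Lambda>: "\<Lambda> \<in> carrier (GL n)" and h: "h \<in> carrier (GL m)"
    and \<pi>: "\<pi> \<in> carrier_mat m n" and eq: "h * \<pi> = rect m n * (gdiag a k g * \<Lambda>)"
    and n: "n = a + k" and m: "m = a + c" "c \<le> k"
  shows "colsp (last_coords a k * (\<pi> * gl_inv n \<Lambda>)\<^sup>T) = colsp (g * rect k c)"
proof -
  have gd: "gdiag a k g \<in> carrier (GL n)" using g n by auto
  have "\<pi> * gl_inv n \<Lambda> = gl_inv m h * (h * \<pi>) * gl_inv n \<Lambda>"
    using h \<pi> \<Lambda> by simp
  also have "\<dots> = gl_inv m h * (rect m n * gdiag a k g)"
    unfolding eq using gd h \<Lambda> right_mult_one_mat[OF GL_carrier[OF gd]] by (simp add: mat_assoc)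
  finally have "(\<pi> * gl_inv n \<Lambda>)\<^sup>T = (rect m n * gdiag a k g)\<^sup>T * (gl_inv m h)\<^sup>T"
    using transpose_mult[OF gl_inv_carrier[OF h] mult_carrier_mat[OF rect_carrier GL_carrier[OF gd]]] by simp
  also have "(rect m n * gdiag a k g)\<^sup>T = (gdiag a k g)\<^sup>T * rect n m"
    using transpose_mult[OF rect_carrier[of m n] GL_carrier[OF gd]] by simp
  finally have T: "(\<pi> * gl_inv n \<Lambda>)\<^sup>T = (gdiag a k g)\<^sup>T * rect n m * (gl_inv m h)\<^sup>T" .
  have "last_coords a k * (\<pi> * gl_inv n \<Lambda>)\<^sup>T = (last_coords a k * (gdiag a k g)\<^sup>T) * rect n m * (gl_inv m h)\<^sup>T"
    unfolding T using gd h n by (simp add: mat_assoc)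
  also have "\<dots> = g * (last_coords a k * rect n m) * (gl_inv m h)\<^sup>T"
    unfolding last_coords_gdiag[OF GL_carrier[OF g]] using g h n by (simp add: mat_assoc)
  finally have L: "last_coords a k * (\<pi> * gl_inv n \<Lambda>)\<^sup>T = g * (last_coords a k * rect n m) * (gl_inv m h)\<^sup>T" .
  have lc: "last_coords a k * rect n m \<in> carrier_mat k m" using n by (intro mult_carrier_mat) auto
  have "colsp (g * (last_coords a k * rect n m) * (gl_inv m h)\<^sup>T) = colsp (g * (last_coords a k * rect n m))"
    using h by (intro colsp_mult_GL[OF mult_carrier_mat[OF GL_carrier[OF g] lc]]) auto
  also have "\<dots> = colsp (g * rect k c)"
    by (rule colsp_mult_left[OF GL_carrier[OF g] lc rect_carrier])
      (use last_coords_rect[OF m(2), of a] n m(1) in simp)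
  finally show ?thesis unfolding L .
qed

context dim_chain
begin

lemma fs_morphism_XS:
  assumes Z: "space_with_functions Z" and \<chi>: "\<And>z. z \<in> points Z \<Longrightarrow> \<chi> z \<in> X"
    and A: "\<And>m e. m \<le> l \<Longrightarrow> e \<in> arcs Q \<Longrightarrow> regular_mat Z (d m (head Q e)) (d m (tail Q e)) (\<lambda>z. repA (stage (\<chi> z) m) e)"
    and B: "\<And>m e. m \<le> l \<Longrightarrow> e \<in> arcs Q \<Longrightarrow> regular_mat Z (d m (tail Q e)) (d m (head Q e)) (\<lambda>z. repB (stage (\<chi> z) m) e)"
    and I: "\<And>m v. m \<le> l \<Longrightarrow> v \<in> verts Q \<Longrightarrow> regular_mat Z (d m v) (f v) (\<lambda>z. repI (stage (\<chi> z) m) v)"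
    and J: "\<And>m v. m \<le> l \<Longrightarrow> v \<in> verts Q \<Longrightarrow> regular_mat Z (f v) (d m v) (\<lambda>z. repJ (stage (\<chi> z) m) v)"
    and L: "\<And>m v. m < l \<Longrightarrow> v \<in> verts Q \<Longrightarrow> regular_mat Z (d (Suc m) v) (d m v) (\<lambda>z. link (\<chi> z) m v)"
  shows "fs_morphism Z XS \<chi>"
  unfolding parabolic_space_def
proof (rule fs_morphism_zariski[OF Z \<chi>])
  fix c assume "c \<in> chain_coords Q l d f"
  then show "(\<lambda>z. c (\<chi> z)) \<in> reg Z (points Z)"
    unfolding chain_coords_def
    by (elim UnE CollectE exE conjE)
      (simp_all add: regular_matD(2)[OF A] regular_matD(2)[OF B] regular_matD(2)[OF I] regular_matD(2)[OF J] regular_matD(2)[OF L])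
qed

interpretation Y: dim_chain Q 1 "end_dims l d" f
  by unfold_locales (use d_mono[OF le0 order_refl] in simp)

abbreviation "forget \<equiv> forget_middle Q l d"

lemma forget_simps [simp]:
  "stage (forget x) 0 = stage x 0" "stage (forget x) (Suc 0) = stage x l" "stage (forget x) 1 = stage x l"
  "v \<in> verts Q \<Longrightarrow> link (forget x) 0 v = link_comp d x l v"
  by (auto simp: forget_middle_def)

lemma link_comp_forget:
  assumes "x \<in> X" "v \<in> verts Q"
  shows "link_comp (end_dims l d) (forget x) 1 v = link_comp d x l v"
  using right_mult_one_mat[OF link_comp_carrier[OF assms(1) order_refl assms(2)]] assms
  by (simp add: One_nat_def)

lemma forget_in:
  assumes x: "x \<in> X"
  shows "forget x \<in> Y.X"
  unfolding Y.parabolic_points_iff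
proof (intro conjI allI impI ballI)
  have m01: "m = 0 \<or> m = 1" if "m \<le> 1" for m :: nat using that by auto
  show "stage (forget x) \<in> extensional {..1}" "link (forget x) \<in> extensional {..<1}"
    by (auto simp: forget_middle_def)
  show "link (forget x) m \<in> extensional (verts Q)" if "m < 1" for m
    using that by (simp add: forget_middle_def)
  show "stage (forget x) m \<in> framed_reps Q (end_dims l d m) f" if "m \<le> 1" for m
    using m01[OF that] parabolic_pointsD(4)[OF x] by auto
  show "stable Q (end_dims l d m) f (stage (forget x) m)" if "m \<le> 1" for m
    using m01[OF that] parabolic_pointsD(5)[OF x] by auto
  show "moment_map_eqs Q (end_dims l d m) (stage (forget x) m)" if "m \<le> 1" for m
    using m01[OF that] parabolic_pointsD(6)[OF x] by auto
  show "link (forget x) m v \<in> carrier_mat (end_dims l d (Suc m) v) (end_dims l d m v)" if "m < 1" "v \<in> verts Q" for m v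
    using that link_comp_carrier[OF x order_refl] by simp
  show "Y.link_eqs (forget x) m" if "m < 1" for m
    unfolding Y.link_eqs_def using that link_comp_eqs[OF x order_refl] by simp
  fix v k assume "v \<in> verts Q" "k \<in> mat_kernel (link_comp (end_dims l d) (forget x) 1 v)"
  then have "kills (stage x 0) v k"
    using parabolic_pointsD(9)[OF x] link_comp_forget[OF x] by simp
  then show "Y.kills (stage (forget x) 0) v k"
    by (simp add: kills_def Y.kills_def)
qed

lemma forget_gauge_act:
  assumes x: "x \<in> X" and h: "gauge_family Q l d h"
  shows "gauge_family Q 1 (end_dims l d) (\<lambda>(m, v). h (if m = 0 then 0 else l, v))"
    and "forget (gauge_act Q l d h x) = gauge_act Q 1 (end_dims l d) (\<lambda>(m, v). h (if m = 0 then 0 else l, v)) (forget x)"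
proof -
  let ?h = "\<lambda>(m, v). h (if m = 0 then 0 else l, v)"
  show h': "gauge_family Q 1 (end_dims l d) ?h"
    using gauge_familyD[OF h] by (auto simp: gauge_family_def end_dims_def)
  show "forget (gauge_act Q l d h x) = gauge_act Q 1 (end_dims l d) ?h (forget x)"
  proof (rule Y.parabolic_points_eqI)
    show "forget (gauge_act Q l d h x) \<in> Y.X" by (rule forget_in[OF gauge_act_closed[OF x h]])
    show "gauge_act Q 1 (end_dims l d) ?h (forget x) \<in> Y.X" by (rule Y.gauge_act_closed[OF forget_in[OF x] h'])
    show "stage (forget (gauge_act Q l d h x)) m = stage (gauge_act Q 1 (end_dims l d) ?h (forget x)) m" if "m \<le> 1" for m
    proof -
      have "m = 0 \<or> m = 1" using that by auto
      then show ?thesis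
        using stage_gauge_act[OF le0] stage_gauge_act[OF order_refl] Y.stage_gauge_act[OF that] by auto
    qed
    show "link (forget (gauge_act Q l d h x)) m v = link (gauge_act Q 1 (end_dims l d) ?h (forget x)) m v"
      if "m < 1" "v \<in> verts Q" for m v
      using that link_comp_gauge_act[OF x h order_refl that(2)] Y.link_gauge_act[OF that] by simp
  qed
qed

lemma orbit_forget_cong:
  assumes "x \<in> X" "y \<in> X" "q x = q y"
  shows "Y.q (forget x) = Y.q (forget y)"
  using assms orbit_eq_iff[OF assms(1,2)] forget_gauge_act[OF assms(1)]
    Y.orbit_gauge_act[OF forget_in[OF assms(1)]] by metis

lemma natural_projection_orbit:
  assumes "x \<in> X"
  shows "natural_projection Q l d (q x) = Y.q (forget x)"
proof -
  have "Y.q (forget y) = Y.q (forget x)" if y: "y \<in> q x" for y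
  proof -
    obtain h where h: "gauge_family Q l d h" "y = gauge_act Q l d h x" using y by (auto simp: orbit_iff)
    then have "y \<in> X" "q y = q x" using gauge_act_closed[OF assms] orbit_gauge_act[OF assms] by auto
    then show ?thesis using orbit_forget_cong assms by blast
  qed
  then have "(\<lambda>x. Y.q (forget x)) ` q x = {Y.q (forget x)}"
    using orbit_self[OF assms] by blast
  then show ?thesis by (simp add: natural_projection_def)
qed

lemma fs_morphism_forget: "fs_morphism XS Y.XS forget"
proof (rule Y.fs_morphism_XS[OF XS])
  have m01: "m = 0 \<or> m = 1" if "m \<le> 1" for m :: nat using that by auto
  note st0 = regular_stage[OF le0] and stl = regular_stage[OF order_refl]
  show "regular_mat XS (end_dims l d m (head Q e)) (end_dims l d m (tail Q e)) (\<lambda>x. repA (stage (forget x) m) e)"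
    "regular_mat XS (end_dims l d m (tail Q e)) (end_dims l d m (head Q e)) (\<lambda>x. repB (stage (forget x) m) e)"
    if "m \<le> 1" "e \<in> arcs Q" for m e
    using m01[OF that(1)] st0(1,2)[OF that(2)] stl(1,2)[OF that(2)] by auto
  show "regular_mat XS (end_dims l d m v) (f v) (\<lambda>x. repI (stage (forget x) m) v)"
    "regular_mat XS (f v) (end_dims l d m v) (\<lambda>x. repJ (stage (forget x) m) v)"
    if "m \<le> 1" "v \<in> verts Q" for m v
    using m01[OF that(1)] st0(3,4)[OF that(2)] stl(3,4)[OF that(2)] by auto
  show "regular_mat XS (end_dims l d (Suc m) v) (end_dims l d m v) (\<lambda>x. link (forget x) m v)"
    if "m < 1" "v \<in> verts Q" for m v
    using that regular_link_comp[OF order_refl that(2)] by simp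
qed (use forget_in points_XS in auto)

lemma fs_morphism_natural_projection: "fs_morphism MS Y.MS (natural_projection Q l d)"
  unfolding MS_eq
proof (rule fs_morphism_from_coinduced[OF XS])
  show "q ` points XS = q ` X" by (simp add: points_XS)
  have "fs_morphism XS Y.MS (\<lambda>x. Y.q (forget x))"
    using fs_morphism_compose[OF fs_morphism_forget Y.fs_morphism_orbit] by (simp add: o_def)
  then show "fs_morphism XS Y.MS (\<lambda>x. natural_projection Q l d (q x))"
    by (rule fs_morphism_cong[OF XS]) (simp add: points_XS natural_projection_orbit)
qed

lemma split_reps_end: "Y.split_reps = split_reps"
  unfolding split_reps_def Y.split_reps_def by simp

lemma forget_std_chain:
  assumes R: "R \<in> split_reps"
  shows "forget (std_chain Q l d R) = std_chain Q 1 (end_dims l d) R"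
proof (rule Y.parabolic_points_eqI[OF forget_in[OF std_chain_in_X[OF R]]])
  show "std_chain Q 1 (end_dims l d) R \<in> Y.X"
    using Y.std_chain_in_X R split_reps_end by blast
  show "stage (forget (std_chain Q l d R)) m = stage (std_chain Q 1 (end_dims l d) R) m" if "m \<le> 1" for m
  proof -
    have "m = 0 \<or> m = 1" using that by auto
    then show ?thesis by auto
  qed
  show "link (forget (std_chain Q l d R)) m v = link (std_chain Q 1 (end_dims l d) R) m v" if "m < 1" "v \<in> verts Q" for m v
    using that link_comp_std_chain[OF order_refl that(2)] by simp
qed

end

text \<open>
  A coframe on an open invariant set \<open>U\<close> of points above the base. The variety is trivial over the image
  of \<open>U\<close>.
\<close>

locale chart = dim_chain Q l d f
  for Q :: "('v, 'e) pre_digraph" and l :: nat and d :: "nat \<Rightarrow> 'v \<Rightarrow> nat" and f :: "'v \<Rightarrow> nat" +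
  fixes U :: "('v, 'e) chain_rep set" and \<Lambda> :: "'v \<Rightarrow> ('v, 'e) chain_rep \<Rightarrow> complex mat"
  assumes oU: "openin (topo (parabolic_space Q 1 (end_dims l d) f)) U"
    and U_inv: "y \<in> U \<Longrightarrow> gauge_family Q 1 (end_dims l d) h \<Longrightarrow> gauge_act Q 1 (end_dims l d) h y \<in> U"
    and \<Lambda>_regular: "v \<in> verts Q \<Longrightarrow>
      regular_mat (fs_open_sub (parabolic_space Q 1 (end_dims l d) f) U) (d 0 v) (d 0 v) (\<Lambda> v)"
    and \<Lambda>_GL: "y \<in> U \<Longrightarrow> v \<in> verts Q \<Longrightarrow> \<Lambda> v y \<in> carrier (GL (d 0 v))"
    and \<Lambda>_link: "y \<in> U \<Longrightarrow> v \<in> verts Q \<Longrightarrow>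
      \<exists>P \<in> carrier (GL (d l v)). P * link_comp (end_dims l d) y 1 v = rect (d l v) (d 0 v) * \<Lambda> v y"
    and \<Lambda>_gauge: "y \<in> U \<Longrightarrow> gauge_family Q 1 (end_dims l d) h \<Longrightarrow> v \<in> verts Q \<Longrightarrow>
      \<Lambda> v (gauge_act Q 1 (end_dims l d) h y) = \<Lambda> v y * gl_inv (d 0 v) (h (0, v))"
begin

interpretation Y: dim_chain Q 1 "end_dims l d" f
  by unfold_locales (use d_mono[OF le0 order_refl] in simp)

text \<open>
  The dimensions of the kernel of the total projection, and of the members of the flags.
\<close>

definition k :: "'v \<Rightarrow> nat" where "k v = d 0 v - d l v"

definition b :: "'v \<Rightarrow> nat \<Rightarrow> nat" where "b v m = d m v - d l v"

lemma d_split: "v \<in> verts Q \<Longrightarrow> d 0 v = d l v + k v"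
  using d_mono[OF le0 order_refl] by (simp add: k_def)

lemma d_split': "m \<le> l \<Longrightarrow> v \<in> verts Q \<Longrightarrow> d m v = d l v + b v m"
  using d_mono[of m l v] by (simp add: b_def)

lemma b_le: "m \<le> l \<Longrightarrow> v \<in> verts Q \<Longrightarrow> b v m \<le> k v"
  using d_mono[OF le0, of m v] by (simp add: b_def k_def)

lemma b_mono: "m \<le> m' \<Longrightarrow> m' \<le> l \<Longrightarrow> v \<in> verts Q \<Longrightarrow> b v m' \<le> b v m"
  using d_mono[of m m' v] by (simp add: b_def)

abbreviation ms :: "nat list" where "ms \<equiv> rev [1..<l]"

lemma ms: "set ms \<subseteq> {..l}" "v \<in> verts Q \<Longrightarrow> sorted (map (b v) ms)"
    "v \<in> verts Q \<Longrightarrow> \<forall>a\<in>set (map (b v) ms). a \<le> k v"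
proof -
  show "set ms \<subseteq> {..l}" by auto
  assume v: "v \<in> verts Q"
  show "sorted (map (b v) ms)"
    unfolding sorted_iff_nth_mono by (auto simp: rev_nth intro!: b_mono[OF _ _ v])
  show "\<forall>a\<in>set (map (b v) ms). a \<le> k v" using b_le[OF _ v] by auto
qed

abbreviation "T v g \<equiv> gdiag (d l v) (k v) g"

lemma T_GL: "v \<in> verts Q \<Longrightarrow> g \<in> carrier (GL (k v)) \<Longrightarrow> T v g \<in> carrier (GL (d 0 v))"
  using d_split by auto

lemma T_rect:
  assumes "v \<in> verts Q" "g \<in> carrier (GL (k v))"
  shows "rect (d l v) (d 0 v) * T v g = rect (d l v) (d 0 v)"
proof -
  have "g * rect (k v) 0 = rect (k v) 0 * 1\<^sub>m 0"
    using assms(2) by (intro eq_matI) auto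
  from gdiag_rect[OF GL_carrier[OF assms(2)] one_carrier_mat this, of "d l v" "d l v"]
  have "rect (d l v) (d 0 v) * T v g = gdiag (d l v) 0 (1\<^sub>m 0) * rect (d l v) (d 0 v)"
    using d_split[OF assms(1)] by simp
  also have "gdiag (d l v) 0 (1\<^sub>m 0) = 1\<^sub>m (d l v)"
    by (intro eq_matI) (auto simp: gdiag_def)
  finally show ?thesis by simp
qed

text \<open>
  Stage zero in the coordinates of the coframe. By equivariance of the coframe it is gauge invariant.
\<close>

definition normal_stage :: "('v, 'e) chain_rep \<Rightarrow> ('v, 'e) framed_rep" where
  "normal_stage y = rep_act Q (d 0) (\<lambda>v. \<Lambda> v y) (stage y 0)"

text \<open>
  Stage zero after a further change of coordinates in the kernel of the total projection: the standard
  chain that it defines has the flag of \<open>g\<close>.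
\<close>

definition turned_stage :: "('v, 'e) chain_rep \<Rightarrow> ('v \<Rightarrow> complex mat) \<Rightarrow> ('v, 'e) framed_rep" where
  "turned_stage y g = rep_act Q (d 0) (\<lambda>v. T v (g v)) (normal_stage y)"

lemma UX: "y \<in> U \<Longrightarrow> y \<in> Y.X"
  using openin_subset[OF oU] by (auto simp: Y.points_XS)

lemma U_stage: "y \<in> U \<Longrightarrow> stage y 0 \<in> framed_reps Q (d 0) f"
  using Y.parabolic_pointsD(4)[OF UX le0] by simp

lemma normal_stage_gauge:
  assumes y: "y \<in> U" and h: "gauge_family Q 1 (end_dims l d) h"
  shows "normal_stage (gauge_act Q 1 (end_dims l d) h y) = normal_stage y"
proof -
  have h0: "h (0, v) \<in> carrier (GL (d 0 v))" if "v \<in> verts Q" for v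
    using gauge_familyD[OF h le0 that] by simp
  let ?g = "\<lambda>v. \<Lambda> v y * gl_inv (d 0 v) (h (0, v))"
  have "normal_stage (gauge_act Q 1 (end_dims l d) h y) = rep_act Q (d 0) ?g (rep_act Q (d 0) (\<lambda>v. h (0, v)) (stage y 0))"
    unfolding normal_stage_def Y.stage_gauge_act[OF le0] end_dims_simps
    using \<Lambda>_gauge[OF y h] by (auto simp: rep_act_def fun_eq_iff restrict_def)
  also have "\<dots> = rep_act Q (d 0) (\<lambda>v. ?g v * h (0, v)) (stage y 0)"
    by (rule rep_act_mult[symmetric, OF _ h0 U_stage[OF y]]) (use \<Lambda>_GL[OF y] h0 in auto)
  also have "\<dots> = normal_stage y"
  proof -
    have "?g v * h (0, v) = \<Lambda> v y" if "v \<in> verts Q" for v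
      using \<Lambda>_GL[OF y that] h0[OF that] right_mult_one_mat[OF GL_carrier[OF \<Lambda>_GL[OF y that]]]
      by (simp add: mat_assoc)
    then show ?thesis unfolding normal_stage_def by (auto simp: rep_act_def fun_eq_iff restrict_def)
  qed
  finally show ?thesis .
qed

lemma turned_stage_eq:
  assumes y: "y \<in> U" and gB: "\<forall>v\<in>verts Q. g v \<in> carrier (GL (k v))"
  shows "turned_stage y g = rep_act Q (d 0) (\<lambda>v. T v (g v) * \<Lambda> v y) (stage y 0)"
  unfolding turned_stage_def normal_stage_def
  by (rule rep_act_mult[symmetric, OF T_GL[OF _ bspec[OF gB]] \<Lambda>_GL[OF y] U_stage[OF y]])

text \<open>
  The point \<open>y\<close> of the base is equivalent to a standard chain, and the coordinates \<open>T v (g v) * \<Lambda> v y\<close>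
  serve as well as \<open>\<Lambda> v y\<close>.
\<close>

lemma turned_stage_props:
  assumes y: "y \<in> U" and gB: "\<forall>v\<in>verts Q. g v \<in> carrier (GL (k v))"
  shows "turned_stage y g \<in> split_reps" "std_chain Q 1 (end_dims l d) (turned_stage y g) \<in> U"
    "Y.q (std_chain Q 1 (end_dims l d) (turned_stage y g)) = Y.q y"
    "v \<in> verts Q \<Longrightarrow> \<Lambda> v (std_chain Q 1 (end_dims l d) (turned_stage y g)) = gl_inv (d 0 v) (T v (g v))"
proof -
  note g = bspec[OF gB]
  obtain P where P: "\<And>v. v \<in> verts Q \<Longrightarrow> P v \<in> carrier (GL (d l v)) \<and>
      P v * link_comp (end_dims l d) y 1 v = rect (d l v) (d 0 v) * \<Lambda> v y"
    using \<Lambda>_link[OF y] by metis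
  let ?h = "\<lambda>(m :: nat, v). if m = 0 then T v (g v) * \<Lambda> v y else P v"
  have TG: "T v (g v) \<in> carrier (GL (d 0 v))" "\<Lambda> v y \<in> carrier (GL (d 0 v))" if "v \<in> verts Q" for v
    using T_GL[OF that g[OF that]] \<Lambda>_GL[OF y that] by auto
  have fam: "gauge_family Q 1 (end_dims l d) ?h"
    using P TG by (auto simp: gauge_family_def end_dims_def)
  have eq: "?h (m, v) * link_comp (end_dims l d) y m v = rect (end_dims l d m v) (end_dims l d 0 v) * ?h (0, v)"
    if m: "m \<le> 1" and v: "v \<in> verts Q" for m v
  proof (cases "m = 0")
    case True
    then show ?thesis
      using TG[OF v] right_mult_one_mat[OF GL_carrier[OF GL_mult_closed[OF TG[OF v]]]]
        left_mult_one_mat[OF GL_carrier[OF GL_mult_closed[OF TG[OF v]]]] by simp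
  next
    case False
    then have m1: "m = 1" using m by simp
    have "rect (d l v) (d 0 v) * (T v (g v) * \<Lambda> v y) = (rect (d l v) (d 0 v) * T v (g v)) * \<Lambda> v y"
      using TG[OF v] by (simp add: mat_assoc)
    also have "\<dots> = rect (d l v) (d 0 v) * \<Lambda> v y" by (simp only: T_rect[OF v g[OF v]])
    finally show ?thesis using P[OF v] m1 by (simp del: link_comp.simps)
  qed
  have R: "rep_act Q (end_dims l d 0) (\<lambda>v. ?h (0, v)) (stage y 0) = turned_stage y g"
    using turned_stage_eq[OF y gB] by simp
  note nf = Y.normal_form[OF UX[OF y] fam eq, unfolded R]
  show "turned_stage y g \<in> split_reps" using nf(2) by (simp add: split_reps_end)
  show "std_chain Q 1 (end_dims l d) (turned_stage y g) \<in> U" using U_inv[OF y fam] nf(1) by simp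
  show "Y.q (std_chain Q 1 (end_dims l d) (turned_stage y g)) = Y.q y"
    using Y.orbit_gauge_act[OF UX[OF y] fam] nf(1) by simp
  assume v: "v \<in> verts Q"
  have "\<Lambda> v (std_chain Q 1 (end_dims l d) (turned_stage y g)) = \<Lambda> v y * gl_inv (d 0 v) (T v (g v) * \<Lambda> v y)"
    using \<Lambda>_gauge[OF y fam v] nf(1) by simp
  also have "\<dots> = gl_inv (d 0 v) (T v (g v))"
    using TG[OF v] by (simp add: gl_inv_mult)
  finally show "\<Lambda> v (std_chain Q 1 (end_dims l d) (turned_stage y g)) = gl_inv (d 0 v) (T v (g v))" .
qed

text \<open>
  The columns are the linear forms that the coordinates of stage \<open>m\<close> define on the kernel of the total
  projection.
\<close>

definition flag_mat :: "nat \<Rightarrow> 'v \<Rightarrow> ('v, 'e) chain_rep \<Rightarrow> complex mat" where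
  "flag_mat m v x = last_coords (d l v) (k v) * (link_comp d x m v * gl_inv (d 0 v) (\<Lambda> v (forget x)))\<^sup>T"

definition flag :: "'v \<Rightarrow> ('v, 'e) chain_rep \<Rightarrow> complex vec set list" where
  "flag v x = map (\<lambda>m. colsp (flag_mat m v x)) ms"

definition XU :: "('v, 'e) chain_rep set" where "XU = {x \<in> X. forget x \<in> U}"

lemma colsp_flag_mat:
  assumes x: "x \<in> XU" and v: "v \<in> verts Q" and m: "m \<le> l" and g: "g \<in> carrier (GL (k v))"
    and h: "h \<in> carrier (GL (d m v))"
    and eq: "h * link_comp d x m v = rect (d m v) (d 0 v) * (T v g * \<Lambda> v (forget x))"
  shows "colsp (flag_mat m v x) = colsp (g * rect (k v) (b v m))"
  unfolding flag_mat_def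
  by (rule colsp_flag_of_coframe[OF g _ h _ eq d_split[OF v] d_split'[OF m v] b_le[OF m v]])
    (use x v link_comp_carrier[OF _ m v] \<Lambda>_GL in \<open>auto simp: XU_def\<close>)

text \<open>The coordinates can be chosen along the kernels of the maps between the stages.\<close>

lemma adapted:
  assumes x: "x \<in> XU" and v: "v \<in> verts Q"
  shows "\<exists>g \<in> carrier (GL (k v)). \<forall>m\<le>l. \<exists>h \<in> carrier (GL (d m v)).
    h * link_comp d x m v = rect (d m v) (d 0 v) * (T v g * \<Lambda> v (forget x))"
proof -
  have xX: "x \<in> X" and xU: "forget x \<in> U" using x by (auto simp: XU_def)
  let ?L = "\<Lambda> v (forget x)"
  have L: "?L \<in> carrier (GL (d 0 v))" by (rule \<Lambda>_GL[OF xU v])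
  let ?\<rho> = "\<lambda>m. link_comp d x m v * gl_inv (d 0 v) ?L"
  obtain P where P: "P \<in> carrier (GL (d l v))" "P * link_comp d x l v = rect (d l v) (d 0 v) * ?L"
    using \<Lambda>_link[OF xU v] link_comp_forget[OF xX v] by auto
  have "\<exists>g \<in> carrier (GL (k v)). \<forall>m\<le>l. \<exists>h \<in> carrier (GL (d m v)). h * ?\<rho> m = rect (d m v) (d 0 v) * T v g"
  proof (rule adapted_coordinates[OF d_split[OF v], of l ?\<rho> "\<lambda>m. d m v"])
    fix m assume m: "m \<le> l"
    note lc = link_comp_carrier[OF xX m v]
    show rc: "?\<rho> m \<in> carrier_mat (d m v) (d 0 v)" using lc L by (intro mult_carrier_mat) auto
    obtain S where S: "S \<in> carrier_mat (d 0 v) (d m v)" "link_comp d x m v * S = 1\<^sub>m (d m v)"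
      using link_comp_right_inverse[OF xX m v] by blast
    have LS: "?L * S \<in> carrier_mat (d 0 v) (d m v)" using L S(1) by (intro mult_carrier_mat) auto
    have "?\<rho> m * (?L * S) = 1\<^sub>m (d m v)"
      using S lc L by (simp add: mat_assoc)
    then have "(?L * S)\<^sup>T * (?\<rho> m)\<^sup>T = 1\<^sub>m (d m v)"
      using transpose_mult[OF rc LS] by simp
    then show "inj_mat ((?\<rho> m)\<^sup>T)"
      using rc LS by (intro inj_matI[of _ "d 0 v" "d m v" "(?L * S)\<^sup>T"]) auto
  next
    fix m assume m: "m < l"
    then have "?\<rho> (Suc m) = link x m v * ?\<rho> m"
      using xX v L by (simp add: mat_assoc)
    then show "\<exists>A \<in> carrier_mat (d (Suc m) v) (d m v). ?\<rho> (Suc m) = A * ?\<rho> m"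
      using parabolic_pointsD(7)[OF xX m v] by blast
    show "d (Suc m) v \<le> d m v" by (rule d_step[OF m v])
  next
    show "gl_inv (d l v) P \<in> carrier (GL (d l v))" using P(1) by simp
    have "?\<rho> l = gl_inv (d l v) P * (P * link_comp d x l v) * gl_inv (d 0 v) ?L"
      using P(1) xX v by simp
    also have "\<dots> = gl_inv (d l v) P * rect (d l v) (d 0 v)"
      unfolding P(2) using P(1) L by (simp add: mat_assoc)
    finally show "?\<rho> l = gl_inv (d l v) P * rect (d l v) (d 0 v)" .
  qed simp
  then obtain g where g: "g \<in> carrier (GL (k v))" "\<And>m. m \<le> l \<Longrightarrow>
      \<exists>h \<in> carrier (GL (d m v)). h * ?\<rho> m = rect (d m v) (d 0 v) * T v g" by blast
  have "\<exists>h \<in> carrier (GL (d m v)). h * link_comp d x m v = rect (d m v) (d 0 v) * (T v g * ?L)" if m: "m \<le> l" for m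
  proof -
    obtain h where h: "h \<in> carrier (GL (d m v))" "h * ?\<rho> m = rect (d m v) (d 0 v) * T v g" using g(2)[OF m] by blast
    have "h * link_comp d x m v = (h * ?\<rho> m) * ?L"
      using h(1) L xX m v right_mult_one_mat[OF link_comp_carrier[OF xX m v]] by (simp add: mat_assoc)
    also have "\<dots> = rect (d m v) (d 0 v) * (T v g * ?L)"
      unfolding h(2) using L T_GL[OF v g(1)] by (simp add: mat_assoc)
    finally show ?thesis using h(1) by blast
  qed
  then show ?thesis using g(1) by blast
qed

abbreviation "FV v \<equiv> flag_variety (map (b v) ms) (k v)"
abbreviation "SF v g \<equiv> std_flag (map (b v) ms) (k v) g"

lemma SF_colsp:
  assumes "v \<in> verts Q" "g \<in> carrier (GL (k v))"
  shows "SF v g = map (\<lambda>m. colsp (g * rect (k v) (b v m))) ms"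
proof -
  have "(\<lambda>x. g *\<^sub>v x) ` coord_subspace (k v) (b v m) = colsp (g * rect (k v) (b v m))" if "m \<in> set ms" for m
    using image_coord_subspace[OF b_le[OF _ assms(1)] GL_carrier[OF assms(2)], of m] that by auto
  then show ?thesis by simp
qed

lemma flag_adapted:
  assumes x: "x \<in> XU"
  obtains g where "\<forall>v\<in>verts Q. g v \<in> carrier (GL (k v))" "\<And>v. v \<in> verts Q \<Longrightarrow> flag v x = SF v (g v)"
    "q (std_chain Q l d (turned_stage (forget x) g)) = q x"
    "\<And>v m. v \<in> verts Q \<Longrightarrow> m \<le> l \<Longrightarrow> colsp (flag_mat m v x) = colsp (g v * rect (k v) (b v m))"
proof -
  have xX: "x \<in> X" and xU: "forget x \<in> U" using x by (auto simp: XU_def)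
  obtain g where g: "\<And>v. v \<in> verts Q \<Longrightarrow> g v \<in> carrier (GL (k v)) \<and> (\<forall>m\<le>l. \<exists>h \<in> carrier (GL (d m v)).
      h * link_comp d x m v = rect (d m v) (d 0 v) * (T v (g v) * \<Lambda> v (forget x)))"
    using adapted[OF x] by metis
  have c: "colsp (flag_mat m v x) = colsp (g v * rect (k v) (b v m))" if "v \<in> verts Q" "m \<le> l" for v m
    using g[OF that(1)] that(2) colsp_flag_mat[OF x that] by blast
  show thesis
  proof (rule that[of g])
    show gB: "\<forall>v\<in>verts Q. g v \<in> carrier (GL (k v))" using g by blast
    note gG = bspec[OF gB]
    show "flag v x = SF v (g v)" if v: "v \<in> verts Q" for v
      unfolding SF_colsp[OF v gG[OF v]] flag_def using c[OF v] by auto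
    have "q (std_chain Q l d (rep_act Q (d 0) (\<lambda>v. T v (g v) * \<Lambda> v (forget x)) (stage x 0))) = q x"
    proof (rule orbit_normal_form(2)[OF xX])
      show "T v (g v) * \<Lambda> v (forget x) \<in> carrier_mat (d 0 v) (d 0 v)" if "v \<in> verts Q" for v
        using GL_carrier[OF GL_mult_closed[OF T_GL[OF that gG[OF that]] \<Lambda>_GL[OF xU that]]] .
    qed (use g in blast)
    then show "q (std_chain Q l d (turned_stage (forget x) g)) = q x"
      using turned_stage_eq[OF xU gB] by simp
    show "colsp (flag_mat m v x) = colsp (g v * rect (k v) (b v m))" if "v \<in> verts Q" "m \<le> l" for v m
      using c that by blast
  qed
qed

text \<open>Two bases along the same flag give the same orbit of chains.\<close>

lemma orbit_turned_stage_cong: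
  assumes y: "y \<in> U" and gB: "\<forall>v\<in>verts Q. g v \<in> carrier (GL (k v))"
    and gB': "\<forall>v\<in>verts Q. g' v \<in> carrier (GL (k v))"
    and eq: "\<And>v. v \<in> verts Q \<Longrightarrow> SF v (g' v) = SF v (g v)"
  shows "q (std_chain Q l d (turned_stage y g')) = q (std_chain Q l d (turned_stage y g))"
proof -
  note g = bspec[OF gB] and g' = bspec[OF gB']
  let ?p = "\<lambda>v. gl_inv (k v) (g v) * g' v"
  have p: "?p v \<in> carrier (GL (k v))" "g v * ?p v = g' v" if "v \<in> verts Q" for v
    using g[OF that] g'[OF that] by auto
  have tri: "\<exists>D \<in> carrier (GL (b v m)). ?p v * rect (k v) (b v m) = rect (k v) (b v m) * D"
    if v: "v \<in> verts Q" and m: "m \<le> l" for v m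
  proof -
    have "colsp (g' v * rect (k v) (b v m)) \<subseteq> colsp (g v * rect (k v) (b v m))"
    proof -
      consider "m = 0" | "m = l" | "m \<in> set ms" using m by force
      then show ?thesis
      proof cases
        case 1
        then have "b v m = k v" by (simp add: b_def k_def)
        then show ?thesis
          using colsp_GL[OF g[OF v]] colsp_GL[OF g'[OF v]] right_mult_one_mat[OF GL_carrier[OF g[OF v]]]
            right_mult_one_mat[OF GL_carrier[OF g'[OF v]]] by simp
      next
        case 2
        then have "b v m = 0" by (simp add: b_def)
        moreover have "g' v * rect (k v) 0 = g v * rect (k v) 0" using g[OF v] g'[OF v] by (intro eq_matI) auto
        ultimately show ?thesis by simp
      next
        case 3
        then show ?thesis using std_flag_eqD[OF eq[OF v] g[OF v] g'[OF v] _ b_le[OF m v]] by auto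
      qed
    qed
    from colsp_rect_eq[OF g[OF v] g'[OF v] b_le[OF m v] this]
    obtain D where D: "D \<in> carrier (GL (b v m))" "g' v * rect (k v) (b v m) = g v * rect (k v) (b v m) * D" by blast
    have "?p v * rect (k v) (b v m) = gl_inv (k v) (g v) * (g' v * rect (k v) (b v m))"
      using g[OF v] g'[OF v] by (simp add: mat_assoc)
    also have "\<dots> = rect (k v) (b v m) * D"
      unfolding D(2) using g[OF v] D(1) by (simp add: mat_assoc)
    finally show ?thesis using D(1) by blast
  qed
  have "turned_stage y g' = rep_act Q (d 0) (\<lambda>v. T v (g' v) * \<Lambda> v y) (stage y 0)"
    by (rule turned_stage_eq[OF y gB'])
  also have "\<dots> = rep_act Q (d 0) (\<lambda>v. T v (?p v) * (T v (g v) * \<Lambda> v y)) (stage y 0)"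
  proof -
    have "T v (g' v) * \<Lambda> v y = T v (?p v) * (T v (g v) * \<Lambda> v y)" if v: "v \<in> verts Q" for v
      using gdiag_mult[OF GL_carrier[OF g[OF v]] GL_carrier[OF p(1)[OF v]], of "d l v"] p(2)[OF v]
        T_GL[OF v g[OF v]] T_GL[OF v p(1)[OF v]] \<Lambda>_GL[OF y v] by (simp add: mat_assoc)
    then show ?thesis by (auto simp: rep_act_def fun_eq_iff restrict_def)
  qed
  also have "\<dots> = rep_act Q (d 0) (\<lambda>v. T v (?p v)) (rep_act Q (d 0) (\<lambda>v. T v (g v) * \<Lambda> v y) (stage y 0))"
    by (rule rep_act_mult[OF T_GL[OF _ p(1)] GL_mult_closed[OF T_GL[OF _ g] \<Lambda>_GL[OF y]] U_stage[OF y]])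
  also have "\<dots> = rep_act Q (d 0) (\<lambda>v. T v (?p v)) (turned_stage y g)"
    by (simp only: turned_stage_eq[OF y gB])
  finally have R: "turned_stage y g' = rep_act Q (d 0) (\<lambda>v. T v (?p v)) (turned_stage y g)" .
  have "q (std_chain Q l d (rep_act Q (d 0) (\<lambda>v. T v (?p v)) (turned_stage y g))) = q (std_chain Q l d (turned_stage y g))"
  proof (rule orbit_std_chain_parabolic(2)[OF turned_stage_props(1)[OF y gB]])
    show "T v (?p v) \<in> carrier_mat (d 0 v) (d 0 v)" if "v \<in> verts Q" for v
      using GL_carrier[OF T_GL[OF that p(1)[OF that]]] .
    fix m v assume m: "m \<le> l" and v: "v \<in> verts Q"
    obtain D where D: "D \<in> carrier (GL (b v m))" "?p v * rect (k v) (b v m) = rect (k v) (b v m) * D"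
      using tri[OF v m] by blast
    have "rect (d m v) (d 0 v) * T v (?p v) = gdiag (d l v) (b v m) D * rect (d m v) (d 0 v)"
      using gdiag_rect[OF GL_carrier[OF p(1)[OF v]] GL_carrier[OF D(1)] D(2) d_split'[OF m v]] d_split[OF v] by simp
    moreover have "gdiag (d l v) (b v m) D \<in> carrier (GL (d m v))" using D(1) d_split'[OF m v] by auto
    ultimately show "\<exists>E \<in> carrier (GL (d m v)). rect (d m v) (d 0 v) * T v (?p v) = E * rect (d m v) (d 0 v)" by blast
  qed
  then show ?thesis by (simp only: R)
qed

lemma flag_std_chain:
  assumes y: "y \<in> U" and gB: "\<forall>v\<in>verts Q. g v \<in> carrier (GL (k v))"
  shows "std_chain Q l d (turned_stage y g) \<in> XU" "Y.q (forget (std_chain Q l d (turned_stage y g))) = Y.q y"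
    "v \<in> verts Q \<Longrightarrow> flag v (std_chain Q l d (turned_stage y g)) = SF v (g v)"
proof -
  note g = bspec[OF gB]
  note t = turned_stage_props[OF y gB]
  let ?x = "std_chain Q l d (turned_stage y g)"
  have xX: "?x \<in> X" by (rule std_chain_in_X[OF t(1)])
  have fx: "forget ?x = std_chain Q 1 (end_dims l d) (turned_stage y g)" by (rule forget_std_chain[OF t(1)])
  show xU: "?x \<in> XU" using xX t(2) fx by (simp add: XU_def)
  show "Y.q (forget ?x) = Y.q y" using t(3) fx by simp
  assume v: "v \<in> verts Q"
  have "colsp (flag_mat m v ?x) = colsp (g v * rect (k v) (b v m))" if m: "m \<le> l" for m
  proof (rule colsp_flag_mat[OF xU v m g[OF v], of "1\<^sub>m (d m v)"])
    show "1\<^sub>m (d m v) * link_comp d ?x m v = rect (d m v) (d 0 v) * (T v (g v) * \<Lambda> v (forget ?x))"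
      using T_GL[OF v g[OF v]] by (simp add: fx t(4)[OF v] link_comp_std_chain[OF m v] left_mult_one_mat[OF rect_carrier]
          right_mult_one_mat[OF rect_carrier])
  qed simp
  then show "flag v ?x = SF v (g v)"
    unfolding SF_colsp[OF v g[OF v]] flag_def by auto
qed

lemma flag_gauge:
  assumes x: "x \<in> XU" and h: "gauge_family Q l d h" and v: "v \<in> verts Q"
  shows "flag v (gauge_act Q l d h x) = flag v x"
proof -
  have xX: "x \<in> X" and xU: "forget x \<in> U" using x by (auto simp: XU_def)
  have "colsp (flag_mat m v (gauge_act Q l d h x)) = colsp (flag_mat m v x)" if m: "m \<le> l" for m
  proof -
    note h0 = gauge_familyD[OF h le0 v] and hm = gauge_familyD[OF h m v]
    have L: "\<Lambda> v (forget x) \<in> carrier (GL (d 0 v))" by (rule \<Lambda>_GL[OF xU v])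
    have "\<Lambda> v (forget (gauge_act Q l d h x)) = \<Lambda> v (forget x) * gl_inv (d 0 v) (h (0, v))"
      unfolding forget_gauge_act(2)[OF xX h] using \<Lambda>_gauge[OF xU forget_gauge_act(1)[OF xX h] v] by simp
    then have "link_comp d (gauge_act Q l d h x) m v * gl_inv (d 0 v) (\<Lambda> v (forget (gauge_act Q l d h x)))
        = h (m, v) * (link_comp d x m v * gl_inv (d 0 v) (\<Lambda> v (forget x)))"
      using link_comp_gauge_act[OF xX h m v] h0 hm L xX m v by (simp add: gl_inv_mult mat_assoc)
    moreover have lc: "link_comp d x m v * gl_inv (d 0 v) (\<Lambda> v (forget x)) \<in> carrier_mat (d m v) (d 0 v)"
      using link_comp_carrier[OF xX m v] L by (intro mult_carrier_mat) auto
    ultimately have "flag_mat m v (gauge_act Q l d h x) = last_coords (d l v) (k v) *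
        ((link_comp d x m v * gl_inv (d 0 v) (\<Lambda> v (forget x)))\<^sup>T * (h (m, v))\<^sup>T)"
      by (simp only: flag_mat_def transpose_mult[OF GL_carrier[OF hm] lc])
    also have "\<dots> = flag_mat m v x * (h (m, v))\<^sup>T"
      unfolding flag_mat_def by (rule mat_assoc[symmetric])
        (use hm carrier_matD[OF lc] in \<open>simp_all add: d_split[OF v, symmetric]\<close>)
    finally have "flag_mat m v (gauge_act Q l d h x) = flag_mat m v x * (h (m, v))\<^sup>T" .
    moreover have "flag_mat m v x \<in> carrier_mat (k v) (d m v)"
      unfolding flag_mat_def using lc d_split[OF v] by (intro mult_carrier_mat[of _ _ "d 0 v"]) auto
    ultimately show ?thesis using colsp_mult_GL[OF _ GL_transpose[OF hm]] by simp
  qed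
  then show ?thesis unfolding flag_def by auto
qed

abbreviation "V \<equiv> Y.q ` U"
abbreviation "np \<equiv> natural_projection Q l d"
abbreviation "EV \<equiv> {e \<in> points MS. np e \<in> V}"

lemma q_mem_V:
  assumes "y \<in> Y.X"
  shows "Y.q y \<in> V \<longleftrightarrow> y \<in> U"
proof
  assume "Y.q y \<in> V"
  then obtain y' where y': "y' \<in> U" "Y.q y' = Y.q y" by auto
  then obtain h where "gauge_family Q 1 (end_dims l d) h" "y = gauge_act Q 1 (end_dims l d) h y'"
    using Y.orbit_eq_iff[OF UX[OF y'(1)] assms] by auto
  then show "y \<in> U" using U_inv[OF y'(1)] by simp
qed auto

lemma preimage_V: "{y \<in> points Y.XS. Y.q y \<in> V} = U"
  unfolding Y.points_XS using q_mem_V UX by blast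

lemma oV: "openin (topo Y.MS) V"
  unfolding Y.MS_eq openin_coinduced preimage_V using oU UX by blast

lemma XU_D: "x \<in> XU \<Longrightarrow> x \<in> X" "x \<in> XU \<Longrightarrow> forget x \<in> U"
  by (simp_all add: XU_def)

lemma EV_orbit:
  assumes "x \<in> X"
  shows "q x \<in> EV \<longleftrightarrow> x \<in> XU"
proof -
  have "q x \<in> points MS" using assms by (simp add: points_MS)
  then have "q x \<in> EV \<longleftrightarrow> np (q x) \<in> V" by blast
  also have "\<dots> \<longleftrightarrow> forget x \<in> U"
    unfolding natural_projection_orbit[OF assms] by (rule q_mem_V[OF forget_in[OF assms]])
  finally show ?thesis using assms by (simp add: XU_def)
qed

lemma EV_iff: "e \<in> EV \<longleftrightarrow> (\<exists>x\<in>XU. e = q x)"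
proof
  assume e: "e \<in> EV"
  then have "e \<in> q ` X" by (simp add: points_MS)
  then show "\<exists>x\<in>XU. e = q x" using e EV_orbit by blast
next
  assume "\<exists>x\<in>XU. e = q x"
  then show "e \<in> EV" using EV_orbit XU_D(1) by blast
qed

lemma preimage_EV: "{x \<in> points XS. q x \<in> EV} = XU"
  unfolding points_XS using EV_orbit XU_D(1) by blast

lemma oEV: "openin (topo MS) EV"
  using fs_morphism_openin[OF fs_morphism_natural_projection oV] .

lemma oXU: "openin (topo XS) XU"
  using fs_morphism_openin[OF fs_morphism_orbit oEV] unfolding preimage_EV .

text \<open>
  The flag does not depend on the representative of the orbit by \<open>flag_gauge\<close>.
\<close>

definition \<Phi> :: "('v, 'e) chain_rep set \<Rightarrow> ('v, 'e) chain_rep set \<times> ('v \<Rightarrow> complex vec set list)" where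
  "\<Phi> e = (np e, \<lambda>v\<in>verts Q. flag v (SOME x. x \<in> X \<and> q x = e))"

lemma \<Phi>_orbit:
  assumes x: "x \<in> XU"
  shows "\<Phi> (q x) = (Y.q (forget x), \<lambda>v\<in>verts Q. flag v x)"
proof -
  have xX: "x \<in> X" using x by (simp add: XU_def)
  define x' where "x' = (SOME x'. x' \<in> X \<and> q x' = q x)"
  have "x' \<in> X \<and> q x' = q x" unfolding x'_def by (rule someI[of _ x]) (use xX in simp)
  then obtain h where "gauge_family Q l d h" "x' = gauge_act Q l d h x"
    using orbit_eq_iff[OF xX, of x'] by metis
  then have "flag v x' = flag v x" if "v \<in> verts Q" for v using flag_gauge[OF x _ that] by simp
  then show ?thesis
    unfolding \<Phi>_def using natural_projection_orbit[OF xX] by (auto simp: x'_def[symmetric])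
qed

definition rep_of :: "('v, 'e) chain_rep set \<Rightarrow> ('v, 'e) chain_rep" where
  "rep_of c = (SOME y. y \<in> U \<and> Y.q y = c)"

lemma rep_of: "c \<in> V \<Longrightarrow> rep_of c \<in> U \<and> Y.q (rep_of c) = c"
  unfolding rep_of_def by (rule someI_ex) auto

definition lift :: "('v \<Rightarrow> complex vec set list) \<Rightarrow> 'v \<Rightarrow> complex mat" where
  "lift W v = (SOME g. g \<in> carrier (GL (k v)) \<and> SF v g = W v)"

lemma lift:
  assumes "v \<in> verts Q" "W v \<in> flags (map (b v) ms) (k v)"
  shows "lift W v \<in> carrier (GL (k v)) \<and> SF v (lift W v) = W v"
  unfolding lift_def by (rule someI_ex) (use flags_transitive[OF assms(2)] in auto)

text \<open>
  The choices of a point above the base and of a basis along the flag do not matter by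
  \<open>orbit_turned_stage_cong\<close>.
\<close>

definition \<Psi> :: "('v, 'e) chain_rep set \<times> ('v \<Rightarrow> complex vec set list) \<Rightarrow> ('v, 'e) chain_rep set" where
  "\<Psi> p = q (std_chain Q l d (turned_stage (rep_of (fst p)) (lift (snd p))))"

lemma turned_stage_rep_of:
  assumes "y \<in> U"
  shows "turned_stage (rep_of (Y.q y)) g = turned_stage y g"
proof -
  have r: "rep_of (Y.q y) \<in> U" "Y.q (rep_of (Y.q y)) = Y.q y" using rep_of[of "Y.q y"] assms by auto
  then obtain h where "gauge_family Q 1 (end_dims l d) h" "y = gauge_act Q 1 (end_dims l d) h (rep_of (Y.q y))"
    using Y.orbit_eq_iff[OF UX[OF r(1)] UX[OF assms]] by metis
  then show ?thesis unfolding turned_stage_def using normal_stage_gauge[OF r(1)] by metis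
qed

lemma \<Psi>_eq:
  assumes y: "y \<in> U" and gB: "\<forall>v\<in>verts Q. g v \<in> carrier (GL (k v))"
    and W: "\<And>v. v \<in> verts Q \<Longrightarrow> SF v (g v) = W v"
  shows "\<Psi> (Y.q y, W) = q (std_chain Q l d (turned_stage y g))"
proof -
  note g = bspec[OF gB]
  have "W v \<in> flags (map (b v) ms) (k v)" if v: "v \<in> verts Q" for v
    using coord_flag_in_flags[OF g[OF v] ms(2,3)[OF v]] W[OF v] by simp
  note lf = lift[of _ W, OF _ this]
  have "q (std_chain Q l d (turned_stage y (lift W))) = q (std_chain Q l d (turned_stage y g))"
    by (rule orbit_turned_stage_cong[OF y gB]) (use lf W in auto)
  then show ?thesis unfolding \<Psi>_def by (simp add: turned_stage_rep_of[OF y])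
qed

lemma \<Psi>_\<Phi>:
  assumes "x \<in> XU"
  shows "\<Psi> (\<Phi> (q x)) = q x"
proof -
  have xU: "forget x \<in> U" using assms by (simp add: XU_def)
  obtain g where g: "\<forall>v\<in>verts Q. g v \<in> carrier (GL (k v))" "\<And>v. v \<in> verts Q \<Longrightarrow> flag v x = SF v (g v)"
    "q (std_chain Q l d (turned_stage (forget x) g)) = q x"
    by (rule flag_adapted[OF assms], rule that, assumption+)
  have "\<Psi> (Y.q (forget x), \<lambda>v\<in>verts Q. flag v x) = q (std_chain Q l d (turned_stage (forget x) g))"
    by (rule \<Psi>_eq[OF xU g(1)]) (use g(2) in auto)
  then show ?thesis using g(3) by (simp add: \<Phi>_orbit[OF assms])
qed

lemma \<Phi>_\<Psi>:
  assumes y: "y \<in> U" and W: "W \<in> (\<Pi>\<^sub>E v\<in>verts Q. flags (map (b v) ms) (k v))"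
  shows "\<Phi> (\<Psi> (Y.q y, W)) = (Y.q y, W)" "\<Psi> (Y.q y, W) \<in> EV"
proof -
  have lf: "\<forall>v\<in>verts Q. lift W v \<in> carrier (GL (k v))" "\<And>v. v \<in> verts Q \<Longrightarrow> SF v (lift W v) = W v"
    using lift[of _ W] W by auto
  let ?x = "std_chain Q l d (turned_stage y (lift W))"
  note f = flag_std_chain[OF y lf(1)]
  have eq: "\<Psi> (Y.q y, W) = q ?x" by (rule \<Psi>_eq[OF y lf])
  then show "\<Psi> (Y.q y, W) \<in> EV" unfolding EV_iff using f(1) by blast
  have "(\<lambda>v\<in>verts Q. flag v ?x) = W"
    using f(3) lf(2) W by (auto simp: PiE_iff extensional_def fun_eq_iff)
  then show "\<Phi> (\<Psi> (Y.q y, W)) = (Y.q y, W)"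
    unfolding eq \<Phi>_orbit[OF f(1)] f(2) by simp
qed

abbreviation "F \<equiv> fs_PiE (verts Q) FV"
abbreviation "BV \<equiv> fs_open_sub Y.MS V"

lemma BV: "space_with_functions BV" "points BV = V"
  using space_with_functions_open_sub[OF Y.MS oV] points_open_sub_open[OF oV] by auto

lemma points_FV: "v \<in> verts Q \<Longrightarrow> points (FV v) = flags (map (b v) ms) (k v)"
  by (rule points_flag_variety[OF ms(2,3)])

lemma points_F: "points F = (\<Pi>\<^sub>E v\<in>verts Q. flags (map (b v) ms) (k v))"
  unfolding points_PiE by (rule PiE_cong) (rule points_FV)

lemma fs_morphism_\<Phi>: "fs_morphism (fs_open_sub MS EV) (fs_prod BV F) \<Phi>"
  unfolding MS_eq
proof (rule fs_morphism_from_coinduced_open[OF XS])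
  let ?S = "fs_open_sub XS XU"
  have S: "space_with_functions ?S" by (rule space_with_functions_open_sub[OF XS oXU])
  interpret S: space_with_functions ?S by (rule S)
  have pS: "points ?S = XU" by (rule points_open_sub_open[OF oXU])
  show "q ` points XS = q ` X" by (simp add: points_XS)
  show "openin (topo (fs_coinduced XS (q ` X) q)) {e \<in> points (fs_coinduced XS (q ` X) q). np e \<in> V}"
    using oEV by (simp only: MS_eq)
  have eqU: "{x \<in> points XS. q x \<in> {e \<in> points (fs_coinduced XS (q ` X) q). np e \<in> V}} = XU"
    using preimage_EV by (simp only: MS_eq)
  have fm: "fs_morphism ?S Y.XS forget"
    by (rule fs_morphism_restrict[OF XS oXU fs_morphism_forget])
  have fmU: "fs_morphism ?S (fs_open_sub Y.XS U) forget"
    by (rule fs_morphism_into_open_sub[OF oU fm]) (simp only: pS XU_D)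
  have 1: "fs_morphism ?S BV (\<lambda>x. Y.q (forget x))"
  proof (rule fs_morphism_into_open_sub[OF oV])
    show "fs_morphism ?S Y.MS (\<lambda>x. Y.q (forget x))"
      using fs_morphism_compose[OF fm Y.fs_morphism_orbit] by (simp add: o_def)
  qed (simp only: pS XU_D imageI)
  have 2: "fs_morphism ?S (FV v) (flag v)" if v: "v \<in> verts Q" for v
  proof -
    have "fs_morphism ?S (FV v) (\<lambda>x. map (\<lambda>m. colsp (flag_mat m v x)) ms)"
    proof (rule fs_morphism_flag_variety[OF S, of l "k v" "\<lambda>m. d m v" "\<lambda>m. flag_mat m v" "b v"])
      fix m assume m: "m \<le> l"
      have Lreg: "regular_mat ?S (d 0 v) (d 0 v) (\<lambda>x. \<Lambda> v (forget x))"
        by (rule regular_mat_compose[OF fmU \<Lambda>_regular[OF v]])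
      have "regular_mat ?S (d m v) (d 0 v) (\<lambda>x. link_comp d x m v * gl_inv (d 0 v) (\<Lambda> v (forget x)))"
        by (rule S.regular_mat_mult[OF regular_mat_open_sub[OF XS oXU regular_link_comp[OF m v]] S.regular_gl_inv[OF Lreg]])
          (simp only: pS \<Lambda>_GL XU_D v)
      from S.regular_mat_mult[OF S.regular_mat_const[OF last_coords_carrier[of "d l v" "k v", folded d_split[OF v]]]
          S.regular_mat_transpose[OF this]]
      show "regular_mat ?S (k v) (d m v) (flag_mat m v)" unfolding flag_mat_def[abs_def] .
    next
      fix x assume "x \<in> points ?S"
      then have x: "x \<in> XU" unfolding pS .
      obtain g where g: "\<forall>v\<in>verts Q. g v \<in> carrier (GL (k v))"
        "\<And>v m. v \<in> verts Q \<Longrightarrow> m \<le> l \<Longrightarrow> colsp (flag_mat m v x) = colsp (g v * rect (k v) (b v m))"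
        using flag_adapted[OF x] by metis
      then show "\<exists>g \<in> carrier (GL (k v)). \<forall>m\<le>l. colsp (flag_mat m v x) = colsp (g * rect (k v) (b v m))"
        using v by blast
    qed (use b_le[OF _ v] b_mono[OF _ _ v] ms v in \<open>auto simp: b_def k_def\<close>)
    then show ?thesis unfolding flag_def[abs_def] .
  qed
  have "fs_morphism ?S (fs_prod BV F) (\<lambda>x. (Y.q (forget x), \<lambda>v\<in>verts Q. flag v x))"
  proof (rule fs_morphism_into_prod[OF BV(1) space_with_functions_PiE S])
    show "fs_morphism ?S BV (\<lambda>x. fst (Y.q (forget x), \<lambda>v\<in>verts Q. flag v x))" using 1 by simp
    have "fs_morphism ?S F (\<lambda>x. \<lambda>v\<in>verts Q. flag v x)"
    proof (rule fs_morphism_into_PiE[OF S])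
      show "fs_morphism ?S (FV v) (\<lambda>x. (\<lambda>v\<in>verts Q. flag v x) v)" if "v \<in> verts Q" for v
        using 2[OF that] that by simp
    qed auto
    then show "fs_morphism ?S F (\<lambda>x. snd (Y.q (forget x), \<lambda>v\<in>verts Q. flag v x))" by simp
  qed
  then show "fs_morphism (fs_open_sub XS {x \<in> points XS. q x \<in> {e \<in> points (fs_coinduced XS (q ` X) q). np e \<in> V}})
      (fs_prod BV F) (\<lambda>x. \<Phi> (q x))"
    unfolding eqU by (rule fs_morphism_cong[OF S]) (simp only: pS \<Phi>_orbit)
qed

lemma normal_stage_rep_of: "y \<in> U \<Longrightarrow> normal_stage (rep_of (Y.q y)) = normal_stage y"
proof -
  assume y: "y \<in> U"
  have r: "rep_of (Y.q y) \<in> U" "Y.q (rep_of (Y.q y)) = Y.q y" using rep_of[of "Y.q y"] y by auto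
  then obtain h where "gauge_family Q 1 (end_dims l d) h" "y = gauge_act Q 1 (end_dims l d) h (rep_of (Y.q y))"
    using Y.orbit_eq_iff[OF UX[OF r(1)] UX[OF y]] by metis
  then show ?thesis using normal_stage_gauge[OF r(1)] by metis
qed

text \<open>The normalised stage zero is invariant, hence a regular function on the quotient.\<close>

lemma regular_normal_stage:
  shows "e \<in> arcs Q \<Longrightarrow> regular_mat BV (d 0 (head Q e)) (d 0 (tail Q e)) (\<lambda>c. repA (normal_stage (rep_of c)) e)"
    and "e \<in> arcs Q \<Longrightarrow> regular_mat BV (d 0 (tail Q e)) (d 0 (head Q e)) (\<lambda>c. repB (normal_stage (rep_of c)) e)"
    and "v \<in> verts Q \<Longrightarrow> regular_mat BV (d 0 v) (f v) (\<lambda>c. repI (normal_stage (rep_of c)) v)"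
    and "v \<in> verts Q \<Longrightarrow> regular_mat BV (f v) (d 0 v) (\<lambda>c. repJ (normal_stage (rep_of c)) v)"
proof -
  let ?S = "fs_open_sub Y.XS U"
  interpret S: space_with_functions ?S by (rule space_with_functions_open_sub[OF Y.XS oU])
  have pS: "points ?S = U" by (rule points_open_sub_open[OF oU])
  have co: "regular_mat BV n m (\<lambda>c. M (normal_stage (rep_of c)))" if "regular_mat ?S n m (\<lambda>y. M (normal_stage y))" for n m M
    unfolding Y.MS_eq
  proof (rule regular_mat_coinduced[OF Y.XS])
    show "Y.q ` points Y.XS = Y.q ` Y.X" by (simp add: Y.points_XS)
    show "openin (topo (fs_coinduced Y.XS (Y.q ` Y.X) Y.q)) V" using oV by (simp only: Y.MS_eq)
    show "regular_mat (fs_open_sub Y.XS {x \<in> points Y.XS. Y.q x \<in> V}) n m (\<lambda>y. M (normal_stage (rep_of (Y.q y))))"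
      unfolding preimage_V by (rule S.regular_mat_cong[OF that]) (simp add: pS normal_stage_rep_of)
  qed
  note st = Y.regular_stage[OF le0, unfolded end_dims_simps, THEN regular_mat_open_sub[OF Y.XS oU]]
  note L = \<Lambda>_regular
  have Li: "regular_mat ?S (d 0 v) (d 0 v) (\<lambda>y. gl_inv (d 0 v) (\<Lambda> v y))" if "v \<in> verts Q" for v
    by (rule S.regular_gl_inv[OF L[OF that]]) (simp add: pS \<Lambda>_GL that)
  show "regular_mat BV (d 0 (head Q e)) (d 0 (tail Q e)) (\<lambda>c. repA (normal_stage (rep_of c)) e)"
    "regular_mat BV (d 0 (tail Q e)) (d 0 (head Q e)) (\<lambda>c. repB (normal_stage (rep_of c)) e)" if e: "e \<in> arcs Q"
  proof -
    note vs = head_in_verts[OF e] tail_in_verts[OF e]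
    have "regular_mat ?S (d 0 (head Q e)) (d 0 (tail Q e)) (\<lambda>y. repA (normal_stage y) e)"
      unfolding normal_stage_def rep_act_simps(1)[OF e]
      by (rule S.regular_mat_mult[OF S.regular_mat_mult[OF L[OF vs(1)] st(1)[OF e]] Li[OF vs(2)]])
    from co[OF this] show "regular_mat BV (d 0 (head Q e)) (d 0 (tail Q e)) (\<lambda>c. repA (normal_stage (rep_of c)) e)" .
    have "regular_mat ?S (d 0 (tail Q e)) (d 0 (head Q e)) (\<lambda>y. repB (normal_stage y) e)"
      unfolding normal_stage_def rep_act_simps(2)[OF e]
      by (rule S.regular_mat_mult[OF S.regular_mat_mult[OF L[OF vs(2)] st(2)[OF e]] Li[OF vs(1)]])
    from co[OF this] show "regular_mat BV (d 0 (tail Q e)) (d 0 (head Q e)) (\<lambda>c. repB (normal_stage (rep_of c)) e)" .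
  qed
  show "regular_mat BV (d 0 v) (f v) (\<lambda>c. repI (normal_stage (rep_of c)) v)"
    "regular_mat BV (f v) (d 0 v) (\<lambda>c. repJ (normal_stage (rep_of c)) v)" if v: "v \<in> verts Q"
  proof -
    have "regular_mat ?S (d 0 v) (f v) (\<lambda>y. repI (normal_stage y) v)"
      unfolding normal_stage_def rep_act_simps(3)[OF v] by (rule S.regular_mat_mult[OF L[OF v] st(3)[OF v]])
    from co[OF this] show "regular_mat BV (d 0 v) (f v) (\<lambda>c. repI (normal_stage (rep_of c)) v)" .
    have "regular_mat ?S (f v) (d 0 v) (\<lambda>y. repJ (normal_stage y) v)"
      unfolding normal_stage_def rep_act_simps(4)[OF v] by (rule S.regular_mat_mult[OF st(4)[OF v] Li[OF v]])
    from co[OF this] show "regular_mat BV (f v) (d 0 v) (\<lambda>c. repJ (normal_stage (rep_of c)) v)" .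
  qed
qed

text \<open>
  Near a given flag, the arbitrary choice of a basis can be replaced by a local section of the general
  linear group over the flag variety; the standard chain obtained from it has regular entries.
\<close>

lemma fs_morphism_\<Psi>: "fs_morphism (fs_prod BV F) (fs_open_sub MS EV) \<Psi>"
proof (rule fs_morphism_local)
  let ?P = "fs_prod BV F"
  show P: "space_with_functions ?P" by (rule space_with_functions_prod[OF BV(1) space_with_functions_PiE])
  have pP: "points ?P = V \<times> points F"
    using points_prod[OF BV(1) space_with_functions_PiE] BV(2) by simp
  fix p0 assume p0: "p0 \<in> points ?P"
  then have W0: "snd p0 v \<in> flags (map (b v) ms) (k v)" if "v \<in> verts Q" for v
    using that by (auto simp: pP points_F)
  obtain W s where Ws: "\<And>v. v \<in> verts Q \<Longrightarrow> openin (topo (FV v)) (W v) \<and> snd p0 v \<in> W v \<and>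
      regular_mat (fs_open_sub (FV v) (W v)) (k v) (k v) (s v) \<and>
      (\<forall>w\<in>W v. s v w \<in> carrier (GL (k v)) \<and> SF v (s v w) = w)"
    using flag_variety_local_section[OF ms(2,3) W0] by metis
  have comp: "fs_morphism ?P (FV v) (\<lambda>p. snd p v)" if "v \<in> verts Q" for v
    using fs_morphism_compose[OF fs_morphism_snd[OF BV(1) space_with_functions_PiE[of "verts Q" FV]]
        fs_morphism_PiE_component[OF that space_with_functions_flag_variety]]
    by (simp add: o_def)
  define N where "N = {p \<in> points ?P. \<forall>v\<in>verts Q. snd p v \<in> W v}"
  have oN: "openin (topo ?P) N"
  proof (cases "verts Q = {}")
    case True
    then show ?thesis by (simp add: N_def)
  next
    case False
    have "N = (\<Inter>v\<in>verts Q. {p \<in> points ?P. snd p v \<in> W v})" using False by (auto simp: N_def)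
    moreover have "openin (topo ?P) (\<Inter>v\<in>verts Q. {p \<in> points ?P. snd p v \<in> W v})"
      using False Ws by (intro openin_Inter) (auto intro!: fs_morphism_openin[OF comp])
    ultimately show ?thesis by simp
  qed
  let ?S = "fs_open_sub ?P N"
  have S: "space_with_functions ?S" by (rule space_with_functions_open_sub[OF P oN])
  interpret S: space_with_functions ?S by (rule S)
  have pS: "points ?S = N" by (rule points_open_sub_open[OF oN])
  have ND: "fst p \<in> V" "snd p \<in> points F" "\<And>v. v \<in> verts Q \<Longrightarrow> snd p v \<in> W v" if "p \<in> N" for p
    using that by (auto simp: N_def pP)
  define \<gamma> where "\<gamma> p v = s v (snd p v)" for p :: "('v, 'e) chain_rep set \<times> ('v \<Rightarrow> complex vec set list)" and v
  have \<gamma>: "\<gamma> p v \<in> carrier (GL (k v))" "SF v (\<gamma> p v) = snd p v" if "p \<in> N" "v \<in> verts Q" for p v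
    using Ws[OF that(2)] ND(3)[OF that] by (auto simp: \<gamma>_def)
  have \<gamma>reg: "regular_mat ?S (k v) (k v) (\<lambda>p. \<gamma> p v)" if v: "v \<in> verts Q" for v
  proof -
    have "fs_morphism ?S (fs_open_sub (FV v) (W v)) (\<lambda>p. snd p v)"
      by (rule fs_morphism_into_open_sub[OF _ fs_morphism_restrict[OF P oN comp[OF v]]])
        (use Ws[OF v] ND(3) v pS in auto)
    from regular_mat_compose[OF this, of "k v" "k v" "s v"] Ws[OF v] show ?thesis by (simp add: \<gamma>_def)
  qed
  have fstm: "fs_morphism ?S BV fst"
    by (rule fs_morphism_restrict[OF P oN fs_morphism_fst[OF BV(1) space_with_functions_PiE]])
  note zr = regular_normal_stage[THEN regular_mat_compose[OF fstm]]
  have Treg: "regular_mat ?S (d 0 v) (d 0 v) (\<lambda>p. T v (\<gamma> p v))" if v: "v \<in> verts Q" for v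
    using S.regular_gdiag[OF \<gamma>reg[OF v], of "d l v"] by (simp only: d_split[OF v, symmetric])
  have TG: "T v (\<gamma> p v) \<in> carrier (GL (d 0 v))" if "p \<in> N" "v \<in> verts Q" for p v
    by (rule T_GL[OF that(2) \<gamma>(1)[OF that]])
  have Tireg: "regular_mat ?S (d 0 v) (d 0 v) (\<lambda>p. gl_inv (d 0 v) (T v (\<gamma> p v)))" if v: "v \<in> verts Q" for v
    by (rule S.regular_gl_inv[OF Treg[OF v]]) (simp add: pS TG v)
  note rc = S.regular_mat_const[OF rect_carrier]
  let ?R = "\<lambda>p. turned_stage (rep_of (fst p)) (\<gamma> p)"
  let ?\<chi> = "\<lambda>p. std_chain Q l d (?R p)"
  have \<chi>: "fs_morphism ?S XS ?\<chi>"
  proof (rule fs_morphism_XS[OF S])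
    show "?\<chi> p \<in> X" if "p \<in> points ?S" for p
    proof -
      have p: "p \<in> N" using that pS by simp
      show ?thesis
        by (rule std_chain_in_X[OF turned_stage_props(1)]) (use rep_of[OF ND(1)[OF p]] \<gamma>(1)[OF p] in auto)
    qed
  next
    fix m e assume m: "m \<le> l" and e: "e \<in> arcs Q"
    note vs = head_in_verts[OF e] tail_in_verts[OF e]
    show "regular_mat ?S (d m (head Q e)) (d m (tail Q e)) (\<lambda>p. repA (stage (?\<chi> p) m) e)"
      unfolding std_chain_simps(1)[OF m] trunc_rep_simps(1)[OF e] turned_stage_def rep_act_simps(1)[OF e]
      by (rule S.regular_mat_mult[OF S.regular_mat_mult[OF rc S.regular_mat_mult[OF S.regular_mat_mult[OF
                Treg[OF vs(1)] zr(1)[OF e]] Tireg[OF vs(2)]]] rc])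
    show "regular_mat ?S (d m (tail Q e)) (d m (head Q e)) (\<lambda>p. repB (stage (?\<chi> p) m) e)"
      unfolding std_chain_simps(1)[OF m] trunc_rep_simps(2)[OF e] turned_stage_def rep_act_simps(2)[OF e]
      by (rule S.regular_mat_mult[OF S.regular_mat_mult[OF rc S.regular_mat_mult[OF S.regular_mat_mult[OF
                Treg[OF vs(2)] zr(2)[OF e]] Tireg[OF vs(1)]]] rc])
  next
    fix m v assume m: "m \<le> l" and v: "v \<in> verts Q"
    show "regular_mat ?S (d m v) (f v) (\<lambda>p. repI (stage (?\<chi> p) m) v)"
      unfolding std_chain_simps(1)[OF m] trunc_rep_simps(3)[OF v] turned_stage_def rep_act_simps(3)[OF v]
      by (rule S.regular_mat_mult[OF rc S.regular_mat_mult[OF Treg[OF v] zr(3)[OF v]]])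
    show "regular_mat ?S (f v) (d m v) (\<lambda>p. repJ (stage (?\<chi> p) m) v)"
      unfolding std_chain_simps(1)[OF m] trunc_rep_simps(4)[OF v] turned_stage_def rep_act_simps(4)[OF v]
      by (rule S.regular_mat_mult[OF S.regular_mat_mult[OF zr(4)[OF v] Tireg[OF v]] rc])
  next
    fix m v assume "m < l" "v \<in> verts Q"
    then show "regular_mat ?S (d (Suc m) v) (d m v) (\<lambda>p. link (?\<chi> p) m v)"
      using rc by simp
  qed
  have \<Psi>\<chi>: "\<Psi> p = q (?\<chi> p)" if p: "p \<in> N" for p
  proof -
    have "\<Psi> (Y.q (rep_of (fst p)), snd p) = q (?\<chi> p)"
      by (rule \<Psi>_eq) (use rep_of[OF ND(1)[OF p]] \<gamma>[OF p] in auto)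
    then show ?thesis using rep_of[OF ND(1)[OF p]] by simp
  qed
  have "fs_morphism ?S (fs_open_sub MS EV) \<Psi>"
  proof (rule fs_morphism_into_open_sub[OF oEV])
    show "fs_morphism ?S MS \<Psi>"
      by (rule fs_morphism_cong[OF S fs_morphism_compose[OF \<chi> fs_morphism_orbit]]) (simp add: pS \<Psi>\<chi>)
    fix p assume "p \<in> points ?S"
    then have p: "p \<in> N" by (simp add: pS)
    have "\<Psi> (Y.q (rep_of (fst p)), snd p) \<in> EV"
      by (rule \<Phi>_\<Psi>(2)) (use rep_of[OF ND(1)[OF p]] ND(2)[OF p] points_F in auto)
    then show "\<Psi> p \<in> EV" using rep_of[OF ND(1)[OF p]] by simp
  qed
  moreover have "p0 \<in> N" using p0 Ws by (auto simp: N_def)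
  ultimately show "\<exists>N. openin (topo ?P) N \<and> p0 \<in> N \<and> fs_morphism (fs_open_sub ?P N) (fs_open_sub MS EV) \<Psi>"
    using oN by blast
qed

lemma trivialisation: "fs_isomorphism (fs_open_sub MS EV) (fs_prod BV F) \<Phi>"
  unfolding fs_isomorphism_def
proof (intro exI[of _ \<Psi>] conjI ballI)
  show "fs_morphism (fs_open_sub MS EV) (fs_prod BV F) \<Phi>" by (rule fs_morphism_\<Phi>)
  show "fs_morphism (fs_prod BV F) (fs_open_sub MS EV) \<Psi>" by (rule fs_morphism_\<Psi>)
  show "\<Psi> (\<Phi> e) = e" if "e \<in> points (fs_open_sub MS EV)" for e
  proof -
    have "e \<in> EV" using that unfolding points_open_sub_open[OF oEV] .
    then obtain x where "x \<in> XU" "e = q x" unfolding EV_iff by blast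
    then show ?thesis using \<Psi>_\<Phi> by simp
  qed
  fix p assume "p \<in> points (fs_prod BV F)"
  then have "p \<in> V \<times> points F"
    unfolding points_prod[OF BV(1) space_with_functions_PiE] BV(2) .
  then have p: "fst p \<in> V" "snd p \<in> points F" by (simp_all only: mem_Times_iff)
  have "\<Phi> (\<Psi> (Y.q (rep_of (fst p)), snd p)) = (Y.q (rep_of (fst p)), snd p)"
    by (rule \<Phi>_\<Psi>(1)) (use rep_of[OF p(1)] p(2) points_F in auto)
  then show "\<Phi> (\<Psi> p) = p" using rep_of[OF p(1)] by simp
qed

lemma local_triviality:
  assumes "y \<in> U"
  shows "\<exists>V \<phi>. openin (topo (parabolic_variety Q 1 (end_dims l d) f)) V \<and> gauge_orbit Q 1 (end_dims l d) y \<in> V \<and>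
    fs_isomorphism (fs_open_sub MS {e \<in> points MS. natural_projection Q l d e \<in> V})
      (fs_prod (fs_open_sub (parabolic_variety Q 1 (end_dims l d) f) V)
        (fs_PiE (verts Q) (\<lambda>v. flag_variety (map (\<lambda>m. d m v - d l v) (rev [1..<l])) (d 0 v - d l v)))) \<phi> \<and>
    (\<forall>e \<in> points MS. natural_projection Q l d e \<in> V \<longrightarrow> fst (\<phi> e) = natural_projection Q l d e)"
proof (intro exI[of _ V] exI[of _ \<Phi>] conjI ballI impI)
  show "openin (topo Y.MS) V" by (rule oV)
  show "Y.q y \<in> V" using assms by blast
  show "fst (\<Phi> e) = np e" for e by (simp add: \<Phi>_def)
  show "fs_isomorphism (fs_open_sub MS EV)
      (fs_prod BV (fs_PiE (verts Q) (\<lambda>v. flag_variety (map (\<lambda>m. d m v - d l v) (rev [1..<l])) (d 0 v - d l v)))) \<Phi>"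
    using trivialisation unfolding b_def[abs_def] k_def[abs_def] .
qed

end

theorem proposition1p9:
  fixes Q :: "('v, 'e) pre_digraph" and l :: nat
    and d :: "nat \<Rightarrow> 'v \<Rightarrow> nat" and f :: "'v \<Rightarrow> nat"
  assumes "fin_digraph Q"
    and "\<And>m v. m < l \<Longrightarrow> v \<in> verts Q \<Longrightarrow> d (Suc m) v \<le> d m v"
  shows "locally_trivial_fibration
           (parabolic_variety Q l d f)
           (parabolic_variety Q 1 (end_dims l d) f)
           (natural_projection Q l d)
           (fs_PiE (verts Q) (\<lambda>v.
              flag_variety (map (\<lambda>m. d m v - d l v) (rev [1..<l])) (d 0 v - d l v)))"
proof -
  interpret dim_chain Q l d f
    using assms by (simp add: dim_chain_def dim_chain_axioms_def)
  interpret Y: dim_chain Q 1 "end_dims l d" f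
    by unfold_locales (use d_mono[OF le0 order_refl] in simp)
  show ?thesis
    unfolding locally_trivial_fibration_def
  proof (intro conjI ballI)
    show "fs_morphism MS Y.MS (natural_projection Q l d)" by (rule fs_morphism_natural_projection)
    fix c assume "c \<in> points Y.MS"
    then obtain y where y: "y \<in> Y.X" "c = Y.q y" by (auto simp: Y.points_MS)
    from Y.coframe_exists[OF y(1), unfolded end_dims_simps]
    obtain U \<Lambda> where U: "openin (topo Y.XS) U" "y \<in> U"
      "\<forall>y\<in>U. \<forall>h. gauge_family Q 1 (end_dims l d) h \<longrightarrow> gauge_act Q 1 (end_dims l d) h y \<in> U"
      "\<forall>v\<in>verts Q. regular_mat (fs_open_sub Y.XS U) (d 0 v) (d 0 v) (\<Lambda> v)"
      "\<forall>y\<in>U. \<forall>v\<in>verts Q. \<Lambda> v y \<in> carrier (GL (d 0 v)) \<and>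
        (\<exists>P\<in>carrier (GL (d l v)). P * link_comp (end_dims l d) y 1 v = rect (d l v) (d 0 v) * \<Lambda> v y)"
      "\<forall>y\<in>U. \<forall>h. gauge_family Q 1 (end_dims l d) h \<longrightarrow>
        (\<forall>v\<in>verts Q. \<Lambda> v (gauge_act Q 1 (end_dims l d) h y) = \<Lambda> v y * gl_inv (d 0 v) (h (0, v)))"
      by (elim exE conjE) (rule that)
    interpret chart Q l d f U \<Lambda>
      by unfold_locales (use U in blast)+
    show "\<exists>V \<phi>. openin (topo Y.MS) V \<and> c \<in> V \<and>
        fs_isomorphism (fs_open_sub MS {x \<in> points MS. natural_projection Q l d x \<in> V})
          (fs_prod (fs_open_sub Y.MS V) (fs_PiE (verts Q) (\<lambda>v.
              flag_variety (map (\<lambda>m. d m v - d l v) (rev [1..<l])) (d 0 v - d l v)))) \<phi> \<and>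
        (\<forall>x\<in>points MS. natural_projection Q l d x \<in> V \<longrightarrow> fst (\<phi> x) = natural_projection Q l d x)"
      unfolding y(2) by (rule local_triviality[OF U(2)])
  qed
qed

end
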